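(* Let $\alpha\in(\tfrac{\pi}{3},\tfrac{2\pi}{3})$ with $\alpha\neq\tfrac{\pi}{2}$, and let $\beta=\tfrac{4\pi}{3}-\alpha$. Then every shield tiling with parameter $\alpha$ is either a shield line tiling or a shield triangle tiling.
   Context: Tiles. The triangle is the equilateral triangle with side length $1$. The shield (with parameter $\alpha$) is the convex hexagon all of whose sides have length $1$ and whose interior angles, taken in cyclic order, are $\alpha,\beta,\alpha,\beta,\alpha,\beta$, where $\beta=\tfrac{4\pi}{3}-\alpha$. It is invariant under the rotation by $2\pi/3$ about a point $O$ (its center). Vertices with angle $\alpha$ are called $\alpha$-vertices and those with angle $\beta$ are called $\beta$-vertices. Opposite vertices are of different type and are collinear with $O$. Shield tiling. A shield tiling is a covering of the Euclidean plane by closed tiles, each isometric to the triangle or to the shield, with pairwise disjoint interiors. It must be edge-to-edge: the intersection of two tiles is empty, a common vertex, or a common entire edge. It is not required that both kinds of tiles occur. Shield line tilings. Let $S$ be a shield, $A$ one of its $\alpha$-vertices, $B$ the opposite ($\beta$-)vertex, and $u=B-A$. Then $S$ and $S+u$ meet at $B$. The two angular sectors at $B$ not covered by $S\cup(S+u)$ each have angle $\pi/3$ and are filled by unit equilateral triangles $t^+,t^-$, each having $B$ as a vertex and one edge on each of $S$ and $S+u$. The shield line determined by $(S,A)$ is the set of tiles $\{S+nu,\ t^++nu,\ t^-+nu : n\in\mathbb{Z}\}$. A shield line tiling is a shield tiling whose set of tiles can be partitioned into shield lines. Shield triangle tilings. Let $S$ be a shield with center at the origin, let $u$ be the vector from an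 $\alpha$-vertex of $S$ to the opposite $\beta$-vertex, let $\rho$ be the rotation by $2\pi/3$ about the origin, and let $L=\mathbb{Z}u+\mathbb{Z}\rho u$. The shields $S+\ell$ ($\ell\in L$) have disjoint interiors. Together with the unit equilateral triangles filling the remaining holes, they form a shield tiling $U$. Each triangle of $U$ shares an edge with exactly three shields $S+\ell_1,S+\ell_2,S+\ell_3$, where $\{\ell_1,\ell_2,\ell_3\}$ is an equilateral triangle of side $|u|$ in $L$. Write $t(\ell_1,\ell_2,\ell_3)$ for this triangle tile; this gives a bijection between triangles of $U$ and such lattice triangles. Fix $v,w\in L$ with $|v|=|w|=|u|$ making an angle $\pi/3$. For an integer $k\ge1$, let $A_k=\{iv+jw: i,j\in\mathbb{Z}_{\ge0},\ i+j\le k-1\}$. The shield triangle of order $k$, denoted $P_k$, is the set of tiles of $U$ consisting of: - the shields $S+\ell$ with $\ell\in A_k$; - the triangles $t(\ell_1,\ell_2,\ell_3)$ of $U$ with at least two of $\ell_1,\ell_2,\ell_3$ in $A_k$; - the three corner triangles $t(0,-v,-w)$, $t(p,p+v,p+v-w)$ with $p=(k-1)v$, and $t(q,q+w,q+w-v)$ with $q=(k-1)w$. The apex of a corner triangle is its vertex not lying on the shield of $P_k$ it touches. The shield triangle tiling of order $k$, denoted $T_k$, is the set of all images $g(\tau)$ with $\tau\in P_k$ and $g$ in the group generated by the rotations by $\pi/3$ about the three apexes. For infinite order, let $A_\infty=\{iv+jw:i,j\in\mathbb{Z}_{\ge0}\}$. Let $P_\infty$ consist of the shields $S+\ell$ with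 $\ell\in A_\infty$, the triangles of $U$ with at least two of their three lattice indices in $A_\infty$, and the triangle $t(0,-v,-w)$. Then $T_\infty$ is the set of images of the tiles of $P_\infty$ under the six rotations by multiples of $\pi/3$ about the apex of $t(0,-v,-w)$. $T_0$ is the regular tiling of the plane by unit equilateral triangles. A shield triangle tiling is a shield tiling that is the image of $T_k$ under an isometry of the plane, for some $k\in\{0,1,2,\dots\}\cup\{\infty\}$. *)

theory Defs
  imports
    "HOL-Analysis.Analysis"
    "HOL-Library.Extended_Nat"
    "HOL-Algebra.Bij"
    "HOL-Algebra.Generated_Groups"
begin

text \<open>The Euclidean plane is the type \<^typ>\<open>complex\<close>; a tiling is a set of tiles, i.e. of subsets
  of \<^typ>\<open>complex\<close>.\<close>

definition vec_angle :: "complex \<Rightarrow> complex \<Rightarrow> real" where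
  "vec_angle x y = arccos (inner x y / (norm x * norm y))"

definition rotation :: "complex \<Rightarrow> real \<Rightarrow> complex \<Rightarrow> complex" where
  "rotation c \<theta> z = c + cis \<theta> * (z - c)"

definition unit_triangle :: "complex set \<Rightarrow> bool" where
  "unit_triangle T \<longleftrightarrow>
     (\<exists>a b c. dist a b = 1 \<and> dist b c = 1 \<and> dist a c = 1 \<and> T = convex hull {a, b, c})"

text \<open>The points \<open>q 0, \<dots>, q 5\<close> are, in cyclic order (of either orientation), the vertices of a
  convex hexagon with unit sides and interior angles \<open>\<alpha>, \<beta>, \<alpha>, \<beta>, \<alpha>, \<beta>\<close>. Being a convex hexagon
  with these vertices in this order is expressed by the six segments joining cyclically
  consecutive points being edges of the convex hull. The \<open>\<alpha>\<close>-vertices have even index, and the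
  vertex opposite to \<open>q i\<close> is \<open>q ((i + 3) mod 6)\<close>.\<close>

definition shield_vertices :: "real \<Rightarrow> (nat \<Rightarrow> complex) \<Rightarrow> bool" where
  "shield_vertices \<alpha> q \<longleftrightarrow>
     inj_on q {..<6} \<and>
     (\<forall>i<6. closed_segment (q i) (q (Suc i mod 6)) edge_of convex hull (q ` {..<6})) \<and>
     (\<forall>i<6. dist (q i) (q (Suc i mod 6)) = 1) \<and>
     (\<forall>i<6. vec_angle (q ((i + 5) mod 6) - q i) (q (Suc i mod 6) - q i)
            = (if even i then \<alpha> else 4 * pi / 3 - \<alpha>))"

definition shield :: "real \<Rightarrow> complex set \<Rightarrow> bool" where
  "shield \<alpha> S \<longleftrightarrow> (\<exists>q. shield_vertices \<alpha> q \<and> S = convex hull (q ` {..<6}))"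

definition edge_to_edge :: "complex set \<Rightarrow> complex set \<Rightarrow> bool" where
  "edge_to_edge X Y \<longleftrightarrow>
     X \<inter> Y = {} \<or>
     (\<exists>x. x extreme_point_of X \<and> x extreme_point_of Y \<and> X \<inter> Y = {x}) \<or>
     (X \<inter> Y edge_of X \<and> X \<inter> Y edge_of Y)"

definition shield_tiling :: "real \<Rightarrow> complex set set \<Rightarrow> bool" where
  "shield_tiling \<alpha> \<T> \<longleftrightarrow>
     (\<forall>X\<in>\<T>. unit_triangle X \<or> shield \<alpha> X) \<and>
     \<Union>\<T> = UNIV \<and>
     pairwise (\<lambda>X Y. interior X \<inter> interior Y = {} \<and> edge_to_edge X Y) \<T>"


section \<open>Shield line tilings\<close>

text \<open>By relabelling the vertices cyclically, \<open>A = q 0\<close> is an arbitrary \<open>\<alpha>\<close>-vertex, and \<open>B = q 3\<close>.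
  The neighbours of \<open>B\<close> are \<open>q 2\<close>, \<open>q 4\<close> in \<open>S\<close>, and \<open>q 1 + u\<close>, \<open>q 5 + u\<close> in \<open>S + u\<close>. The line
  \<open>A B\<close> has \<open>q 1\<close>, \<open>q 2\<close> on one side and \<open>q 4\<close>, \<open>q 5\<close> on the other.\<close>

definition shield_line :: "real \<Rightarrow> complex set set \<Rightarrow> bool" where
  "shield_line \<alpha> \<L> \<longleftrightarrow>
     (\<exists>q S u t1 t2. shield_vertices \<alpha> q \<and>
        S = convex hull (q ` {..<6}) \<and>
        u = q 3 - q 0 \<and>
        t1 = convex hull {q 3, q 2, q 1 + u} \<and>
        t2 = convex hull {q 3, q 4, q 5 + u} \<and>
        \<L> = {(+) (of_int n * u) ` X | n X. X \<in> {S, t1, t2}})"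

definition shield_line_tiling :: "real \<Rightarrow> complex set set \<Rightarrow> bool" where
  "shield_line_tiling \<alpha> \<T> \<longleftrightarrow>
     shield_tiling \<alpha> \<T> \<and> (\<exists>P. partition_on \<T> P \<and> (\<forall>\<L>\<in>P. shield_line \<alpha> \<L>))"


section \<open>Shield triangle tilings\<close>

definition shield_lattice :: "complex \<Rightarrow> complex set" where
  "shield_lattice u = {of_int i * u + of_int j * (cis (2 * pi / 3) * u) | i j. True}"

text \<open>The data fixed for the construction: a shield centered at the origin, the vector \<open>u\<close> from an
  \<open>\<alpha>\<close>-vertex to the opposite vertex, and lattice vectors \<open>v\<close>, \<open>w\<close>.\<close>

definition shield_frame ::
  "real \<Rightarrow> complex set \<Rightarrow> complex \<Rightarrow> complex \<Rightarrow> complex \<Rightarrow> bool" where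
  "shield_frame \<alpha> S u v w \<longleftrightarrow>
     (\<exists>q. shield_vertices \<alpha> q \<and> S = convex hull (q ` {..<6}) \<and> u = q 3 - q 0) \<and>
     rotation 0 (2 * pi / 3) ` S = S \<and>
     v \<in> shield_lattice u \<and> w \<in> shield_lattice u \<and>
     norm v = norm u \<and> norm w = norm u \<and> vec_angle v w = pi / 3"

text \<open>The triangles of \<open>U\<close>, i.e. those filling the holes left by the shields \<open>S + l\<close>.\<close>

definition hole_triangles :: "complex set \<Rightarrow> complex \<Rightarrow> complex set set" where
  "hole_triangles S u =
     {T. unit_triangle T \<and>
         interior T \<in> components (- (\<Union>l\<in>shield_lattice u. (+) l ` S))}"

definition shares_edge :: "complex set \<Rightarrow> complex set \<Rightarrow> bool" where
  "shares_edge X Y \<longleftrightarrow> (\<exists>e. e edge_of X \<and> e edge_of Y)"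

text \<open>The tile \<open>t(a, b, c)\<close>, well defined when \<open>a, b, c\<close> form a lattice triangle of side \<open>norm u\<close>.\<close>

definition tri_tile ::
  "complex set \<Rightarrow> complex \<Rightarrow> complex \<Rightarrow> complex \<Rightarrow> complex \<Rightarrow> complex set" where
  "tri_tile S u a b c =
     (THE T. T \<in> hole_triangles S u \<and> (\<forall>l\<in>{a, b, c}. shares_edge T ((+) l ` S)))"

text \<open>The shields \<open>S + l\<close> with \<open>l \<in> A\<close>, and the triangles \<open>t(a, b, c)\<close> with at least two indices
  in \<open>A\<close>.\<close>

definition patch :: "complex set \<Rightarrow> complex \<Rightarrow> complex set \<Rightarrow> complex set set" where
  "patch S u A =
     {(+) l ` S | l. l \<in> A} \<union>
     {tri_tile S u a b c | a b c.
        a \<in> shield_lattice u \<and> b \<in> shield_lattice u \<and> c \<in> shield_lattice u \<and>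
        dist a b = norm u \<and> dist b c = norm u \<and> dist a c = norm u \<and>
        card ({a, b, c} \<inter> A) \<ge> 2}"

definition apex :: "complex set \<Rightarrow> complex set \<Rightarrow> complex" where
  "apex T X = (THE x. x extreme_point_of T \<and> x \<notin> X)"

text \<open>The following two definitions are meant for \<open>k \<ge> 1\<close>.\<close>

definition shield_triangle ::
  "complex set \<Rightarrow> complex \<Rightarrow> complex \<Rightarrow> complex \<Rightarrow> nat \<Rightarrow> complex set set" where
  "shield_triangle S u v w k =
     (let p = of_nat (k - 1) * v; q = of_nat (k - 1) * w in
        patch S u {of_nat i * v + of_nat j * w | i j. i + j \<le> k - 1} \<union>
        {tri_tile S u 0 (- v) (- w),
         tri_tile S u p (p + v) (p + v - w),
         tri_tile S u q (q + w) (q + w - v)})"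

definition shield_triangle_tiles ::
  "complex set \<Rightarrow> complex \<Rightarrow> complex \<Rightarrow> complex \<Rightarrow> nat \<Rightarrow> complex set set" where
  "shield_triangle_tiles S u v w k =
     (let p = of_nat (k - 1) * v; q = of_nat (k - 1) * w;
          apexes = {apex (tri_tile S u 0 (- v) (- w)) S,
                    apex (tri_tile S u p (p + v) (p + v - w)) ((+) p ` S),
                    apex (tri_tile S u q (q + w) (q + w - v)) ((+) q ` S)}
      in {g ` X | g X. X \<in> shield_triangle S u v w k \<and>
            g \<in> generate (BijGroup UNIV) ((\<lambda>c. rotation c (pi / 3)) ` apexes)})"

definition shield_triangle_tiles_infinite ::
  "complex set \<Rightarrow> complex \<Rightarrow> complex \<Rightarrow> complex \<Rightarrow> complex set set" where
  "shield_triangle_tiles_infinite S u v w =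
     (let t = tri_tile S u 0 (- v) (- w) in
        {rotation (apex t S) (of_nat n * (pi / 3)) ` X | n X.
           n < 6 \<and>
           X \<in> patch S u {of_nat i * v + of_nat j * w | i j :: nat. True} \<union> {t}})"

definition regular_triangle_tiles :: "complex set set" where
  "regular_triangle_tiles =
     {convex hull {z, z + 1, z + cis \<theta>} | z \<theta>.
        z \<in> {of_int i + of_int j * cis (pi / 3) | i j. True} \<and> \<theta> \<in> {pi / 3, - pi / 3}}"

definition T_tiles ::
  "complex set \<Rightarrow> complex \<Rightarrow> complex \<Rightarrow> complex \<Rightarrow> enat \<Rightarrow> complex set set" where
  "T_tiles S u v w K =
     (case K of
        enat k \<Rightarrow> if k = 0 then regular_triangle_tiles else shield_triangle_tiles S u v w k
      | \<infinity> \<Rightarrow> shield_triangle_tiles_infinite S u v w)"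

text \<open>Up to an isometry, the tiling does not depend on the choice of the frame: all shields with
  parameter \<open>\<alpha>\<close> are congruent, and the symmetries of a shield (rotations by \<open>2\<pi>/3\<close> and reflections
  in the lines joining opposite vertices) act transitively on the pairs \<open>{v, w}\<close>. So the
  existential quantification over the frame is harmless.\<close>

definition shield_triangle_tiling :: "real \<Rightarrow> complex set set \<Rightarrow> bool" where
  "shield_triangle_tiling \<alpha> \<T> \<longleftrightarrow>
     shield_tiling \<alpha> \<T> \<and>
     (\<exists>S u v w K f. shield_frame \<alpha> S u v w \<and>
        (\<forall>x y. dist (f x) (f y) = dist x y) \<and>
        \<T> = (`) f ` T_tiles S u v w K)"

end

theory Submission
  imports Defs
begin

text \<open>
  The angles at a vertex sum up to \<open>2 * pi\<close>, and two \<open>\<alpha>\<close>-angles, or two \<open>\<beta>\<close>-angles, of shields sharing a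
  side never meet at a vertex. As \<open>\<alpha> \<noteq> pi / 2\<close>, a vertex belongs either to triangles only, or to one
  \<open>\<alpha>\<close>-angle, one \<open>\<beta>\<close>-angle and two triangles. In the latter case the two shields either share a side or
  are opposite, with a triangle on either side. Whether a side of a shield borders a triangle determines
  the situation at its two ends, and this propagates: opposite pairs continue along a diagonal until a side shared by two
  shields stops them. If some diagonal never stops, then all parallel diagonals through the shields of the tiling
  do not stop either, and the tiling is a union of shield lines. Otherwise some side of a shield borders a triangle
  while both adjacent sides are shared with shields (a corner). Growing the region of shields from a corner row by row gives a shield triangle,
  of order \<open>K\<close>, and six copies of it surround the apex of the corner. Rotating around the apexes, the copies
  reach every tile by connectedness. A tiling without shields is the regular one.
\<close>

text \<open>All information travels through single triangles. A triangle lying between two shields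
  has a further side, and whether a triangle or a shield lies across it can be read off at either of
  the two shields; so a shared side at one shield forces a shared side at the next. This is what
  carries shared sides along a diagonal, along a row and along the boundary of a growing region.

  The value \<open>pi / 2\<close> is excluded because there two \<open>\<beta>\<close>-angles and
  one triangle, or two \<open>\<alpha>\<close>-angles and three triangles, would close up around a
  vertex.

  The combinatorial part knows neither \<open>\<alpha>\<close> nor convexity: points and directions
  are built from \<open>\<omega>\<close> and the two turns \<open>c True\<close>,
  \<open>c False\<close>, and the relations \<open>\<omega> * \<omega> = \<omega> - 1\<close> and
  \<open>c True * c False = \<omega> - 1\<close> suffice to identify them.

  The sectors around an apex are never compared all at once: one turn by \<open>pi / 3\<close>
  cannot increase the order, and six turns return to the start.\<close>

definition \<omega> :: complex where "\<omega> = cis (pi / 3)"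

lemma omega_Complex: "\<omega> = Complex (1/2) (sqrt 3 / 2)"
  by (simp add: \<omega>_def complex_eq_iff cos_60 sin_60)

lemma omega_sq: "\<omega> * \<omega> = \<omega> - 1"
  by (simp add: omega_Complex complex_eq_iff)

lemma omega_sq': "\<omega> * (\<omega> * x) = \<omega> * x - x"
  by (simp add: omega_sq mult.assoc[symmetric] algebra_simps)

text \<open>The combinatorial form of a tiling. A dart \<open>(z, d)\<close> is the side from \<open>z\<close> to \<open>z + d\<close> of the tile on
  its left, which is a triangle if \<open>T z d\<close>, and a shield if \<open>H s z d\<close>; then \<open>s\<close> tells whether \<open>z\<close> is an
  \<open>\<alpha>\<close>-vertex of it. The exterior angle of the shield at \<open>z + d\<close> is the argument of \<open>c s\<close>.\<close>

locale shield_darts =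
  fixes c :: "bool \<Rightarrow> complex"
    and H :: "bool \<Rightarrow> complex \<Rightarrow> complex \<Rightarrow> bool"
    and T :: "complex \<Rightarrow> complex \<Rightarrow> bool"
  assumes cc: "c s * c (\<not> s) = \<omega> - 1"
    and H_next: "H s z d \<Longrightarrow> H (\<not> s) (z + d) (c s * d)"
    and T_next: "T z d \<Longrightarrow> T (z + d) ((\<omega> - 1) * d)"
    and HT_excl: "H s z d \<Longrightarrow> T z d \<Longrightarrow> False"
    and HH_excl: "H s z d \<Longrightarrow> H (\<not> s) z d \<Longrightarrow> False"
    and H_vertex: "H s z d \<Longrightarrow>
      (H (\<not> s) z (\<omega> * (c s * d)) \<and> T z (- (\<omega> * d)) \<and> T z ((1 - \<omega>) * d)) \<or>
      (T z (\<omega> * (c s * d)) \<and> T z ((\<omega> - 1) * (c s * d)) \<and> H (\<not> s) z (- (c s * d))) \<or>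
      (T z (\<omega> * (c s * d)) \<and> H (\<not> s) z ((\<omega> - 1) * (c s * d)) \<and> T z ((1 - \<omega>) * d))"
    and T_vertex: "T z d \<Longrightarrow> T z (\<omega> * d) \<Longrightarrow> T z ((\<omega> - 1) * d) \<Longrightarrow>
      T z (- d) \<and> T z (- (\<omega> * d)) \<and> T z ((1 - \<omega>) * d)"
    and conn: "\<And>QH QT. (\<And>s z d. QH s z d \<Longrightarrow> H s z d) \<Longrightarrow> (\<And>z d. QT z d \<Longrightarrow> T z d) \<Longrightarrow>
      (\<And>s z d. QH s z d \<Longrightarrow> QH (\<not> s) (z + d) (c s * d)) \<Longrightarrow>
      (\<And>z d. QT z d \<Longrightarrow> QT (z + d) ((\<omega> - 1) * d)) \<Longrightarrow>
      (\<And>s z d. QH s z d \<Longrightarrow> QT (z + d) (- d) \<or> (\<exists>s'. QH s' (z + d) (- d))) \<Longrightarrow>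
      (\<And>z d. QT z d \<Longrightarrow> QT (z + d) (- d) \<or> (\<exists>s'. QH s' (z + d) (- d))) \<Longrightarrow>
      (\<exists>s z d. QH s z d) \<or> (\<exists>z d. QT z d) \<Longrightarrow>
      (\<forall>s z d. H s z d \<longrightarrow> QH s z d) \<and> (\<forall>z d. T z d \<longrightarrow> QT z d)"
begin

lemma cc': "c (\<not> s) * c s = \<omega> - 1"
  using cc[of "\<not> s"] by simp

lemma ccx: "c s * (c (\<not> s) * x) = \<omega> * x - x" "c (\<not> s) * (c s * x) = \<omega> * x - x"
proof -
  have "c s * (c (\<not> s) * x) = (c s * c (\<not> s)) * x" "c (\<not> s) * (c s * x) = (c (\<not> s) * c s) * x"
    by (simp_all only: mult.assoc)
  then show "c s * (c (\<not> s) * x) = \<omega> * x - x" "c (\<not> s) * (c s * x) = \<omega> * x - x"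
    unfolding cc cc' by (simp_all add: algebra_simps)
qed

text \<open>These rules bring every product of \<open>\<omega>\<close> and the turns into a normal
  form that is linear in \<open>\<omega>\<close> and contains no product of the two turns. Equality
  of points and directions is thereby left to the simplifier.\<close>

lemmas nf = algebra_simps omega_sq omega_sq' cc cc' ccx

text \<open>Two turns make a rotation by \<open>2 * pi / 3\<close>, so the six directions are
  \<open>d\<close>, \<open>c s * d\<close> and their rotations. In the sequel the sides are counted
  from 0 at \<open>(z, d)\<close>; side \<open>k\<close> is conclusion \<open>k\<close>, and it
  starts in vertex \<open>k\<close>.\<close>

lemma H_cycle:
  assumes "H s z d"
  shows "H (\<not> s) (z + d) (c s * d)"
    and "H s (z + d + c s * d) ((\<omega> - 1) * d)"
    and "H (\<not> s) (z + \<omega> * d + c s * d) ((\<omega> - 1) * (c s * d))"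
    and "H s (z + \<omega> * d + \<omega> * (c s * d)) (- (\<omega> * d))"
    and "H (\<not> s) (z + \<omega> * (c s * d)) (- (\<omega> * (c s * d)))"
proof -
  show 1: "H (\<not> s) (z + d) (c s * d)" using H_next[OF assms] .
  show 2: "H s (z + d + c s * d) ((\<omega> - 1) * d)"
    using H_next[OF 1] by (simp add: nf)
  show 3: "H (\<not> s) (z + \<omega> * d + c s * d) ((\<omega> - 1) * (c s * d))"
    using H_next[OF 2] by (simp add: nf)
  show 4: "H s (z + \<omega> * d + \<omega> * (c s * d)) (- (\<omega> * d))"
    using H_next[OF 3] by (simp add: nf)
  show 5: "H (\<not> s) (z + \<omega> * (c s * d)) (- (\<omega> * (c s * d)))"
    using H_next[OF 4] by (simp add: nf)
qed

lemma T_cycle: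
  assumes "T z d"
  shows "T (z + d) ((\<omega> - 1) * d)" "T (z + \<omega> * d) (- (\<omega> * d))"
proof -
  show 1: "T (z + d) ((\<omega> - 1) * d)" using T_next[OF assms] .
  show 2: "T (z + \<omega> * d) (- (\<omega> * d))" using T_next[OF 1] by (simp add: nf)
qed

text \<open>The tile across a side of a shield is a shield in \<open>SS\<close> and a triangle in \<open>ST\<close>. In \<open>X\<close>, the two
  shields at \<open>z\<close> are separated by triangles, so that they are translates of one another along their
  common diagonal.\<close>

definition SS where "SS s z d \<longleftrightarrow> H s z d \<and> H s (z + d) (- d)"
definition ST where "ST s z d \<longleftrightarrow> H s z d \<and> T (z + d) (- d)"
definition X where "X s z d \<longleftrightarrow> H s z d \<and> T z (\<omega> * (c s * d)) \<and>
  H (\<not> s) z ((\<omega> - 1) * (c s * d)) \<and> T z ((1 - \<omega>) * d)"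

lemma SS_ST: "SS s z d \<Longrightarrow> ST s z d \<Longrightarrow> False"
  unfolding SS_def ST_def using HT_excl by blast

lemma SS_rev: "SS s z d \<Longrightarrow> SS s (z + d) (- d)"
  unfolding SS_def by simp

lemma T_back: "T z ((1 - \<omega>) * d) \<Longrightarrow> T (z + d) (- d)"
  using T_cycle(2)[of z "(1 - \<omega>) * d"] by (simp add: nf)

text \<open>Only one other shield meets the vertex, so at most one of the two sides at
  \<open>z\<close> is shared: the incoming one, the outgoing one, or neither. The negated facts make
  the three cases exclusive, which the later arguments by elimination use.\<close>

lemma vertex_cases:
  assumes "H s z d"
  obtains (prev) "SS (\<not> s) (z + \<omega> * (c s * d)) (- (\<omega> * (c s * d)))" "ST s z d"
      "H (\<not> s) z (\<omega> * (c s * d))" "T z (- (\<omega> * d))" "T z ((1 - \<omega>) * d)" "\<not> X s z d"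
      "\<not> SS s z d"
  | ("next") "SS s z d" "ST (\<not> s) (z + \<omega> * (c s * d)) (- (\<omega> * (c s * d)))"
      "T z (\<omega> * (c s * d))" "T z ((\<omega> - 1) * (c s * d))" "H (\<not> s) z (- (c s * d))" "\<not> X s z d"
      "\<not> SS (\<not> s) (z + \<omega> * (c s * d)) (- (\<omega> * (c s * d)))"
  | (X) "X s z d" "ST s z d" "ST (\<not> s) (z + \<omega> * (c s * d)) (- (\<omega> * (c s * d)))"
      "\<not> SS s z d" "\<not> SS (\<not> s) (z + \<omega> * (c s * d)) (- (\<omega> * (c s * d)))"
proof -
  note h5 = H_cycle(5)[OF assms]
  consider (1) "H (\<not> s) z (\<omega> * (c s * d))" "T z (- (\<omega> * d))" "T z ((1 - \<omega>) * d)"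
    | (2) "T z (\<omega> * (c s * d))" "T z ((\<omega> - 1) * (c s * d))" "H (\<not> s) z (- (c s * d))"
    | (3) "T z (\<omega> * (c s * d))" "H (\<not> s) z ((\<omega> - 1) * (c s * d))" "T z ((1 - \<omega>) * d)"
    using H_vertex[OF assms] by blast
  then show thesis
  proof cases
    case 1
    have a: "ST s z d" unfolding ST_def using assms T_back[OF 1(3)] by simp
    have "\<not> SS s z d" using a SS_ST by blast
    moreover have "SS (\<not> s) (z + \<omega> * (c s * d)) (- (\<omega> * (c s * d)))"
      unfolding SS_def using h5 1(1) by simp
    moreover have "\<not> X s z d" unfolding X_def using 1(1) HT_excl by blast
    ultimately show ?thesis using a 1 prev by blast
  next
    case 2
    have "H s (z + d) (- d)" using H_cycle(5)[OF 2(3)] by (simp add: nf)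
    then have a: "SS s z d" unfolding SS_def using assms by simp
    have b: "ST (\<not> s) (z + \<omega> * (c s * d)) (- (\<omega> * (c s * d)))"
      unfolding ST_def using h5 2(1) by simp
    have "\<not> X s z d" unfolding X_def using a SS_ST[of s z d] T_back[of z d] unfolding ST_def SS_def by blast
    then show ?thesis using a b 2 "next" SS_ST by blast
  next
    case 3
    have a: "ST s z d" unfolding ST_def using assms T_back[OF 3(3)] by simp
    have b: "ST (\<not> s) (z + \<omega> * (c s * d)) (- (\<omega> * (c s * d)))"
      unfolding ST_def using h5 3(1) by simp
    have "X s z d" unfolding X_def using 3 assms by blast
    then show ?thesis using a b X SS_ST by blast
  qed
qed

lemma edge_cases: "H s z d \<Longrightarrow> SS s z d \<or> ST s z d"
  by (erule vertex_cases) blast+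

lemma X_iff: "X s z d \<longleftrightarrow> ST s z d \<and> ST (\<not> s) (z + \<omega> * (c s * d)) (- (\<omega> * (c s * d)))"
proof
  assume "X s z d"
  then have "H s z d" unfolding X_def by blast
  then show "ST s z d \<and> ST (\<not> s) (z + \<omega> * (c s * d)) (- (\<omega> * (c s * d)))"
    using \<open>X s z d\<close> by (cases rule: vertex_cases) blast+
next
  assume a: "ST s z d \<and> ST (\<not> s) (z + \<omega> * (c s * d)) (- (\<omega> * (c s * d)))"
  then have "H s z d" unfolding ST_def by blast
  then show "X s z d" using a SS_ST by (cases rule: vertex_cases) blast+
qed

text \<open>The version of \<open>X_iff\<close> seen from the incoming edge of the vertex.\<close>

lemma X_iff': "X (\<not> s) (z + d) (c s * d) \<longleftrightarrow> ST s z d \<and> ST (\<not> s) (z + d) (c s * d)"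
  using X_iff[of "\<not> s" "z + d" "c s * d"] by (auto simp: nf)

lemma X_flip: "X s z d \<Longrightarrow> X (\<not> s) z ((\<omega> - 1) * (c s * d))"
  unfolding X_def by (auto simp: nf)

lemma SS_next: "SS s z d \<Longrightarrow> ST (\<not> s) (z + d) (c s * d)"
proof -
  assume a: "SS s z d"
  then have "H (\<not> s) (z + d) (c s * d)" unfolding SS_def using H_next by blast
  then show ?thesis
  proof (cases rule: vertex_cases)
    case "next"
    then show ?thesis using a by (simp add: nf)
  qed
qed

lemma SS_prev: "SS s z d \<Longrightarrow> ST (\<not> s) (z + \<omega> * (c s * d)) (- (\<omega> * (c s * d)))"
proof -
  assume a: "SS s z d"
  then have "H s z d" unfolding SS_def by blast
  then show ?thesis using a by (cases rule: vertex_cases) blast+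
qed

text \<open>The triangle outside the side has a second side at \<open>z\<close>. The tile across
  that second side is the next one around \<open>z\<close>: a shield in the situation
  \<open>X\<close>, a triangle otherwise. So the kind of a single tile, which other shields see as
  well, decides what happens at \<open>z\<close>. All propagation rests on this lemma and on its
  mirror image at \<open>z + d\<close>.\<close>

lemma triangle_prev:
  assumes "ST s z d"
  shows "X s z d \<and> H s (z + (1 - \<omega>) * d) ((\<omega> - 1) * d) \<or>
    SS (\<not> s) (z + \<omega> * (c s * d)) (- (\<omega> * (c s * d))) \<and> H (\<not> s) z (\<omega> * (c s * d)) \<and>
      T z (- (\<omega> * d)) \<and> T (z + (1 - \<omega>) * d) ((\<omega> - 1) * d)"
proof -
  have "H s z d" using assms unfolding ST_def by blast
  then show ?thesis
  proof (cases rule: vertex_cases)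
    case prev
    then show ?thesis using T_cycle(2)[OF prev(4)] by (simp add: nf)
  next
    case "next"
    then show ?thesis using assms SS_ST by blast
  next
    case X
    then have "H (\<not> s) z ((\<omega> - 1) * (c s * d))" unfolding X_def by blast
    from H_cycle(5)[OF this] show ?thesis using X by (simp add: nf)
  qed
qed

lemma triangle_next:
  assumes "ST s z d"
  shows "X (\<not> s) (z + d) (c s * d) \<and> H s (z + d) (- (\<omega> * d)) \<or>
    SS (\<not> s) (z + d) (c s * d) \<and> H s (z + d) (- ((\<omega> - 1) * d)) \<and>
      T (z + d) (- (\<omega> * d))"
proof -
  have "H (\<not> s) (z + d) (c s * d)" using assms H_next unfolding ST_def by blast
  then show ?thesis
  proof (cases rule: vertex_cases)
    case prev
    then have "SS s z d" by (simp add: nf)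
    then show ?thesis using assms SS_ST by blast
  next
    case "next"
    then show ?thesis by (simp add: nf)
  next
    case X
    then have "H s (z + d) ((\<omega> - 1) * (c (\<not> s) * (c s * d)))" unfolding X_def by simp
    then show ?thesis using X by (simp add: nf)
  qed
qed

lemma ST_H: "ST s z d \<Longrightarrow> H s z d" and X_H: "X s z d \<Longrightarrow> H s z d"
  unfolding ST_def X_def by blast+

section \<open>Propagation\<close>

text \<open>Connectedness in terms of shields alone: passing through shared sides and to opposite
  shields is enough, because the triangles bordering reached shields lead only to reached shields
  and to other such triangles.\<close>

lemma shields_conn:
  assumes QH: "\<And>s z d. Q s z d \<Longrightarrow> H s z d"
    and Qn: "\<And>s z d. Q s z d \<Longrightarrow> Q (\<not> s) (z + d) (c s * d)"
    and QSS: "\<And>s z d. Q s z d \<Longrightarrow> SS s z d \<Longrightarrow> Q s (z + d) (- d)"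
    and QX: "\<And>s z d. Q s z d \<Longrightarrow> X s z d \<Longrightarrow> Q (\<not> s) z ((\<omega> - 1) * (c s * d))"
    and ne: "Q s0 z0 d0"
  shows "(\<forall>s z d. H s z d \<longrightarrow> Q s z d) \<and> (\<forall>z d. T z d \<longrightarrow> (\<exists>s.
    Q s (z + d) (- d) \<or> Q s (z + \<omega> * d) ((1 - \<omega>) * d) \<or> Q s z (\<omega> * d)))"
proof -
  define QT where "QT z d \<longleftrightarrow> T z d \<and> (\<exists>s.
    Q s (z + d) (- d) \<or> Q s (z + \<omega> * d) ((1 - \<omega>) * d) \<or> Q s z (\<omega> * d))" for z d
  have QTn: "QT (z + d) ((\<omega> - 1) * d)" if "QT z d" for z d
  proof -
    have "T (z + d) ((\<omega> - 1) * d)" using that T_next unfolding QT_def by blast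
    then show ?thesis using that unfolding QT_def by (auto simp: nf)
  qed
  have Qc: "Q (\<not> s) (z + \<omega> * (c s * d)) (- (\<omega> * (c s * d)))" if "Q s z d" for s z d
    using Qn[OF Qn[OF Qn[OF Qn[OF Qn[OF that]]]]] by (simp add: nf)
  \<comment> \<open>The two remaining sides of a triangle that borders a reached shield. In an
    opposite pair the shield across is reached by \<open>QX\<close>; otherwise a triangle lies
    across, and it borders the shield reached through the adjacent shared side.\<close>
  have rT: "QT (z + (1 - \<omega>) * d) ((\<omega> - 1) * d) \<or> (\<exists>s'. Q s' (z + (1 - \<omega>) * d) ((\<omega> - 1) * d))"
    and rT': "QT (z + d) (- (\<omega> * d)) \<or> (\<exists>s'. Q s' (z + d) (- (\<omega> * d)))"
    if q: "Q s z d" and t: "T (z + d) (- d)" for s z d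
  proof -
    have st: "ST s z d" unfolding ST_def using q t QH by blast
    show "QT (z + (1 - \<omega>) * d) ((\<omega> - 1) * d) \<or> (\<exists>s'. Q s' (z + (1 - \<omega>) * d) ((\<omega> - 1) * d))"
      using triangle_prev[OF st]
    proof
      assume "X s z d \<and> H s (z + (1 - \<omega>) * d) ((\<omega> - 1) * d)"
      then have "Q (\<not> s) z ((\<omega> - 1) * (c s * d))" using QX q by blast
      from Qc[OF this] show ?thesis by (auto simp: nf)
    next
      assume a: "SS (\<not> s) (z + \<omega> * (c s * d)) (- (\<omega> * (c s * d))) \<and> H (\<not> s) z (\<omega> * (c s * d)) \<and>
        T z (- (\<omega> * d)) \<and> T (z + (1 - \<omega>) * d) ((\<omega> - 1) * d)"
      have "Q (\<not> s) z (\<omega> * (c s * d))"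
        using QSS[OF Qc[OF q]] a by simp
      from Qc[OF this] have "Q s (z - \<omega> * d) (\<omega> * d)" by (simp add: nf)
      then have "QT z (- (\<omega> * d))" unfolding QT_def using a by auto
      from QTn[OF QTn[OF this]] have "QT (z + (1 - \<omega>) * d) ((\<omega> - 1) * d)"
        by (simp add: nf)
      then show ?thesis by blast
    qed
    show "QT (z + d) (- (\<omega> * d)) \<or> (\<exists>s'. Q s' (z + d) (- (\<omega> * d)))"
      using triangle_next[OF st]
    proof
      assume a: "X (\<not> s) (z + d) (c s * d) \<and> H s (z + d) (- (\<omega> * d))"
      then have "Q s (z + d) ((\<omega> - 1) * (c (\<not> s) * (c s * d)))"
        using QX[OF Qn[OF q]] by simp
      then show ?thesis by (auto simp: nf)
    next
      assume a: "SS (\<not> s) (z + d) (c s * d) \<and> H s (z + d) (- ((\<omega> - 1) * d)) \<and>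
        T (z + d) (- (\<omega> * d))"
      have "Q (\<not> s) (z + d + c s * d) (- (c s * d))"
        using QSS[OF Qn[OF q]] a by simp
      from Qn[OF this] have "Q s (z + d) (- ((\<omega> - 1) * d))" by (simp add: nf)
      then have "QT (z + d) (- (\<omega> * d))" unfolding QT_def using a by (auto simp: nf)
      then show ?thesis by blast
    qed
  qed
  have "(\<forall>s z d. H s z d \<longrightarrow> Q s z d) \<and> (\<forall>z d. T z d \<longrightarrow> QT z d)"
  proof (rule conn)
    show "\<And>s z d. Q s z d \<Longrightarrow> H s z d" by (rule QH)
    show "\<And>z d. QT z d \<Longrightarrow> T z d" unfolding QT_def by blast
    show "\<And>s z d. Q s z d \<Longrightarrow> Q (\<not> s) (z + d) (c s * d)" by (rule Qn)
    show "\<And>z d. QT z d \<Longrightarrow> QT (z + d) ((\<omega> - 1) * d)" by (rule QTn)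
    show "QT (z + d) (- d) \<or> (\<exists>s'. Q s' (z + d) (- d))" if "Q s z d" for s z d
    proof (cases "SS s z d")
      case True then show ?thesis using QSS that by blast
    next
      case False
      then have "T (z + d) (- d)" using edge_cases[OF QH[OF that]] unfolding ST_def by blast
      then have "QT (z + d) (- d)" unfolding QT_def using that by auto
      then show ?thesis by blast
    qed
    show "QT (z + d) (- d) \<or> (\<exists>s'. Q s' (z + d) (- d))" if qt: "QT z d" for z d
    proof -
      have t: "T z d" using qt unfolding QT_def by blast
      obtain s where "Q s (z + d) (- d) \<or> Q s (z + \<omega> * d) ((1 - \<omega>) * d) \<or> Q s z (\<omega> * d)"
        using qt unfolding QT_def by blast
      then show ?thesis
      proof (elim disjE)
        assume "Q s (z + d) (- d)" then show ?thesis by blast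
      next
        assume q: "Q s (z + \<omega> * d) ((1 - \<omega>) * d)"
        from rT'[OF q] T_cycle(1)[OF t] show ?thesis by (simp add: nf)
      next
        assume q: "Q s z (\<omega> * d)"
        from rT[OF q] T_cycle(2)[OF t] show ?thesis by (simp add: nf)
      qed
    qed
    show "(\<exists>s z d. Q s z d) \<or> (\<exists>z d. QT z d)" using ne by blast
  qed
  then show ?thesis unfolding QT_def by blast
qed

text \<open>\<open>P\<close> marks some darts of a shield and \<open>Q\<close> all darts of the
  marked shields. The conditions on shared sides and opposite pairs then have to be checked only for
  the six sides counted from a marked dart.\<close>

lemma shields_conn6:
  assumes PH: "\<And>s z d. P s z d \<Longrightarrow> H s z d" and ne: "P s0 z0 d0"
    and QDef: "\<And>s z d. Q s z d \<longleftrightarrow> P s z d \<or>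
      P (\<not> s) (z + d) (c s * d) \<or> P s (z + d + c s * d) ((\<omega> - 1) * d) \<or>
      P (\<not> s) (z + \<omega> * d + c s * d) ((\<omega> - 1) * (c s * d)) \<or>
      P s (z + \<omega> * d + \<omega> * (c s * d)) (- (\<omega> * d)) \<or>
      P (\<not> s) (z + \<omega> * (c s * d)) (- (\<omega> * (c s * d)))"
    and SSX: "\<And>s z d s' z' d'. P s z d \<Longrightarrow> (s', z', d') \<in> {(s, z, d),
       (\<not> s, z + d, c s * d), (s, z + d + c s * d, (\<omega> - 1) * d),
       (\<not> s, z + \<omega> * d + c s * d, (\<omega> - 1) * (c s * d)),
       (s, z + \<omega> * d + \<omega> * (c s * d), - (\<omega> * d)), (\<not> s, z + \<omega> * (c s * d), - (\<omega> * (c s * d)))} \<Longrightarrow>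
      (SS s' z' d' \<longrightarrow> Q s' (z' + d') (- d')) \<and>
      (X s' z' d' \<longrightarrow> Q (\<not> s') z' ((\<omega> - 1) * (c s' * d')))"
  shows "(\<forall>s z d. H s z d \<longrightarrow> Q s z d) \<and> (\<forall>z d. T z d \<longrightarrow> (\<exists>s.
    Q s (z + d) (- d) \<or> Q s (z + \<omega> * d) ((1 - \<omega>) * d) \<or> Q s z (\<omega> * d)))"
proof (rule shields_conn)
  have Q6: "(\<exists>t y f. P t y f \<and> (s, z, d) \<in> {(t, y, f),
       (\<not> t, y + f, c t * f), (t, y + f + c t * f, (\<omega> - 1) * f),
       (\<not> t, y + \<omega> * f + c t * f, (\<omega> - 1) * (c t * f)),
       (t, y + \<omega> * f + \<omega> * (c t * f), - (\<omega> * f)), (\<not> t, y + \<omega> * (c t * f), - (\<omega> * (c t * f)))})"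
    if "Q s z d" for s z d
    using that unfolding QDef
  proof (elim disjE)
    assume a: "P s z d"
    show ?thesis by (rule exI[of _ s], rule exI, rule exI, rule conjI, rule a) simp
  next
    assume a: "P (\<not> s) (z + d) (c s * d)"
    show ?thesis by (rule exI, rule exI, rule exI, rule conjI, rule a) (simp add: nf)
  next
    assume a: "P s (z + d + c s * d) ((\<omega> - 1) * d)"
    show ?thesis by (rule exI, rule exI, rule exI, rule conjI, rule a) (simp add: nf)
  next
    assume a: "P (\<not> s) (z + \<omega> * d + c s * d) ((\<omega> - 1) * (c s * d))"
    show ?thesis by (rule exI, rule exI, rule exI, rule conjI, rule a) (simp add: nf)
  next
    assume a: "P s (z + \<omega> * d + \<omega> * (c s * d)) (- (\<omega> * d))"
    show ?thesis by (rule exI, rule exI, rule exI, rule conjI, rule a) (simp add: nf)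
  next
    assume a: "P (\<not> s) (z + \<omega> * (c s * d)) (- (\<omega> * (c s * d)))"
    show ?thesis by (rule exI, rule exI, rule exI, rule conjI, rule a) (simp add: nf)
  qed
  show "H s z d" if "Q s z d" for s z d
  proof -
    from Q6[OF that] obtain t y f where p: "P t y f" and m: "(s, z, d) \<in> {(t, y, f),
       (\<not> t, y + f, c t * f), (t, y + f + c t * f, (\<omega> - 1) * f),
       (\<not> t, y + \<omega> * f + c t * f, (\<omega> - 1) * (c t * f)),
       (t, y + \<omega> * f + \<omega> * (c t * f), - (\<omega> * f)), (\<not> t, y + \<omega> * (c t * f), - (\<omega> * (c t * f)))}"
      by blast
    show ?thesis using m PH[OF p] H_cycle[OF PH[OF p]] by auto
  qed
  show "Q (\<not> s) (z + d) (c s * d)" if "Q s z d" for s z d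
    using that unfolding QDef by (auto simp: nf)
  show "Q s (z + d) (- d)" if q: "Q s z d" and ss: "SS s z d" for s z d
    using Q6[OF q] SSX ss by blast
  show "Q (\<not> s) z ((\<omega> - 1) * (c s * d))" if q: "Q s z d" and ss: "X s z d" for s z d
    using Q6[OF q] SSX ss by blast
  show "Q s0 z0 d0" using ne unfolding QDef by blast
qed

section \<open>Lines\<close>

text \<open>\<open>\<omega> * d + c s * d\<close> is the diagonal of the shield from
  \<open>z\<close> to the opposite vertex.\<close>

definition line where "line s z d \<longleftrightarrow> (\<forall>n::int. X s (z + of_int n * (\<omega> * d + c s * d)) d)"

lemma line_shift: "line s z d \<Longrightarrow> line s (z + of_int m * (\<omega> * d + c s * d)) d"
proof -
  assume a: "line s z d"
  have "X s (z + of_int m * (\<omega> * d + c s * d) + of_int n * (\<omega> * d + c s * d)) d" for n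
    using a[unfolded line_def, rule_format, of "m + n"] by (simp add: algebra_simps)
  then show ?thesis unfolding line_def by blast
qed

text \<open>The same line read backwards: the other shield at \<open>z\<close> has the opposite
  diagonal, so the index runs through the integers in the reverse order.\<close>

lemma line_flip: "line s z d \<Longrightarrow> line (\<not> s) z ((\<omega> - 1) * (c s * d))"
proof -
  assume a: "line s z d"
  have "X (\<not> s) (z + of_int n * (\<omega> * ((\<omega> - 1) * (c s * d)) + c (\<not> s) * ((\<omega> - 1) * (c s * d))))
     ((\<omega> - 1) * (c s * d))" for n
    using X_flip[OF a[unfolded line_def, rule_format, of "- n"]] by (simp add: nf)
  then show ?thesis unfolding line_def by blast
qed

lemma line_X: "line s z d \<Longrightarrow> X s z d" "line s z d \<Longrightarrow> X (\<not> s) (z + \<omega> * d + c s * d) ((\<omega> - 1) * (c s * d))"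
proof -
  assume a: "line s z d"
  show "X s z d" using a[unfolded line_def, rule_format, of 0] by simp
  show "X (\<not> s) (z + \<omega> * d + c s * d) ((\<omega> - 1) * (c s * d))"
    using X_flip[OF a[unfolded line_def, rule_format, of 1]] by (simp add: algebra_simps)
qed

text \<open>At the vertex between two consecutive shields of a diagonal, one triangle borders side 2
  of the first and side 0 of the second. A triangle lies across its third side iff side 1 of the
  first shield is shared, and also iff side 1 of the second is shared.\<close>

lemma X_step:
  assumes x3: "X (\<not> s) (z + \<omega> * d + c s * d) ((\<omega> - 1) * (c s * d))"
  shows "SS (\<not> s) (z + d) (c s * d) \<longleftrightarrow>
    SS (\<not> s) (z + (\<omega> * d + c s * d) + d) (c s * d)"
proof -
  have st: "ST s (z + d + c s * d) ((\<omega> - 1) * d)"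
    using x3[unfolded X_iff] by (simp add: nf)
  have x0: "X s (z + (\<omega> * d + c s * d)) d" using X_flip[OF x3] by (simp add: nf)
  then have st': "ST s (z + (\<omega> * d + c s * d)) d" using X_iff by blast
  show ?thesis
  proof
    assume ss: "SS (\<not> s) (z + d) (c s * d)"
    have "\<not> X s (z + d + c s * d) ((\<omega> - 1) * d)"
      using ss SS_ST X_iff'[of "\<not> s" "z + d" "c s * d"] by (auto simp: nf)
    with triangle_prev[OF st] have "T (z + d + \<omega> * d + c s * d) (- (\<omega> * d))"
      by (auto simp: nf)
    then show "SS (\<not> s) (z + (\<omega> * d + c s * d) + d) (c s * d)"
      using triangle_next[OF st'] HT_excl by (auto simp: nf)
  next
    assume ss: "SS (\<not> s) (z + (\<omega> * d + c s * d) + d) (c s * d)"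
    have "\<not> X (\<not> s) (z + (\<omega> * d + c s * d) + d) (c s * d)"
      using ss SS_ST X_iff by blast
    with triangle_next[OF st'] have "T (z + d + \<omega> * d + c s * d) (- (\<omega> * d))"
      by (auto simp: nf)
    then show "SS (\<not> s) (z + d) (c s * d)"
      using triangle_prev[OF st] HT_excl by (auto simp: nf)
  qed
qed

lemma line_all:
  assumes l: "line s z d"
  shows "SS (\<not> s) (z + d) (c s * d) \<longleftrightarrow>
    SS (\<not> s) (z + of_int n * (\<omega> * d + c s * d) + d) (c s * d)"
proof (induction n rule: int_induct[where k = 0])
  case base
  then show ?case by simp
next
  case (step1 i)
  then show ?case using X_step[OF line_X(2)[OF line_shift[OF l, of i]]] by (simp add: algebra_simps)
next
  case (step2 i)
  then show ?case using X_step[OF line_X(2)[OF line_shift[OF l, of "i - 1"]]] by (simp add: algebra_simps)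
qed

text \<open>If the sides facing downwards border triangles, the vertices at both their ends are
  opposite pairs all along the line, and the shields opposite there form a parallel row, shifted by
  one lattice vector.\<close>

lemma line_X_below:
  assumes l: "line s z d" and x: "X (\<not> s) (z + d) (c s * d)"
  shows "line s (z - \<omega> * (\<omega> * d + c s * d)) d"
proof -
  define p where "p n = z + of_int n * (\<omega> * d + c s * d)" for n :: int
  have pS: "p (n + 1) = p n + (\<omega> * d + c s * d)" for n unfolding p_def by (simp add: algebra_simps)
  have lp: "line s (p n) d" for n unfolding p_def by (rule line_shift[OF l])
  have st: "ST (\<not> s) (p n + d) (c s * d)" for n
  proof -
    have "\<not> SS (\<not> s) (z + d) (c s * d)" using x SS_ST X_iff by blast
    then have "\<not> SS (\<not> s) (p n + d) (c s * d)" using line_all[OF l] unfolding p_def by blast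
    moreover have "H (\<not> s) (p n + d) (c s * d)" by (rule H_next[OF X_H[OF line_X(1)[OF lp]]])
    ultimately show ?thesis using edge_cases by blast
  qed
  have x1: "X (\<not> s) (p n + d) (c s * d)" for n
    using X_iff' st[of n] line_X(1)[OF lp, of n] X_iff by blast
  have x2: "X s (p n + d + c s * d) ((\<omega> - 1) * d)" for n
    using st[of n] X_iff'[of "\<not> s" "p n + d" "c s * d"] line_X(2)[OF lp, of n, unfolded X_iff]
    by (simp add: nf)
  define p' where "p' n = p n - \<omega> * (\<omega> * d + c s * d)" for n
  have h': "H s (p' n) d" for n
  proof -
    have "H s (p n + d) (- (\<omega> * d))" using x1[of n] unfolding X_def by (simp add: nf)
    from H_cycle(2)[OF this] show ?thesis unfolding p'_def by (simp add: nf)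
  qed
  \<comment> \<open>The previous shield of the new row also ends in this vertex, so a shield lies
    across the triangle next to side 5; this excludes that side 0 is shared.\<close>
  have x': "X s (p' (n + 1)) d" for n
  proof -
    have sh: "ST (\<not> s) (p' (n+1) + \<omega> * (c s * d)) (- (\<omega> * (c s * d)))"
    proof -
      have "X (\<not> s) (p n + d + c s * d) ((\<omega> - 1) * (c s * ((\<omega> - 1) * d)))"
        by (rule X_flip[OF x2])
      then show ?thesis unfolding p'_def X_iff pS by (simp add: nf)
    qed
    have "H (\<not> s) (p' n + \<omega> * d + c s * d) ((\<omega> - 1) * (c s * d))" by (rule H_cycle(3)[OF h'])
    then have "H (\<not> s) (p' (n + 1)) ((\<omega> - 1) * (c s * d))" unfolding p'_def pS by (simp add: nf)
    then have "\<not> T (p' (n + 1)) ((\<omega> - 1) * (c s * d))" using HT_excl by blast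
    then show ?thesis using triangle_next[OF sh] by (auto simp: nf)
  qed
  show ?thesis unfolding line_def
  proof
    fix n :: int
    show "X s (z - \<omega> * (\<omega> * d + c s * d) + of_int n * (\<omega> * d + c s * d)) d"
      using x'[of "n - 1"] unfolding p'_def p_def by (simp add: algebra_simps)
  qed
qed

text \<open>Shields attached along shared sides are turned by \<open>pi\<close>, hence the direction
  \<open>- d\<close>. The point \<open>z + (2 - \<omega>) * d\<close> is the start of the dart of
  direction \<open>- d\<close> on the shield attached to the preceding shield of the line.\<close>

lemma line_SS_below:
  assumes l: "line s z d" and x: "SS (\<not> s) (z + d) (c s * d)"
  shows "line s (z + (2 - \<omega>) * d) (- d)"
proof -
  define p where "p n = z + of_int n * (\<omega> * d + c s * d)" for n :: int
  have pS: "p n = p (n - 1) + (\<omega> * d + c s * d)" for n unfolding p_def by (simp add: algebra_simps)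
  have ss: "SS (\<not> s) (p n + d) (c s * d)" for n
    using line_all[OF l] x unfolding p_def by blast
  have h: "H (\<not> s) (p n + d + c s * d) (- (c s * d))" for n
    using ss[of n] unfolding SS_def by simp
  have x': "X s (p n + (2 - \<omega>) * d) (- d)" for n
  proof -
    have "SS (\<not> s) (p n + d + c s * d) (- (c s * d))" using SS_rev[OF ss] .
    from SS_next[OF this] have st: "ST s (p n + d) ((1 - \<omega>) * d)" by (simp add: nf)
    have "H s (p (n - 1) + d + c s * d + \<omega> * (c (\<not> s) * (- (c s * d)))) (- (\<omega> * (c (\<not> s) * (- (c s * d)))))"
      using H_cycle(5)[OF h[of "n - 1"]] by simp
    then have "H s (p n + (2 - \<omega>) * d) (- d)" unfolding pS[of n] by (simp add: nf)
    then have "\<not> T (p n + (2 - \<omega>) * d) (- d)" using HT_excl by blast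
    with triangle_next[OF st] have "X (\<not> s) (p n + d + (1 - \<omega>) * d) (c s * ((1 - \<omega>) * d))"
      by (auto simp: nf)
    from X_flip[OF this] show ?thesis by (simp add: nf)
  qed
  show ?thesis unfolding line_def
  proof
    fix n :: int
    show "X s (z + (2 - \<omega>) * d + of_int n * (\<omega> * - d + c s * - d)) (- d)"
      using x'[of "- n"] unfolding p_def by (simp add: algebra_simps)
  qed
qed

end

context shield_darts begin

definition lines where "lines s d0 = {(z, d). line s z d \<and> (d = d0 \<or> d = - d0)}"

lemma line_below:
  assumes l: "(z, d) \<in> lines s d0"
  shows "ST (\<not> s) (z + d) (c s * d) \<Longrightarrow> (z - \<omega> * (\<omega> * d + c s * d), d) \<in> lines s d0"
    and "SS (\<not> s) (z + d) (c s * d) \<Longrightarrow> (z + (2 - \<omega>) * d, - d) \<in> lines s d0"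
proof -
  have ln: "line s z d" and d: "d = d0 \<or> d = - d0" using l unfolding lines_def by auto
  show "(z - \<omega> * (\<omega> * d + c s * d), d) \<in> lines s d0" if "ST (\<not> s) (z + d) (c s * d)"
  proof -
    have "X (\<not> s) (z + d) (c s * d)" using X_iff' that line_X(1)[OF ln] X_iff by blast
    from line_X_below[OF ln this] show ?thesis using d unfolding lines_def by simp
  qed
  show "(z + (2 - \<omega>) * d, - d) \<in> lines s d0" if "SS (\<not> s) (z + d) (c s * d)"
    using line_SS_below[OF ln that] d unfolding lines_def by auto
qed

text \<open>Above and below are exchanged by \<open>line_flip\<close> at the far end of the shield,
  so this reduces to \<open>line_below\<close>.\<close>

lemma line_above:
  assumes l: "(z, d) \<in> lines s d0"
  shows "ST s (z + \<omega> * d + \<omega> * (c s * d)) (- (\<omega> * d)) \<Longrightarrow>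
      (z + \<omega> * (\<omega> * d + c s * d), d) \<in> lines s d0"
    and "SS s (z + \<omega> * d + \<omega> * (c s * d)) (- (\<omega> * d)) \<Longrightarrow>
      (z + (2 * \<omega> - 1) * (c s * d), - d) \<in> lines s d0"
proof -
  have ln: "line s z d" and d: "d = d0 \<or> d = - d0" using l unfolding lines_def by auto
  have ln1: "line s (z + of_int 1 * (\<omega> * d + c s * d)) d" by (rule line_shift[OF ln])
  from line_flip[OF this]
  have fl: "line (\<not> s) (z + \<omega> * d + c s * d) ((\<omega> - 1) * (c s * d))" by (simp add: nf)
  then have "(z + \<omega> * d + c s * d, (\<omega> - 1) * (c s * d)) \<in> lines (\<not> s) ((\<omega> - 1) * (c s * d))"
    unfolding lines_def by simp
  note below = line_below[OF this]
  show "(z + \<omega> * (\<omega> * d + c s * d), d) \<in> lines s d0"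
    if a: "ST s (z + \<omega> * d + \<omega> * (c s * d)) (- (\<omega> * d))"
  proof -
    have "line (\<not> s) (z + \<omega> * d + c s * d -
       \<omega> * (\<omega> * ((\<omega> - 1) * (c s * d)) + c (\<not> s) * ((\<omega> - 1) * (c s * d)))) ((\<omega> - 1) * (c s * d))"
      using below(1) a unfolding lines_def by (simp add: nf)
    from line_flip[OF this]
    have "line s (z + \<omega> * d + c s * d + \<omega> * (\<omega> * d + c s * d)) d" by (simp add: nf)
    from line_shift[OF this, of "- 1"] have "line s (z + \<omega> * (\<omega> * d + c s * d)) d"
      by (simp add: algebra_simps)
    then show ?thesis using d unfolding lines_def by simp
  qed
  show "(z + (2 * \<omega> - 1) * (c s * d), - d) \<in> lines s d0"
    if a: "SS s (z + \<omega> * d + \<omega> * (c s * d)) (- (\<omega> * d))"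
  proof -
    have "line (\<not> s) (z + \<omega> * d + c s * d + (2 - \<omega>) * ((\<omega> - 1) * (c s * d)))
       (- ((\<omega> - 1) * (c s * d)))"
      using below(2) a unfolding lines_def by (simp add: nf)
    from line_flip[OF this]
    have "line s (z + \<omega> * d + c s * d + (2 - \<omega>) * ((\<omega> - 1) * (c s * d))) (- d)" by (simp add: nf)
    from line_shift[OF this, of 1] have "line s (z + (2 * \<omega> - 1) * (c s * d)) (- d)"
      by (simp add: nf)
    then show ?thesis using d unfolding lines_def by auto
  qed
qed

lemma lines_shift: "(z, d) \<in> lines s d0 \<Longrightarrow> (z + of_int m * (\<omega> * d + c s * d), d) \<in> lines s d0"
  unfolding lines_def using line_shift by auto

lemma lines_shift1: "(z, d) \<in> lines s d0 \<Longrightarrow> (z + \<omega> * d + c s * d, d) \<in> lines s d0"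
  "(z, d) \<in> lines s d0 \<Longrightarrow> (z - \<omega> * d - c s * d, d) \<in> lines s d0"
  using lines_shift[of z d s d0 1] lines_shift[of z d s d0 "-1"] by (simp_all add: algebra_simps)

lemma line_statuses:
  assumes "(z, d) \<in> lines s d0"
  shows "ST s z d" "ST s (z + d + c s * d) ((\<omega> - 1) * d)"
    "ST (\<not> s) (z + \<omega> * d + c s * d) ((\<omega> - 1) * (c s * d))"
    "ST (\<not> s) (z + \<omega> * (c s * d)) (- (\<omega> * (c s * d)))"
    "H s z d"
proof -
  have l: "line s z d" using assms unfolding lines_def by simp
  show "ST s z d" "ST (\<not> s) (z + \<omega> * (c s * d)) (- (\<omega> * (c s * d)))"
    using line_X(1)[OF l] X_iff by blast+
  show "ST (\<not> s) (z + \<omega> * d + c s * d) ((\<omega> - 1) * (c s * d))"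
    "ST s (z + d + c s * d) ((\<omega> - 1) * d)"
    using line_X(2)[OF l, unfolded X_iff] by (simp_all add: nf)
  show "H s z d" using line_X(1)[OF l] X_H by blast
qed

lemma triangle_orbit_next:
  assumes "(z, d) \<in> {(y, g), (y + g, (\<omega> - 1) * g), (y + \<omega> * g, - (\<omega> * g))}"
  shows "(z + d, (\<omega> - 1) * d) \<in> {(y, g), (y + g, (\<omega> - 1) * g), (y + \<omega> * g, - (\<omega> * g))}"
proof -
  consider "z = y" "d = g" | "z = y + g" "d = (\<omega> - 1) * g" | "z = y + \<omega> * g" "d = - (\<omega> * g)"
    using assms by blast
  then show ?thesis
  proof cases
    case 1 show ?thesis unfolding 1 by simp
  next
    case 2 show ?thesis unfolding 2 by (simp add: nf)
  next
    case 3 show ?thesis unfolding 3 by (simp add: nf)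
  qed
qed

text \<open>One infinite diagonal determines the rest: every way out of its shields leads along the
  line or into one of the two adjacent parallel lines, so the shields on such lines are closed under
  the moves of \<open>shields_conn6\<close>. The two values of \<open>g\<close> are the triangles on
  either side of the start of a shield.\<close>

lemma lines_cover:
  assumes l0: "line s0 z0 d0"
  shows "H s0 z d \<Longrightarrow> \<exists>(y, f) \<in> lines s0 d0.
      (z, d) \<in> {(y, f), (y + f + c s0 * f, (\<omega> - 1) * f),
        (y + \<omega> * f + \<omega> * (c s0 * f), - (\<omega> * f))}"
    and "T z d \<Longrightarrow> \<exists>(y, f) \<in> lines s0 d0. \<exists>g\<in>{(1 - \<omega>) * f, \<omega> * (c s0 * f)}.
      (z, d) \<in> {(y, g), (y + g, (\<omega> - 1) * g), (y + \<omega> * g, - (\<omega> * g))}"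
proof -
  define P where "P t y f \<longleftrightarrow> t = s0 \<and> (y, f) \<in> lines s0 d0" for t y f
  define Q where "Q s z d \<longleftrightarrow> P s z d \<or>
      P (\<not> s) (z + d) (c s * d) \<or> P s (z + d + c s * d) ((\<omega> - 1) * d) \<or>
      P (\<not> s) (z + \<omega> * d + c s * d) ((\<omega> - 1) * (c s * d)) \<or>
      P s (z + \<omega> * d + \<omega> * (c s * d)) (- (\<omega> * d)) \<or>
      P (\<not> s) (z + \<omega> * (c s * d)) (- (\<omega> * (c s * d)))" for s z d
  have QI: "Q s y f" "Q (\<not> s) (y + f) (c s * f)" "Q s (y + f + c s * f) ((\<omega> - 1) * f)"
      "Q (\<not> s) (y + \<omega> * f + c s * f) ((\<omega> - 1) * (c s * f))"
      "Q s (y + \<omega> * f + \<omega> * (c s * f)) (- (\<omega> * f))"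
      "Q (\<not> s) (y + \<omega> * (c s * f)) (- (\<omega> * (c s * f)))" if "P s y f" for s y f
    using that unfolding Q_def by (auto simp: nf)
  have main: "(\<forall>s z d. H s z d \<longrightarrow> Q s z d) \<and> (\<forall>z d. T z d \<longrightarrow> (\<exists>s.
    Q s (z + d) (- d) \<or> Q s (z + \<omega> * d) ((1 - \<omega>) * d) \<or> Q s z (\<omega> * d)))"
  proof (rule shields_conn6[OF _ _ Q_def])
    show "H s z d" if "P s z d" for s z d using that line_statuses(5) unfolding P_def by blast
    show "P s0 z0 d0" using l0 unfolding P_def lines_def by simp
    fix s z d s' z' d'
    assume p: "P s z d" and m: "(s', z', d') \<in> {(s, z, d),
       (\<not> s, z + d, c s * d), (s, z + d + c s * d, (\<omega> - 1) * d),
       (\<not> s, z + \<omega> * d + c s * d, (\<omega> - 1) * (c s * d)),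
       (s, z + \<omega> * d + \<omega> * (c s * d), - (\<omega> * d)), (\<not> s, z + \<omega> * (c s * d), - (\<omega> * (c s * d)))}"
    have s: "s = s0" and zd: "(z, d) \<in> lines s d0" using p unfolding P_def by auto
    note st = line_statuses[OF zd]
    have Pl: "P s y f" if "(y, f) \<in> lines s d0" for y f using that s unfolding P_def by simp
    note QIl = QI[OF Pl]
    note sh = QIl[OF lines_shift1(1)[OF zd]] QIl[OF lines_shift1(2)[OF zd]]
    have h1: "H (\<not> s) (z + d) (c s * d)" and h4: "H s (z + \<omega> * d + \<omega> * (c s * d)) (- (\<omega> * d))"
      using H_cycle st(5) by blast+
    show "(SS s' z' d' \<longrightarrow> Q s' (z' + d') (- d')) \<and>
      (X s' z' d' \<longrightarrow> Q (\<not> s') z' ((\<omega> - 1) * (c s' * d')))"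
      using m unfolding insert_iff empty_iff prod.inject
    proof (elim disjE conjE)
      assume e: "s' = s" "z' = z" "d' = d"
      have "\<not> SS s' z' d'" using st e SS_ST by blast
      moreover have "Q (\<not> s') z' ((\<omega> - 1) * (c s' * d'))" using sh unfolding e by (simp add: nf)
      ultimately show ?thesis by blast
    next
      assume e: "s' = (\<not> s)" "z' = z + d" "d' = c s * d"
      have "Q s' (z' + d') (- d')" if "SS s' z' d'"
        using QIl[OF lines_shift1(2)[OF line_below(2)[OF zd that[unfolded e]]]] unfolding e by (simp add: nf)
      moreover have "Q (\<not> s') z' ((\<omega> - 1) * (c s' * d'))" if "X s' z' d'"
      proof -
        have "ST (\<not> s) (z + d) (c s * d)" using that X_iff e by blast
        from QIl[OF line_below(1)[OF zd this]] show ?thesis unfolding e by (simp add: nf)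
      qed
      ultimately show ?thesis by blast
    next
      assume e: "s' = s" "z' = z + d + c s * d" "d' = (\<omega> - 1) * d"
      have "\<not> SS s' z' d'" using st(2) e SS_ST by blast
      moreover have "Q (\<not> s') z' ((\<omega> - 1) * (c s' * d'))" if "X s' z' d'"
      proof -
        have "ST (\<not> s) (z + d) (c s * d)" using that unfolding X_iff e by (simp add: nf)
        from QIl[OF lines_shift1(1)[OF line_below(1)[OF zd this]]]
        show ?thesis unfolding e by (simp add: nf)
      qed
      ultimately show ?thesis by blast
    next
      assume e: "s' = (\<not> s)" "z' = z + \<omega> * d + c s * d" "d' = (\<omega> - 1) * (c s * d)"
      have "\<not> SS s' z' d'" using st e SS_ST by blast
      moreover have "Q (\<not> s') z' ((\<omega> - 1) * (c s' * d'))" using sh unfolding e by (simp add: nf)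
      ultimately show ?thesis by blast
    next
      assume e: "s' = s" "z' = z + \<omega> * d + \<omega> * (c s * d)" "d' = - (\<omega> * d)"
      have "Q s' (z' + d') (- d')" if "SS s' z' d'"
        using QIl[OF lines_shift1(2)[OF line_above(2)[OF zd that[unfolded e]]]] unfolding e by (simp add: nf)
      moreover have "Q (\<not> s') z' ((\<omega> - 1) * (c s' * d'))" if "X s' z' d'"
      proof -
        have "ST s (z + \<omega> * d + \<omega> * (c s * d)) (- (\<omega> * d))" using that X_iff e by blast
        from QIl[OF line_above(1)[OF zd this]] show ?thesis unfolding e by (simp add: nf)
      qed
      ultimately show ?thesis by blast
    next
      assume e: "s' = (\<not> s)" "z' = z + \<omega> * (c s * d)" "d' = - (\<omega> * (c s * d))"
      have "\<not> SS s' z' d'" using st(4) e SS_ST by blast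
      moreover have "Q (\<not> s') z' ((\<omega> - 1) * (c s' * d'))" if "X s' z' d'"
      proof -
        have "ST s (z + \<omega> * d + \<omega> * (c s * d)) (- (\<omega> * d))"
          using that unfolding X_iff e by (simp add: nf)
        from QIl[OF lines_shift1(2)[OF line_above(1)[OF zd this]]]
        show ?thesis unfolding e by (simp add: nf)
      qed
      ultimately show ?thesis by blast
    qed simp
  qed
  have Qs: "\<exists>(y, f) \<in> lines s0 d0.
      (s = s0 \<and> (z, d) \<in> {(y, f), (y + f + c s0 * f, (\<omega> - 1) * f),
        (y + \<omega> * f + \<omega> * (c s0 * f), - (\<omega> * f))}) \<or>
      (s = (\<not> s0) \<and> (z, d) \<in> {(y + f, c s0 * f),
       (y + \<omega> * f + c s0 * f, (\<omega> - 1) * (c s0 * f)),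
       (y + \<omega> * (c s0 * f), - (\<omega> * (c s0 * f)))})" if "Q s z d" for s z d
    using that unfolding Q_def P_def
  proof (elim disjE conjE)
    assume a: "s = s0" "(z, d) \<in> lines s0 d0"
    show ?thesis by (rule bexI[OF _ a(2)]) (simp add: a(1))
  next
    assume a: "(\<not> s) = s0" "(z + d, c s * d) \<in> lines s0 d0"
    then have e: "s0 = (\<not> s)" by simp
    show ?thesis unfolding e by (rule bexI[OF _ a(2)[unfolded e]]) (simp add: nf)
  next
    assume a: "s = s0" "(z + d + c s * d, (\<omega> - 1) * d) \<in> lines s0 d0"
    show ?thesis unfolding a(1)[symmetric] by (rule bexI[OF _ a(2)[unfolded a(1)[symmetric]]]) (simp add: nf)
  next
    assume a: "(\<not> s) = s0" "(z + \<omega> * d + c s * d, (\<omega> - 1) * (c s * d)) \<in> lines s0 d0"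
    then have e: "s0 = (\<not> s)" by simp
    show ?thesis unfolding e by (rule bexI[OF _ a(2)[unfolded e]]) (simp add: nf)
  next
    assume a: "s = s0" "(z + \<omega> * d + \<omega> * (c s * d), - (\<omega> * d)) \<in> lines s0 d0"
    show ?thesis unfolding a(1)[symmetric] by (rule bexI[OF _ a(2)[unfolded a(1)[symmetric]]]) (simp add: nf)
  next
    assume a: "(\<not> s) = s0" "(z + \<omega> * (c s * d), - (\<omega> * (c s * d))) \<in> lines s0 d0"
    then have e: "s0 = (\<not> s)" by simp
    show ?thesis unfolding e by (rule bexI[OF _ a(2)[unfolded e]]) (simp add: nf)
  qed
  show "\<exists>(y, f) \<in> lines s0 d0.
      (z, d) \<in> {(y, f), (y + f + c s0 * f, (\<omega> - 1) * f),
        (y + \<omega> * f + \<omega> * (c s0 * f), - (\<omega> * f))}" if "H s0 z d"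
    using main Qs[of s0 z d] that by auto
  have tri: "\<exists>(y, f) \<in> lines s0 d0. \<exists>g\<in>{(1 - \<omega>) * f, \<omega> * (c s0 * f)}.
      (z + d, - d) \<in> {(y, g), (y + g, (\<omega> - 1) * g), (y + \<omega> * g, - (\<omega> * g))}"
    if q: "Q s z d" and t: "T (z + d) (- d)" for s z d
  proof -
    have wit: ?thesis if "(y, f) \<in> lines s0 d0" "g = (1 - \<omega>) * f \<or> g = \<omega> * (c s0 * f)"
      "(z + d, - d) \<in> {(y, g), (y + g, (\<omega> - 1) * g), (y + \<omega> * g, - (\<omega> * g))}" for y f g
      using that by blast
    obtain y f where yf: "(y, f) \<in> lines s0 d0" and
      "(s = s0 \<and> (z, d) \<in> {(y, f), (y + f + c s0 * f, (\<omega> - 1) * f),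
        (y + \<omega> * f + \<omega> * (c s0 * f), - (\<omega> * f))}) \<or>
      (s = (\<not> s0) \<and> (z, d) \<in> {(y + f, c s0 * f),
       (y + \<omega> * f + c s0 * f, (\<omega> - 1) * (c s0 * f)),
       (y + \<omega> * (c s0 * f), - (\<omega> * (c s0 * f)))})" using Qs[OF q] by blast
    then consider "s = s0" "z = y" "d = f"
      | "s = s0" "z = y + f + c s0 * f" "d = (\<omega> - 1) * f"
      | "s = s0" "z = y + \<omega> * f + \<omega> * (c s0 * f)" "d = - (\<omega> * f)"
      | "s = (\<not> s0)" "z = y + f" "d = c s0 * f"
      | "s = (\<not> s0)" "z = y + \<omega> * f + c s0 * f" "d = (\<omega> - 1) * (c s0 * f)"
      | "s = (\<not> s0)" "z = y + \<omega> * (c s0 * f)" "d = - (\<omega> * (c s0 * f))" by auto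
    then show ?thesis
    proof cases
      case 1
      show ?thesis by (rule wit[OF yf, of "(1 - \<omega>) * f"]) (use 1(2,3) in \<open>simp_all add: nf\<close>)
    next
      case 2
      show ?thesis by (rule wit[OF lines_shift1(1)[OF yf], of "(1 - \<omega>) * f"]) (use 2(2,3) in \<open>simp_all add: nf\<close>)
    next
      case 3
      \<comment> \<open>The triangle above this side is counted with the line above, which exists as
        the side is not shared. In the next case the line below is used in the same way.\<close>
      have "ST s z d" unfolding ST_def 3(1) using t H_cycle(4)[OF line_statuses(5)[OF yf]] 3(2,3) by simp
      then have "(y + \<omega> * (\<omega> * f + c s0 * f), f) \<in> lines s0 d0"
        using line_above(1)[OF yf] unfolding 3 by simp
      from lines_shift1(1)[OF lines_shift1(2)[OF this]]
      show ?thesis by (rule wit[of _ f "(1 - \<omega>) * f"]) (use 3(2,3) in \<open>simp_all add: nf\<close>)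
    next
      case 4
      have "ST s z d" unfolding ST_def 4(1) using t H_cycle(1)[OF line_statuses(5)[OF yf]] 4(2,3) by simp
      then have "(y - \<omega> * (\<omega> * f + c s0 * f), f) \<in> lines s0 d0"
        using line_below(1)[OF yf] unfolding 4 by simp
      from lines_shift1(1)[OF this]
      show ?thesis by (rule wit[of _ f "\<omega> * (c s0 * f)"]) (use 4(2,3) in \<open>simp_all add: nf\<close>)
    next
      case 5
      show ?thesis by (rule wit[OF lines_shift1(1)[OF yf], of "\<omega> * (c s0 * f)"]) (use 5(2,3) in \<open>simp_all add: nf\<close>)
    next
      case 6
      show ?thesis by (rule wit[OF yf, of "\<omega> * (c s0 * f)"]) (use 6(2,3) in \<open>simp_all add: nf\<close>)
    qed
  qed
  show "\<exists>(y, f) \<in> lines s0 d0. \<exists>g\<in>{(1 - \<omega>) * f, \<omega> * (c s0 * f)}.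
      (z, d) \<in> {(y, g), (y + g, (\<omega> - 1) * g), (y + \<omega> * g, - (\<omega> * g))}" if t: "T z d"
  proof -
    obtain s where "Q s (z + d) (- d) \<or> Q s (z + \<omega> * d) ((1 - \<omega>) * d) \<or> Q s z (\<omega> * d)"
      using main t by blast
    then show ?thesis
    proof (elim disjE)
      assume q: "Q s (z + d) (- d)"
      show ?thesis using tri[OF q] t by simp
    next
      assume q: "Q s (z + \<omega> * d) ((1 - \<omega>) * d)"
      have "T (z + \<omega> * d + (1 - \<omega>) * d) (- ((1 - \<omega>) * d))"
        using T_cycle(1)[OF t] by (simp add: nf)
      from tri[OF q this] obtain y f g where yf: "(y, f) \<in> lines s0 d0"
        and g: "g\<in>{(1 - \<omega>) * f, \<omega> * (c s0 * f)}" and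
        m: "(z + \<omega> * d + (1 - \<omega>) * d, - ((1 - \<omega>) * d)) \<in> {(y, g), (y + g, (\<omega> - 1) * g), (y + \<omega> * g, - (\<omega> * g))}"
        by blast
      have "(z, d) \<in> {(y, g), (y + g, (\<omega> - 1) * g), (y + \<omega> * g, - (\<omega> * g))}"
        using triangle_orbit_next[OF triangle_orbit_next[OF m]] by (simp add: nf)
      then show ?thesis using yf g by blast
    next
      assume q: "Q s z (\<omega> * d)"
      have "T (z + \<omega> * d) (- (\<omega> * d))" using T_cycle(2)[OF t] by simp
      from tri[OF q this] obtain y f g where yf: "(y, f) \<in> lines s0 d0"
        and g: "g\<in>{(1 - \<omega>) * f, \<omega> * (c s0 * f)}" and
        m: "(z + \<omega> * d, - (\<omega> * d)) \<in> {(y, g), (y + g, (\<omega> - 1) * g), (y + \<omega> * g, - (\<omega> * g))}"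
        by blast
      have "(z, d) \<in> {(y, g), (y + g, (\<omega> - 1) * g), (y + \<omega> * g, - (\<omega> * g))}"
        using triangle_orbit_next[OF m] by (simp add: nf)
      then show ?thesis using yf g by blast
    qed
  qed
qed

section \<open>Corners and sectors\<close>

definition corner where "corner s z d \<longleftrightarrow> ST s z d \<and> SS (\<not> s) (z + d) (c s * d) \<and>
  SS (\<not> s) (z + \<omega> * (c s * d)) (- (\<omega> * (c s * d)))"

text \<open>\<open>(z - \<omega> * d, \<omega> * d)\<close> is \<open>(z, d)\<close> turned by
  \<open>pi / 3\<close> about the apex \<open>z + (1 - \<omega>) * d\<close>. Both other sides of
  the triangle border triangles, so three consecutive triangles meet at the apex, and then all six
  tiles there are triangles. This makes the shield across the side before \<open>z\<close> have a
  corner as well.\<close>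

lemma corner_rot:
  assumes "corner s z d"
  shows "corner s (z - \<omega> * d) (\<omega> * d)"
proof -
  have st: "ST s z d" and ss1: "SS (\<not> s) (z + d) (c s * d)"
    and ss2: "SS (\<not> s) (z + \<omega> * (c s * d)) (- (\<omega> * (c s * d)))"
    using assms unfolding corner_def by blast+
  have "\<not> X s z d" using ss2 X_iff SS_ST by blast
  with triangle_prev[OF st] have p: "H (\<not> s) z (\<omega> * (c s * d))" "T z (- (\<omega> * d))"
    "T (z + (1 - \<omega>) * d) ((\<omega> - 1) * d)" by blast+
  have "\<not> X (\<not> s) (z + d) (c s * d)" using ss1 X_iff SS_ST by blast
  with triangle_next[OF st] have n: "T (z + d) (- (\<omega> * d))" by blast
  have t: "T (z + (1 - \<omega>) * d) d" using T_cycle(1)[OF n] by (simp add: nf)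
  have "T (z + d) (- d)" using st unfolding ST_def by blast
  from T_cycle(2)[OF this] have t1: "T (z + (1 - \<omega>) * d) (\<omega> * d)" by (simp add: nf)
  \<comment> \<open>This triangle lies across the second side of the triangle bordering the rotated
    dart and so rules out an opposite pair there.\<close>
  have "T (z + (1 - \<omega>) * d) (- d)" using T_vertex[OF t t1 p(3)] by blast
  then have nh: "\<not> H s (z + (1 - \<omega>) * d) (- d)" using HT_excl by blast
  have h: "H s (z - \<omega> * d) (\<omega> * d)" using H_cycle(5)[OF p(1)] by (simp add: nf)
  have st': "ST s (z - \<omega> * d) (\<omega> * d)" unfolding ST_def using h p(2) by simp
  have "SS (\<not> s) (z - \<omega> * d + \<omega> * (c s * (\<omega> * d))) (- (\<omega> * (c s * (\<omega> * d))))"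
    using triangle_prev[OF st'] nh by (auto simp: nf)
  moreover have "SS (\<not> s) (z - \<omega> * d + \<omega> * d) (c s * (\<omega> * d))"
    using SS_rev[OF ss2] by (simp add: nf)
  ultimately show ?thesis unfolding corner_def using st' by blast
qed

lemma corner_rot_inv:
  assumes "corner s z d"
  shows "corner s (z + d) ((1 - \<omega>) * d)"
  using corner_rot[OF corner_rot[OF corner_rot[OF corner_rot[OF corner_rot[OF assms]]]]]
  by (simp add: nf)

text \<open>Without shared sides every vertex of a shield belongs to an opposite pair. Otherwise let
  side 1 of a shield be shared. Sides 0 and 2 then border triangles, and since neither is a corner,
  sides 5 and 3 are not shared. So the diagonal continues at both ends, and \<open>X_step\<close>
  hands the shared side on to the next shield.\<close>

lemma corner_or_line:
  assumes "H s z d"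
  shows "(\<exists>s z d. corner s z d) \<or> (\<exists>z d. line True z d)"
proof -
  have "\<exists>s z d. line s z d" if nc: "\<nexists>s z d. corner s z d"
  proof (cases "\<exists>s z d. SS s z d")
    case False
    have all: "X s z d" if "H s z d" for s z d
      using that False by (cases rule: vertex_cases) blast+
    have fw: "X s (y + (\<omega> * f + c s * f)) f" if "X s y f" for s y f
    proof -
      have "X (\<not> s) (y + \<omega> * f + c s * f) ((\<omega> - 1) * (c s * f))"
        by (rule all[OF H_cycle(3)[OF X_H[OF that]]])
      from X_flip[OF this] show ?thesis by (simp add: nf)
    qed
    have bw: "X s (y - (\<omega> * f + c s * f)) f" if "X s y f" for s y f
    proof -
      have "H (\<not> s) y ((\<omega> - 1) * (c s * f))" using that unfolding X_def by blast
      from all[OF H_cycle(3)[OF this]] have "X s (y - \<omega> * f - c s * f) f" by (simp add: nf)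
      then show ?thesis by (simp add: nf)
    qed
    have "X s (z + of_int n * (\<omega> * d + c s * d)) d" for n
    proof (induction n rule: int_induct[where k = 0])
      case base show ?case using all[OF assms] by simp
    next
      case (step1 i) show ?case using fw[OF step1(2)] by (simp add: algebra_simps)
    next
      case (step2 i) show ?case using bw[OF step2(2)] by (simp add: algebra_simps)
    qed
    then show ?thesis unfolding line_def by blast
  next
    case True
    then obtain t y f where ss: "SS t y f" by blast
    \<comment> \<open>The data are renamed so that the given shared side becomes side 1 of the
      shield \<open>(z, d)\<close>, the side that \<open>X_step\<close> speaks about.\<close>
    define s where "s = (\<not> t)"
    define d where "d = - (c (\<not> s) * (\<omega> * f))"
    define z where "z = y - d"
    have f: "c s * d = f" unfolding d_def by (simp add: nf)
    have ss0: "SS (\<not> s) (z + d) (c s * d)" unfolding f z_def using ss s_def by simp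
    have X0: "X s z d" if a: "SS (\<not> s) (z + d) (c s * d)" for z
    proof -
      have st: "ST s z d" using SS_prev[OF a] by (simp add: nf)
      from ST_H[OF this] show ?thesis
      proof (cases rule: vertex_cases)
        case prev
        then have "corner s z d" unfolding corner_def using a by blast
        then show ?thesis using nc by blast
      next
        case "next" then show ?thesis using st SS_ST by blast
      qed
    qed
    have X3: "X (\<not> s) (z + \<omega> * d + c s * d) ((\<omega> - 1) * (c s * d))"
      if a: "SS (\<not> s) (z + d) (c s * d)" for z
    proof -
      have st: "ST s (z + d + c s * d) ((\<omega> - 1) * d)" using SS_next[OF a] by (simp add: nf)
      have h: "H (\<not> s) (z + \<omega> * d + c s * d) ((\<omega> - 1) * (c s * d))"
        using H_cycle(3)[OF X_H[OF X0[OF a]]] .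
      have ns: "\<not> SS (\<not> s) (z + \<omega> * d + c s * d) ((\<omega> - 1) * (c s * d))"
      proof
        assume b: "SS (\<not> s) (z + \<omega> * d + c s * d) ((\<omega> - 1) * (c s * d))"
        have "corner s (z + d + c s * d) ((\<omega> - 1) * d)"
          unfolding corner_def using st a b by (simp add: nf)
        then show False using nc by blast
      qed
      then have "ST (\<not> s) (z + \<omega> * d + c s * d) ((\<omega> - 1) * (c s * d))" using edge_cases[OF h] by blast
      then show ?thesis using st X_iff'[of s "z + d + c s * d" "(\<omega> - 1) * d"] by (simp add: nf)
    qed
    have "SS (\<not> s) (z + of_int n * (\<omega> * d + c s * d) + d) (c s * d)" for n
    proof (induction n rule: int_induct[where k = 0])
      case base show ?case using ss0 by simp
    next
      case (step1 i)
      show ?case using X_step[OF X3[OF step1(2)]] step1(2) by (simp add: algebra_simps)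
    next
      case (step2 i)
      have "X (\<not> s) (z + of_int (i - 1) * (\<omega> * d + c s * d) + \<omega> * d + c s * d) ((\<omega> - 1) * (c s * d))"
        using X_flip[OF X0[OF step2(2)]] by (simp add: algebra_simps)
      from X_step[OF this] step2(2) show ?case by (simp add: algebra_simps)
    qed
    then have "line s z d" unfolding line_def using X0 by blast
    then show ?thesis by blast
  qed
  then show ?thesis using line_flip by (metis (full_types))
qed


end

section \<open>The triangular array of shields grown from a corner, and its order\<close>

context shield_darts begin

text \<open>Coordinates with respect to the diagonal and its rotation by \<open>pi / 3\<close>; the
  rows of the array are the sets with constant \<open>i + j\<close>.\<close>

definition pt where "pt s z d i j =
  z + of_nat i * (\<omega> * d + c s * d) + of_nat j * (\<omega> * (\<omega> * d + c s * d))"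

lemma pt_simps: "pt s z d 0 0 = z" "pt s z d (Suc i) j = pt s z d i j + \<omega> * d + c s * d"
  "pt s z d i (Suc j) = pt s z d i j + \<omega> * d - d + \<omega> * (c s * d)"
  unfolding pt_def by (simp_all add: nf)

text \<open>Side 1 lies on the wall \<open>j = 0\<close>, side 5 on the wall \<open>i = 0\<close>,
  and side 3 faces the next row. Away from the walls the vertices 0 and 5, or 1 and 2, are opposite
  pairs with earlier or neighbouring shields.\<close>

definition placed where "placed s z d i j \<longleftrightarrow> H s (pt s z d i j) d \<and>
  (0 < i \<longrightarrow> X s (pt s z d i j) d \<and>
    X (\<not> s) (pt s z d i j + \<omega> * (c s * d)) (- (\<omega> * (c s * d)))) \<and>
  (0 < j \<longrightarrow> X (\<not> s) (pt s z d i j + d) (c s * d) \<and>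
    X s (pt s z d i j + d + c s * d) ((\<omega> - 1) * d)) \<and>
  (i = 0 \<longrightarrow> SS (\<not> s) (pt s z d i j + \<omega> * (c s * d)) (- (\<omega> * (c s * d)))) \<and>
  (j = 0 \<longrightarrow> SS (\<not> s) (pt s z d i j + d) (c s * d))"

definition top where "top s z d i j \<longleftrightarrow>
  SS (\<not> s) (pt s z d i j + \<omega> * d + c s * d) ((\<omega> - 1) * (c s * d))"

definition rows where "rows s z d n \<longleftrightarrow> (\<forall>i j. i + j \<le> n \<longrightarrow> placed s z d i j)"

lemma corner_rows: "corner s z d \<Longrightarrow> rows s z d 0"
  unfolding rows_def corner_def placed_def using ST_H by (auto simp: pt_simps)

lemma placed_H: "placed s z d i j \<Longrightarrow> H s (pt s z d i j) d"
  unfolding placed_def by blast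

lemma placed_edges:
  assumes "placed s z d i j"
  shows "ST s (pt s z d i j) d"
    and "ST s (pt s z d i j + d + c s * d) ((\<omega> - 1) * d)"
    and "ST s (pt s z d i j + \<omega> * d + \<omega> * (c s * d)) (- (\<omega> * d))"
proof -
  let ?P = "pt s z d i j"
  show "ST s ?P d"
  proof (cases "i = 0")
    case True
    then have "SS (\<not> s) (?P + \<omega> * (c s * d)) (- (\<omega> * (c s * d)))" using assms unfolding placed_def by blast
    from SS_next[OF this] show ?thesis by (simp add: nf)
  next
    case False
    then show ?thesis using assms X_iff unfolding placed_def by blast
  qed
  show "ST s (?P + d + c s * d) ((\<omega> - 1) * d)"
  proof (cases "j = 0")
    case True
    then have "SS (\<not> s) (?P + d) (c s * d)" using assms unfolding placed_def by blast
    from SS_next[OF this] show ?thesis by (simp add: nf)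
  next
    case False
    then show ?thesis using assms X_iff unfolding placed_def by blast
  qed
  show "ST s (?P + \<omega> * d + \<omega> * (c s * d)) (- (\<omega> * d))"
  proof (cases "i = 0")
    case True
    then have "SS (\<not> s) (?P + \<omega> * (c s * d)) (- (\<omega> * (c s * d)))" using assms unfolding placed_def by blast
    from SS_prev[OF this] show ?thesis by (simp add: nf)
  next
    case False
    then have "X (\<not> s) (?P + \<omega> * (c s * d)) (- (\<omega> * (c s * d)))" using assms unfolding placed_def by blast
    then show ?thesis unfolding X_iff by (simp add: nf)
  qed
qed

text \<open>Sides 2, 3 and 4 of the last row border triangles, so its vertices 3 and 4 are opposite
  pairs and give the shields of the next row. Neighbours in the new row recognise each other across
  the triangle between them, and each wall is handed on by its last shield.\<close>

lemma rows_Suc: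
  assumes r: "rows s z d n" and nt: "\<And>i j. i + j = n \<Longrightarrow> \<not> top s z d i j"
  shows "rows s z d (Suc n)"
proof -
  have old: "placed s z d i j" if "i + j \<le> n" for i j using r that unfolding rows_def by blast
  have st34: "ST (\<not> s) (pt s z d i j + \<omega> * d + c s * d) ((\<omega> - 1) * (c s * d))" if "i + j = n" for i j
  proof -
    have "H (\<not> s) (pt s z d i j + \<omega> * d + c s * d) ((\<omega> - 1) * (c s * d))"
      using H_cycle(3)[OF placed_H[OF old]] that by simp
    then show ?thesis using nt[OF that] edge_cases unfolding top_def by blast
  qed
  have xr: "X s (pt s z d (Suc i) j) d" if ij: "i + j = n" for i j
  proof -
    have "X (\<not> s) (pt s z d i j + d + c s * d + (\<omega> - 1) * d) (c s * ((\<omega> - 1) * d))"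
      unfolding X_iff' using placed_edges(2)[OF old] st34[OF ij] ij by (simp add: nf)
    from X_flip[OF this] show ?thesis by (simp add: nf pt_simps)
  qed
  have xu: "X (\<not> s) (pt s z d i (Suc j) + d) (c s * d)" if ij: "i + j = n" for i j
  proof -
    have "X s (pt s z d i j + \<omega> * d + c s * d + (\<omega> - 1) * (c s * d)) (c (\<not> s) * ((\<omega> - 1) * (c s * d)))"
      using X_iff'[of "\<not> s" "pt s z d i j + \<omega> * d + c s * d" "(\<omega> - 1) * (c s * d)"]
        placed_edges(3)[OF old] st34[OF ij] ij by (simp add: nf)
    from X_flip[OF this] show ?thesis by (simp add: nf pt_simps)
  qed
  have x5: "X (\<not> s) (pt s z d (Suc i) j + \<omega> * (c s * d)) (- (\<omega> * (c s * d)))" if ij: "i + j = n" for i j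
  proof -
    have st: "ST (\<not> s) (pt s z d (Suc i) j + \<omega> * (c s * d)) (- (\<omega> * (c s * d)))"
      using xr[OF ij] X_iff by blast
    have "H (\<not> s) (pt s z d i (Suc j) + d) (c s * d)" using X_H[OF xu[OF ij]] .
    then have "\<not> T (pt s z d i (Suc j) + d) (c s * d)" using HT_excl by blast
    then show ?thesis using triangle_prev[OF st] by (auto simp: nf pt_simps)
  qed
  have x2: "X s (pt s z d i (Suc j) + d + c s * d) ((\<omega> - 1) * d)" if ij: "i + j = n" for i j
  proof -
    have st: "ST (\<not> s) (pt s z d i (Suc j) + d) (c s * d)"
      using xu[OF ij] X_iff by blast
    have "H (\<not> s) (pt s z d (Suc i) j + \<omega> * (c s * d)) (- (\<omega> * (c s * d)))" using X_H[OF x5[OF ij]] .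
    then have "\<not> T (pt s z d (Suc i) j + \<omega> * (c s * d)) (- (\<omega> * (c s * d)))" using HT_excl by blast
    then show ?thesis using triangle_next[OF st] by (auto simp: nf pt_simps)
  qed
  \<comment> \<open>The old end shield has side 1 shared, hence a triangle lies across the far side
    of the triangle at its side 2. The new end shield sees the same triangle after its side 0, which
    excludes an opposite pair.\<close>
  have w1: "SS (\<not> s) (pt s z d (Suc n) 0 + d) (c s * d)"
  proof -
    have pl: "placed s z d n 0" by (rule old) simp
    have ss: "SS (\<not> s) (pt s z d n 0 + d) (c s * d)" using pl unfolding placed_def by blast
    have st: "ST s (pt s z d n 0 + d + c s * d) ((\<omega> - 1) * d)" by (rule placed_edges(2)[OF pl])
    have "\<not> X s (pt s z d n 0 + d + c s * d) ((\<omega> - 1) * d)"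
      using ss SS_ST X_iff'[of "\<not> s" "pt s z d n 0 + d" "c s * d"] by (auto simp: nf)
    with triangle_prev[OF st] have "T (pt s z d n 0 + d + c s * d + \<omega> * d) (- (\<omega> * d))" by (auto simp: nf)
    then have "\<not> H s (pt s z d (Suc n) 0 + d) (- (\<omega> * d))" using HT_excl by (auto simp: nf pt_simps)
    moreover have "ST s (pt s z d (Suc n) 0) d" using xr[of n 0] X_iff by simp
    ultimately show ?thesis using triangle_next by blast
  qed
  have w2: "SS (\<not> s) (pt s z d 0 (Suc n) + \<omega> * (c s * d)) (- (\<omega> * (c s * d)))"
  proof -
    have pl: "placed s z d 0 n" by (rule old) simp
    have ss: "SS (\<not> s) (pt s z d 0 n + \<omega> * (c s * d)) (- (\<omega> * (c s * d)))" using pl unfolding placed_def by blast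
    have st: "ST s (pt s z d 0 n + \<omega> * d + \<omega> * (c s * d)) (- (\<omega> * d))" by (rule placed_edges(3)[OF pl])
    have "\<not> X (\<not> s) (pt s z d 0 n + \<omega> * (c s * d)) (- (\<omega> * (c s * d)))"
      using ss SS_ST X_iff by blast
    with triangle_next[OF st] have "T (pt s z d 0 n + \<omega> * (c s * d)) ((\<omega> - 1) * d)" by (auto simp: nf)
    then have "\<not> H s (pt s z d 0 (Suc n) + (1 - \<omega>) * d) ((\<omega> - 1) * d)" using HT_excl by (auto simp: nf pt_simps)
    moreover have "ST s (pt s z d 0 (Suc n)) d"
      using xu[of 0 n] X_iff' by simp
    ultimately show ?thesis using triangle_prev by blast
  qed
  have "placed s z d i j" if "i + j \<le> Suc n" for i j
  proof (cases "i + j \<le> n")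
    case True then show ?thesis by (rule old)
  next
    case False
    then have ij: "i + j = Suc n" using that by simp
    have a: "X s (pt s z d i j) d \<and> X (\<not> s) (pt s z d i j + \<omega> * (c s * d)) (- (\<omega> * (c s * d)))" if "0 < i"
    proof -
      have e: "i = Suc (i - 1)" and n: "(i - 1) + j = n" using that ij by auto
      show ?thesis using xr[OF n] x5[OF n] unfolding e[symmetric] by blast
    qed
    have b: "X (\<not> s) (pt s z d i j + d) (c s * d) \<and> X s (pt s z d i j + d + c s * d) ((\<omega> - 1) * d)" if "0 < j"
    proof -
      have e: "j = Suc (j - 1)" and n: "i + (j - 1) = n" using that ij by auto
      show ?thesis using xu[OF n] x2[OF n] unfolding e[symmetric] by blast
    qed
    have "H s (pt s z d i j) d"
    proof (cases "0 < i")
      case True then show ?thesis using a X_H by blast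
    next
      case False
      then have "0 < j" using ij by simp
      then show ?thesis using b X_iff' ST_H by blast
    qed
    moreover have "SS (\<not> s) (pt s z d i j + \<omega> * (c s * d)) (- (\<omega> * (c s * d)))" if "i = 0"
      using w2 that ij by simp
    moreover have "SS (\<not> s) (pt s z d i j + d) (c s * d)" if "j = 0"
      using w1 that ij by simp
    ultimately show ?thesis unfolding placed_def using a b by blast
  qed
  then show ?thesis unfolding rows_def by blast
qed

text \<open>Neighbours in a row have a triangle between them whose third side faces the next row.
  For both of them, side 3 is shared iff a triangle lies across that third side.\<close>

lemma top_step:
  assumes r: "rows s z d (Suc n)" and ij: "i + j = n"
  shows "top s z d (Suc i) j \<longleftrightarrow> top s z d i (Suc j)"
proof -
  have p1: "placed s z d (Suc i) j" and p2: "placed s z d i (Suc j)"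
    using r ij unfolding rows_def by auto
  let ?P = "pt s z d (Suc i) j" and ?R = "pt s z d i (Suc j)"
  have st1: "ST s (?P + \<omega> * d + \<omega> * (c s * d)) (- (\<omega> * d))" by (rule placed_edges(3)[OF p1])
  have st2: "ST s (?R + d + c s * d) ((\<omega> - 1) * d)" by (rule placed_edges(2)[OF p2])
  have e: "?R + \<omega> * d + c s * d = ?P + \<omega> * d + \<omega> * (c s * d) - d" by (simp add: pt_simps nf)
  have t1: "top s z d (Suc i) j \<longleftrightarrow> T (?R + \<omega> * d + c s * d) d"
  proof
    assume "top s z d (Suc i) j"
    then have ss: "SS (\<not> s) (?P + \<omega> * d + c s * d) ((\<omega> - 1) * (c s * d))" unfolding top_def .
    have "\<not> X s (?P + \<omega> * d + \<omega> * (c s * d)) (- (\<omega> * d))"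
      using ss SS_ST X_iff'[of "\<not> s" "?P + \<omega> * d + c s * d" "(\<omega> - 1) * (c s * d)"] by (auto simp: nf)
    with triangle_prev[OF st1] show "T (?R + \<omega> * d + c s * d) d" unfolding e by (auto simp: nf)
  next
    assume t: "T (?R + \<omega> * d + c s * d) d"
    then have "\<not> H s (?R + \<omega> * d + c s * d) d" using HT_excl by blast
    with triangle_prev[OF st1] show "top s z d (Suc i) j" unfolding e top_def by (auto simp: nf)
  qed
  have t2: "top s z d i (Suc j) \<longleftrightarrow> T (?R + \<omega> * d + c s * d) d"
  proof
    assume "top s z d i (Suc j)"
    then have ss: "SS (\<not> s) (?R + \<omega> * d + c s * d) ((\<omega> - 1) * (c s * d))" unfolding top_def .
    have "\<not> X (\<not> s) (?R + \<omega> * d + c s * d) ((\<omega> - 1) * (c s * d))"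
      using ss SS_ST X_iff by blast
    with triangle_next[OF st2] show "T (?R + \<omega> * d + c s * d) d" by (auto simp: nf)
  next
    assume t: "T (?R + \<omega> * d + c s * d) d"
    then have "\<not> H s (?R + \<omega> * d + c s * d) d" using HT_excl by blast
    with triangle_next[OF st2] show "top s z d i (Suc j)" unfolding top_def by (auto simp: nf)
  qed
  show ?thesis using t1 t2 by blast
qed

lemma top_const:
  assumes r: "rows s z d n" and "i + j = n"
  shows "top s z d i j \<longleftrightarrow> top s z d n 0"
  using assms(2)
proof (induction j arbitrary: i)
  case 0 then show ?case by simp
next
  case (Suc j)
  then obtain m where m: "n = Suc m" "i + j = m" by auto
  show ?case using top_step[OF r[unfolded m(1)] m(2)] Suc.IH[of "Suc i"] Suc.prems by simp
qed

text \<open>The corner \<open>(z, d)\<close> belongs to a shield triangle of order \<open>K\<close>.\<close>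

definition state where "state s z d K \<longleftrightarrow> corner s z d \<and> (0::enat) < K \<and>
  (\<forall>m. enat (Suc m) < K \<longrightarrow> \<not> top s z d m 0) \<and> (\<forall>m. K = enat (Suc m) \<longrightarrow> top s z d m 0)"

lemma state_rows:
  assumes st: "state s z d K" and "enat n < K"
  shows "rows s z d n"
  using assms(2)
proof (induction n)
  case 0
  then show ?case using st corner_rows unfolding state_def by blast
next
  case (Suc n)
  have "enat n < K" by (rule less_trans[OF _ Suc.prems]) simp
  then have r: "rows s z d n" by (rule Suc.IH)
  have "\<not> top s z d n 0" using st Suc.prems unfolding state_def by blast
  then show ?case using rows_Suc[OF r] top_const[OF r] by blast
qed

lemma state_placed: "state s z d K \<Longrightarrow> enat (i + j) < K \<Longrightarrow> placed s z d i j"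
  using state_rows[of s z d K "i + j"] unfolding rows_def by blast

lemma state_top: "state s z d K \<Longrightarrow> enat (i + j) < K \<Longrightarrow> top s z d i j \<longleftrightarrow> K = enat (Suc (i + j))"
proof -
  assume st: "state s z d K" and k: "enat (i + j) < K"
  have "top s z d i j \<longleftrightarrow> top s z d (i + j) 0" by (rule top_const[OF state_rows[OF st k] refl])
  moreover have "enat (Suc (i + j)) \<le> K" using k by (simp add: Suc_ile_eq)
  ultimately consider "K = enat (Suc (i + j))" "top s z d (i + j) 0" | "enat (Suc (i + j)) < K" "\<not> top s z d (i + j) 0"
    using st unfolding state_def by (cases "K = enat (Suc (i + j))") auto
  then show ?thesis
    using \<open>top s z d i j \<longleftrightarrow> top s z d (i + j) 0\<close> by cases auto
qed

lemma corner_state: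
  assumes "corner s z d" shows "\<exists>K. state s z d K"
proof (cases "\<exists>m. top s z d m 0")
  case True
  define m where "m = (LEAST m. top s z d m 0)"
  have "top s z d m 0" using True unfolding m_def by (auto intro: LeastI_ex)
  moreover have "\<not> top s z d k 0" if "k < m" for k using that unfolding m_def by (rule not_less_Least)
  ultimately have "state s z d (enat (Suc m))" unfolding state_def using assms by (auto simp: zero_enat_def)
  then show ?thesis by blast
next
  case False
  then have "state s z d \<infinity>" unfolding state_def using assms by auto
  then show ?thesis by blast
qed

lemma state_unique_le: "state s z d K \<Longrightarrow> state s z d K' \<Longrightarrow> K' \<le> K"
proof (rule ccontr)
  assume a: "state s z d K" "state s z d K'" "\<not> K' \<le> K"
  then obtain k where k: "K = enat k" by (cases K) auto
  have "0 < k" using a(1) k unfolding state_def by (auto simp: zero_enat_def)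
  then obtain m where m: "K = enat (Suc m)" using k by (cases k) auto
  then have "enat (Suc m) < K'" using a(3) by simp
  then show False using a(1,2) m unfolding state_def by blast
qed

text \<open>At the far end of the wall \<open>i = 0\<close>, sides 5 and 3 of the last shield are
  shared, so side 4 is a corner. Turning this corner backwards about its own apex shows that the
  last shield of the rotated sector has its top side shared, which bounds the new order.\<close>

lemma state_rot_le:
  assumes st: "state s z d K"
  shows "\<exists>K'\<le>K. state s (z - \<omega> * d) (\<omega> * d) K'"
proof -
  have "corner s (z - \<omega> * d) (\<omega> * d)" using st corner_rot unfolding state_def by blast
  then obtain K' where st': "state s (z - \<omega> * d) (\<omega> * d) K'" using corner_state by blast
  have "K' \<le> K"
  proof (rule ccontr)
    assume n: "\<not> K' \<le> K"
    then obtain k where "K = enat k" by (cases K) auto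
    moreover then have "0 < k" using st unfolding state_def by (auto simp: zero_enat_def)
    ultimately obtain N where K: "K = enat (Suc N)" by (cases k) auto
    have pl: "placed s z d 0 N" by (rule state_placed[OF st]) (simp add: K)
    have tp: "top s z d 0 N" using state_top[OF st, of 0 N] K by simp
    have "corner s (pt s z d 0 N + \<omega> * d + \<omega> * (c s * d)) (- (\<omega> * d))"
      unfolding corner_def
    proof (intro conjI)
      show "ST s (pt s z d 0 N + \<omega> * d + \<omega> * (c s * d)) (- (\<omega> * d))" by (rule placed_edges(3)[OF pl])
      show "SS (\<not> s) (pt s z d 0 N + \<omega> * d + \<omega> * (c s * d) + - (\<omega> * d)) (c s * - (\<omega> * d))"
        using pl unfolding placed_def by (simp add: nf)
      show "SS (\<not> s) (pt s z d 0 N + \<omega> * d + \<omega> * (c s * d) + \<omega> * (c s * - (\<omega> * d)))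
          (- (\<omega> * (c s * - (\<omega> * d))))"
        using tp unfolding top_def by (simp add: nf)
    qed
    from corner_rot_inv[OF this]
    have "SS (\<not> s) (pt s z d 0 N + \<omega> * (c s * d) - d) (- (c s * d))"
      unfolding corner_def by (simp add: nf)
    moreover have "pt s (z - \<omega> * d) (\<omega> * d) N 0 = pt s z d 0 N - \<omega> * d"
      unfolding pt_def by (simp add: nf)
    ultimately have "top s (z - \<omega> * d) (\<omega> * d) N 0" unfolding top_def by (simp add: nf)
    moreover have "enat (Suc N) < K'" using n K by simp
    ultimately show False using st' unfolding state_def by blast
  qed
  then show ?thesis using st' by blast
qed

text \<open>Six turns by \<open>pi / 3\<close> are the identity, so the inequalities form a cycle
  and all orders agree.\<close>

lemma state_rot:
  assumes st: "state s z d K"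
  shows "state s (z - \<omega> * d) (\<omega> * d) K"
proof -
  obtain K1 where k1: "K1 \<le> K" and s1: "state s (z - \<omega> * d) (\<omega> * d) K1"
    using state_rot_le[OF st] by blast
  obtain K2 where k2: "K2 \<le> K1" and s2: "state s (z + d - 2 * (\<omega> * d)) ((\<omega> - 1) * d) K2"
    using state_rot_le[OF s1] by (auto simp: nf)
  obtain K3 where k3: "K3 \<le> K2" and s3: "state s (z + 2 * d - 2 * (\<omega> * d)) (- d) K3"
    using state_rot_le[OF s2] by (auto simp: nf)
  obtain K4 where k4: "K4 \<le> K3" and s4: "state s (z + 2 * d - \<omega> * d) (- (\<omega> * d)) K4"
    using state_rot_le[OF s3] by (auto simp: nf)
  obtain K5 where k5: "K5 \<le> K4" and s5: "state s (z + d) ((1 - \<omega>) * d) K5"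
    using state_rot_le[OF s4] by (auto simp: nf)
  obtain K6 where k6: "K6 \<le> K5" and s6: "state s (z) (d) K6"
    using state_rot_le[OF s5] by (auto simp: nf)
  have "state s z d K6" by (rule s6)
  from state_unique_le[OF this st] have "K \<le> K6" .
  then have "K1 = K" using k1 k2 k3 k4 k5 k6 by (metis order.trans order.antisym)
  then show ?thesis using s1 by simp
qed

lemma state_rot_inv: "state s z d K \<Longrightarrow> state s (z + d) ((1 - \<omega>) * d) K"
  using state_rot[OF state_rot[OF state_rot[OF state_rot[OF state_rot[of s z d K]]]]]
  by (simp add: nf)

end

text \<open>Stated with the turns as a parameter, so that the combinatorial and the geometric
  development can both use it.\<close>

definition hexagon_darts :: "(bool \<Rightarrow> complex) \<Rightarrow> bool \<Rightarrow> complex \<Rightarrow> complex \<Rightarrow> (bool \<times> complex \<times> complex) set" where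
  "hexagon_darts c s z d = {(s, z, d),
   (\<not> s, z + d, c s * d), (s, z + d + c s * d, (\<omega> - 1) * d),
   (\<not> s, z + \<omega> * d + c s * d, (\<omega> - 1) * (c s * d)),
   (s, z + \<omega> * d + \<omega> * (c s * d), - (\<omega> * d)), (\<not> s, z + \<omega> * (c s * d), - (\<omega> * (c s * d)))}"

section \<open>Cyclic symmetry of a finite shield triangle, and covering by sectors\<close>

context shield_darts begin

abbreviation "hexagon_set \<equiv> hexagon_darts c"
lemmas hexagon_set_def = hexagon_darts_def

text \<open>With \<open>N - i - j\<close> as third coordinate, the positions of a triangular array
  have barycentric coordinates; passing to the next corner permutes them cyclically.\<close>

lemma pt_kappa: "i + j \<le> N \<Longrightarrow> pt s (pt s z d N 0 + d + c s * d) ((\<omega> - 1) * d) i j =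
  pt s z d (N - i - j) i + d + c s * d"
proof -
  assume "i + j \<le> N"
  then obtain m where "N = m + i + j" by (metis add.commute add.left_commute le_Suc_ex)
  then show ?thesis unfolding pt_def by (simp add: nf)
qed

text \<open>A finite shield triangle has three equivalent corners: the walls \<open>j = 0\<close>
  and \<open>i = 0\<close> and the top row change places cyclically. Seen from the new corner the
  top row is the old wall \<open>i = 0\<close>, so the order is unchanged.\<close>

lemma state_kappa:
  assumes st: "state s z d (enat (Suc N))"
  shows "state s (pt s z d N 0 + d + c s * d) ((\<omega> - 1) * d) (enat (Suc N))"
proof -
  have pl: "placed s z d i j" if "i + j \<le> N" for i j by (rule state_placed[OF st]) (use that in simp)
  have tp: "top s z d N 0" using st unfolding state_def by blast
  have c: "corner s (pt s z d N 0 + d + c s * d) ((\<omega> - 1) * d)"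
    unfolding corner_def
  proof (intro conjI)
    show "ST s (pt s z d N 0 + d + c s * d) ((\<omega> - 1) * d)" by (rule placed_edges(2)[OF pl]) simp
    show "SS (\<not> s) (pt s z d N 0 + d + c s * d + (\<omega> - 1) * d) (c s * ((\<omega> - 1) * d))"
      using tp unfolding top_def by (simp add: nf)
    show "SS (\<not> s) (pt s z d N 0 + d + c s * d + \<omega> * (c s * ((\<omega> - 1) * d)))
       (- (\<omega> * (c s * ((\<omega> - 1) * d))))"
      using pl[of N 0] unfolding placed_def by (simp add: nf)
  qed
  have q: "pt s (pt s z d N 0 + d + c s * d) ((\<omega> - 1) * d) m 0 = pt s z d (N - m) m + d + c s * d"
    if "m \<le> N" for m using pt_kappa[of m 0 N s z d] that by simp
  have t: "top s (pt s z d N 0 + d + c s * d) ((\<omega> - 1) * d) m 0 \<longleftrightarrow>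
      SS (\<not> s) (pt s z d (N - m) m + \<omega> * (c s * d)) (- (\<omega> * (c s * d)))" if "m \<le> N" for m
    unfolding top_def q[OF that] by (simp add: nf)
  have "\<not> top s (pt s z d N 0 + d + c s * d) ((\<omega> - 1) * d) m 0" if "m < N" for m
  proof -
    have "placed s z d (N - m) m" by (rule pl) (use that in simp)
    then have "X (\<not> s) (pt s z d (N - m) m + \<omega> * (c s * d)) (- (\<omega> * (c s * d)))"
      using that unfolding placed_def by simp
    then have "\<not> SS (\<not> s) (pt s z d (N - m) m + \<omega> * (c s * d)) (- (\<omega> * (c s * d)))"
      using X_iff SS_ST by blast
    then show ?thesis using t that by simp
  qed
  moreover have "top s (pt s z d N 0 + d + c s * d) ((\<omega> - 1) * d) N 0"
    using pl[of 0 N] t[of N] unfolding placed_def by simp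
  ultimately show ?thesis unfolding state_def using c by (auto simp: zero_enat_def)
qed

text \<open>Only the closure of \<open>\<Sigma>\<close> matters, so the finite and the infinite
  order are treated together. Opposite pairs stay within the sector; a shared side 5 leads to the
  sector turned by \<open>rot\<close>, a shared side 1 to that of \<open>rot_inv\<close>, and a
  shared side 3 through \<open>kappa\<close> to a sector around another apex.\<close>

lemma sectors_cover:
  assumes st: "\<And>z d. (z, d) \<in> \<Sigma> \<Longrightarrow> state s z d K"
    and rot: "\<And>z d. (z, d) \<in> \<Sigma> \<Longrightarrow> (z - \<omega> * d, \<omega> * d) \<in> \<Sigma>"
    and rot_inv: "\<And>z d. (z, d) \<in> \<Sigma> \<Longrightarrow> (z + d, (1 - \<omega>) * d) \<in> \<Sigma>"
    and kappa: "\<And>z d N. (z, d) \<in> \<Sigma> \<Longrightarrow> K = enat (Suc N) \<Longrightarrow>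
      (pt s z d N 0 + d + c s * d, (\<omega> - 1) * d) \<in> \<Sigma>"
    and ne: "(z0, d0) \<in> \<Sigma>"
  shows "H t x g \<Longrightarrow> \<exists>(y, f) \<in> \<Sigma>. \<exists>i j. enat (i + j) < K \<and> (t, x, g) \<in> hexagon_set s (pt s y f i j) f"
    and "T x g \<Longrightarrow> \<exists>(y, f) \<in> \<Sigma>. \<exists>i j. enat (i + j) < K \<and>
      (\<exists>(t, p, h) \<in> hexagon_set s (pt s y f i j) f. ST t p h \<and>
        (x, g) \<in> {(p + h, - h), (p, - ((\<omega> - 1) * h)), (p + h - \<omega> * h, \<omega> * h)})"
proof -
  define P where "P t x g \<longleftrightarrow> t = s \<and> (\<exists>y i j. (y, g) \<in> \<Sigma> \<and> enat (i + j) < K \<and> x = pt s y g i j)" for t x g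
  define Q where "Q s z d \<longleftrightarrow> P s z d \<or>
      P (\<not> s) (z + d) (c s * d) \<or> P s (z + d + c s * d) ((\<omega> - 1) * d) \<or>
      P (\<not> s) (z + \<omega> * d + c s * d) ((\<omega> - 1) * (c s * d)) \<or>
      P s (z + \<omega> * d + \<omega> * (c s * d)) (- (\<omega> * d)) \<or>
      P (\<not> s) (z + \<omega> * (c s * d)) (- (\<omega> * (c s * d)))" for s z d
  have QI: "Q s y f" "Q (\<not> s) (y + f) (c s * f)" "Q s (y + f + c s * f) ((\<omega> - 1) * f)"
      "Q (\<not> s) (y + \<omega> * f + c s * f) ((\<omega> - 1) * (c s * f))"
      "Q s (y + \<omega> * f + \<omega> * (c s * f)) (- (\<omega> * f))"
      "Q (\<not> s) (y + \<omega> * (c s * f)) (- (\<omega> * (c s * f)))" if "P s y f" for s y f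
    using that unfolding Q_def by (auto simp: nf)
  have main: "(\<forall>s z d. H s z d \<longrightarrow> Q s z d) \<and> (\<forall>z d. T z d \<longrightarrow> (\<exists>s.
    Q s (z + d) (- d) \<or> Q s (z + \<omega> * d) ((1 - \<omega>) * d) \<or> Q s z (\<omega> * d)))"
  proof (rule shields_conn6[OF _ _ Q_def])
    show "H s z d" if "P s z d" for s z d
      using that placed_H[OF state_placed[OF st]] unfolding P_def by blast
    have "K > 0" using st[OF ne] unfolding state_def by blast
    then show "P s z0 d0" unfolding P_def using ne pt_simps(1)[of s z0 d0]
      by (auto simp: zero_enat_def intro!: exI[of _ z0] exI[of _ "0::nat"])
    fix t p d t' x g
    assume p: "P t p d" and m: "(t', x, g) \<in> {(t, p, d),
       (\<not> t, p + d, c t * d), (t, p + d + c t * d, (\<omega> - 1) * d),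
       (\<not> t, p + \<omega> * d + c t * d, (\<omega> - 1) * (c t * d)),
       (t, p + \<omega> * d + \<omega> * (c t * d), - (\<omega> * d)), (\<not> t, p + \<omega> * (c t * d), - (\<omega> * (c t * d)))}"
    obtain z i j where t: "t = s" and zd: "(z, d) \<in> \<Sigma>" and K: "enat (i + j) < K"
      and pp: "p = pt s z d i j" using p unfolding P_def by blast
    have pl: "placed s z d i j" by (rule state_placed[OF st[OF zd] K])
    note ed = placed_edges[OF pl]
    have PI: "P s (pt s y f k l) f" if "(y, f) \<in> \<Sigma>" "enat (k + l) < K" for y f k l
      using that unfolding P_def by blast
    have Kle: "enat (Suc (i + j)) \<le> K" using K by (simp add: Suc_ile_eq)
    have tp: "top s z d i j \<longleftrightarrow> K = enat (Suc (i + j))" by (rule state_top[OF st[OF zd] K])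
    note m' = m[unfolded t pp insert_iff empty_iff prod.inject]
    show "(SS t' x g \<longrightarrow> Q t' (x + g) (- g)) \<and> (X t' x g \<longrightarrow> Q (\<not> t') x ((\<omega> - 1) * (c t' * g)))"
      using m'
    proof (elim disjE conjE)
      assume e: "t' = s" "x = pt s z d i j" "g = d"
      have "\<not> SS t' x g" using ed(1) e SS_ST by blast
      moreover have "Q (\<not> t') x ((\<omega> - 1) * (c t' * g))" if x: "X t' x g"
      proof -
        have "i \<noteq> 0" using x pl SS_ST unfolding e X_iff placed_def by blast
        then obtain k where k: "i = Suc k" by (cases i) auto
        have "enat (k + j) < K" using K unfolding k by (rule less_trans[rotated]) simp
        from QI[OF PI[OF zd this]] show ?thesis unfolding e k by (simp add: nf pt_simps)
      qed
      ultimately show ?thesis by blast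
    next
      assume e: "t' = (\<not> s)" "x = pt s z d i j + d" "g = c s * d"
      have "Q t' (x + g) (- g)" if x: "SS t' x g"
      proof -
        have "j = 0" using x pl SS_ST unfolding e X_iff placed_def by blast
        have "enat (0 + i) < K" using K \<open>j = 0\<close> by simp
        note q = QI[OF PI[OF rot_inv[OF zd] this]]
        have "pt s (z + d) ((1 - \<omega>) * d) 0 i = pt s z d i j + d" unfolding \<open>j = 0\<close> pt_def by (simp add: nf)
        then show ?thesis using q unfolding e by (simp add: nf)
      qed
      moreover have "Q (\<not> t') x ((\<omega> - 1) * (c t' * g))" if x: "X t' x g"
      proof -
        have "j \<noteq> 0" using x pl SS_ST unfolding e X_iff placed_def by blast
        then obtain k where k: "j = Suc k" by (cases j) auto
        have "enat (i + k) < K" using K unfolding k by (rule less_trans[rotated]) simp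
        from QI[OF PI[OF zd this]] show ?thesis unfolding e k by (simp add: nf pt_simps)
      qed
      ultimately show ?thesis by blast
    next
      assume e: "t' = s" "x = pt s z d i j + d + c s * d" "g = (\<omega> - 1) * d"
      have "\<not> SS t' x g" using ed(2) e SS_ST by blast
      moreover have "Q (\<not> t') x ((\<omega> - 1) * (c t' * g))" if x: "X t' x g"
      proof -
        have "ST (\<not> s) (pt s z d i j + d) (c s * d)" using x unfolding e X_iff by (simp add: nf)
        then have "j \<noteq> 0" using pl SS_ST unfolding placed_def by blast
        then obtain k where k: "j = Suc k" by (cases j) auto
        have "enat (Suc i + k) < K" using K unfolding k by simp
        from QI[OF PI[OF zd this]] show ?thesis unfolding e k by (simp add: nf pt_simps)
      qed
      ultimately show ?thesis by blast
    next
      assume e: "t' = (\<not> s)" "x = pt s z d i j + \<omega> * d + c s * d" "g = (\<omega> - 1) * (c s * d)"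
      have "Q t' (x + g) (- g)" if x: "SS t' x g"
      proof -
        have k: "K = enat (Suc (i + j))" using x tp unfolding e top_def by blast
        have "enat (0 + j) < K" using k by simp
        \<comment> \<open>Beyond the top row lies the sector turned about the apex at the end of the
          wall \<open>j = 0\<close>; its wall is indexed by \<open>j\<close> only.\<close>
        note q = QI[OF PI[OF rot_inv[OF kappa[OF zd k]] this]]
        let ?w = "pt s z d (i + j) 0 + d + c s * d" and ?f = "(\<omega> - 1) * d"
        have "pt s (?w + ?f) ((1 - \<omega>) * ?f) 0 j = pt s ?w ?f j 0 + ?f"
          unfolding pt_def[of s "?w + ?f"] pt_def[of s ?w] by (simp add: nf)
        also have "\<dots> = pt s z d i j + d + c s * d + ?f"
          using pt_kappa[of j 0 "i + j" s z d] by simp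
        finally show ?thesis using q unfolding e by (simp add: nf)
      qed
      moreover have "Q (\<not> t') x ((\<omega> - 1) * (c t' * g))" if x: "X t' x g"
      proof -
        have "\<not> top s z d i j" using x SS_ST unfolding e X_iff top_def by blast
        then have "enat (Suc i + j) < K" using tp Kle by simp
        from QI[OF PI[OF zd this]] show ?thesis unfolding e by (simp add: nf pt_simps)
      qed
      ultimately show ?thesis by blast
    next
      assume e: "t' = s" "x = pt s z d i j + \<omega> * d + \<omega> * (c s * d)" "g = - (\<omega> * d)"
      have "\<not> SS t' x g" using ed(3) e SS_ST by blast
      moreover have "Q (\<not> t') x ((\<omega> - 1) * (c t' * g))" if x: "X t' x g"
      proof -
        have "ST (\<not> s) (pt s z d i j + \<omega> * d + c s * d) ((\<omega> - 1) * (c s * d))"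
          using x unfolding e X_iff by (simp add: nf)
        then have "\<not> top s z d i j" using SS_ST unfolding top_def by blast
        then have "enat (i + Suc j) < K" using tp Kle by simp
        from QI[OF PI[OF zd this]] show ?thesis unfolding e by (simp add: nf pt_simps)
      qed
      ultimately show ?thesis by blast
    next
      assume e: "t' = (\<not> s)" "x = pt s z d i j + \<omega> * (c s * d)" "g = - (\<omega> * (c s * d))"
      have "Q t' (x + g) (- g)" if x: "SS t' x g"
      proof -
        have "i = 0" using x pl SS_ST unfolding e X_iff placed_def by blast
        have "enat (j + 0) < K" using K \<open>i = 0\<close> by simp
        note q = QI[OF PI[OF rot[OF zd] this]]
        have "pt s (z - \<omega> * d) (\<omega> * d) j 0 = pt s z d i j - \<omega> * d" unfolding \<open>i = 0\<close> pt_def by (simp add: nf)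
        then show ?thesis using q unfolding e by (simp add: nf)
      qed
      moreover have "Q (\<not> t') x ((\<omega> - 1) * (c t' * g))" if x: "X t' x g"
      proof -
        have "i \<noteq> 0" using x pl SS_ST unfolding e X_iff placed_def by blast
        then obtain k where k: "i = Suc k" by (cases i) auto
        have "enat (k + Suc j) < K" using K unfolding k by simp
        from QI[OF PI[OF zd this]] show ?thesis unfolding e k by (simp add: nf pt_simps)
      qed
      ultimately show ?thesis by blast
    qed simp
  qed
  have hex: "\<exists>(y, f) \<in> \<Sigma>. \<exists>i j. enat (i + j) < K \<and> (t, x, g) \<in> hexagon_set s (pt s y f i j) f"
    if q: "Q t x g" for t x g
  proof -
    have wit: ?thesis if "P t' p f" "(t, x, g) \<in> hexagon_set t' p f" for t' p f
      using that unfolding P_def by blast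
    show ?thesis using q unfolding Q_def
    proof (elim disjE)
      assume "P t x g" from wit[OF this] show ?thesis unfolding hexagon_set_def by simp
    next
      assume "P (\<not> t) (x + g) (c t * g)" from wit[OF this] show ?thesis unfolding hexagon_set_def by (simp add: nf)
    next
      assume "P t (x + g + c t * g) ((\<omega> - 1) * g)"
      from wit[OF this] show ?thesis unfolding hexagon_set_def by (simp add: nf)
    next
      assume "P (\<not> t) (x + \<omega> * g + c t * g) ((\<omega> - 1) * (c t * g))"
      from wit[OF this] show ?thesis unfolding hexagon_set_def by (simp add: nf)
    next
      assume "P t (x + \<omega> * g + \<omega> * (c t * g)) (- (\<omega> * g))"
      from wit[OF this] show ?thesis unfolding hexagon_set_def by (simp add: nf)
    next
      assume "P (\<not> t) (x + \<omega> * (c t * g)) (- (\<omega> * (c t * g)))"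
      from wit[OF this] show ?thesis unfolding hexagon_set_def by (simp add: nf)
    qed
  qed
  show "\<exists>(y, f) \<in> \<Sigma>. \<exists>i j. enat (i + j) < K \<and> (t, x, g) \<in> hexagon_set s (pt s y f i j) f" if "H t x g"
    using hex main that by blast
  have QH: "H t x g" if qt: "Q t x g" for t x g
  proof -
    obtain y f i j where yf: "(y, f) \<in> \<Sigma>" "enat (i + j) < K" and m: "(t, x, g) \<in> hexagon_set s (pt s y f i j) f"
      using hex[OF qt] by blast
    have "H s (pt s y f i j) f" by (rule placed_H[OF state_placed[OF st[OF yf(1)] yf(2)]])
    from H_cycle[OF this] this show ?thesis using m unfolding hexagon_set_def by auto
  qed
  show "\<exists>(y, f) \<in> \<Sigma>. \<exists>i j. enat (i + j) < K \<and>
      (\<exists>(t, p, h) \<in> hexagon_set s (pt s y f i j) f. ST t p h \<and>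
        (x, g) \<in> {(p + h, - h), (p, - ((\<omega> - 1) * h)), (p + h - \<omega> * h, \<omega> * h)})" if tt: "T x g"
  proof -
    have wit: ?thesis if "Q t p h" "T (p + h) (- h)"
      "(x, g) \<in> {(p + h, - h), (p, - ((\<omega> - 1) * h)), (p + h - \<omega> * h, \<omega> * h)}" for t p h
      using hex[OF that(1)] that(2,3) QH[OF that(1)] unfolding ST_def by blast
    obtain t where "Q t (x + g) (- g) \<or> Q t (x + \<omega> * g) ((1 - \<omega>) * g) \<or> Q t x (\<omega> * g)"
      using main tt by blast
    then show ?thesis
    proof (elim disjE)
      assume a: "Q t (x + g) (- g)"
      show ?thesis by (rule wit[OF a]) (use tt in simp_all)
    next
      assume a: "Q t (x + \<omega> * g) ((1 - \<omega>) * g)"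
      show ?thesis by (rule wit[OF a]) (use T_cycle(1)[OF tt] in \<open>simp_all add: nf\<close>)
    next
      assume a: "Q t x (\<omega> * g)"
      show ?thesis by (rule wit[OF a]) (use T_cycle(2)[OF tt] in \<open>simp_all add: nf\<close>)
    qed
  qed
qed

end

section \<open>Tiles and their darts\<close>

text \<open>Being to the left of a line of direction \<open>d\<close> is expressed by the imaginary
  part of \<open>p * cnj d\<close>; this turns it into a condition on an inner product, the form in
  which supporting lines and half planes appear.\<close>

lemma inner_ii: "inner (\<i> * d) p = Im (p * cnj d)"
  by (simp add: inner_complex_def algebra_simps)

lemma perpendicular_complex:
  assumes "Re (cnj D * a) = 0" "D \<noteq> 0"
  shows "a = of_real (Im (cnj D * a) / (norm D)\<^sup>2) * (\<i> * D)"
proof -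
  define x where "x = Im (cnj D * a)"
  have "cnj D * a = \<i> * of_real x" using assms(1) unfolding x_def by (simp add: complex_eq_iff)
  then have "D * (cnj D * a) = D * (\<i> * of_real x)" by simp
  moreover have "D * (cnj D * a) = of_real ((norm D)\<^sup>2) * a"
    by (simp only: complex_norm_square mult.assoc)
  ultimately show ?thesis unfolding x_def[symmetric] using assms(2) by (simp add: field_simps)
qed

lemma norm_1_cnj: "norm (d::complex) = 1 \<Longrightarrow> d * cnj d = 1"
  using complex_norm_square[of d] by simp

lemma convex_left: "convex {p. 0 \<le> Im ((p - z) * cnj d)}"
proof -
  have "{p. 0 \<le> Im ((p - z) * cnj d)} = {p. inner (\<i> * d) p \<ge> inner (\<i> * d) z}"
    unfolding inner_ii by (simp add: algebra_simps)
  then show ?thesis by (simp add: convex_halfspace_ge)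
qed

text \<open>By the sine rule, \<open>cis t\<close> has positive coordinates with respect to
  \<open>1\<close> and \<open>cis \<theta>\<close>. Scaled by a small \<open>e\<close> their sum
  stays below 1, so all three barycentric coordinates are positive.\<close>

lemma sector_interior:
  assumes d: "d \<noteq> 0" and t: "0 < t" "t < \<theta>" "\<theta> < pi"
  obtains e0 where "0 < e0" "e0 \<le> 1"
    "\<And>e. 0 < e \<Longrightarrow> e < e0 \<Longrightarrow> z + e *\<^sub>R (cis t * d) \<in> interior (convex hull {z, z + d, z + cis \<theta> * d})"
proof -
  have sp: "0 < sin \<theta>" "0 < sin t" "0 < sin (\<theta> - t)" using t by (auto intro: sin_gt_zero)
  define A where "A = sin (\<theta> - t) / sin \<theta>"
  define B where "B = sin t / sin \<theta>"
  have AB: "0 < A" "0 < B" using sp unfolding A_def B_def by auto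
  have ct: "cis t = of_real A + of_real B * cis \<theta>"
    using sp unfolding A_def B_def
    by (simp add: complex_eq_iff sin_diff field_simps)
  have nc: "\<not> collinear {z, z + d, z + cis \<theta> * d}"
  proof
    assume "collinear {z, z + d, z + cis \<theta> * d}"
    then have "collinear {0, d, cis \<theta> * d}"
      using collinear_3[of "z + d" z "z + cis \<theta> * d"] by (simp add: insert_commute)
    then obtain r where "cis \<theta> * d = r *\<^sub>R d" using d unfolding collinear_lemma by auto
    then have "cis \<theta> = of_real r" using d by (simp add: scaleR_conv_of_real)
    then have "sin \<theta> = 0" by (simp add: complex_eq_iff)
    then show False using sp by simp
  qed
  show thesis
  proof (rule that[of "min 1 (1 / (A + B))"])
    show "0 < min 1 (1 / (A + B))" using AB by simp
    show "min 1 (1 / (A + B)) \<le> 1" by simp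
    fix e :: real assume e: "0 < e" "e < min 1 (1 / (A + B))"
    then have "e * (A + B) < 1" using AB by (simp add: field_simps)
    moreover have "(1 - e * A - e * B) *\<^sub>R z + (e * A) *\<^sub>R (z + d) + (e * B) *\<^sub>R (z + cis \<theta> * d)
      = z + e *\<^sub>R (cis t * d)"
      unfolding ct scaleR_conv_of_real by (simp add: algebra_simps)
    moreover have "0 < e * A" "0 < e * B" using e AB by auto
    ultimately show "z + e *\<^sub>R (cis t * d) \<in> interior (convex hull {z, z + d, z + cis \<theta> * d})"
      unfolding interior_convex_hull_3_minimal[OF nc DIM_complex]
      by (intro CollectI exI[of _ "1 - e * A - e * B"] exI[of _ "e * A"] exI[of _ "e * B"])
        (auto simp: algebra_simps)
  qed
qed

lemma in_closure_interior:
  fixes X :: "complex set"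
  assumes "convex X" "closed X" "interior X \<noteq> {}" "p \<in> X" "open U" "p \<in> U"
  shows "U \<inter> interior X \<noteq> {}"
proof -
  have "closure (interior X) = X" using convex_closure_interior[OF assms(1,3)] assms(2) by simp
  then have "p \<in> closure (interior X)" using assms(4) by simp
  then show ?thesis using assms(5,6) open_Int_closure_eq_empty by blast
qed

locale shield_angle =
  fixes \<alpha> :: real
  assumes \<alpha>1: "pi / 3 < \<alpha>" and \<alpha>2: "\<alpha> < 2 * pi / 3"
begin

text \<open>The exterior angle at the end of a side: if the side starts in an
  \<open>\<alpha>\<close>-vertex it ends in a \<open>\<beta>\<close>-vertex, and
  \<open>pi - \<beta>\<close> is \<open>\<alpha> - pi / 3\<close>.\<close>

definition ph where "ph s = (if s then \<alpha> - pi / 3 else pi - \<alpha>)"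
definition c where "c s = cis (ph s)"

lemma ph: "0 < ph s" "ph s < 2 * pi / 3" "ph s + ph (\<not> s) = 2 * pi / 3"
  using \<alpha>1 \<alpha>2 pi_gt_zero unfolding ph_def by (auto split: if_splits)

lemma c_norm: "norm (c s) = 1" unfolding c_def by simp

lemma cc: "c s * c (\<not> s) = \<omega> - 1"
  unfolding c_def cis_mult ph omega_sq[symmetric] by (simp add: \<omega>_def cis_mult)

lemma Im_c: "0 < Im (c s)" using ph[of s] unfolding c_def by (auto intro: sin_gt_zero)

lemma oc: "\<omega> * c s = cis (ph s + pi / 3)"
  unfolding c_def \<omega>_def cis_mult by (simp add: add.commute)

lemma Im_oc: "0 < Im (\<omega> * c s)" using ph[of s] unfolding oc by (auto intro: sin_gt_zero)

lemma Im_omega: "0 < Im \<omega>" by (simp add: omega_Complex)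

text \<open>\<open>tile l z d\<close> has the dart \<open>(z, d)\<close> on its boundary. It is a triangle if \<open>l = None\<close>, and a shield if
  \<open>l = Some s\<close>, with an \<open>\<alpha>\<close>-vertex at \<open>z\<close> iff \<open>s\<close>.\<close>

fun base_verts :: "bool option \<Rightarrow> complex set" where
  "base_verts None = {0, 1, \<omega>}"
| "base_verts (Some s) = {0, 1, 1 + c s, \<omega> + c s, \<omega> + \<omega> * c s, \<omega> * c s}"

fun tile_angle :: "bool option \<Rightarrow> real" where
  "tile_angle None = pi / 3" | "tile_angle (Some s) = ph s + pi / 3"

fun tile_turn :: "bool option \<Rightarrow> complex" where
  "tile_turn None = \<omega>" | "tile_turn (Some s) = \<omega> * c s"

lemma tile_turn_cis: "tile_turn l = cis (tile_angle l)"
proof (cases l)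
  case None then show ?thesis by (simp add: \<omega>_def)
next
  case (Some s) then show ?thesis by (simp only: tile_turn.simps tile_angle.simps oc)
qed

lemma tile_angle: "0 < tile_angle l" "tile_angle l < pi" "pi / 3 \<le> tile_angle l"
proof (atomize (full), cases l)
  case None then show "0 < tile_angle l \<and> tile_angle l < pi \<and> pi / 3 \<le> tile_angle l" using pi_gt_zero by simp
next
  case (Some s) then show "0 < tile_angle l \<and> tile_angle l < pi \<and> pi / 3 \<le> tile_angle l"
    using ph(1,2)[of s] pi_gt_zero by simp
qed

lemma shield_angle_bounds: "0 < tile_angle (Some s)" "tile_angle (Some s) < pi" "pi / 3 < tile_angle (Some s)"
  using tile_angle[of "Some s"] ph(1)[of s] by simp_all

fun next_dart :: "bool option \<times> complex \<times> complex \<Rightarrow> bool option \<times> complex \<times> complex" where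
  "next_dart (None, z, d) = (None, z + d, (\<omega> - 1) * d)"
| "next_dart (Some s, z, d) = (Some (\<not> s), z + d, c s * d)"

definition verts where "verts l z d = (\<lambda>w. z + d * w) ` base_verts l"
definition tile where "tile l z d = convex hull (verts l z d)"

fun dart_tile where "dart_tile (l, z, d) = tile l z d"
fun dart_verts where "dart_verts (l, z, d) = verts l z d"

lemma cc': "c (\<not> s) * c s = \<omega> - 1"
  using cc[of "\<not> s"] by simp

lemma ccx: "c s * (c (\<not> s) * x) = \<omega> * x - x" "c (\<not> s) * (c s * x) = \<omega> * x - x"
proof -
  have "c s * (c (\<not> s) * x) = (c s * c (\<not> s)) * x" "c (\<not> s) * (c s * x) = (c (\<not> s) * c s) * x"
    by (simp_all only: mult.assoc)
  then show "c s * (c (\<not> s) * x) = \<omega> * x - x" "c (\<not> s) * (c s * x) = \<omega> * x - x"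
    unfolding cc cc' by (simp_all add: algebra_simps)
qed

lemma c_TF: "c True * c False = \<omega> - 1" "c False * c True = \<omega> - 1"
  "c True * (c False * x) = \<omega> * x - x" "c False * (c True * x) = \<omega> * x - x"
  using cc[of True] cc[of False] ccx[of True] ccx[of False] by simp_all

lemmas nf = algebra_simps omega_sq omega_sq' cc cc' ccx

lemma verts_simps: "verts None z d = {z, z + d, z + \<omega> * d}"
  "verts (Some s) z d = {z, z + d, z + d + c s * d, z + \<omega> * d + c s * d,
     z + \<omega> * d + \<omega> * (c s * d), z + \<omega> * (c s * d)}"
  unfolding verts_def by (simp_all add: algebra_simps)

lemma dart_verts_next: "dart_verts (next_dart x) = dart_verts x"
proof -
  obtain l z d where x: "x = (l, z, d)" by (cases x)
  show ?thesis
  proof (cases l)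
    case None
    have "z + d + \<omega> * ((\<omega> - 1) * d) = z" "z + d + (\<omega> - 1) * d = z + \<omega> * d" by (simp_all add: nf)
    then show ?thesis unfolding x None next_dart.simps dart_verts.simps verts_simps by auto
  next
    case (Some s)
    have e: "z + d + \<omega> * (c s * d) + c (\<not> s) * (c s * d) = z + \<omega> * d + \<omega> * (c s * d)"
      "z + d + \<omega> * (c s * d) + \<omega> * (c (\<not> s) * (c s * d)) = z + \<omega> * (c s * d)"
      "z + d + \<omega> * (c (\<not> s) * (c s * d)) = z"
      "z + d + c s * d + c (\<not> s) * (c s * d) = z + \<omega> * d + c s * d"
      by (simp_all add: nf)
    show ?thesis unfolding x Some next_dart.simps dart_verts.simps verts_simps e by auto
  qed
qed

lemma dart_verts_iter: "dart_verts ((next_dart ^^ n) x) = dart_verts x"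
  by (induction n) (simp_all add: dart_verts_next)

lemma dart_tile_verts: "dart_tile x = convex hull (dart_verts x)"
  by (cases x) (simp add: tile_def)

lemma dart_tile_iter: "dart_tile ((next_dart ^^ n) x) = dart_tile x"
  unfolding dart_tile_verts dart_verts_iter ..

lemma norm_iter: "norm (snd (snd ((next_dart ^^ n) x))) = norm (snd (snd x))"
proof (induction n)
  case (Suc n)
  have "norm (snd (snd (next_dart y))) = norm (snd (snd y))" for y
  proof -
    obtain l z d where y: "y = (l, z, d)" by (cases y)
    have "norm (\<omega> - 1) = 1" unfolding omega_sq[symmetric] unfolding \<omega>_def by (simp add: norm_mult)
    then show ?thesis unfolding y by (cases l) (simp_all add: norm_mult c_norm)
  qed
  then show ?case using Suc by simp
qed simp

definition prev_label :: "bool option \<Rightarrow> bool option" where "prev_label l = map_option Not l"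

text \<open>Two steps around a triangle, or five around a shield, lead to the dart arriving at
  \<open>z\<close>.\<close>

lemma last_dart: "\<exists>n. (next_dart ^^ n) (l, z, d) = (prev_label l, z + tile_turn l * d, - (tile_turn l * d))"
proof (cases l)
  case None
  show ?thesis unfolding None prev_label_def by (rule exI[of _ 2]) (simp add: numeral_2_eq_2 nf)
next
  case (Some s)
  show ?thesis unfolding Some prev_label_def by (rule exI[of _ 5]) (simp add: eval_nat_numeral nf)
qed

lemma vertex_dart:
  assumes "p \<in> verts l z d"
  obtains n l' d' where "(next_dart ^^ n) (l, z, d) = (l', p, d')"
proof -
  have "\<exists>n. fst (snd ((next_dart ^^ n) (l, z, d))) = p"
  proof (cases l)
    case None
    consider "p = z" | "p = z + d" | "p = z + \<omega> * d" using assms unfolding None verts_simps by blast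
    then show ?thesis
    proof cases
      case 1 then show ?thesis by (intro exI[of _ 0]) simp
    next
      case 2 then show ?thesis unfolding None by (intro exI[of _ 1]) simp
    next
      case 3 then show ?thesis unfolding None by (intro exI[of _ 2]) (simp add: eval_nat_numeral nf)
    qed
  next
    case (Some s)
    consider "p = z" | "p = z + d" | "p = z + d + c s * d" | "p = z + \<omega> * d + c s * d"
      | "p = z + \<omega> * d + \<omega> * (c s * d)" | "p = z + \<omega> * (c s * d)"
      using assms unfolding Some verts_simps by blast
    then show ?thesis
    proof cases
      case 1 then show ?thesis by (intro exI[of _ 0]) simp
    next
      case 2 then show ?thesis unfolding Some by (intro exI[of _ 1]) simp
    next
      case 3 then show ?thesis unfolding Some by (intro exI[of _ 2]) (simp add: eval_nat_numeral nf)
    next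
      case 4 then show ?thesis unfolding Some by (intro exI[of _ 3]) (simp add: eval_nat_numeral nf)
    next
      case 5 then show ?thesis unfolding Some by (intro exI[of _ 4]) (simp add: eval_nat_numeral nf)
    next
      case 6 then show ?thesis unfolding Some by (intro exI[of _ 5]) (simp add: eval_nat_numeral nf)
    qed
  qed
  then show thesis using that by (metis prod.collapse)
qed

text \<open>Apart from its two ends, every vertex is strictly to the left of the side from 0 to 1.
  As each vertex starts a dart of the same tile, this one fact gives convex position, the edges and
  the extreme points.\<close>

lemma W_side: "w \<in> base_verts l \<Longrightarrow> w = 0 \<or> w = 1 \<or> 0 < Im w"
  using Im_c Im_oc Im_omega by (cases l) (auto simp: add_pos_pos simp del: times_complex.simps)

lemma verts_finite: "finite (verts l z d)"
  unfolding verts_def by (cases l) simp_all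

lemma verts_side:
  assumes d: "norm d = 1" and v: "v \<in> verts l z d"
  shows "v = z \<or> v = z + d \<or> 0 < Im ((v - z) * cnj d)"
proof -
  obtain w where w: "w \<in> base_verts l" "v = z + d * w" using v unfolding verts_def by blast
  have "(v - z) * cnj d = w" using norm_1_cnj[OF d] unfolding w(2) by (simp add: mult.commute mult.left_commute)
  then show ?thesis using W_side[OF w(1)] w(2) by (simp only:) auto
qed

lemma tile_props: "convex (tile l z d)" "compact (tile l z d)" "closed (tile l z d)" "polyhedron (tile l z d)"
    "verts l z d \<subseteq> tile l z d"
  unfolding tile_def
  by (simp_all add: verts_finite finite_imp_compact_convex_hull compact_imp_closed
      polyhedron_convex_hull hull_subset)

lemma z_verts: "z \<in> verts l z d" "z + d \<in> verts l z d" "z + tile_turn l * d \<in> verts l z d"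
  by (cases l; simp add: verts_simps)+

lemma tile_side:
  assumes "norm d = 1" "p \<in> tile l z d"
  shows "0 \<le> Im ((p - z) * cnj d)"
proof -
  have "tile l z d \<subseteq> {p. 0 \<le> Im ((p - z) * cnj d)}"
    unfolding tile_def
    by (rule hull_minimal) (use verts_side[OF assms(1)] convex_left norm_1_cnj[OF assms(1)] in force)+
  then show ?thesis using assms(2) by blast
qed

lemma seg_tile: "closed_segment z (z + d) \<subseteq> tile l z d"
  using z_verts tile_props(1,5) by (metis closed_segment_subset subsetD)

lemma tile_line_face:
  assumes d: "norm d = 1"
  shows "tile l z d \<inter> {p. Im ((p - z) * cnj d) = 0} face_of tile l z d"
    and "tile l z d \<inter> {p. Im ((p - z) * cnj d) = 0} = closed_segment z (z + d)"
proof -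
  let ?F = "tile l z d \<inter> {p. Im ((p - z) * cnj d) = 0}"
  have e: "{p. Im ((p - z) * cnj d) = 0} = {p. inner (\<i> * d) p = inner (\<i> * d) z}"
    unfolding inner_ii by (simp add: algebra_simps)
  show f: "?F face_of tile l z d" unfolding e
    by (rule face_of_Int_supporting_hyperplane_ge[OF tile_props(1)])
      (use tile_side[OF d, of _ l z] in \<open>simp only: inner_ii left_diff_distrib minus_complex.sel diff_ge_0_iff_ge\<close>)
  obtain s' where s': "s' \<subseteq> verts l z d" "?F = convex hull s'"
    using face_of_convex_hull_subset[OF _ f[unfolded tile_def]] verts_finite finite_imp_compact
    unfolding tile_def by metis
  have "s' \<subseteq> {z, z + d}"
  proof
    fix v assume v: "v \<in> s'"
    then have "v \<in> ?F" unfolding s'(2) by (rule hull_inc)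
    then show "v \<in> {z, z + d}" using verts_side[OF d] v s'(1) by fastforce
  qed
  then have "?F \<subseteq> closed_segment z (z + d)"
    unfolding s'(2) segment_convex_hull by (rule hull_mono)
  moreover have "closed_segment z (z + d) \<subseteq> ?F"
  proof -
    have "convex ?F" using face_of_imp_convex[OF f] .
    moreover have "z \<in> ?F" "z + d \<in> ?F" using subsetD[OF tile_props(5) z_verts(1)] subsetD[OF tile_props(5) z_verts(2)] norm_1_cnj[OF d] by simp_all
    ultimately show ?thesis by (rule closed_segment_subset[rotated 2])
  qed
  ultimately show "?F = closed_segment z (z + d)" by blast
qed

lemma dart_edge:
  assumes d: "norm d = 1"
  shows "closed_segment z (z + d) edge_of tile l z d"
proof -
  have "aff_dim (closed_segment z (z + d)) = 1"
  proof -
    have "d \<noteq> 0" using d by auto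
    then show ?thesis unfolding segment_convex_hull aff_dim_convex_hull aff_dim_2 by simp
  qed
  then show ?thesis using tile_line_face[OF d] unfolding edge_of_def by metis
qed

lemma sector_tile:
  assumes d: "norm d = 1" and t: "0 < t" "t < tile_angle l"
  obtains e0 where "0 < e0" "e0 \<le> 1"
    "\<And>e. 0 < e \<Longrightarrow> e < e0 \<Longrightarrow> z + e *\<^sub>R (cis t * d) \<in> interior (tile l z d)"
proof -
  have "d \<noteq> 0" using d by auto
  from sector_interior[OF this t tile_angle(2)[of l]] obtain e0 where e0: "0 < e0" "e0 \<le> 1"
    "\<And>e. 0 < e \<Longrightarrow> e < e0 \<Longrightarrow> z + e *\<^sub>R (cis t * d) \<in> interior (convex hull {z, z + d, z + cis (tile_angle l) * d})"
    by metis
  have "interior (convex hull {z, z + d, z + cis (tile_angle l) * d}) \<subseteq> interior (tile l z d)"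
    unfolding tile_def using z_verts unfolding tile_turn_cis[symmetric] by (intro interior_mono hull_mono) auto
  then show thesis using e0 that by blast
qed

lemma tile_interior: "norm d = 1 \<Longrightarrow> interior (tile l z d) \<noteq> {}"
  using sector_tile[of d "tile_angle l / 2" l z] tile_angle(1)[of l] by (metis dense divide_pos_pos empty_iff field_sum_of_halves less_add_same_cancel1 zero_less_numeral)

lemma tile_extreme:
  assumes d: "norm d = 1"
  shows "p extreme_point_of tile l z d \<longleftrightarrow> p \<in> verts l z d"
proof
  show "p extreme_point_of tile l z d \<Longrightarrow> p \<in> verts l z d"
    unfolding tile_def by (rule extreme_point_of_convex_hull)
next
  assume "p \<in> verts l z d"
  then obtain n l' d' where n: "(next_dart ^^ n) (l, z, d) = (l', p, d')" by (rule vertex_dart)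
  have t: "tile l' p d' = tile l z d" using dart_tile_iter[of n "(l, z, d)"] n by simp
  have d': "norm d' = 1" using norm_iter[of n "(l, z, d)"] n d by simp
  have f: "closed_segment p (p + d') face_of tile l z d"
    using dart_edge[OF d', of p l'] unfolding t edge_of_def by simp
  have "p extreme_point_of closed_segment p (p + d')" by (simp add: extreme_point_of_segment)
  then show "p extreme_point_of tile l z d" using extreme_point_of_face[OF f] by simp
qed

text \<open>An edge contains two vertices \<open>p\<close> and \<open>q\<close>, and its supporting
  line passes through them, which fixes the normal vector up to a real factor \<open>k\<close>. It
  remains to see that \<open>p\<close> and \<open>q\<close> are consecutive vertices.\<close>

lemma edge_dart:
  assumes d: "norm d = 1" and F: "F edge_of tile l z d"
  obtains n l' z' d' where "(next_dart ^^ n) (l, z, d) = (l', z', d')" "F = closed_segment z' (z' + d')"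
proof -
  have Ff: "F face_of tile l z d" and ad: "aff_dim F = 1" using F unfolding edge_of_def by auto
  obtain s' where s': "s' \<subseteq> verts l z d" "F = convex hull s'"
    using face_of_convex_hull_subset[OF _ Ff[unfolded tile_def]] verts_finite finite_imp_compact by metis
  have "\<exists>p q. p \<in> s' \<and> q \<in> s' \<and> p \<noteq> q"
  proof (rule ccontr)
    assume "\<not> ?thesis"
    then have "s' = {} \<or> (\<exists>p. s' = {p})" by blast
    then show False using ad unfolding s'(2) aff_dim_convex_hull by auto
  qed
  then obtain p q where pq: "p \<in> s'" "q \<in> s'" "p \<noteq> q" by blast
  then have pF: "p \<in> F" "q \<in> F" unfolding s'(2) by (auto intro: hull_inc)
  obtain n l1 d1 where n: "(next_dart ^^ n) (l, z, d) = (l1, p, d1)"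
    using vertex_dart pq s'(1) by (metis subsetD)
  have vt: "verts l1 p d1 = verts l z d" using dart_verts_iter[of n "(l, z, d)"] n by simp
  have t: "tile l1 p d1 = tile l z d" unfolding tile_def vt ..
  have d1: "norm d1 = 1" using norm_iter[of n "(l, z, d)"] n d by simp
  have "F exposed_face_of tile l z d" using Ff exposed_face_of_polyhedron[OF tile_props(4)] by blast
  then obtain a b where ab: "tile l z d \<subseteq> {x. inner a x \<le> b}" "F = tile l z d \<inter> {x. inner a x = b}"
    unfolding exposed_face_of_def by blast
  have a0: "a \<noteq> 0"
  proof
    assume "a = 0"
    then have "F = tile l z d" using ab pF by auto
    moreover have "aff_dim (tile l z d) = 2"
      using tile_interior[OF d, of l z] aff_dim_nonempty_interior by fastforce
    ultimately show False using ad by simp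
  qed
  have apq: "inner a p = b" "inner a q = b" using pF ab(2) by auto
  define k where "k = Im (cnj (q - p) * a) / (norm (q - p))\<^sup>2"
  have nz: "norm (q - p) > 0" using pq by simp
  have az: "a = of_real k * (\<i> * (q - p))"
    unfolding k_def by (rule perpendicular_complex)
      (use apq pq(3) in \<open>simp_all add: inner_complex_def algebra_simps\<close>)
  then have k0: "k \<noteq> 0" using a0 by auto
  have ix: "inner a x - b = k * Im ((x - p) * cnj (q - p))" for x
  proof -
    have "inner a x - b = inner a (x - p)" using apq by (simp add: inner_diff_right)
    also have "\<dots> = k * inner (\<i> * (q - p)) (x - p)" unfolding az by (simp add: scaleR_conv_of_real[symmetric])
    finally show ?thesis unfolding inner_ii .
  qed
  have Fk: "F = tile l z d \<inter> {x. Im ((x - p) * cnj (q - p)) = 0}"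
  proof -
    have "inner a x = b \<longleftrightarrow> Im ((x - p) * cnj (q - p)) = 0" for x
      using ix[of x] k0 by (metis eq_iff_diff_eq_0 mult_eq_0_iff)
    then show ?thesis unfolding ab(2) by blast
  qed
  have le: "k * Im ((v - p) * cnj (q - p)) \<le> 0" if "v \<in> verts l z d" for v
    using ab(1) tile_props(5)[of l z d] that ix[of v] by force
  obtain w where w: "w \<in> base_verts l1" "q = p + d1 * w" using pq s'(1) vt unfolding verts_def by blast
  have s1: "(p + d1 * y - p) * cnj (q - p) = y * cnj w" for y
  proof -
    have "(p + d1 * y - p) * cnj (q - p) = (d1 * cnj d1) * (y * cnj w)" unfolding w(2) by simp
    then show ?thesis unfolding norm_1_cnj[OF d1] by simp
  qed
  have i1: "k * Im (cnj w) \<le> 0"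
  proof -
    have v: "p + d1 \<in> verts l z d" using z_verts(2)[of p d1 l1] unfolding vt .
    have e: "(p + d1 - p) * cnj (q - p) = cnj w" using s1[of 1] by simp
    show ?thesis using le[OF v] unfolding e .
  qed
  have i2: "k * Im (tile_turn l1 * cnj w) \<le> 0"
  proof -
    have v: "p + tile_turn l1 * d1 \<in> verts l z d" using z_verts(3)[of p l1 d1] unfolding vt .
    have e: "(p + tile_turn l1 * d1 - p) * cnj (q - p) = tile_turn l1 * cnj w"
      using s1[of "tile_turn l1"] by (simp only: mult.commute[of "tile_turn l1" d1])
    show ?thesis using le[OF v] unfolding e .
  qed
  \<comment> \<open>Otherwise the two neighbours of \<open>p\<close> would lie strictly on different
    sides of the line through \<open>p\<close> and \<open>q\<close>, which supports the
    tile.\<close>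
  have "w = 1 \<or> w = tile_turn l1"
  proof (rule ccontr)
    assume nw: "\<not> (w = 1 \<or> w = tile_turn l1)"
    have w0: "w \<noteq> 0" using w(2) pq(3) by auto
    obtain s where s: "l1 = Some s" using nw w0 w(1) by (cases l1) auto
    have co: "c s * cnj (c s) = 1" "\<omega> * cnj \<omega> = 1"
      by (simp_all add: norm_1_cnj c_norm \<omega>_def)
    have "Im w > 0" using W_side[OF w(1)] nw w0 by blast
    moreover have "Im (tile_turn l1 * cnj w) > 0"
    proof -
      consider "w = 1 + c s" | "w = \<omega> + c s" | "w = \<omega> + \<omega> * c s"
        using w(1) w0 nw unfolding s by auto
      then show ?thesis
      proof cases
        case 1
        have "tile_turn l1 * cnj w = \<omega> * c s + \<omega> * (c s * cnj (c s))" unfolding s 1 by (simp add: algebra_simps)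
        then show ?thesis using Im_oc[of s] Im_omega co by (simp del: times_complex.simps)
      next
        case 2
        have "tile_turn l1 * cnj w = c s * (\<omega> * cnj \<omega>) + \<omega> * (c s * cnj (c s))" unfolding s 2 by (simp add: algebra_simps)
        then show ?thesis using Im_c[of s] Im_omega co by (simp del: times_complex.simps)
      next
        case 3
        have "tile_turn l1 * cnj w = c s * (\<omega> * cnj \<omega>) + (\<omega> * cnj \<omega>) * (c s * cnj (c s))" unfolding s 3 by (simp add: algebra_simps)
        then show ?thesis using Im_c[of s] co by (simp del: times_complex.simps)
      qed
    qed
    ultimately show False using i1 i2 k0 by (auto simp: mult_le_0_iff zero_le_mult_iff)
  qed
  then show thesis
  proof
    assume "w = 1"
    then have "F = closed_segment p (p + d1)"
      using tile_line_face(2)[OF d1, of l1 p] unfolding Fk t w(2) by simp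
    then show thesis using that n by blast
  next
    \<comment> \<open>Here \<open>q\<close> precedes \<open>p\<close>, and the edge belongs to the
      dart arriving at \<open>p\<close>.\<close>
    assume wm: "w = tile_turn l1"
    obtain m where m: "(next_dart ^^ m) (l1, p, d1) = (prev_label l1, p + tile_turn l1 * d1, - (tile_turn l1 * d1))"
      using last_dart by blast
    have nm: "(next_dart ^^ (m + n)) (l, z, d) = (prev_label l1, p + tile_turn l1 * d1, - (tile_turn l1 * d1))"
      using m n by (simp add: funpow_add)
    have q: "q = p + tile_turn l1 * d1" unfolding w(2) wm by (simp add: mult.commute)
    have t2: "tile (prev_label l1) q (p - q) = tile l z d"
      using dart_tile_iter[of "m + n" "(l, z, d)"] nm q by simp
    have d2: "norm (p - q) = 1" using norm_iter[of "m + n" "(l, z, d)"] nm q d by simp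
    have "Im ((x - q) * cnj (p - q)) = - Im ((x - p) * cnj (q - p))" for x
      by (simp add: algebra_simps)
    then have "{x. Im ((x - q) * cnj (p - q)) = 0} = {x. Im ((x - p) * cnj (q - p)) = 0}"
      by (simp only: neg_equal_0_iff_equal)
    then have "F = closed_segment q (q + (p - q))"
      using tile_line_face(2)[OF d2, of "prev_label l1" q] unfolding t2 Fk by (simp only:)
    then show thesis using that[OF nm] q by simp
  qed
qed

end

section \<open>From the metric description of triangles and shields to tiles given by a dart\<close>

lemma cis_of_inner:
  assumes "norm x = 1" "norm y = 1" "inner x y = cos \<theta>" "0 < \<theta>" "\<theta> < pi" "0 < Im (y * cnj x)"
  shows "y = cis \<theta> * x"
proof -
  have r: "Re (y * cnj x) = cos \<theta>" using assms(3) by (simp add: inner_complex_def algebra_simps)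
  have "norm (y * cnj x) = 1" using assms by (simp add: norm_mult)
  then have "(Re (y * cnj x))\<^sup>2 + (Im (y * cnj x))\<^sup>2 = 1" by (simp add: cmod_def)
  then have "(Im (y * cnj x))\<^sup>2 = (sin \<theta>)\<^sup>2" unfolding r sin_squared_eq by linarith
  then have "Im (y * cnj x) = sin \<theta>" using assms(6) sin_gt_zero[OF assms(4,5)]
    by (smt (verit) power2_eq_iff)
  then have "y * cnj x = cis \<theta>" using r by (simp add: complex_eq_iff)
  then have "y * (x * cnj x) = cis \<theta> * x" by (simp add: mult.commute mult.left_commute)
  then show ?thesis using norm_1_cnj[OF assms(1)] by simp
qed

lemma vec_angle_unit:
  assumes "norm x = 1" "norm y = 1" "vec_angle x y = \<theta>"
  shows "inner x y = cos \<theta>"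
proof -
  have "\<bar>inner x y\<bar> \<le> 1" using Cauchy_Schwarz_ineq2[of x y] assms by simp
  then show ?thesis using assms unfolding vec_angle_def by auto
qed

text \<open>Positive when \<open>q\<close> turns counterclockwise at \<open>q i\<close>. The angles
  of a shield are unoriented, so the sign has to be recovered from convexity.\<close>

definition ccw_turn :: "(nat \<Rightarrow> complex) \<Rightarrow> nat \<Rightarrow> real" where
  "ccw_turn q i = Im ((q ((i + 5) mod 6) - q i) * cnj (q (Suc i mod 6) - q i))"

lemma less_6: "i < 6 \<longleftrightarrow> i = 0 \<or> i = 1 \<or> i = 2 \<or> i = 3 \<or> i = 4 \<or> i = (5::nat)"
  by auto

text \<open>The line supporting side \<open>i\<close> has the vertices before and after that side
  strictly on the same side. In terms of turns this says that those at the two ends of a side have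
  equal signs.\<close>

lemma hexagon_turns:
  assumes inj: "inj_on q {..<6}"
    and ed: "\<And>i. i < 6 \<Longrightarrow> closed_segment (q i) (q (Suc i mod 6)) edge_of convex hull (q ` {..<6})"
  shows "(\<forall>i<6. 0 < ccw_turn q i) \<or> (\<forall>i<6. ccw_turn q i < 0)"
proof -
  let ?X = "convex hull (q ` {..<6})"
  have poly: "polyhedron ?X" by (simp add: polyhedron_convex_hull)
  have qX: "q j \<in> ?X" if "j < 6" for j using that by (intro hull_inc) auto
  have ext: "q j extreme_point_of ?X" if "j < 6" for j
  proof -
    have f: "closed_segment (q j) (q (Suc j mod 6)) face_of ?X" using ed[OF that] unfolding edge_of_def by simp
    have "q j extreme_point_of closed_segment (q j) (q (Suc j mod 6))" by (simp add: extreme_point_of_segment)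
    then show ?thesis using extreme_point_of_face[OF f] by simp
  qed
  have side: "\<exists>k. k \<noteq> 0 \<and> (\<forall>j<6. j \<noteq> i \<longrightarrow> j \<noteq> Suc i mod 6 \<longrightarrow>
      k * Im ((q j - q i) * cnj (q (Suc i mod 6) - q i)) < 0)" if i: "i < 6" for i
  proof -
    let ?F = "closed_segment (q i) (q (Suc i mod 6))" and ?D = "q (Suc i mod 6) - q i"
    have Ff: "?F face_of ?X" and ad: "aff_dim ?F = 1" using ed[OF i] unfolding edge_of_def by auto
    have "?F exposed_face_of ?X" using Ff exposed_face_of_polyhedron[OF poly] by blast
    then obtain a b where ab: "?X \<subseteq> {x. inner a x \<le> b}" "?F = ?X \<inter> {x. inner a x = b}"
      unfolding exposed_face_of_def by blast
    have D0: "?D \<noteq> 0" using ad by auto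
    have e: "inner a (q i) = b" "inner a (q (Suc i mod 6)) = b" using ab(2) by (metis Int_iff ends_in_segment mem_Collect_eq)+
    define k where "k = Im (cnj ?D * a) / (norm ?D)\<^sup>2"
    have az: "a = of_real k * (\<i> * ?D)" unfolding k_def
      by (rule perpendicular_complex[OF _ D0]) (use e in \<open>simp add: inner_complex_def algebra_simps\<close>)
    have ix: "inner a x - b = k * Im ((x - q i) * cnj ?D)" for x
    proof -
      have "inner a x - b = inner a (x - q i)" using e by (simp add: inner_diff_right)
      also have "\<dots> = k * inner (\<i> * ?D) (x - q i)" unfolding az by (simp add: scaleR_conv_of_real[symmetric])
      finally show ?thesis unfolding inner_ii .
    qed
    have lt: "k * Im ((q j - q i) * cnj ?D) < 0" if j: "j < 6" "j \<noteq> i" "j \<noteq> Suc i mod 6" for j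
    proof -
      have "inner a (q j) \<le> b" using ab(1) qX[OF j(1)] by blast
      moreover have "inner a (q j) \<noteq> b"
      proof
        assume "inner a (q j) = b"
        then have m: "q j \<in> ?F" using ab(2) qX[OF j(1)] by blast
        then have "q j extreme_point_of ?F" using extreme_point_of_face[OF Ff] ext[OF j(1)] by blast
        then have "q j = q i \<or> q j = q (Suc i mod 6)" by (simp add: extreme_point_of_segment)
        then show False using inj j i by (auto simp: inj_on_def)
      qed
      ultimately show ?thesis using ix[of "q j"] by linarith
    qed
    have "k \<noteq> 0" using lt[of "(i + 2) mod 6"] i unfolding less_6 by auto
    then show ?thesis using lt by blast
  qed
  have step: "0 < ccw_turn q i * ccw_turn q (Suc i mod 6)" if i: "i < 6" for i
  proof -
    obtain k where k: "k \<noteq> 0" "\<And>j. j < 6 \<Longrightarrow> j \<noteq> i \<Longrightarrow> j \<noteq> Suc i mod 6 \<Longrightarrow>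
      k * Im ((q j - q i) * cnj (q (Suc i mod 6) - q i)) < 0" using side[OF i] by blast
    have 1: "k * ccw_turn q i < 0"
      unfolding ccw_turn_def by (rule k(2)) (use i in \<open>auto simp: less_6\<close>)
    have "ccw_turn q (Suc i mod 6) = Im ((q ((i + 2) mod 6) - q i) * cnj (q (Suc i mod 6) - q i))"
    proof -
      have "(Suc i mod 6 + 5) mod 6 = i" "Suc (Suc i mod 6) mod 6 = (i + 2) mod 6" using i by (auto simp: less_6)
      then show ?thesis unfolding ccw_turn_def by (simp add: algebra_simps)
    qed
    then have 2: "k * ccw_turn q (Suc i mod 6) < 0"
      using k(2)[of "(i + 2) mod 6"] i by (auto simp: less_6)
    show ?thesis using 1 2 by (auto simp: mult_less_0_iff zero_less_mult_iff)
  qed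
  show ?thesis using step[of 0] step[of 1] step[of 2] step[of 3] step[of 4] step[of 5]
    unfolding less_6 by (auto simp: zero_less_mult_iff)
qed

context shield_angle begin

lemma angle_turn: "- cis (- (4 * pi / 3 - \<alpha>)) = c True" "- cis (- \<alpha>) = c False"
proof -
  have "- cis x = cis (x + pi)" for x by (simp add: complex_eq_iff)
  moreover have "- (4 * pi / 3 - \<alpha>) + pi = ph True" "- \<alpha> + pi = ph False" unfolding ph_def by simp_all
  ultimately show "- cis (- (4 * pi / 3 - \<alpha>)) = c True" "- cis (- \<alpha>) = c False" unfolding c_def by simp_all
qed

lemma hexagon_verts:
  assumes di: "\<And>i. i < 6 \<Longrightarrow> dist (q i) (q (Suc i mod 6)) = 1"
    and an: "\<And>i. i < 6 \<Longrightarrow> vec_angle (q ((i + 5) mod 6) - q i) (q (Suc i mod 6) - q i)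
            = (if even i then \<alpha> else 4 * pi / 3 - \<alpha>)"
    and tu: "\<And>i. i < 6 \<Longrightarrow> 0 < ccw_turn q i"
  shows "q 1 = q 0 + (q 1 - q 0) \<and> q 2 = q 1 + c True * (q 1 - q 0) \<and> q 3 = q 2 + (\<omega> - 1) * (q 1 - q 0) \<and>
     q 4 = q 3 + c True * ((\<omega> - 1) * (q 1 - q 0)) \<and> q 5 = q 4 - \<omega> * (q 1 - q 0)"
proof -
  have st: "q (Suc i mod 6) - q i = c (odd i) * (q i - q ((i + 5) mod 6))"
    if i: "i < 6" for i
  proof -
    define \<theta> where "\<theta> = (if even i then \<alpha> else 4 * pi / 3 - \<alpha>)"
    have tile_angle: "0 < \<theta>" "\<theta> < pi" using \<alpha>1 \<alpha>2 pi_gt_zero unfolding \<theta>_def by (auto split: if_splits)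
    let ?x = "q (Suc i mod 6) - q i" and ?y = "q ((i + 5) mod 6) - q i"
    have nx: "norm ?x = 1" using di[OF i] by (simp add: dist_norm norm_minus_commute)
    have ny: "norm ?y = 1"
    proof -
      have "Suc ((i + 5) mod 6) mod 6 = i" using i by (auto simp: less_6)
      then show ?thesis using di[of "(i + 5) mod 6"] by (simp add: dist_norm)
    qed
    have "inner ?y ?x = cos \<theta>" by (rule vec_angle_unit[OF ny nx]) (use an[OF i] \<theta>_def in simp)
    then have "?y = cis \<theta> * ?x"
      using cis_of_inner[OF nx ny _ tile_angle] tu[OF i] unfolding ccw_turn_def by (simp add: inner_commute)
    then have "cis (- \<theta>) * ?y = ?x" by (simp add: cis_mult mult.assoc[symmetric])
    then have "?x = - cis (- \<theta>) * (q i - q ((i + 5) mod 6))" by (metis minus_diff_eq mult_minus_left mult_minus_right)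
    moreover have "- cis (- \<theta>) = c (odd i)"
    proof (cases "even i")
      case True then show ?thesis unfolding \<theta>_def using angle_turn(2) by simp
    next
      case False
      then have "\<theta> = 4 * pi / 3 - \<alpha>" unfolding \<theta>_def by simp
      then show ?thesis using False angle_turn(1) by (simp only: simp_thms)
    qed
    ultimately show ?thesis by simp
  qed
  have e: "Suc 1 mod 6 = (2::nat)" "(1 + 5) mod 6 = (0::nat)" "Suc 2 mod 6 = (3::nat)" "(2 + 5) mod 6 = (1::nat)"
    "Suc 3 mod 6 = (4::nat)" "(3 + 5) mod 6 = (2::nat)" "Suc 4 mod 6 = (5::nat)" "(4 + 5) mod 6 = (3::nat)"
    "odd (1::nat) = True" "odd (2::nat) = False" "odd (3::nat) = True" "odd (4::nat) = False"
    by simp_all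
  have 1: "q 2 - q 1 = c True * (q 1 - q 0)" by (rule st[of 1, unfolded e]) simp
  have 2: "q 3 - q 2 = c False * (q 2 - q 1)" by (rule st[of 2, unfolded e]) simp
  have 3: "q 4 - q 3 = c True * (q 3 - q 2)" by (rule st[of 3, unfolded e]) simp
  have 4: "q 5 - q 4 = c False * (q 4 - q 3)" by (rule st[of 4, unfolded e]) simp
  have cc1: "c False * (c True * x) = (\<omega> - 1) * x" for x using ccx(2)[of True x] by (simp add: algebra_simps)
  have 5: "q 3 - q 2 = (\<omega> - 1) * (q 1 - q 0)" unfolding 2 1 cc1 ..
  have "q 5 - q 4 = (\<omega> - 1) * ((\<omega> - 1) * (q 1 - q 0))" unfolding 4 3 cc1 5 ..
  also have "\<dots> = - (\<omega> * (q 1 - q 0))" by (simp add: nf)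
  finally have 6: "q 5 - q 4 = - (\<omega> * (q 1 - q 0))" .
  show ?thesis using 1 3 5 6 by (simp add: algebra_simps)
qed

lemma shield_tile:
  assumes "shield \<alpha> S"
  shows "\<exists>z d. norm d = 1 \<and> S = tile (Some True) z d"
proof -
  obtain q where q: "shield_vertices \<alpha> q" "S = convex hull (q ` {..<6})" using assms unfolding shield_def by blast
  have inj: "inj_on q {..<6}"
    and ed: "\<And>i. i < 6 \<Longrightarrow> closed_segment (q i) (q (Suc i mod 6)) edge_of convex hull (q ` {..<6})"
    and di: "\<And>i. i < 6 \<Longrightarrow> dist (q i) (q (Suc i mod 6)) = 1"
    and an: "\<And>i. i < 6 \<Longrightarrow> vec_angle (q ((i + 5) mod 6) - q i) (q (Suc i mod 6) - q i)
            = (if even i then \<alpha> else 4 * pi / 3 - \<alpha>)"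
    using q(1) unfolding shield_vertices_def by blast+
  have img: "p ` {..<6} = {p 0, p 1, p 2, p 3, p 4, p 5}" for p :: "nat \<Rightarrow> complex"
    by (auto simp: less_6)
  have fin: ?thesis if d: "norm (p 1 - p 0) = 1" and S: "S = convex hull (p ` {..<6})" and
     p: "p 1 = p 0 + (p 1 - p 0) \<and> p 2 = p 1 + c True * (p 1 - p 0) \<and> p 3 = p 2 + (\<omega> - 1) * (p 1 - p 0) \<and>
     p 4 = p 3 + c True * ((\<omega> - 1) * (p 1 - p 0)) \<and> p 5 = p 4 - \<omega> * (p 1 - p 0)" for p :: "nat \<Rightarrow> complex"
  proof -
    define z d where "z = p 0" and "d = p 1 - p 0"
    have 0: "p 0 = z" and 1: "p 1 = z + d" unfolding z_def d_def by simp_all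
    have e: "p 2 = p 1 + c True * d" "p 3 = p 2 + (\<omega> - 1) * d"
      "p 4 = p 3 + c True * ((\<omega> - 1) * d)" "p 5 = p 4 - \<omega> * d" using p unfolding d_def by blast+
    have 2: "p 2 = z + d + c True * d" unfolding e 1 by simp
    have 3: "p 3 = z + \<omega> * d + c True * d" unfolding e(2) 2 by (simp add: nf)
    have 4: "p 4 = z + \<omega> * d + \<omega> * (c True * d)" unfolding e(3) 3 by (simp add: nf)
    have 5: "p 5 = z + \<omega> * (c True * d)" unfolding e(4) 4 by (simp add: nf)
    note 0 1 2 3 4 5
    then have "S = tile (Some True) z d" unfolding S img tile_def verts_simps by simp
    then show ?thesis using d unfolding d_def by blast
  qed
  from hexagon_turns[OF inj ed] show ?thesis
  proof
    assume "\<forall>i<6. 0 < ccw_turn q i"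
    then have "q 1 = q 0 + (q 1 - q 0) \<and> q 2 = q 1 + c True * (q 1 - q 0) \<and> q 3 = q 2 + (\<omega> - 1) * (q 1 - q 0) \<and>
     q 4 = q 3 + c True * ((\<omega> - 1) * (q 1 - q 0)) \<and> q 5 = q 4 - \<omega> * (q 1 - q 0)"
      by (intro hexagon_verts[OF di an]) auto
    moreover have "norm (q 1 - q 0) = 1" using di[of 0] by (simp add: dist_norm norm_minus_commute)
    ultimately show ?thesis using fin[OF _ q(2)] by blast
  next
    assume neg: "\<forall>i<6. ccw_turn q i < 0"
    \<comment> \<open>A clockwise numbering is reversed. Keeping the vertex 0 in place preserves the
      parity of the indices and hence the kind of each vertex.\<close>
    define p where "p i = q ((6 - i) mod 6)" for i
    have idx: "(6 - Suc i mod 6) mod 6 = ((6 - i) mod 6 + 5) mod 6" "(6 - (i + 5) mod 6) mod 6 = Suc ((6 - i) mod 6) mod 6"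
      "even ((6 - i) mod 6) = even i" "Suc (((6 - i) mod 6 + 5) mod 6) mod 6 = (6 - i) mod 6" if "i < 6" for i :: nat
      using that unfolding less_6 by (elim disjE; simp)+
    have pd: "dist (p i) (p (Suc i mod 6)) = 1" if "i < 6" for i
      using di[of "((6 - i) mod 6 + 5) mod 6"] unfolding p_def idx[OF that] by (simp add: dist_commute)
    have vc: "vec_angle x y = vec_angle y x" for x y unfolding vec_angle_def by (simp add: inner_commute mult.commute)
    have pa: "vec_angle (p ((i + 5) mod 6) - p i) (p (Suc i mod 6) - p i)
            = (if even i then \<alpha> else 4 * pi / 3 - \<alpha>)" if "i < 6" for i
      using an[of "(6 - i) mod 6"] unfolding p_def idx[OF that] by (simp add: vc)
    have im: "Im (x * cnj y) < 0 \<Longrightarrow> 0 < Im (y * cnj x)" for x y by (simp add: algebra_simps)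
    have pt: "0 < ccw_turn p i" if "i < 6" for i
    proof -
      have "ccw_turn q ((6 - i) mod 6) < 0" using neg by simp
      then show ?thesis unfolding ccw_turn_def p_def idx[OF that] by (rule im)
    qed
    have "p ` {..<6} = q ` {..<6}" unfolding img p_def by auto
    moreover have "norm (p 1 - p 0) = 1" using pd[of 0] by (simp add: dist_norm norm_minus_commute)
    ultimately show ?thesis using fin[OF _ _ hexagon_verts[OF pd pa pt]] q(2) by simp
  qed
qed

lemma triangle_tile:
  assumes "unit_triangle X"
  shows "\<exists>z d. norm d = 1 \<and> X = tile None z d"
proof -
  obtain a b p where d: "dist a b = 1" "dist b p = 1" "dist a p = 1" and X: "X = convex hull {a, b, p}"
    using assms unfolding unit_triangle_def by blast
  define x y where "x = b - a" and "y = p - a"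
  have n: "norm x = 1" "norm y = 1" "norm (x - y) = 1"
    using d unfolding x_def y_def by (auto simp: dist_norm norm_minus_commute)
  have "(norm (x - y))\<^sup>2 = (norm x)\<^sup>2 + (norm y)\<^sup>2 - 2 * inner x y"
    by (simp add: power2_norm_eq_inner inner_diff_left inner_diff_right inner_commute)
  then have ip: "inner x y = cos (pi / 3)" using n by (simp add: cos_60)
  have pi3: "0 < pi / 3" "pi / 3 < pi" by simp_all
  have nz: "Im (y * cnj x) \<noteq> 0"
  proof
    assume i: "Im (y * cnj x) = 0"
    have "Re (y * cnj x) = 1 / 2" using ip by (simp add: inner_complex_def cos_60 algebra_simps)
    moreover have "norm (y * cnj x) = 1" using n by (simp add: norm_mult)
    ultimately show False using i by (simp add: cmod_eq_Re)
  qed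
  show ?thesis
  proof (cases "0 < Im (y * cnj x)")
    case True
    have "y = \<omega> * x" unfolding \<omega>_def by (rule cis_of_inner[OF n(1,2) ip pi3 True])
    then have "p = a + \<omega> * x" "b = a + x" unfolding x_def y_def by (simp_all add: algebra_simps)
    then have "X = tile None a x" unfolding X tile_def verts_simps by simp
    then show ?thesis using n by blast
  next
    case False
    have "Im (x * cnj y) = - Im (y * cnj x)" by (simp add: algebra_simps)
    then have "0 < Im (x * cnj y)" using False nz by linarith
    then have "x = \<omega> * y" unfolding \<omega>_def by (intro cis_of_inner[OF n(2,1) _ pi3]) (simp_all add: ip inner_commute)
    then have "b = a + \<omega> * y" "p = a + y" unfolding x_def y_def by (simp_all add: algebra_simps)
    then have "X = tile None a y" unfolding X tile_def verts_simps by (simp add: insert_commute)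
    then show ?thesis using n by blast
  qed
qed

lemma tile_image: "tile l (z + b * y) (b * d) = (\<lambda>p. z + b * p) ` tile l y d"
proof -
  have "(\<lambda>p. z + b * p) ` (convex hull S) = convex hull ((\<lambda>p. z + b * p) ` S)" for S
  proof -
    have "(\<lambda>p. z + b * p) ` S = (+) z ` ((*) b ` S)" for S by (simp add: image_image)
    then show ?thesis
      by (simp add: convex_hull_translation convex_hull_linear_image bounded_linear.linear bounded_linear_mult_right)
  qed
  then show ?thesis unfolding tile_def verts_def by (simp add: image_image algebra_simps)
qed

text \<open>All tiles are congruent to one of two fixed tiles, so common inner and outer radii
  exist; they are what local finiteness needs.\<close>

lemma tile_ball:
  obtains r R where "0 < r" "0 < R" "\<And>l z d. l \<in> {None, Some True} \<Longrightarrow> norm d = 1 \<Longrightarrow>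
    \<exists>x. ball x r \<subseteq> tile l z d \<and> tile l z d \<subseteq> cball x R"
proof -
  have "\<exists>x r R. 0 < r \<and> 0 < R \<and> ball x r \<subseteq> tile l 0 1 \<and> tile l 0 1 \<subseteq> cball x R" for l
  proof -
    obtain x where "x \<in> interior (tile l 0 1)" using tile_interior[of 1 l 0] by auto
    then obtain r where "0 < r" "ball x r \<subseteq> tile l 0 1" unfolding mem_interior by blast
    moreover obtain R where "tile l 0 1 \<subseteq> cball x R"
      using tile_props(2)[of l 0 1] compact_imp_bounded bounded_any_center[of _ x] by (metis mem_cball subsetI)
    then have "tile l 0 1 \<subseteq> cball x (max R 1)" by (auto simp: subset_iff)
    ultimately show ?thesis by (metis less_max_iff_disj zero_less_one)
  qed
  then obtain x r R where *: "\<And>l. 0 < r l \<and> 0 < R l \<and> ball (x l) (r l) \<subseteq> tile l 0 1 \<and> tile l 0 1 \<subseteq> cball (x l) (R l)"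
    by metis
  show thesis
  proof (rule that[of "min (r None) (r (Some True))" "max (R None) (R (Some True))"])
    show "0 < min (r None) (r (Some True))" "0 < max (R None) (R (Some True))" using * by (auto simp: less_max_iff_disj)
    fix l z and d :: complex assume l: "l \<in> {None, Some True}" and d: "norm d = 1"
    have im: "tile l z d = (\<lambda>p. z + d * p) ` tile l 0 1" using tile_image[of l z d 0 1] by simp
    have dd: "dist (z + d * p) (z + d * q) = dist p q" "dist (d * p) (d * q) = dist p q" for p q
    proof -
      have "dist (d * p) (d * q) = norm (d * (p - q))" by (simp add: dist_norm right_diff_distrib)
      then show "dist (d * p) (d * q) = dist p q" using d by (simp add: norm_mult dist_norm)
      then show "dist (z + d * p) (z + d * q) = dist p q" by simp
    qed
    have "ball (z + d * x l) (min (r None) (r (Some True))) \<subseteq> tile l z d"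
    proof
      fix y assume y: "y \<in> ball (z + d * x l) (min (r None) (r (Some True)))"
      define p where "p = (y - z) / d"
      have yp: "y = z + d * p" unfolding p_def using d by auto
      have "p \<in> ball (x l) (r l)" using y l unfolding yp by (auto simp: dd)
      then show "y \<in> tile l z d" unfolding im yp using * by blast
    qed
    moreover have "tile l z d \<subseteq> cball (z + d * x l) (max (R None) (R (Some True)))"
    proof
      fix y assume "y \<in> tile l z d"
      then obtain p where p: "p \<in> tile l 0 1" "y = z + d * p" unfolding im by blast
      then have "dist (x l) p \<le> R l" using *[of l] by auto
      then show "y \<in> cball (z + d * x l) (max (R None) (R (Some True)))" using l unfolding p(2) mem_cball dd by auto
    qed
    ultimately show "\<exists>x. ball x (min (r None) (r (Some True))) \<subseteq> tile l z d \<and>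
        tile l z d \<subseteq> cball x (max (R None) (R (Some True)))" by blast
  qed
qed

end

section \<open>Tiles around a vertex\<close>

locale shield_plane = shield_angle +
  fixes \<T> :: "complex set set"
  assumes \<alpha>3: "\<alpha> \<noteq> pi / 2" and tiling: "shield_tiling \<alpha> \<T>"
begin

definition D where "D l z d \<longleftrightarrow> norm d = 1 \<and> tile l z d \<in> \<T>"

lemma tile_rep: "X \<in> \<T> \<Longrightarrow> \<exists>l z d. l \<in> {None, Some True} \<and> D l z d \<and> X = tile l z d"
proof -
  assume X: "X \<in> \<T>"
  then consider "unit_triangle X" | "shield \<alpha> X" using tiling unfolding shield_tiling_def by blast
  then show ?thesis
  proof cases
    case 1
    from triangle_tile[OF 1] show ?thesis using X unfolding D_def by blast
  next
    case 2
    from shield_tile[OF 2] show ?thesis using X unfolding D_def by blast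
  qed
qed

lemma cover: "\<exists>X\<in>\<T>. p \<in> X"
  using tiling unfolding shield_tiling_def by blast

lemma disjoint_interiors: "X \<in> \<T> \<Longrightarrow> Y \<in> \<T> \<Longrightarrow> X \<noteq> Y \<Longrightarrow> interior X \<inter> interior Y = {}"
  and edge_to_edge: "X \<in> \<T> \<Longrightarrow> Y \<in> \<T> \<Longrightarrow> X \<noteq> Y \<Longrightarrow> edge_to_edge X Y"
  using tiling unfolding shield_tiling_def pairwise_def by blast+

lemma tile_closed: "X \<in> \<T> \<Longrightarrow> closed X" and tile_convex: "X \<in> \<T> \<Longrightarrow> convex X"
  and tile_inter: "X \<in> \<T> \<Longrightarrow> interior X \<noteq> {}"
proof -
  have "closed X \<and> convex X \<and> interior X \<noteq> {}" if X: "X \<in> \<T>"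
  proof -
    obtain l z d where "D l z d" "X = tile l z d" using tile_rep[OF X] by blast
    then show ?thesis using tile_props(1,3)[of l z d] tile_interior[of d l z] unfolding D_def by simp
  qed
  then show "X \<in> \<T> \<Longrightarrow> closed X" "X \<in> \<T> \<Longrightarrow> convex X" "X \<in> \<T> \<Longrightarrow> interior X \<noteq> {}" by blast+
qed

lemma interior_meets:
  assumes "X \<in> \<T>" "Y \<in> \<T>" "p \<in> interior X" "p \<in> Y"
  shows "X = Y"
proof (rule ccontr)
  assume "X \<noteq> Y"
  have "interior X \<inter> interior Y \<noteq> {}"
    by (rule in_closure_interior[OF tile_convex tile_closed tile_inter _ open_interior])
      (use assms in auto)
  then show False using disjoint_interiors assms \<open>X \<noteq> Y\<close> by blast
qed

text \<open>Each tile contains a ball of radius \<open>r\<close> about its centre, and no other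
  centre can lie in that ball. So centres are at least \<open>r\<close> apart, and infinitely many
  of them in a bounded region would accumulate.\<close>

lemma locally_finite: "finite {X \<in> \<T>. X \<inter> cball p R \<noteq> {}}"
proof -
  obtain r R0 where r: "0 < r" "0 < R0" and b: "\<And>l z d. l \<in> {None, Some True} \<Longrightarrow> norm d = 1 \<Longrightarrow>
    \<exists>x. ball x r \<subseteq> tile l z d \<and> tile l z d \<subseteq> cball x R0" using tile_ball by blast
  have "\<forall>X\<in>\<T>. \<exists>x. ball x r \<subseteq> X \<and> X \<subseteq> cball x R0" using tile_rep b unfolding D_def by metis
  then obtain ctr where ctr: "\<And>X. X \<in> \<T> \<Longrightarrow> ball (ctr X) r \<subseteq> X \<and> X \<subseteq> cball (ctr X) R0" by metis
  have int: "ball (ctr X) r \<subseteq> interior X" if "X \<in> \<T>" for X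
    using ctr[OF that] by (simp add: interior_maximal)
  have sep: "r \<le> dist (ctr X) (ctr Y)" if "X \<in> \<T>" "Y \<in> \<T>" "X \<noteq> Y" for X Y
  proof (rule ccontr)
    assume "\<not> r \<le> dist (ctr X) (ctr Y)"
    then have "ctr Y \<in> interior X" using int[OF that(1)] by auto
    moreover have "ctr Y \<in> Y" using ctr[OF that(2)] r by auto
    ultimately show False using interior_meets that by blast
  qed
  let ?S = "{X \<in> \<T>. X \<inter> cball p R \<noteq> {}}"
  have inj: "inj_on ctr ?S" using sep r unfolding inj_on_def by fastforce
  have "finite (ctr ` ?S)"
  proof (rule ccontr)
    assume inf: "infinite (ctr ` ?S)"
    have "ctr ` ?S \<subseteq> cball p (R + R0)"
    proof
      fix y assume "y \<in> ctr ` ?S"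
      then obtain X q where X: "X \<in> \<T>" "y = ctr X" "q \<in> X" "q \<in> cball p R" by blast
      then have "q \<in> cball (ctr X) R0" using ctr[OF X(1)] by blast
      then have "dist y q \<le> R0" using X(2) by simp
      then show "y \<in> cball p (R + R0)" using X(4) dist_triangle[of p y q] by (simp add: dist_commute)
    qed
    then obtain x where "x islimpt ctr ` ?S"
      using inf compact_cball[of p "R + R0"] unfolding compact_eq_Bolzano_Weierstrass by blast
    then have inf1: "infinite (ctr ` ?S \<inter> ball x (r / 2))" using r unfolding islimpt_eq_infinite_ball by simp
    then obtain y where y1: "y \<in> ctr ` ?S \<inter> ball x (r / 2)"
      using infinite_imp_nonempty[OF inf1] unfolding ex_in_conv[symmetric] by (elim exE)
    have inf2: "infinite (ctr ` ?S \<inter> ball x (r / 2) - {y})" using inf1 by simp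
    then obtain y' where "y' \<in> ctr ` ?S \<inter> ball x (r / 2) - {y}"
      using infinite_imp_nonempty[OF inf2] unfolding ex_in_conv[symmetric] by (elim exE)
    with y1 have y: "y \<in> ctr ` ?S \<inter> ball x (r / 2)" "y' \<in> ctr ` ?S \<inter> ball x (r / 2)" "y \<noteq> y'" by auto
    then have "dist y y' < r" using dist_triangle_half_r[of x y r y'] by (simp add: dist_commute)
    moreover obtain X Y where "X \<in> \<T>" "Y \<in> \<T>" "y = ctr X" "y' = ctr Y" using y by blast
    ultimately show False using sep y(3) by (metis not_le)
  qed
  then show ?thesis using inj finite_imageD by blast
qed

lemma closed_Union: "\<S> \<subseteq> \<T> \<Longrightarrow> closed (\<Union>\<S>)"
proof -
  assume S: "\<S> \<subseteq> \<T>"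
  show ?thesis unfolding closed_def open_contains_ball
  proof
    fix p assume p: "p \<in> - \<Union>\<S>"
    let ?N = "{X \<in> \<S>. X \<inter> cball p 1 \<noteq> {}}"
    have "finite ?N" by (rule finite_subset[OF _ locally_finite[of p 1]]) (use S in blast)
    then have "closed (\<Union>?N)" using S tile_closed by (intro closed_Union) auto
    then have op: "open (- \<Union>?N)" by (simp add: open_closed)
    have "p \<in> - \<Union>?N" using p by blast
    then obtain e where e: "0 < e" "ball p e \<subseteq> - \<Union>?N" by (rule openE[OF op])
    have "ball p (min e 1) \<subseteq> - \<Union>\<S>"
    proof
      fix q assume q: "q \<in> ball p (min e 1)"
      have "q \<notin> X" if X: "X \<in> \<S>" for X
      proof (cases "X \<inter> cball p 1 = {}")
        case True
        moreover have "q \<in> cball p 1" using q by simp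
        ultimately show ?thesis by blast
      next
        case False
        moreover have "q \<in> ball p e" using q by simp
        then have "q \<in> - \<Union>?N" by (rule subsetD[OF e(2)])
        ultimately show ?thesis using X by blast
      qed
      then show "q \<in> - \<Union>\<S>" by blast
    qed
    then show "\<exists>e>0. ball p e \<subseteq> - \<Union>\<S>" using e(1) by (intro exI[of _ "min e 1"]) auto
  qed
qed

text \<open>All angles are at least \<open>pi / 3\<close>, so a short step in the direction
  \<open>pi / 6\<close> from the dart enters the interior of both tiles.\<close>

lemma same_tile:
  assumes "D l z d" "D l' z d"
  shows "tile l z d = tile l' z d"
proof -
  have d: "norm d = 1" and t: "tile l z d \<in> \<T>" "tile l' z d \<in> \<T>" using assms unfolding D_def by auto
  define t where "t = pi / 6"
  have t0: "0 < t" "t < tile_angle l" "t < tile_angle l'"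
    using tile_angle(3)[of l] tile_angle(3)[of l'] pi_gt_zero unfolding t_def by linarith+
  obtain e1 where e1: "0 < e1" "\<And>e. 0 < e \<Longrightarrow> e < e1 \<Longrightarrow> z + e *\<^sub>R (cis t * d) \<in> interior (tile l z d)"
    using sector_tile[OF d t0(1,2)] by metis
  obtain e2 where e2: "0 < e2" "\<And>e. 0 < e \<Longrightarrow> e < e2 \<Longrightarrow> z + e *\<^sub>R (cis t * d) \<in> interior (tile l' z d)"
    using sector_tile[OF d t0(1,3)] by metis
  obtain e where e: "0 < e" "e < e1" "e < e2" using e1(1) e2(1) by (metis dense min_less_iff_conj)
  show ?thesis
    by (rule interior_meets[OF t e1(2)[OF e(1,2)] subsetD[OF interior_subset e2(2)[OF e(1,3)]]])
qed

text \<open>The midpoint of the side is a limit of points to its right, which belong to other tiles;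
  as the union of those is closed, some other tile contains the midpoint. The midpoint is not a
  vertex, so by the edge-to-edge condition the two tiles share a whole edge, which can only be this
  side.\<close>

lemma neighbour:
  assumes D: "D l z d"
  shows "\<exists>l'. D l' (z + d) (- d)"
proof -
  let ?X = "tile l z d"
  have d: "norm d = 1" and X: "?X \<in> \<T>" using D unfolding D_def by auto
  define M where "M = z + d / 2"
  have ms: "M \<in> open_segment z (z + d)"
    unfolding M_def in_segment using d by (auto intro!: exI[of _ "1/2"] simp: scaleR_conv_of_real field_simps)
  have "M \<in> \<Union>(\<T> - {?X})"
  proof -
    have "closed (\<Union>(\<T> - {?X}))" by (rule closed_Union) blast
    moreover have "\<exists>y\<in>\<Union>(\<T> - {?X}). dist y M < e" if "0 < e" for e
    proof -
      define y where "y = M - of_real (e / 2) * (\<i> * d)"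
      have "(y - z) * cnj d = (1 / 2 - of_real (e / 2) * \<i>) * (d * cnj d)"
        unfolding y_def M_def by (simp add: algebra_simps)
      then have "Im ((y - z) * cnj d) = - e / 2" unfolding norm_1_cnj[OF d] by simp
      then have "y \<notin> ?X" using tile_side[OF d, of y l z] that by auto
      moreover obtain Y where "Y \<in> \<T>" "y \<in> Y" using cover by blast
      moreover have "dist y M < e" unfolding y_def using d that by (simp add: dist_norm norm_mult)
      ultimately show ?thesis by blast
    qed
    ultimately show ?thesis using closure_approachable closure_closed by metis
  qed
  then obtain Y where Y: "Y \<in> \<T>" "Y \<noteq> ?X" "M \<in> Y" by blast
  have MX: "M \<in> ?X" using ms seg_tile segment_open_subset_closed by blast
  have zX: "z \<in> ?X" "z + d \<in> ?X" using z_verts tile_props(5) by blast+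
  have e: "edge_to_edge ?X Y" using edge_to_edge X Y by metis
  have "?X \<inter> Y edge_of ?X \<and> ?X \<inter> Y edge_of Y"
  proof -
    have "\<not> x extreme_point_of ?X \<or> ?X \<inter> Y \<noteq> {x}" for x
    proof (rule ccontr)
      assume "\<not> ?thesis"
      then have "x extreme_point_of ?X" "?X \<inter> Y = {x}" by auto
      moreover then have "M = x" using MX Y(3) by (metis IntI singletonD)
      ultimately have "M extreme_point_of ?X" by simp
      then show False using ms zX unfolding extreme_point_of_def by blast
    qed
    then show ?thesis using e MX Y(3) unfolding edge_to_edge_def by blast
  qed
  then have F: "?X \<inter> Y edge_of ?X" "?X \<inter> Y edge_of Y" by auto
  have FX: "?X \<inter> Y = closed_segment z (z + d)"
  proof -
    obtain n l' p f where n: "(next_dart ^^ n) (l, z, d) = (l', p, f)" "?X \<inter> Y = closed_segment p (p + f)"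
      using edge_dart[OF d F(1)] by blast
    have fc: "closed_segment p (p + f) face_of ?X" using F(1) n(2) unfolding edge_of_def by simp
    have "z \<in> closed_segment p (p + f)" "z + d \<in> closed_segment p (p + f)"
      using face_ofD[OF fc ms zX] MX Y(3) n(2) by blast+
    moreover have "z extreme_point_of ?X" "z + d extreme_point_of ?X" using tile_extreme[OF d] z_verts by blast+
    ultimately have "z \<in> {p, p + f}" "z + d \<in> {p, p + f}"
      using extreme_point_of_face[OF fc] extreme_point_of_segment by blast+
    moreover have "z \<noteq> z + d" using d by auto
    ultimately have "{z, z + d} = {p, p + f}" by auto
    then show ?thesis unfolding n(2) closed_segment_eq by simp
  qed
  obtain l2 z2 d2 where r: "D l2 z2 d2" "Y = tile l2 z2 d2" using tile_rep[OF Y(1)] by blast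
  then have d2: "norm d2 = 1" unfolding D_def by simp
  obtain n l' p f where n: "(next_dart ^^ n) (l2, z2, d2) = (l', p, f)" "?X \<inter> Y = closed_segment p (p + f)"
    using edge_dart[OF d2 F(2)[unfolded r(2)]] r(2) by metis
  have tY: "tile l' p f = Y" using dart_tile_iter[of n "(l2, z2, d2)"] n(1) r(2) by simp
  have nf: "norm f = 1" using norm_iter[of n "(l2, z2, d2)"] n(1) d2 by simp
  have DY: "D l' p f" unfolding D_def tY using nf Y(1) by simp
  have "{z, z + d} = {p, p + f}" using FX n(2) closed_segment_eq by metis
  then have "z = p \<and> d = f \<or> z + d = p \<and> - d = f" by (auto simp: doubleton_eq_iff add_eq_0_iff)
  then show ?thesis
  proof
    assume "z = p \<and> d = f"
    then have "tile l z d = Y" using same_tile[OF D] DY tY by metis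
    then show ?thesis using Y(2) by simp
  next
    assume "z + d = p \<and> - d = f"
    then show ?thesis using DY by blast
  qed
qed

lemma D_iter: "D l z d \<Longrightarrow> (next_dart ^^ n) (l, z, d) = (l', z', d') \<Longrightarrow> D l' z' d'"
  using dart_tile_iter[of n "(l, z, d)"] norm_iter[of n "(l, z, d)"] unfolding D_def by simp

lemma D_last: "D l z d \<Longrightarrow> D (prev_label l) (z + tile_turn l * d) (- (tile_turn l * d))"
  using last_dart D_iter by blast

text \<open>Crossing the side that arrives at \<open>z\<close> gives the next tile counterclockwise
  around \<open>z\<close>.\<close>

lemma rotate: "D l z d \<Longrightarrow> \<exists>l'. D l' z (cis (tile_angle l) * d)"
  using neighbour[OF D_last] unfolding tile_turn_cis by fastforce

text \<open>Points of such a side close to \<open>z\<close> are interior to the first tile, so both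
  tiles coincide. But then points just to the right of the side belong to the tile, although it lies
  on the left of its darts.\<close>

lemma sector_empty:
  assumes D: "D l z d" and D': "D l' z (cis t * d)" and t: "0 < t" "t < tile_angle l"
  shows False
proof -
  have d: "norm d = 1" and X: "tile l z d \<in> \<T>" using D unfolding D_def by auto
  let ?d = "cis t * d" let ?Y = "tile l' z ?d"
  have d': "norm ?d = 1" and Y: "?Y \<in> \<T>" using D' unfolding D_def by auto
  obtain e0 where e0: "0 < e0" "e0 \<le> 1" "\<And>e. 0 < e \<Longrightarrow> e < e0 \<Longrightarrow> z + e *\<^sub>R ?d \<in> interior (tile l z d)"
    using sector_tile[OF d t] by metis
  define p where "p = z + (e0 / 2) *\<^sub>R ?d"
  have pX: "p \<in> interior (tile l z d)" unfolding p_def using e0(1) by (intro e0(3)) auto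
  have "p \<in> closed_segment z (z + ?d)" unfolding p_def in_segment
    using e0 by (auto intro!: exI[of _ "e0 / 2"] simp: algebra_simps)
  then have pY: "p \<in> ?Y" using seg_tile by blast
  have eq: "tile l z d = ?Y" by (rule interior_meets[OF X Y pX pY])
  then obtain r where r: "0 < r" "ball p r \<subseteq> ?Y" using pX unfolding mem_interior by metis
  define q where "q = p - of_real (r / 2) * (\<i> * ?d)"
  have "dist p q < r" unfolding q_def using d r by (simp add: dist_norm norm_mult)
  then have "q \<in> ?Y" using r by auto
  then have "0 \<le> Im ((q - z) * cnj ?d)" by (rule tile_side[OF d'])
  moreover have "Im ((q - z) * cnj ?d) = - r / 2"
  proof -
    have "(q - z) * cnj ?d = (of_real (e0 / 2) - of_real (r / 2) * \<i>) * (?d * cnj ?d)"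
      unfolding q_def p_def scaleR_conv_of_real by (simp add: algebra_simps)
    then show ?thesis unfolding norm_1_cnj[OF d'] by (simp only: mult_1_right) simp
  qed
  ultimately show False using r by linarith
qed

text \<open>The angles \<open>pi / 3\<close>, \<open>\<alpha>\<close> and \<open>\<beta>\<close> are
  distinct. With two labels, the side that follows after the smaller angle would start inside the
  larger one.\<close>

lemma label_unique:
  assumes "D l z d" "D l' z d" shows "l = l'"
proof (rule ccontr)
  assume n: "l \<noteq> l'"
  have "tile_angle l \<noteq> tile_angle l'"
  proof -
    have "tile_angle (Some s) \<noteq> pi / 3" for s using shield_angle_bounds(3)[of s] by simp
    moreover have "tile_angle (Some True) \<noteq> tile_angle (Some False)" using \<alpha>2 by (simp add: ph_def)
    ultimately show ?thesis using n by (cases l; cases l') (auto simp del: tile_angle.simps(2), (metis (full_types))+)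
  qed
  then consider "tile_angle l < tile_angle l'" | "tile_angle l' < tile_angle l" by linarith
  then show False
  proof cases
    case 1
    then show False using rotate[OF assms(1)] sector_empty[OF assms(2) _ tile_angle(1)[of l]] by blast
  next
    case 2
    then show False using rotate[OF assms(2)] sector_empty[OF assms(1) _ tile_angle(1)[of l']] by blast
  qed
qed

text \<open>The reached tiles and the remaining ones have closed unions that cover the plane. A
  common point off the vertices would lie on a common side and so would make the second tile
  reached. Hence the two unions meet only in vertices; these form a countable set, and the plane
  without a countable set is connected.\<close>

lemma connected_tiles:
  assumes RD: "\<And>l z d. R l z d \<Longrightarrow> D l z d"
    and Rn: "\<And>l z d. R l z d \<Longrightarrow> case next_dart (l, z, d) of (l', z', d') \<Rightarrow> R l' z' d'"
    and Rr: "\<And>l z d. R l z d \<Longrightarrow> \<exists>l'. R l' (z + d) (- d)"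
    and ne: "R l0 z0 d0" and D: "D l z d"
  shows "R l z d"
proof -
  define \<S> where "\<S> = {tile l z d | l z d. R l z d}"
  have SR: "R l' z' d'" if "R l z d" "(next_dart ^^ n) (l, z, d) = (l', z', d')" for n l z d l' z' d'
    using that(2)
  proof (induction n arbitrary: l' z' d')
    case 0 then show ?case using that(1) by simp
  next
    case (Suc n)
    obtain l1 z1 d1 where e: "(next_dart ^^ n) (l, z, d) = (l1, z1, d1)" by (metis prod_cases3)
    show ?case using Rn[OF Suc.IH[OF e]] Suc.prems e by simp
  qed
  have ST: "\<S> \<subseteq> \<T>" using RD unfolding \<S>_def D_def by blast
  define V where "V = (\<Union>X\<in>\<T>. {x. x extreme_point_of X})"
  have cT: "countable \<T>"
  proof (rule countable_image_inj_on)
    show "countable (interior ` \<T>)"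
    proof (rule countable_disjoint_open_subsets)
      show "disjoint (interior ` \<T>)"
        unfolding disjoint_def using disjoint_interiors by fastforce
    qed auto
    show "inj_on interior \<T>"
    proof (rule inj_onI)
      fix X Y assume "X \<in> \<T>" "Y \<in> \<T>" "interior X = interior Y"
      then show "X = Y" using disjoint_interiors tile_inter by (metis Int_absorb)
    qed
  qed
  have fV: "finite {x. x extreme_point_of X}" if "X \<in> \<T>" for X
    using tile_rep[OF that] verts_finite unfolding D_def by (auto simp: tile_extreme)
  have cV: "countable V" unfolding V_def using cT fV by (intro countable_UN) (auto intro: countable_finite)
  have unc: "\<not> X \<subseteq> V" if XT: "X \<in> \<T>" for X
  proof
    assume "X \<subseteq> V"
    then have "countable (interior X)" using cV countable_subset interior_subset by metis
    moreover obtain x where "x \<in> interior X" using tile_inter[OF XT] by blast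
    then obtain r where "0 < r" "ball x r \<subseteq> interior X" using open_interior open_contains_ball by blast
    ultimately show False using uncountable_ball[of r x] countable_subset by blast
  qed
  have meet: "x \<in> V" if X: "X \<in> \<S>" and Y: "Y \<in> \<T> - \<S>" and x: "x \<in> X" "x \<in> Y" for X Y x
  proof (rule ccontr)
    assume xV: "x \<notin> V"
    have XT: "X \<in> \<T>" and YT: "Y \<in> \<T>" and XY: "X \<noteq> Y" using X Y ST by auto
    have ne: "X \<inter> Y \<noteq> {}" using x by blast
    have ns: "\<not> (p extreme_point_of X \<and> p extreme_point_of Y \<and> X \<inter> Y = {p})" for p
    proof
      assume a: "p extreme_point_of X \<and> p extreme_point_of Y \<and> X \<inter> Y = {p}"
      then have "x = p" using x by (metis IntI singletonD)
      then have "x \<in> V" using a XT unfolding V_def by blast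
      then show False using xV by simp
    qed
    have "X \<inter> Y edge_of X \<and> X \<inter> Y edge_of Y"
      using edge_to_edge[OF XT YT XY] ne ns unfolding edge_to_edge_def by meson
    then have "X \<inter> Y edge_of X" "X \<inter> Y edge_of Y" by simp_all
    obtain l1 z1 d1 where 1: "R l1 z1 d1" "X = tile l1 z1 d1" using X unfolding \<S>_def by blast
    have n1: "norm d1 = 1" using RD[OF 1(1)] unfolding D_def by simp
    obtain n l2 z2 d2 where 2: "(next_dart ^^ n) (l1, z1, d1) = (l2, z2, d2)" "X \<inter> Y = closed_segment z2 (z2 + d2)"
      using edge_dart[OF n1] \<open>X \<inter> Y edge_of X\<close> 1(2) by metis
    have R2: "R l2 z2 d2" by (rule SR[OF 1(1) 2(1)])
    obtain l3 where R3: "R l3 (z2 + d2) (- d2)" using Rr[OF R2] by blast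
    obtain l4 z4 d4 where 4: "D l4 z4 d4" "Y = tile l4 z4 d4" using tile_rep[OF YT] by blast
    have n4: "norm d4 = 1" using 4(1) unfolding D_def by simp
    obtain m l5 z5 d5 where 5: "(next_dart ^^ m) (l4, z4, d4) = (l5, z5, d5)" "X \<inter> Y = closed_segment z5 (z5 + d5)"
      using edge_dart[OF n4] \<open>X \<inter> Y edge_of Y\<close> 4(2) by metis
    have D5: "D l5 z5 d5" by (rule D_iter[OF 4(1) 5(1)])
    have t5: "tile l5 z5 d5 = Y" using dart_tile_iter[of m "(l4, z4, d4)"] 5(1) 4(2) by simp
    have "{z2, z2 + d2} = {z5, z5 + d5}" using 2(2) 5(2) closed_segment_eq by metis
    then have "z5 = z2 \<and> d5 = d2 \<or> z5 = z2 + d2 \<and> d5 = - d2"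
      by (auto simp: doubleton_eq_iff add_eq_0_iff)
    then have "Y \<in> \<S>"
    proof
      assume "z5 = z2 \<and> d5 = d2"
      then have "Y = tile l2 z2 d2" using same_tile[OF RD[OF R2]] D5 t5 by metis
      then show ?thesis using R2 unfolding \<S>_def by blast
    next
      assume "z5 = z2 + d2 \<and> d5 = - d2"
      then have "Y = tile l3 (z2 + d2) (- d2)" using same_tile[OF RD[OF R3]] D5 t5 by metis
      then show ?thesis using R3 unfolding \<S>_def by blast
    qed
    then show False using Y by blast
  qed
  have "connected (- V)"
    by (rule path_connected_imp_connected, rule path_connected_complement_countable) (simp_all add: cV)
  then have con: "connected (UNIV - V)" by (simp add: Compl_eq_Diff_UNIV)
  have cl: "closed (\<Union>\<S>)" "closed (\<Union>(\<T> - \<S>))" using closed_Union ST by auto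
  have cov: "UNIV - V \<subseteq> \<Union>\<S> \<union> \<Union>(\<T> - \<S>)" using cover by blast
  have dis: "\<Union>\<S> \<inter> \<Union>(\<T> - \<S>) \<inter> (UNIV - V) = {}" using meet by blast
  have "\<Union>\<S> \<inter> (UNIV - V) = {} \<or> \<Union>(\<T> - \<S>) \<inter> (UNIV - V) = {}"
    using con[unfolded connected_closed] cl cov dis by blast
  moreover have "tile l0 z0 d0 \<in> \<S>" using ne unfolding \<S>_def by blast
  then have "\<Union>\<S> \<inter> (UNIV - V) \<noteq> {}" using unc ST by blast
  ultimately have "\<Union>(\<T> - \<S>) \<inter> (UNIV - V) = {}" by blast
  then have "\<T> - \<S> = {}" using unc by blast
  then have "tile l z d \<in> \<S>" using D unfolding D_def by blast
  then obtain l1 z1 d1 where 1: "R l1 z1 d1" "tile l z d = tile l1 z1 d1" unfolding \<S>_def by blast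
  have d: "norm d = 1" and n1: "norm d1 = 1" using RD[OF 1(1)] D unfolding D_def by auto
  have "closed_segment z (z + d) edge_of tile l1 z1 d1" using dart_edge[OF d, of z l] 1(2) by simp
  then obtain n l2 z2 d2 where 2: "(next_dart ^^ n) (l1, z1, d1) = (l2, z2, d2)" "closed_segment z (z + d) = closed_segment z2 (z2 + d2)"
    using edge_dart[OF n1] by metis
  have R2: "R l2 z2 d2" by (rule SR[OF 1(1) 2(1)])
  have t2: "tile l2 z2 d2 = tile l z d" using dart_tile_iter[of n "(l1, z1, d1)"] 2(1) 1(2) by simp
  have "{z, z + d} = {z2, z2 + d2}" using 2(2) closed_segment_eq by metis
  then have "z2 = z \<and> d2 = d \<or> z2 = z + d \<and> d2 = - d"
    by (auto simp: doubleton_eq_iff add_eq_0_iff)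
  then show ?thesis
  proof
    assume "z2 = z \<and> d2 = d"
    then show ?thesis using R2 label_unique[OF D] RD[OF R2] by metis
  next
    \<comment> \<open>A tile with a side traversed in both directions would lie on both sides of the
      line, hence within it.\<close>
    assume e: "z2 = z + d \<and> d2 = - d"
    have "D l2 (z + d) (- d)" using RD[OF R2] e by simp
    have "tile l z d \<subseteq> {p. Im ((p - z) * cnj d) = 0}"
    proof
      fix p assume p: "p \<in> tile l z d"
      define w where "w = (p - z) * cnj d"
      have a: "0 \<le> Im ((p - (z + d)) * cnj (- d))"
        using p tile_side[of "- d" p l2 "z + d"] t2 e d by (simp only: norm_minus_cancel)
      have b: "(p - (z + d)) * cnj (- d) = 1 - w"
        unfolding w_def norm_1_cnj[OF d, symmetric] by (simp add: algebra_simps)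
      have "Im w \<le> 0" using a unfolding b by simp
      then have "Im ((p - z) * cnj d) \<le> 0" unfolding w_def .
      then show "p \<in> {p. Im ((p - z) * cnj d) = 0}" using tile_side[OF d p] by (simp only: mem_Collect_eq order.antisym)
    qed
    moreover have "z + tile_turn l * d \<in> tile l z d" using z_verts tile_props(5) by blast
    ultimately have "Im ((z + tile_turn l * d - z) * cnj d) = 0" by blast
    moreover have "(z + tile_turn l * d - z) * cnj d = tile_turn l * (d * cnj d)" by (simp only: add_diff_cancel_left' mult.assoc)
    ultimately have "Im (tile_turn l * (d * cnj d)) = 0" by (simp only:)
    then show ?thesis unfolding norm_1_cnj[OF d] tile_turn_cis using sin_gt_zero[OF tile_angle(1,2), of l] by simp
  qed
qed

end

section \<open>Angle sums at a vertex\<close>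

context shield_plane begin

abbreviation "DA \<equiv> D (Some True)"
abbreviation "DB \<equiv> D (Some False)"
abbreviation "DN \<equiv> D None"

lemma tile_angle_values: "tile_angle (Some True) = \<alpha>" "tile_angle (Some False) = 4 * pi / 3 - \<alpha>" "tile_angle None = pi / 3"
  by (simp_all add: ph_def)

lemma turn_step:
  assumes "D l z (cis \<theta> * d)"
  shows "\<exists>l'. D l' z (cis (\<theta> + tile_angle l) * d)"
  using rotate[OF assms] by (simp add: cis_mult mult.assoc[symmetric] add.commute)

text \<open>Past a full turn, the first side would start inside the last angle.\<close>

lemma turn_le:
  assumes "D l0 z d" "D l z (cis \<theta> * d)" "0 < \<theta>" "\<theta> < 2 * pi"
  shows "\<theta> + tile_angle l \<le> 2 * pi"
proof (rule ccontr)
  assume a: "\<not> \<theta> + tile_angle l \<le> 2 * pi"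
  have e: "cis (2 * pi - \<theta>) * (cis \<theta> * d) = d" by (simp add: cis_mult mult.assoc[symmetric])
  have "D l0 z (cis (2 * pi - \<theta>) * (cis \<theta> * d))" unfolding e by (rule assms(1))
  from sector_empty[OF assms(2) this] show False using a assms(3,4) by simp
qed

lemma label_cases: "l = None \<or> l = Some True \<or> l = Some False"
  by (cases l) auto

lemma turn_cases:
  assumes D0: "D l0 z d" and D1: "D l1 z (cis \<theta> * d)" and t: "0 \<le> \<theta>" "\<theta> + tile_angle l1 \<le> 2 * pi"
  shows "\<theta> + tile_angle l1 = 2 * pi \<or>
    DN z (cis (\<theta> + tile_angle l1) * d) \<and> \<theta> + tile_angle l1 + pi / 3 \<le> 2 * pi \<or>
    DA z (cis (\<theta> + tile_angle l1) * d) \<and> \<theta> + tile_angle l1 + \<alpha> \<le> 2 * pi \<or>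
    DB z (cis (\<theta> + tile_angle l1) * d) \<and> \<theta> + tile_angle l1 + (4 * pi / 3 - \<alpha>) \<le> 2 * pi"
proof (cases "\<theta> + tile_angle l1 = 2 * pi")
  case False
  then have t': "0 < \<theta> + tile_angle l1" "\<theta> + tile_angle l1 < 2 * pi" using t tile_angle(1)[of l1] by linarith+
  obtain l where l: "D l z (cis (\<theta> + tile_angle l1) * d)" using turn_step[OF D1] by blast
  have le: "\<theta> + tile_angle l1 + tile_angle l \<le> 2 * pi" by (rule turn_le[OF D0 l t'])
  consider "l = None" | "l = Some True" | "l = Some False" using label_cases by blast
  then show ?thesis
  proof cases
    case 1 then show ?thesis using l le tile_angle_values(3) by simp
  next
    case 2 then show ?thesis using l le tile_angle_values(1) by simp
  next
    case 3 then show ?thesis using l le[unfolded 3 tile_angle_values(2)] by blast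
  qed
qed simp

text \<open>One step counterclockwise, shaped for nested case distinctions: each case carries the
  bound on the accumulated angle, so that impossible branches are refuted by linear arithmetic
  alone.\<close>

lemma step_N:
  assumes D0: "D l0 z d" and D1: "DN z (cis \<theta> * d)" and t: "0 \<le> \<theta>" "\<theta> + pi / 3 \<le> 2 * pi"
  obtains (closed) "\<theta> + pi / 3 = 2 * pi"
    | (N) "DN z (cis (\<theta> + pi / 3) * d)" "\<theta> + pi / 3 + pi / 3 \<le> 2 * pi"
    | (A) "DA z (cis (\<theta> + pi / 3) * d)" "\<theta> + pi / 3 + \<alpha> \<le> 2 * pi"
    | (B) "DB z (cis (\<theta> + pi / 3) * d)" "\<theta> + pi / 3 + (4 * pi / 3 - \<alpha>) \<le> 2 * pi"
  using turn_cases[OF D0 D1] t unfolding tile_angle_values by metis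

lemma step_A:
  assumes D0: "D l0 z d" and D1: "DA z (cis \<theta> * d)" and t: "0 \<le> \<theta>" "\<theta> + \<alpha> \<le> 2 * pi"
  obtains (closed) "\<theta> + \<alpha> = 2 * pi"
    | (N) "DN z (cis (\<theta> + \<alpha>) * d)" "\<theta> + \<alpha> + pi / 3 \<le> 2 * pi"
    | (A) "DA z (cis (\<theta> + \<alpha>) * d)" "\<theta> + \<alpha> + \<alpha> \<le> 2 * pi"
    | (B) "DB z (cis (\<theta> + \<alpha>) * d)" "\<theta> + \<alpha> + (4 * pi / 3 - \<alpha>) \<le> 2 * pi"
  using turn_cases[OF D0 D1] t unfolding tile_angle_values by metis

lemma step_B:
  assumes D0: "D l0 z d" and D1: "DB z (cis \<theta> * d)" and t: "0 \<le> \<theta>" "\<theta> + (4 * pi / 3 - \<alpha>) \<le> 2 * pi"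
  obtains (closed) "\<theta> + (4 * pi / 3 - \<alpha>) = 2 * pi"
    | (N) "DN z (cis (\<theta> + (4 * pi / 3 - \<alpha>)) * d)" "\<theta> + (4 * pi / 3 - \<alpha>) + pi / 3 \<le> 2 * pi"
    | (A) "DA z (cis (\<theta> + (4 * pi / 3 - \<alpha>)) * d)" "\<theta> + (4 * pi / 3 - \<alpha>) + \<alpha> \<le> 2 * pi"
    | (B) "DB z (cis (\<theta> + (4 * pi / 3 - \<alpha>)) * d)" "\<theta> + (4 * pi / 3 - \<alpha>) + (4 * pi / 3 - \<alpha>) \<le> 2 * pi"
  using turn_cases[OF D0 D1] t unfolding tile_angle_values by metis

lemmas bounds = \<alpha>1 \<alpha>2 \<alpha>3 pi_gt_zero

text \<open>The angle left over is \<open>2 * \<alpha> - 2 * pi / 3\<close>. It is too small for an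
  angle of a shield and for two triangles; being zero or \<open>pi / 3\<close> would mean
  \<open>\<alpha> = pi / 3\<close> or \<open>\<alpha> = pi / 2\<close>.\<close>

lemma no_BB:
  assumes B: "DB z d" and B': "DB z (cis (4 * pi / 3 - \<alpha>) * d)"
  shows False
proof -
  have le: "(4 * pi / 3 - \<alpha>) + (4 * pi / 3 - \<alpha>) \<le> 2 * pi"
    using turn_le[OF B B'] bounds unfolding tile_angle_values by linarith
  have n: "0 \<le> 4 * pi / 3 - \<alpha>" using bounds by linarith
  from B B' n le show False
  proof (cases rule: step_B)
    case N
    have n2: "0 \<le> (4 * pi / 3 - \<alpha>) + (4 * pi / 3 - \<alpha>)" using bounds by linarith
    from B N(1) n2 N(2) show ?thesis
      by (cases rule: step_N) (use N(2) bounds in linarith)+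
  qed (use bounds in linarith)+
qed

text \<open>At the other end of the shared side the same two shields would have adjacent
  \<open>\<beta>\<close>-angles.\<close>

lemma no_AA:
  assumes A: "DA z d" and A': "DA z (cis \<alpha> * d)"
  shows False
proof -
  let ?f = "cis \<alpha> * d"
  have m: "tile_turn (Some True) = cis \<alpha>" unfolding tile_turn_cis tile_angle_values ..
  have 1: "DB (z + ?f) (- ?f)" using D_last[OF A] unfolding m prev_label_def by simp
  have 2: "DB (z + ?f) (c True * ?f)" using D_iter[OF A', of 1] by simp
  have "cis (4 * pi / 3 - \<alpha>) * (c True * ?f) = - ?f"
  proof -
    have "cis (4 * pi / 3 - \<alpha>) * c True = - 1"
      unfolding c_def ph_def cis_mult by (simp add: complex_eq_iff)
    then show ?thesis by (simp add: mult.assoc[symmetric])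
  qed
  then show False using no_BB[OF 2] 1 by simp
qed

lemma no_AA_at:
  assumes "DA z (cis \<theta> * d)" "DA z (cis (\<theta> + \<alpha>) * d)"
  shows False
  by (rule no_AA[OF assms(1)]) (use assms(2) in \<open>simp add: cis_mult mult.assoc[symmetric] add.commute\<close>)

lemma no_BB_at:
  assumes "DB z (cis \<theta> * d)" "DB z (cis (\<theta> + (4 * pi / 3 - \<alpha>)) * d)"
  shows False
  by (rule no_BB[OF assms(1)]) (use assms(2) in \<open>simp add: cis_mult mult.assoc[symmetric] add.commute\<close>)

lemma cis_2pi: "\<theta> = 2 * pi \<Longrightarrow> cis \<theta> * d = d"
  by simp

text \<open>The tiles around a vertex are listed in counterclockwise order; the angles must sum up to \<open>2 * pi\<close>,
  and this leaves only the sequences in the statements.\<close>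

lemma vertex_A:
  assumes D0: "DA z d"
  shows "DB z (cis (0 + \<alpha>) * d) \<and> DN z (cis (0 + \<alpha> + (4 * pi / 3 - \<alpha>)) * d) \<and> DN z (cis (0 + \<alpha> + (4 * pi / 3 - \<alpha>) + pi / 3) * d) \<or>
    DN z (cis (0 + \<alpha>) * d) \<and> DN z (cis (0 + \<alpha> + pi / 3) * d) \<and> DB z (cis (0 + \<alpha> + pi / 3 + pi / 3) * d) \<or>
    DN z (cis (0 + \<alpha>) * d) \<and> DB z (cis (0 + \<alpha> + pi / 3) * d) \<and> DN z (cis (0 + \<alpha> + pi / 3 + (4 * pi / 3 - \<alpha>)) * d)"
proof -
  have c0: "DA z (cis 0 * d)" using D0 by simp
  have l0: "0 + \<alpha> \<le> 2 * pi" using bounds by linarith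
  have n1: "0 \<le> (0::real)" using bounds by linarith
  from D0 c0 n1 l0 show ?thesis
  proof (cases rule: step_A)
    case N
    note c2 = N
    have n3: "0 \<le> 0 + \<alpha>" using bounds by linarith
    from D0 c2(1) n3 c2(2) show ?thesis
    proof (cases rule: step_N)
      case N
      note c4 = N
      have n5: "0 \<le> 0 + \<alpha> + pi / 3" using bounds by linarith
      from D0 c4(1) n5 c4(2) show ?thesis
      proof (cases rule: step_N)
        case N
        note c6 = N
        have n7: "0 \<le> 0 + \<alpha> + pi / 3 + pi / 3" using bounds by linarith
        from D0 c6(1) n7 c6(2) show ?thesis
        proof (cases rule: step_N)
          case N
          note c8 = N
          have n9: "0 \<le> 0 + \<alpha> + pi / 3 + pi / 3 + pi / 3" using bounds by linarith
          from D0 c8(1) n9 c8(2) show ?thesis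
          proof (cases rule: step_N)
          qed (use bounds in linarith)+
        next
          case A
          note c10 = A
          have n11: "0 \<le> 0 + \<alpha> + pi / 3 + pi / 3 + pi / 3" using bounds by linarith
          from D0 c10(1) n11 c10(2) show ?thesis
          proof (cases rule: step_A)
          qed (use bounds in linarith)+
        qed (use bounds in linarith)+
      next
        case A
        note c12 = A
        have n13: "0 \<le> 0 + \<alpha> + pi / 3 + pi / 3" using bounds by linarith
        from D0 c12(1) n13 c12(2) show ?thesis
        proof (cases rule: step_A)
          case N
          note c14 = N
          have n15: "0 \<le> 0 + \<alpha> + pi / 3 + pi / 3 + \<alpha>" using bounds by linarith
          from D0 c14(1) n15 c14(2) show ?thesis
          proof (cases rule: step_N)
          qed (use bounds in linarith)+
        next
          case A
          note c16 = A
          show ?thesis using no_AA_at[OF c12(1) c16(1)] by blast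
        qed (use bounds in linarith)+
      next
        case B
        note c17 = B
        show ?thesis using c2(1) c4(1) c17(1) by (simp add: algebra_simps)
      qed (use bounds in linarith)+
    next
      case A
      note c18 = A
      have n19: "0 \<le> 0 + \<alpha> + pi / 3" using bounds by linarith
      from D0 c18(1) n19 c18(2) show ?thesis
      proof (cases rule: step_A)
        case N
        note c20 = N
        have n21: "0 \<le> 0 + \<alpha> + pi / 3 + \<alpha>" using bounds by linarith
        from D0 c20(1) n21 c20(2) show ?thesis
        proof (cases rule: step_N)
          case N
          note c22 = N
          have n23: "0 \<le> 0 + \<alpha> + pi / 3 + \<alpha> + pi / 3" using bounds by linarith
          from D0 c22(1) n23 c22(2) show ?thesis
          proof (cases rule: step_N)
          qed (use bounds in linarith)+
        next
          case A
          note c24 = A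
          have n25: "0 \<le> 0 + \<alpha> + pi / 3 + \<alpha> + pi / 3" using bounds by linarith
          from D0 c24(1) n25 c24(2) show ?thesis
          proof (cases rule: step_A)
            \<comment> \<open>The one closed sequence that arithmetic does not exclude: three
              \<open>\<alpha>\<close>-angles and two triangles, with
              \<open>\<alpha> = 4 * pi / 9\<close>. Here the last \<open>\<alpha>\<close>-angle
              shares a side with the first one.\<close>
            case closed
            then have "DA z (cis (0 + \<alpha> + pi / 3 + \<alpha> + pi / 3 + \<alpha>) * d)" using D0 cis_2pi by metis
            then show ?thesis using no_AA_at[OF c24(1)] by metis
          qed (use bounds in linarith)+
        qed (use bounds in linarith)+
      next
        case A
        note c26 = A
        show ?thesis using no_AA_at[OF c18(1) c26(1)] by blast
      qed (use bounds in linarith)+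
    next
      case B
      note c27 = B
      have n28: "0 \<le> 0 + \<alpha> + pi / 3" using bounds by linarith
      from D0 c27(1) n28 c27(2) show ?thesis
      proof (cases rule: step_B)
        case N
        note c29 = N
        show ?thesis using c2(1) c27(1) c29(1) by (simp add: algebra_simps)
      qed (use bounds in linarith)+
    qed (use bounds in linarith)+
  next
    case A
    note c30 = A
    show ?thesis using no_AA_at[OF c0 c30(1)] by blast
  next
    case B
    note c31 = B
    have n32: "0 \<le> 0 + \<alpha>" using bounds by linarith
    from D0 c31(1) n32 c31(2) show ?thesis
    proof (cases rule: step_B)
      case N
      note c33 = N
      have n34: "0 \<le> 0 + \<alpha> + (4 * pi / 3 - \<alpha>)" using bounds by linarith
      from D0 c33(1) n34 c33(2) show ?thesis
      proof (cases rule: step_N)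
        case N
        note c35 = N
        show ?thesis using c31(1) c33(1) c35(1) by (simp add: algebra_simps)
      qed (use bounds in linarith)+
    next
      case A
      note c36 = A
      have n37: "0 \<le> 0 + \<alpha> + (4 * pi / 3 - \<alpha>)" using bounds by linarith
      from D0 c36(1) n37 c36(2) show ?thesis
      proof (cases rule: step_A)
      qed (use bounds in linarith)+
    qed (use bounds in linarith)+
  qed (use bounds in linarith)+
qed

lemma vertex_B:
  assumes D0: "DB z d"
  shows "DA z (cis (0 + (4 * pi / 3 - \<alpha>)) * d) \<and> DN z (cis (0 + (4 * pi / 3 - \<alpha>) + \<alpha>) * d) \<and> DN z (cis (0 + (4 * pi / 3 - \<alpha>) + \<alpha> + pi / 3) * d) \<or>
    DN z (cis (0 + (4 * pi / 3 - \<alpha>)) * d) \<and> DN z (cis (0 + (4 * pi / 3 - \<alpha>) + pi / 3) * d) \<and> DA z (cis (0 + (4 * pi / 3 - \<alpha>) + pi / 3 + pi / 3) * d) \<or>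
    DN z (cis (0 + (4 * pi / 3 - \<alpha>)) * d) \<and> DA z (cis (0 + (4 * pi / 3 - \<alpha>) + pi / 3) * d) \<and> DN z (cis (0 + (4 * pi / 3 - \<alpha>) + pi / 3 + \<alpha>) * d)"
proof -
  have c0: "DB z (cis 0 * d)" using D0 by simp
  have l0: "0 + (4 * pi / 3 - \<alpha>) \<le> 2 * pi" using bounds by linarith
  have n1: "0 \<le> (0::real)" using bounds by linarith
  from D0 c0 n1 l0 show ?thesis
  proof (cases rule: step_B)
    case N
    note c2 = N
    have n3: "0 \<le> 0 + (4 * pi / 3 - \<alpha>)" using bounds by linarith
    from D0 c2(1) n3 c2(2) show ?thesis
    proof (cases rule: step_N)
      case N
      note c4 = N
      have n5: "0 \<le> 0 + (4 * pi / 3 - \<alpha>) + pi / 3" using bounds by linarith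
      from D0 c4(1) n5 c4(2) show ?thesis
      proof (cases rule: step_N)
        case N
        note c6 = N
        have n7: "0 \<le> 0 + (4 * pi / 3 - \<alpha>) + pi / 3 + pi / 3" using bounds by linarith
        from D0 c6(1) n7 c6(2) show ?thesis
        proof (cases rule: step_N)
        qed (use bounds in linarith)+
      next
        case A
        note c8 = A
        show ?thesis using c2(1) c4(1) c8(1) by (simp add: algebra_simps)
      qed (use bounds in linarith)+
    next
      case A
      note c9 = A
      have n10: "0 \<le> 0 + (4 * pi / 3 - \<alpha>) + pi / 3" using bounds by linarith
      from D0 c9(1) n10 c9(2) show ?thesis
      proof (cases rule: step_A)
        case N
        note c11 = N
        show ?thesis using c2(1) c9(1) c11(1) by (simp add: algebra_simps)
      qed (use bounds in linarith)+
    next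
      case B
      note c12 = B
      have n13: "0 \<le> 0 + (4 * pi / 3 - \<alpha>) + pi / 3" using bounds by linarith
      from D0 c12(1) n13 c12(2) show ?thesis
      proof (cases rule: step_B)
      qed (use bounds in linarith)+
    qed (use bounds in linarith)+
  next
    case A
    note c14 = A
    have n15: "0 \<le> 0 + (4 * pi / 3 - \<alpha>)" using bounds by linarith
    from D0 c14(1) n15 c14(2) show ?thesis
    proof (cases rule: step_A)
      case N
      note c16 = N
      have n17: "0 \<le> 0 + (4 * pi / 3 - \<alpha>) + \<alpha>" using bounds by linarith
      from D0 c16(1) n17 c16(2) show ?thesis
      proof (cases rule: step_N)
        case N
        note c18 = N
        show ?thesis using c14(1) c16(1) c18(1) by (simp add: algebra_simps)
      qed (use bounds in linarith)+
    next
      case A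
      note c19 = A
      show ?thesis using no_AA_at[OF c14(1) c19(1)] by blast
    qed (use bounds in linarith)+
  next
    case B
    note c20 = B
    show ?thesis using no_BB_at[OF c0 c20(1)] by blast
  qed (use bounds in linarith)+
qed

lemma vertex_N:
  assumes D0: "DN z d" and D1: "DN z (cis (0 + pi / 3) * d)" and D2: "DN z (cis (0 + pi / 3 + pi / 3) * d)"
  shows "DN z (cis (0 + pi / 3) * d) \<and> DN z (cis (0 + pi / 3 + pi / 3) * d) \<and> DN z (cis (0 + pi / 3 + pi / 3 + pi / 3) * d) \<and> DN z (cis (0 + pi / 3 + pi / 3 + pi / 3 + pi / 3) * d) \<and> DN z (cis (0 + pi / 3 + pi / 3 + pi / 3 + pi / 3 + pi / 3) * d)"
proof -
  have l0: "0 + pi / 3 + pi / 3 + pi / 3 \<le> 2 * pi" using bounds by linarith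
  have n1: "0 \<le> 0 + pi / 3 + pi / 3" using bounds by linarith
  from D0 D2 n1 l0 show ?thesis
  proof (cases rule: step_N)
    case N
    note c2 = N
    have n3: "0 \<le> 0 + pi / 3 + pi / 3 + pi / 3" using bounds by linarith
    from D0 c2(1) n3 c2(2) show ?thesis
    proof (cases rule: step_N)
      case N
      note c4 = N
      have n5: "0 \<le> 0 + pi / 3 + pi / 3 + pi / 3 + pi / 3" using bounds by linarith
      from D0 c4(1) n5 c4(2) show ?thesis
      proof (cases rule: step_N)
        case N
        note c6 = N
        show ?thesis using D1 D2 c2(1) c4(1) c6(1) by (simp add: algebra_simps)
      qed (use bounds in linarith)+
    next
      case A
      note c7 = A
      have n8: "0 \<le> 0 + pi / 3 + pi / 3 + pi / 3 + pi / 3" using bounds by linarith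
      from D0 c7(1) n8 c7(2) show ?thesis
      proof (cases rule: step_A)
      qed (use bounds in linarith)+
    qed (use bounds in linarith)+
  next
    case A
    note c9 = A
    have n10: "0 \<le> 0 + pi / 3 + pi / 3 + pi / 3" using bounds by linarith
    from D0 c9(1) n10 c9(2) show ?thesis
    proof (cases rule: step_A)
      case N
      note c11 = N
      have n12: "0 \<le> 0 + pi / 3 + pi / 3 + pi / 3 + \<alpha>" using bounds by linarith
      from D0 c11(1) n12 c11(2) show ?thesis
      proof (cases rule: step_N)
      qed (use bounds in linarith)+
    next
      case A
      note c13 = A
      show ?thesis using no_AA_at[OF c9(1) c13(1)] by blast
    qed (use bounds in linarith)+
  next
    case B
    note c14 = B
    have n15: "0 \<le> 0 + pi / 3 + pi / 3 + pi / 3" using bounds by linarith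
    from D0 c14(1) n15 c14(2) show ?thesis
    proof (cases rule: step_B)
    qed (use bounds in linarith)+
  qed (use bounds in linarith)+
qed

lemma cis_turns: "cis (x + pi / 3) = \<omega> * cis x" "cis (x + \<alpha>) = \<omega> * c True * cis x"
  "cis (x + (4 * pi / 3 - \<alpha>)) = \<omega> * c False * cis x"
proof -
  have "cis \<alpha> = \<omega> * c True" "cis (4 * pi / 3 - \<alpha>) = \<omega> * c False"
    using tile_turn_cis[of "Some True"] tile_turn_cis[of "Some False"] by (simp_all add: ph_def)
  then show "cis (x + pi / 3) = \<omega> * cis x" "cis (x + \<alpha>) = \<omega> * c True * cis x"
    "cis (x + (4 * pi / 3 - \<alpha>)) = \<omega> * c False * cis x"
    unfolding \<omega>_def by (simp_all only: cis_mult[symmetric] mult.commute)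
qed

lemma vertex_shield:
  assumes "D (Some s) z d"
  shows "(D (Some (\<not> s)) z (\<omega> * (c s * d)) \<and> DN z (- (\<omega> * d)) \<and> DN z ((1 - \<omega>) * d)) \<or>
      (DN z (\<omega> * (c s * d)) \<and> DN z ((\<omega> - 1) * (c s * d)) \<and> D (Some (\<not> s)) z (- (c s * d))) \<or>
      (DN z (\<omega> * (c s * d)) \<and> D (Some (\<not> s)) z ((\<omega> - 1) * (c s * d)) \<and> DN z ((1 - \<omega>) * d))"
proof (cases s)
  case True
  have e: "cis (0 + \<alpha>) * d = \<omega> * (c True * d)"
    "cis (0 + \<alpha> + (4 * pi / 3 - \<alpha>)) * d = - (\<omega> * d)"
    "cis (0 + \<alpha> + (4 * pi / 3 - \<alpha>) + pi / 3) * d = (1 - \<omega>) * d"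
    "cis (0 + \<alpha> + pi / 3) * d = (\<omega> - 1) * (c True * d)"
    "cis (0 + \<alpha> + pi / 3 + pi / 3) * d = - (c True * d)"
    "cis (0 + \<alpha> + pi / 3 + (4 * pi / 3 - \<alpha>)) * d = (1 - \<omega>) * d"
    unfolding cis_turns cis_zero by (simp_all add: algebra_simps omega_sq omega_sq' c_TF)
  have "s = True" using True by simp
  then show ?thesis using vertex_A[of z d, unfolded e] assms by (simp only: not_True_eq_False simp_thms)
next
  case False
  have e: "cis (0 + (4 * pi / 3 - \<alpha>)) * d = \<omega> * (c False * d)"
    "cis (0 + (4 * pi / 3 - \<alpha>) + \<alpha>) * d = - (\<omega> * d)"
    "cis (0 + (4 * pi / 3 - \<alpha>) + \<alpha> + pi / 3) * d = (1 - \<omega>) * d"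
    "cis (0 + (4 * pi / 3 - \<alpha>) + pi / 3) * d = (\<omega> - 1) * (c False * d)"
    "cis (0 + (4 * pi / 3 - \<alpha>) + pi / 3 + pi / 3) * d = - (c False * d)"
    "cis (0 + (4 * pi / 3 - \<alpha>) + pi / 3 + \<alpha>) * d = (1 - \<omega>) * d"
    unfolding cis_turns cis_zero by (simp_all add: algebra_simps omega_sq omega_sq' c_TF)
  have "s = False" using False by simp
  then show ?thesis using vertex_B[of z d, unfolded e] assms by (simp only: not_False_eq_True simp_thms)
qed

sublocale shield_darts c "\<lambda>s. D (Some s)" "D None"
proof
  show "c s * c (\<not> s) = \<omega> - 1" for s by (rule cc)
  show "D (Some (\<not> s)) (z + d) (c s * d)" if "D (Some s) z d" for s z d
    using D_iter[OF that, of 1] by simp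
  show "DN (z + d) ((\<omega> - 1) * d)" if "DN z d" for z d
    using D_iter[OF that, of 1] by simp
  show False if "D (Some s) z d" "DN z d" for s z d using label_unique[OF that] by simp
  show False if "D (Some s) z d" "D (Some (\<not> s)) z d" for s z d using label_unique[OF that] by simp
  show "(D (Some (\<not> s)) z (\<omega> * (c s * d)) \<and> DN z (- (\<omega> * d)) \<and> DN z ((1 - \<omega>) * d)) \<or>
      (DN z (\<omega> * (c s * d)) \<and> DN z ((\<omega> - 1) * (c s * d)) \<and> D (Some (\<not> s)) z (- (c s * d))) \<or>
      (DN z (\<omega> * (c s * d)) \<and> D (Some (\<not> s)) z ((\<omega> - 1) * (c s * d)) \<and> DN z ((1 - \<omega>) * d))"
    if "D (Some s) z d" for s z d by (rule vertex_shield[OF that])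
  show "DN z (- d) \<and> DN z (- (\<omega> * d)) \<and> DN z ((1 - \<omega>) * d)"
    if "DN z d" "DN z (\<omega> * d)" "DN z ((\<omega> - 1) * d)" for z d
  proof -
    have e: "cis (0 + pi / 3) * d = \<omega> * d" "cis (0 + pi / 3 + pi / 3) * d = (\<omega> - 1) * d"
      "cis (0 + pi / 3 + pi / 3 + pi / 3) * d = - d"
      "cis (0 + pi / 3 + pi / 3 + pi / 3 + pi / 3) * d = - (\<omega> * d)"
      "cis (0 + pi / 3 + pi / 3 + pi / 3 + pi / 3 + pi / 3) * d = (1 - \<omega>) * d"
      unfolding cis_turns cis_zero by (simp_all add: algebra_simps omega_sq omega_sq')
    show ?thesis using vertex_N[of z d, unfolded e] that by blast
  qed
  fix QH :: "bool \<Rightarrow> complex \<Rightarrow> complex \<Rightarrow> bool" and QT :: "complex \<Rightarrow> complex \<Rightarrow> bool"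
  assume 1: "\<And>s z d. QH s z d \<Longrightarrow> D (Some s) z d" "\<And>z d. QT z d \<Longrightarrow> DN z d"
    and 2: "\<And>s z d. QH s z d \<Longrightarrow> QH (\<not> s) (z + d) (c s * d)"
      "\<And>z d. QT z d \<Longrightarrow> QT (z + d) ((\<omega> - 1) * d)"
    and 3: "\<And>s z d. QH s z d \<Longrightarrow> QT (z + d) (- d) \<or> (\<exists>s'. QH s' (z + d) (- d))"
      "\<And>z d. QT z d \<Longrightarrow> QT (z + d) (- d) \<or> (\<exists>s'. QH s' (z + d) (- d))"
    and 4: "(\<exists>s z d. QH s z d) \<or> (\<exists>z d. QT z d)"
  \<comment> \<open>The predicates on shields and triangles are merged into one on labelled darts,
    the form of \<open>connected_tiles\<close>.\<close>
  define R where "R l = (case l of None \<Rightarrow> QT | Some s \<Rightarrow> QH s)" for l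
  have RI: "R None z d \<longleftrightarrow> QT z d" "R (Some s) z d \<longleftrightarrow> QH s z d" for s z d unfolding R_def by simp_all
  obtain l0 z0 d0 where ne: "R l0 z0 d0" using 4 RI by metis
  have R1: "D l z d" if "R l z d" for l z d using that 1 by (cases l) (auto simp: RI)
  have R2: "case next_dart (l, z, d) of (l', z', d') \<Rightarrow> R l' z' d'" if "R l z d" for l z d
    using that 2 by (cases l) (auto simp: RI)
  have R3: "\<exists>l'. R l' (z + d) (- d)" if "R l z d" for l z d
  proof -
    have "QT (z + d) (- d) \<or> (\<exists>s'. QH s' (z + d) (- d))" using that 3 by (cases l) (auto simp: RI)
    then show ?thesis using RI by metis
  qed
  have "R l z d" if "D l z d" for l z d by (rule connected_tiles[of R, OF R1 R2 R3 ne that])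
  then show "(\<forall>s z d. D (Some s) z d \<longrightarrow> QH s z d) \<and> (\<forall>z d. DN z d \<longrightarrow> QT z d)"
    using RI by blast
qed

end

section \<open>Shield lines\<close>

context shield_angle begin

text \<open>The numbering of the vertices used by \<open>shield_vertices\<close>, starting in an
  \<open>\<alpha>\<close>-vertex.\<close>

definition hexv where
  "hexv z d i = z + d * ([0, 1, 1 + c True, \<omega> + c True, \<omega> + \<omega> * c True, \<omega> * c True] ! i)"

lemma hexv_simps: "hexv z d 0 = z" "hexv z d 1 = z + d" "hexv z d 2 = z + d + c True * d"
  "hexv z d 3 = z + \<omega> * d + c True * d" "hexv z d 4 = z + \<omega> * d + \<omega> * (c True * d)"
  "hexv z d 5 = z + \<omega> * (c True * d)"
  unfolding hexv_def by (simp_all add: eval_nat_numeral algebra_simps)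

lemma hexv_image: "hexv z d ` {..<6} = verts (Some True) z d"
proof -
  have e: "{..<6} = {0, 1, 2, 3, 4, 5::nat}" by auto
  show ?thesis unfolding e image_insert image_empty hexv_simps verts_simps ..
qed

lemma omega_facts: "\<omega> \<noteq> 0" "\<omega> \<noteq> 1" "\<omega> - 1 \<noteq> 0" "\<omega> \<noteq> - 1" "\<omega> - 1 \<noteq> 1" "\<omega> - 1 \<noteq> - 1" "norm \<omega> = 1" "norm (\<omega> - 1) = 1"
proof -
  show "\<omega> \<noteq> 0" "\<omega> \<noteq> 1" "\<omega> - 1 \<noteq> 0" "\<omega> \<noteq> - 1" "\<omega> - 1 \<noteq> 1" "\<omega> - 1 \<noteq> - 1"
    by (simp_all add: omega_Complex complex_eq_iff)
  show 1: "norm \<omega> = 1" by (simp add: \<omega>_def)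
  show "norm (\<omega> - 1) = 1" unfolding omega_sq[symmetric] by (simp add: norm_mult 1)
qed

lemma hexv_corner:
  fixes i :: nat
  assumes d: "norm d = 1" and i: "i < 6"
  obtains f n where "(next_dart ^^ n) (Some True, z, d) = (Some (even i), hexv z d i, f)"
    "hexv z d (Suc i mod 6) = hexv z d i + f" "hexv z d ((i + 5) mod 6) = hexv z d i + tile_turn (Some (even i)) * f"
    "norm f = 1"
proof -
  have n1: "norm (\<omega> * x) = norm x" "norm ((\<omega> - 1) * x) = norm x" "norm (c s * x) = norm x" for x s
    using omega_facts c_norm by (simp_all add: norm_mult)
  consider "i = 0" | "i = 1" | "i = 2" | "i = 3" | "i = 4" | "i = 5" using i by (auto simp: less_6)
  then show thesis
  proof cases
    case 1
    show ?thesis by (rule that[of 0 d]) (use 1 d in \<open>simp_all add: hexv_simps hexv_simps(2)[simplified]\<close>)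
  next
    case 2
    have e: "Suc 1 mod 6 = (2::nat)" "(1 + 5) mod 6 = (0::nat)" by simp_all
    have o: "even (1::nat) = False" by simp
    show ?thesis unfolding 2
      by (rule that[of 1 "c True * d", unfolded 2 e o hexv_simps]) (simp_all add: n1 d, simp_all add: nf c_TF)
  next
    case 3
    have e: "Suc 2 mod 6 = (3::nat)" "(2 + 5) mod 6 = (1::nat)" by simp_all
    have o: "even (2::nat) = True" by simp
    show ?thesis unfolding 3
      by (rule that[of 2 "(\<omega> - 1) * d", unfolded 3 e o hexv_simps])
        (simp_all add: n1 d, simp_all add: eval_nat_numeral nf c_TF)
  next
    case 4
    have e: "Suc 3 mod 6 = (4::nat)" "(3 + 5) mod 6 = (2::nat)" by simp_all
    have o: "even (3::nat) = False" by simp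
    show ?thesis unfolding 4
      by (rule that[of 3 "(\<omega> - 1) * (c True * d)", unfolded 4 e o hexv_simps])
        (simp_all add: n1 d, simp_all add: eval_nat_numeral nf c_TF)
  next
    case 5
    have e: "Suc 4 mod 6 = (5::nat)" "(4 + 5) mod 6 = (3::nat)" by simp_all
    have o: "even (4::nat) = True" by simp
    show ?thesis unfolding 5
      by (rule that[of 4 "- (\<omega> * d)", unfolded 5 e o hexv_simps])
        (simp_all add: n1 d, simp_all add: eval_nat_numeral nf c_TF)
  next
    case 6
    have e: "Suc 5 mod 6 = (0::nat)" "(5 + 5) mod 6 = (4::nat)" by simp_all
    have o: "even (5::nat) = False" by simp
    show ?thesis unfolding 6
      by (rule that[of 5 "- (\<omega> * (c True * d))", unfolded 6 e o hexv_simps])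
        (simp_all add: n1 d, simp_all add: eval_nat_numeral nf c_TF)
  qed
qed

lemma hexv_inj:
  assumes d: "d \<noteq> 0"
  shows "inj_on (hexv z d) {..<6}"
proof -
  let ?c = "c True"
  have i: "0 < Im ?c" "0 < Im (\<omega> * ?c)" "0 < Im \<omega>" using Im_c Im_oc Im_omega by blast+
  have c0: "?c \<noteq> 0" using i by auto
  have c1: "1 + ?c \<noteq> 0" using i by (auto simp: complex_eq_iff)
  have i0: "0 < Im (1 + ?c)" "0 < Im (\<omega> + ?c)" "0 < Im (\<omega> + \<omega> * ?c)"
    using i by (simp_all only: plus_complex.sel one_complex.sel)
  have pos: "w \<noteq> 0" "w \<noteq> 1" if "0 < Im w" for w using that by auto
  have n2: "1 + ?c \<noteq> \<omega> + ?c" using omega_facts by simp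
  have n3: "1 + ?c \<noteq> \<omega> + \<omega> * ?c"
  proof
    assume "1 + ?c = \<omega> + \<omega> * ?c"
    moreover have "(1 - \<omega>) * (1 + ?c) = (1 + ?c) - (\<omega> + \<omega> * ?c)" by (simp add: algebra_simps)
    ultimately have "(1 - \<omega>) * (1 + ?c) = 0" by simp
    then show False using c1 omega_facts(2) by simp
  qed
  have n4: "1 + ?c \<noteq> \<omega> * ?c"
  proof
    assume a: "1 + ?c = \<omega> * ?c"
    have "\<omega> + ?c = \<omega> * (1 + ?c) - \<omega> * (\<omega> * ?c)" by (simp add: nf)
    then have "\<omega> + ?c = 0" unfolding a by simp
    then show False using i0(2) by (metis less_irrefl zero_complex.sel(2))
  qed
  have n5: "\<omega> + ?c \<noteq> \<omega> + \<omega> * ?c" using c0 omega_facts(2) by simp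
  have n6: "\<omega> + ?c \<noteq> \<omega> * ?c"
  proof
    assume "\<omega> + ?c = \<omega> * ?c"
    moreover have "\<omega> * (1 - \<omega> * ?c) = (\<omega> + ?c) - \<omega> * ?c" by (simp add: nf)
    ultimately have "\<omega> * (1 - \<omega> * ?c) = 0" by simp
    then have "\<omega> * ?c = 1" using omega_facts(1) by simp
    then show False using pos(2)[OF i(2)] by blast
  qed
  have n7: "\<omega> + \<omega> * ?c \<noteq> \<omega> * ?c" using omega_facts by simp
  let ?L = "[0, 1, 1 + ?c, \<omega> + ?c, \<omega> + \<omega> * ?c, \<omega> * ?c]"
  have "distinct ?L"
    using pos[OF i(2)] pos[OF i0(1)] pos[OF i0(2)] pos[OF i0(3)] n2 n3 n4 n5 n6 n7
    unfolding distinct.simps list.set insert_iff empty_iff by (metis zero_neq_one)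
  then have "inj_on ((!) ?L) {..<6}" by (intro inj_onI) (simp add: nth_eq_iff_index_eq)
  then show ?thesis unfolding hexv_def inj_on_def using d by simp
qed

lemma shield_vertices_hexv:
  assumes d: "norm d = 1"
  shows "shield_vertices \<alpha> (hexv z d)"
  unfolding shield_vertices_def
proof (intro conjI allI impI)
  show "inj_on (hexv z d) {..<6}" using d by (intro hexv_inj) auto
  fix i :: nat assume i: "i < 6"
  obtain f n where f: "(next_dart ^^ n) (Some True, z, d) = (Some (even i), hexv z d i, f)"
    "hexv z d (Suc i mod 6) = hexv z d i + f" "hexv z d ((i + 5) mod 6) = hexv z d i + tile_turn (Some (even i)) * f"
    "norm f = 1" by (rule hexv_corner[OF d i])
  have "tile (Some (even i)) (hexv z d i) f = tile (Some True) z d"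
    using dart_tile_iter[of n "(Some True, z, d)"] f(1) by simp
  then show "closed_segment (hexv z d i) (hexv z d (Suc i mod 6)) edge_of convex hull (hexv z d ` {..<6})"
    unfolding f(2) hexv_image tile_def[symmetric] using dart_edge[OF f(4), of "hexv z d i" "Some (even i)"] by simp
  show "dist (hexv z d i) (hexv z d (Suc i mod 6)) = 1" unfolding f(2) using f(4) by (simp add: dist_norm)
  have "vec_angle (tile_turn (Some (even i)) * f) f = tile_angle (Some (even i))"
  proof -
    have "inner (tile_turn (Some (even i)) * f) f = cos (tile_angle (Some (even i)))"
    proof -
      have "inner (tile_turn (Some (even i)) * f) f = Re (tile_turn (Some (even i)) * (f * cnj f))"
        by (simp add: inner_complex_def algebra_simps)
      then show ?thesis unfolding norm_1_cnj[OF f(4)] tile_turn_cis by simp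
    qed
    moreover have "norm (tile_turn (Some (even i)) * f) = 1" unfolding tile_turn_cis using f(4) by (simp add: norm_mult)
    ultimately show ?thesis unfolding vec_angle_def using f(4) tile_angle[of "Some (even i)"] by (simp add: arccos_cos del: tile_angle.simps)
  qed
  then show "vec_angle (hexv z d ((i + 5) mod 6) - hexv z d i) (hexv z d (Suc i mod 6) - hexv z d i) =
      (if even i then \<alpha> else 4 * pi / 3 - \<alpha>)"
    unfolding f(2,3) by (simp add: ph_def)
qed

lemma tile_translate: "(+) a ` tile l z d = tile l (z + a) d"
  using tile_image[of l a 1 z d] by (simp add: add.commute)

text \<open>The triangles are attached at the start \<open>p\<close> of each shield, while
  \<open>shield_line\<close> attaches them at its end; since the index runs through all integers,
  this is a shift by one.\<close>

definition lineset where "lineset z d = (\<Union>n::int. let p = z + of_int n * (\<omega> * d + c True * d) in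
  {tile (Some True) p d, tile None p ((1 - \<omega>) * d), tile None p (\<omega> * (c True * d))})"

lemma shield_line_lineset:
  assumes d: "norm d = 1"
  shows "shield_line \<alpha> (lineset z d)"
proof -
  let ?u = "\<omega> * d + c True * d"
  have u: "hexv z d 3 - hexv z d 0 = ?u" by (simp add: hexv_simps)
  have S: "convex hull (hexv z d ` {..<6}) = tile (Some True) z d" unfolding hexv_image tile_def ..
  have t1: "convex hull {hexv z d 3, hexv z d 2, hexv z d 1 + ?u} = tile None (z + ?u) ((1 - \<omega>) * d)"
    unfolding tile_def verts_simps hexv_simps by (rule arg_cong[of _ _ "(hull) convex"]) (simp add: nf)
  have t2: "convex hull {hexv z d 3, hexv z d 4, hexv z d 5 + ?u} = tile None (z + ?u) (\<omega> * (c True * d))"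
  proof -
    have "hexv z d 3 = z + ?u" "hexv z d 4 = z + ?u + \<omega> * (\<omega> * (c True * d))" "hexv z d 5 + ?u = z + ?u + \<omega> * (c True * d)"
      unfolding hexv_simps by (simp_all add: nf)
    then show ?thesis unfolding tile_def verts_simps by (simp only: insert_commute)
  qed
  have "lineset z d = {(+) (of_int n * ?u) ` Y | n Y. Y \<in> {tile (Some True) z d, tile None (z + ?u) ((1 - \<omega>) * d), tile None (z + ?u) (\<omega> * (c True * d))}}"
    (is "_ = ?R")
  proof (intro equalityI subsetI)
    fix B assume "B \<in> lineset z d"
    then obtain n :: int where n: "B = tile (Some True) (z + of_int n * ?u) d \<or>
      B = tile None (z + of_int n * ?u) ((1 - \<omega>) * d) \<or> B = tile None (z + of_int n * ?u) (\<omega> * (c True * d))"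
      unfolding lineset_def by (auto simp: Let_def)
    have e: "z + of_int n * ?u = z + ?u + of_int (n - 1) * ?u" by (simp add: algebra_simps)
    from n show "B \<in> ?R"
    proof (elim disjE)
      assume "B = tile (Some True) (z + of_int n * ?u) d"
      then show ?thesis unfolding tile_translate[symmetric] by blast
    next
      assume "B = tile None (z + of_int n * ?u) ((1 - \<omega>) * d)"
      then show ?thesis unfolding e tile_translate[symmetric] by blast
    next
      assume "B = tile None (z + of_int n * ?u) (\<omega> * (c True * d))"
      then show ?thesis unfolding e tile_translate[symmetric] by blast
    qed
  next
    fix B assume "B \<in> ?R"
    then obtain n :: int where n: "B = tile (Some True) (z + of_int n * ?u) d \<or>
      B = tile None (z + ?u + of_int n * ?u) ((1 - \<omega>) * d) \<or> B = tile None (z + ?u + of_int n * ?u) (\<omega> * (c True * d))"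
      unfolding tile_translate[symmetric] by blast
    have e: "z + ?u + of_int n * ?u = z + of_int (n + 1) * ?u" by (simp add: algebra_simps)
    show "B \<in> lineset z d" using n unfolding e lineset_def Let_def by blast
  qed
  note L = this
  show ?thesis unfolding shield_line_def
    by (rule exI[of _ "hexv z d"], rule exI[of _ "tile (Some True) z d"], rule exI[of _ ?u],
       rule exI[of _ "tile None (z + ?u) ((1 - \<omega>) * d)"], rule exI[of _ "tile None (z + ?u) (\<omega> * (c True * d))"],
       intro conjI, rule shield_vertices_hexv[OF d], rule S[symmetric], rule u[symmetric],
       rule t1[symmetric], rule t2[symmetric], rule L)
qed

lemma triangle_orbit:
  assumes "(next_dart ^^ n) (None, y, g) = (l, z, d)"
  shows "l = None \<and> (z, d) \<in> {(y, g), (y + g, (\<omega> - 1) * g), (y + \<omega> * g, - (\<omega> * g))}"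
  using assms
proof (induction n arbitrary: l z d)
  case 0 then show ?case by simp
next
  case (Suc n)
  obtain l1 z1 d1 where e: "(next_dart ^^ n) (None, y, g) = (l1, z1, d1)" by (metis prod_cases3)
  have p: "(l, z, d) = next_dart (l1, z1, d1)" using Suc.prems e by simp
  from Suc.IH[OF e] consider "(l1, z1, d1) = (None, y, g)" | "(l1, z1, d1) = (None, y + g, (\<omega> - 1) * g)"
    | "(l1, z1, d1) = (None, y + \<omega> * g, - (\<omega> * g))" by auto
  then have "(l, z, d) = (None, y + g, (\<omega> - 1) * g) \<or> (l, z, d) = (None, y + \<omega> * g, - (\<omega> * g)) \<or> (l, z, d) = (None, y, g)"
  proof cases
    case 1 show ?thesis unfolding p 1 by simp
  next
    case 2 show ?thesis unfolding p 2 by (simp add: nf)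
  next
    case 3 show ?thesis unfolding p 3 by (simp add: nf)
  qed
  then show ?case by auto
qed

lemma hexagon_orbit:
  assumes "(next_dart ^^ n) (Some s, y, g) = (l, z, d)"
  shows "(l, z, d) \<in> {(Some s, y, g), (Some (\<not> s), y + g, c s * g), (Some s, y + g + c s * g, (\<omega> - 1) * g),
   (Some (\<not> s), y + \<omega> * g + c s * g, (\<omega> - 1) * (c s * g)),
   (Some s, y + \<omega> * g + \<omega> * (c s * g), - (\<omega> * g)), (Some (\<not> s), y + \<omega> * (c s * g), - (\<omega> * (c s * g)))}"
  using assms
proof (induction n arbitrary: l z d)
  case 0 then show ?case by simp
next
  case (Suc n)
  obtain l1 z1 d1 where e: "(next_dart ^^ n) (Some s, y, g) = (l1, z1, d1)" by (metis prod_cases3)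
  have p: "(l, z, d) = next_dart (l1, z1, d1)" using Suc.prems e by simp
  from Suc.IH[OF e] consider "(l1, z1, d1) = (Some s, y, g)" | "(l1, z1, d1) = (Some (\<not> s), y + g, c s * g)"
    | "(l1, z1, d1) = (Some s, y + g + c s * g, (\<omega> - 1) * g)"
    | "(l1, z1, d1) = (Some (\<not> s), y + \<omega> * g + c s * g, (\<omega> - 1) * (c s * g))"
    | "(l1, z1, d1) = (Some s, y + \<omega> * g + \<omega> * (c s * g), - (\<omega> * g))"
    | "(l1, z1, d1) = (Some (\<not> s), y + \<omega> * (c s * g), - (\<omega> * (c s * g)))" by blast
  then show ?case
  proof cases
    case 1 show ?thesis unfolding p 1 by (simp add: nf)
  next
    case 2 show ?thesis unfolding p 2 by (simp add: nf)
  next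
    case 3 show ?thesis unfolding p 3 by (simp add: nf)
  next
    case 4 show ?thesis unfolding p 4 by (simp add: nf)
  next
    case 5 show ?thesis unfolding p 5 by (simp add: nf)
  next
    case 6 show ?thesis unfolding p 6 by (simp add: nf)
  qed
qed

end

section \<open>The partition into shield lines\<close>

context shield_plane begin

text \<open>A tile lies on the left of its darts, so it cannot have a side in both directions. Hence
  its darts form a single orbit of \<open>next_dart\<close>.\<close>

lemma dart_unique:
  assumes D: "D l z d" and D': "D l' z' d'" and eq: "tile l z d = tile l' z' d'"
  shows "\<exists>n. (next_dart ^^ n) (l, z, d) = (l', z', d')"
proof -
  define R where "R a b e \<longleftrightarrow> (\<exists>n. (next_dart ^^ n) (l, z, d) = (a, b, e))" for a b e
  have d: "norm d = 1" and d': "norm d' = 1" using D D' unfolding D_def by auto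
  have "closed_segment z' (z' + d') edge_of tile l z d" using dart_edge[OF d', of z' l'] eq by simp
  then obtain n l2 z2 d2 where 2: "(next_dart ^^ n) (l, z, d) = (l2, z2, d2)" "closed_segment z' (z' + d') = closed_segment z2 (z2 + d2)"
    using edge_dart[OF d] by metis
  have t2: "tile l2 z2 d2 = tile l' z' d'" using dart_tile_iter[of n "(l, z, d)"] 2(1) eq by simp
  have D2: "D l2 z2 d2" by (rule D_iter[OF D 2(1)])
  have "{z', z' + d'} = {z2, z2 + d2}" using 2(2) closed_segment_eq by metis
  then have "z2 = z' \<and> d2 = d' \<or> z2 = z' + d' \<and> d2 = - d'"
    by (auto simp: doubleton_eq_iff add_eq_0_iff)
  then show ?thesis
  proof
    assume "z2 = z' \<and> d2 = d'"
    then show ?thesis using 2(1) label_unique[OF D'] D2 by metis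
  next
    assume e: "z2 = z' + d' \<and> d2 = - d'"
    obtain e0 where e0: "0 < e0" "\<And>e. 0 < e \<Longrightarrow> e < e0 \<Longrightarrow> z' + e *\<^sub>R (cis (tile_angle l' / 2) * d') \<in> interior (tile l' z' d')"
      using sector_tile[OF d', of "tile_angle l' / 2" l' z'] tile_angle(1)[of l'] by (metis half_gt_zero_iff field_sum_of_halves less_add_same_cancel1)
    define p where "p = z' + (e0 / 2) *\<^sub>R (cis (tile_angle l' / 2) * d')"
    have "p \<in> tile l2 (z' + d') (- d')"
      using e0(2)[of "e0 / 2"] e0(1) interior_subset t2 e unfolding p_def by fastforce
    then have a: "0 \<le> Im ((p - (z' + d')) * cnj (- d'))" using d' by (intro tile_side) auto
    have b: "(p - (z' + d')) * cnj (- d') = 1 - of_real (e0 / 2) * cis (tile_angle l' / 2)"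
    proof -
      have "(p - (z' + d')) * cnj (- d') = (1 - of_real (e0 / 2) * cis (tile_angle l' / 2)) * (d' * cnj d')"
        unfolding p_def scaleR_conv_of_real by (simp add: algebra_simps)
      then show ?thesis unfolding norm_1_cnj[OF d'] by simp
    qed
    have "0 < sin (tile_angle l' / 2)" using tile_angle(1,2)[of l'] by (intro sin_gt_zero) auto
    then show ?thesis using a e0(1) unfolding b by (simp add: mult_le_0_iff)
  qed
qed

lemma lineset_subset:
  assumes l: "(z, d) \<in> lines True d0" and B: "B \<in> lineset z d"
  shows "\<exists>l' z' d'. D l' z' d' \<and> B = tile l' z' d' \<and> (\<exists>n. let p = z + of_int n * (\<omega> * d + c True * d) in
    (l', z', d') \<in> {(Some True, p, d), (None, p, (1 - \<omega>) * d), (None, p, \<omega> * (c True * d))})"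
proof -
  obtain n :: int where n: "B = tile (Some True) (z + of_int n * (\<omega> * d + c True * d)) d \<or>
      B = tile None (z + of_int n * (\<omega> * d + c True * d)) ((1 - \<omega>) * d) \<or>
      B = tile None (z + of_int n * (\<omega> * d + c True * d)) (\<omega> * (c True * d))"
    using B unfolding lineset_def by (auto simp: Let_def)
  let ?p = "z + of_int n * (\<omega> * d + c True * d)"
  have "X True ?p d" using l unfolding lines_def line_def by blast
  then have "D (Some True) ?p d" "DN ?p ((1 - \<omega>) * d)" "DN ?p (\<omega> * (c True * d))"
    unfolding X_def by blast+
  then show ?thesis using n unfolding Let_def by blast
qed

text \<open>The exterior angle \<open>ph True\<close> lies strictly between 0 and
  \<open>pi / 3\<close>, so the imaginary part of \<open>c True\<close> is strictly between those of
  the sixth roots of unity. This helps to tell apart the two kinds of triangles in a shield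
  line.\<close>

lemma sixth_roots:
  assumes "c True = x" "x \<in> {1, -1, \<omega>, - \<omega>, \<omega> - 1, 1 - \<omega>}"
  shows False
proof -
  have "0 < Im x" using Im_c[of True] assms(1) by simp
  moreover have "Im x < sqrt 3 / 2"
  proof -
    have "sin (ph True) < sin (pi / 3)"
      using \<alpha>1 \<alpha>2 pi_gt_zero unfolding ph_def by (intro sin_monotone_2pi) auto
    then show ?thesis using assms(1) unfolding c_def by (auto simp: sin_60)
  qed
  ultimately show False using assms(2) by (auto simp: omega_Complex)
qed

text \<open>Lines with a common tile must coincide for the partition. The darts of a shield from its
  \<open>\<alpha>\<close>-vertices differ by rotations by \<open>2 * pi / 3\<close>, so only one of
  them has direction \<open>d\<close> or \<open>- d\<close>. For a triangle, the two kinds are shown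
  to be distinct first; then the same argument fixes the dart.\<close>

lemma lineset_eq:
  assumes l: "(z, d) \<in> lines True d0" and l': "(z', d') \<in> lines True d0"
    and B: "B \<in> lineset z d" "B \<in> lineset z' d'"
  shows "lineset z d = lineset z' d'"
proof -
  have dd: "d = d0 \<or> d = - d0" "d' = d0 \<or> d' = - d0" using l l' unfolding lines_def by auto
  then have dd': "d' = d \<or> d' = - d" by auto
  have "line True z d" using l unfolding lines_def by simp
  then have nd: "norm d = 1" using X_H[OF line_X(1)] unfolding D_def by blast
  then have d0: "d \<noteq> 0" by auto
  obtain l1 z1 d1 n where 1: "D l1 z1 d1" "B = tile l1 z1 d1" "(l1, z1, d1) \<in> {(Some True, z + of_int n * (\<omega> * d + c True * d), d),
      (None, z + of_int n * (\<omega> * d + c True * d), (1 - \<omega>) * d), (None, z + of_int n * (\<omega> * d + c True * d), \<omega> * (c True * d))}"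
    using lineset_subset[OF l B(1)] unfolding Let_def by blast
  obtain l2 z2 d2 m where 2: "D l2 z2 d2" "B = tile l2 z2 d2" "(l2, z2, d2) \<in> {(Some True, z' + of_int m * (\<omega> * d' + c True * d'), d'),
      (None, z' + of_int m * (\<omega> * d' + c True * d'), (1 - \<omega>) * d'), (None, z' + of_int m * (\<omega> * d' + c True * d'), \<omega> * (c True * d'))}"
    using lineset_subset[OF l' B(2)] unfolding Let_def by blast
  obtain k where k: "(next_dart ^^ k) (l1, z1, d1) = (l2, z2, d2)" using dart_unique[OF 1(1) 2(1)] 1(2) 2(2) by metis
  have key: "z + of_int n * (\<omega> * d + c True * d) = z' + of_int m * (\<omega> * d' + c True * d') \<and> d' = d"
  proof -
    have r: "a = b" if "a * d = b * d" for a b using that d0 by simp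
    consider (S) "l1 = Some True" "z1 = z + of_int n * (\<omega> * d + c True * d)" "d1 = d"
      | (T) g where "l1 = None" "z1 = z + of_int n * (\<omega> * d + c True * d)" "d1 = g * d" "g = 1 - \<omega> \<or> g = \<omega> * c True"
    proof -
      from 1(3) consider "l1 = Some True \<and> z1 = z + of_int n * (\<omega> * d + c True * d) \<and> d1 = d"
        | "l1 = None \<and> z1 = z + of_int n * (\<omega> * d + c True * d) \<and> d1 = (1 - \<omega>) * d"
        | "l1 = None \<and> z1 = z + of_int n * (\<omega> * d + c True * d) \<and> d1 = \<omega> * c True * d"
        by (auto simp: mult.assoc)
      then show thesis using that by cases blast+
    qed
    then show ?thesis
    proof cases
      case S
      from hexagon_orbit[OF k[unfolded S(1)]] 2(3)
      have 3: "l2 = Some True" "z2 = z' + of_int m * (\<omega> * d' + c True * d')" "d2 = d'"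
        and 4: "(z2, d2) = (z1, d1) \<or> d2 = (\<omega> - 1) * d1 \<or> d2 = - (\<omega> * d1)" by auto
      from 4 show ?thesis
      proof (elim disjE)
        assume a: "(z2, d2) = (z1, d1)"
        have "d' = d" using a S(3) 3(3) by simp
        moreover have "z' + of_int m * (\<omega> * d' + c True * d') = z1" using a 3(2) by simp
        ultimately show ?thesis using S(2) by metis
      next
        assume "d2 = (\<omega> - 1) * d1"
        then have "(\<omega> - 1) * d = 1 * d \<or> (\<omega> - 1) * d = (- 1) * d" using dd' 3 S by auto
        then show ?thesis using r omega_facts by blast
      next
        assume "d2 = - (\<omega> * d1)"
        then have "- (\<omega> * d) = d \<or> - (\<omega> * d) = - d" using dd' 3(3) S(3) by metis
        then have "\<omega> * d = (- 1) * d \<or> \<omega> * d = 1 * d"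
          by (metis minus_minus mult_1 mult_minus1 neg_equal_iff_equal)
        then show ?thesis using r omega_facts by blast
      qed
    next
      case T
      from triangle_orbit[OF k[unfolded T(1)]] have ln: "l2 = None"
        and 4: "(z2, d2) = (z1, d1) \<or> d2 = (\<omega> - 1) * d1 \<or> d2 = - (\<omega> * d1)" by auto
      from 2(3) ln obtain g' where 3: "z2 = z' + of_int m * (\<omega> * d' + c True * d')" "d2 = g' * d'"
        "g' = 1 - \<omega> \<or> g' = \<omega> * c True"
      proof -
        from 2(3) ln have "z2 = z' + of_int m * (\<omega> * d' + c True * d')"
          "d2 = (1 - \<omega>) * d' \<or> d2 = \<omega> * c True * d'" by (auto simp: mult.assoc)
        then show thesis using that by blast
      qed
      have cn: "c True \<noteq> 1" "c True \<noteq> - 1" "c True \<noteq> \<omega>" "c True \<noteq> - \<omega>" "c True \<noteq> \<omega> - 1" "c True \<noteq> 1 - \<omega>" "c True \<noteq> 0"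
        using sixth_roots c_norm[of True] by auto
      obtain e where e: "d' = e * d" "e = 1 \<or> e = - 1" using dd' by (metis mult_1 mult_minus1)
      have q: "g' * e = g \<or> g' * e = (\<omega> - 1) * g \<or> g' * e = - (\<omega> * g)"
        using 4 r[of "g' * e" g] r[of "g' * e" "(\<omega> - 1) * g"] r[of "g' * e" "- (\<omega> * g)"]
        unfolding 3(2) T(3) e(1) by (auto simp: mult.assoc)
      \<comment> \<open>Taking sixth powers removes all sixth roots of unity and leaves
        \<open>c True ^ 6 = 1\<close>, which contradicts
        \<open>0 < 6 * ph True < 2 * pi\<close>.\<close>
      have mixed: False if "\<omega> * c True * a = (1 - \<omega>) * b" "a \<in> {1, -1, \<omega> - 1, 1 - \<omega>, \<omega>, - \<omega>}"
        "b \<in> {1, -1, \<omega> - 1, 1 - \<omega>, \<omega>, - \<omega>}" for a b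
      proof -
        have w6: "\<omega> ^ 6 = 1"
        proof -
          have "\<omega> ^ 3 = - 1" by (simp add: power3_eq_cube nf)
          then have "(\<omega> ^ 3) ^ 2 = 1" by simp
          then show ?thesis by (simp only: power_mult[symmetric]) simp
        qed
        have w6': "(\<omega> - 1) ^ 6 = 1" unfolding omega_sq[symmetric] by (simp add: power_mult_distrib w6)
        have "(1 - \<omega>) ^ 6 = (- (\<omega> - 1)) ^ 6" by simp
        then have w6'': "(1 - \<omega>) ^ 6 = 1" using w6' by (simp only: power_minus_even even_numeral)
        have six: "x ^ 6 = 1" if "x \<in> {1, -1, \<omega> - 1, 1 - \<omega>, \<omega>, - \<omega>}" for x
          using that w6 w6' w6'' by auto
        have "(\<omega> * c True * a) ^ 6 = ((1 - \<omega>) * b) ^ 6" unfolding that(1) ..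
        then have "c True ^ 6 = 1" using six[OF that(2)] six[OF that(3)] w6 w6'' by (simp add: power_mult_distrib)
        then have "cis (6 * ph True) = 1" unfolding c_def using Complex.DeMoivre[of "ph True" 6] by simp
        then have "cos (6 * ph True) = 1" by (simp add: complex_eq_iff)
        then obtain n :: int where n: "6 * ph True = of_int n * 2 * pi" using cos_one_2pi_int by blast
        have "0 < 6 * ph True" "6 * ph True < 2 * pi" using \<alpha>1 \<alpha>2 unfolding ph_def by auto
        then have "0 < of_int n * (2 * pi)" "of_int n * (2 * pi) < 1 * (2 * pi)" unfolding n by (simp_all add: mult.assoc)
        then have "0 < n" "real_of_int n < 1" using pi_gt_zero
          by (simp_all add: zero_less_mult_iff) 
        then show False by linarith
      qed
      have "g' = g \<and> e = 1"
      proof (cases "g = g'")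
        case True
        have "g \<noteq> 0" using T(4) omega_facts cn by auto
        moreover have "e * g = 1 * g \<or> e * g = (\<omega> - 1) * g \<or> e * g = (- \<omega>) * g"
          using q True by (simp add: mult.commute[of e])
        ultimately have "e = 1 \<or> e = \<omega> - 1 \<or> e = - \<omega>" unfolding mult_cancel_right by blast
        then show ?thesis using e(2) omega_facts True by auto
      next
        case False
        then consider "g = 1 - \<omega>" "g' = \<omega> * c True" | "g' = 1 - \<omega>" "g = \<omega> * c True" using T(4) 3(3) by blast
        then show ?thesis
        proof cases
          case 1
          have "\<omega> * c True * e = (1 - \<omega>) * 1 \<or> \<omega> * c True * e = (1 - \<omega>) * (\<omega> - 1) \<or>
              \<omega> * c True * e = (1 - \<omega>) * (- \<omega>)" using q unfolding 1 by (auto simp: algebra_simps)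
          then show ?thesis using mixed e(2) by blast
        next
          case 2
          have "\<omega> * c True * 1 = (1 - \<omega>) * e \<or> \<omega> * c True * (\<omega> - 1) = (1 - \<omega>) * e \<or>
              \<omega> * c True * (- \<omega>) = (1 - \<omega>) * e" using q unfolding 2 by (auto simp: algebra_simps)
          then show ?thesis using mixed e(2) by blast
        qed
      qed
      then have "g' = g" "d' = d" using e(1) by auto
      have "g \<noteq> 0" using T(4) omega_facts cn by auto
      have "- \<omega> \<noteq> 1" using omega_facts(4) by (metis minus_minus)
      then have "(\<omega> - 1) * g \<noteq> 1 * g" "(- \<omega>) * g \<noteq> 1 * g"
        unfolding mult_cancel_right using \<open>g \<noteq> 0\<close> omega_facts(5) by blast+
      then have "(\<omega> - 1) * g \<noteq> g" "- (\<omega> * g) \<noteq> g" by simp_all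
      then have "d2 \<noteq> (\<omega> - 1) * d1" "d2 \<noteq> - (\<omega> * d1)"
        using r[of g "(\<omega> - 1) * g"] r[of g "- (\<omega> * g)"] unfolding 3(2) T(3) \<open>g' = g\<close> \<open>d' = d\<close> by (auto simp: mult.assoc)
      then show ?thesis using 4 3(1) T(2) \<open>d' = d\<close> by auto
    qed
  qed
  let ?u = "\<omega> * d + c True * d"
  have z': "z' = z + of_int (n - m) * ?u" using key by (simp add: algebra_simps)
  have sh: "z' + of_int k * ?u = z + of_int (k + (n - m)) * ?u" "z + of_int k * ?u = z' + of_int (k - (n - m)) * ?u" for k
    unfolding z' by (simp_all add: algebra_simps)
  show ?thesis
  proof (intro equalityI subsetI)
    fix C assume "C \<in> lineset z d"
    then obtain k :: int where "C \<in> {tile (Some True) (z + of_int k * ?u) d, tile None (z + of_int k * ?u) ((1 - \<omega>) * d),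
       tile None (z + of_int k * ?u) (\<omega> * (c True * d))}" unfolding lineset_def Let_def by blast
    then show "C \<in> lineset z' d'" unfolding sh(2) lineset_def Let_def using key by blast
  next
    fix C assume "C \<in> lineset z' d'"
    then obtain k :: int where "C \<in> {tile (Some True) (z' + of_int k * ?u) d, tile None (z' + of_int k * ?u) ((1 - \<omega>) * d),
       tile None (z' + of_int k * ?u) (\<omega> * (c True * d))}" unfolding lineset_def Let_def using key by blast
    then show "C \<in> lineset z d" unfolding sh(1) lineset_def Let_def by blast
  qed
qed

lemma line_tiling:
  assumes l0: "line True z0 d0"
  shows "shield_line_tiling \<alpha> \<T>"
proof -
  define P where "P = (\<lambda>(z, d). lineset z d) ` lines True d0"
  have nrm: "norm d = 1" if "(z, d) \<in> lines True d0" for z d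
  proof -
    have "line True z d" using that unfolding lines_def by simp
    then show ?thesis using X_H[OF line_X(1)] unfolding D_def by blast
  qed
  have mem: "tile (Some True) y f \<in> lineset y f" "tile None y ((1 - \<omega>) * f) \<in> lineset y f"
    "tile None y (\<omega> * (c True * f)) \<in> lineset y f" for y f
    unfolding lineset_def Let_def by (rule UN_I[of 0], simp, simp)+
  have "partition_on \<T> P"
  proof (rule partition_onI)
    show "\<Union>P = \<T>"
    proof (intro equalityI subsetI)
      fix B assume "B \<in> \<Union>P"
      then obtain z d where "(z, d) \<in> lines True d0" "B \<in> lineset z d" unfolding P_def by auto
      from lineset_subset[OF this] show "B \<in> \<T>" unfolding D_def by blast
    next
      fix B assume "B \<in> \<T>"
      then obtain l z d where l: "l \<in> {None, Some True}" and D: "D l z d" and B: "B = tile l z d"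
        using tile_rep by blast
      show "B \<in> \<Union>P"
      proof (cases l)
        case None
        obtain y f g where yf: "(y, f) \<in> lines True d0" and g: "g = (1 - \<omega>) * f \<or> g = \<omega> * (c True * f)"
          and m: "(z, d) \<in> {(y, g), (y + g, (\<omega> - 1) * g), (y + \<omega> * g, - (\<omega> * g))}"
          using lines_cover(2)[OF l0 D[unfolded None]] by blast
        have "\<exists>n. (next_dart ^^ n) (None, y, g) = (None, z, d)"
        proof -
          have "(next_dart ^^ 0) (None, y, g) = (None, y, g)" "(next_dart ^^ 1) (None, y, g) = (None, y + g, (\<omega> - 1) * g)"
            "(next_dart ^^ 2) (None, y, g) = (None, y + \<omega> * g, - (\<omega> * g))" by (simp_all add: eval_nat_numeral nf)
          then show ?thesis using m by (metis insertE prod.inject singletonD)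
        qed
        then have "tile None y g = tile None z d" using dart_tile_iter[of _ "(None, y, g)"] by (metis dart_tile.simps)
        then have "B \<in> lineset y f" using g mem unfolding B None by metis
        then show ?thesis using yf unfolding P_def by force
      next
        case (Some s)
        then have s: "l = Some True" using l by simp
        obtain y f where yf: "(y, f) \<in> lines True d0"
          and m: "(z, d) \<in> {(y, f), (y + f + c True * f, (\<omega> - 1) * f), (y + \<omega> * f + \<omega> * (c True * f), - (\<omega> * f))}"
          using lines_cover(1)[OF l0 D[unfolded s]] by blast
        have "\<exists>n. (next_dart ^^ n) (Some True, y, f) = (Some True, z, d)"
        proof -
          have "(next_dart ^^ 0) (Some True, y, f) = (Some True, y, f)"
            "(next_dart ^^ 2) (Some True, y, f) = (Some True, y + f + c True * f, (\<omega> - 1) * f)"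
            "(next_dart ^^ 4) (Some True, y, f) = (Some True, y + \<omega> * f + \<omega> * (c True * f), - (\<omega> * f))"
            by (simp_all add: eval_nat_numeral nf c_TF)
          then show ?thesis using m by (metis insertE prod.inject singletonD)
        qed
        then have "tile (Some True) y f = tile (Some True) z d" using dart_tile_iter[of _ "(Some True, y, f)"] by (metis dart_tile.simps)
        then have "B \<in> lineset y f" using mem unfolding B s by metis
        then show ?thesis using yf unfolding P_def by force
      qed
    qed
    show "{} \<notin> P" unfolding P_def using mem(1) by auto
    show "disjnt p q" if pq: "p \<in> P" "q \<in> P" "p \<noteq> q" for p q
    proof -
      obtain z d z' d' where "(z, d) \<in> lines True d0" "p = lineset z d" "(z', d') \<in> lines True d0" "q = lineset z' d'"
        using pq(1,2) unfolding P_def by auto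
      then show ?thesis using lineset_eq pq(3) unfolding disjnt_iff by blast
    qed
  qed
  moreover have "\<forall>\<L>\<in>P. shield_line \<alpha> \<L>"
    unfolding P_def using shield_line_lineset nrm by auto
  ultimately show ?thesis unfolding shield_line_tiling_def using tiling by blast
qed

end

section \<open>Holes between the shields of a lattice\<close>

context shield_angle begin

abbreviation "hexagon \<equiv> hexagon_darts c"

lemma hexagon_cases:
  assumes "(t, x, g) \<in> hexagon s z d"
  obtains (0) "t = s" "x = z" "g = d" | (1) "t = (\<not> s)" "x = z + d" "g = c s * d"
    | (2) "t = s" "x = z + d + c s * d" "g = (\<omega> - 1) * d"
    | (3) "t = (\<not> s)" "x = z + \<omega> * d + c s * d" "g = (\<omega> - 1) * (c s * d)"
    | (4) "t = s" "x = z + \<omega> * d + \<omega> * (c s * d)" "g = - (\<omega> * d)"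
    | (5) "t = (\<not> s)" "x = z + \<omega> * (c s * d)" "g = - (\<omega> * (c s * d))"
  using assms unfolding hexagon_darts_def by blast

lemma hexagon_iter:
  assumes "(t, x, g) \<in> hexagon s z d"
  shows "\<exists>n. (next_dart ^^ n) (Some s, z, d) = (Some t, x, g)"
  using assms
proof (cases rule: hexagon_cases)
  case 0 show ?thesis unfolding 0 by (rule exI[of _ 0]) (simp add: eval_nat_numeral nf)
next
  case 1 show ?thesis unfolding 1 by (rule exI[of _ 1]) (simp add: eval_nat_numeral nf)
next
  case 2 show ?thesis unfolding 2 by (rule exI[of _ 2]) (simp add: eval_nat_numeral nf)
next
  case 3 show ?thesis unfolding 3 by (rule exI[of _ 3]) (simp add: eval_nat_numeral nf)
next
  case 4 show ?thesis unfolding 4 by (rule exI[of _ 4]) (simp add: eval_nat_numeral nf)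
next
  case 5 show ?thesis unfolding 5 by (rule exI[of _ 5]) (simp add: eval_nat_numeral nf)
qed

lemma hexagon_label:
  assumes "(next_dart ^^ n) (Some s, z, d) = (l, x, g)"
  obtains t where "l = Some t" "(t, x, g) \<in> hexagon s z d"
proof -
  from hexagon_orbit[OF assms] consider "(l, x, g) = (Some s, z, d)" | "(l, x, g) = (Some (\<not> s), z + d, c s * d)" | "(l, x, g) = (Some s, z + d + c s * d, (\<omega> - 1) * d)" | "(l, x, g) = (Some (\<not> s), z + \<omega> * d + c s * d, (\<omega> - 1) * (c s * d))" | "(l, x, g) = (Some s, z + \<omega> * d + \<omega> * (c s * d), - (\<omega> * d))" | "(l, x, g) = (Some (\<not> s), z + \<omega> * (c s * d), - (\<omega> * (c s * d)))"
    by blast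
  then show thesis
    by cases (rule that, simp, simp add: hexagon_darts_def)+
qed

lemma hexagon_tile: "(t, x, g) \<in> hexagon s z d \<Longrightarrow> tile (Some t) x g = tile (Some s) z d"
  using hexagon_iter dart_tile_iter by (metis dart_tile.simps)

lemma hexagon_norm: "(t, x, g) \<in> hexagon s z d \<Longrightarrow> norm g = norm d"
  using hexagon_iter norm_iter by (metis snd_conv)

lemma hexagon_translate: "(t, x + a, g) \<in> hexagon s (z + a) d \<longleftrightarrow> (t, x, g) \<in> hexagon s z d"
  unfolding hexagon_darts_def by (auto simp: algebra_simps)

text \<open>The shield with dart \<open>(p, f)\<close> has its centre at the origin: the centre is
  the mean of \<open>p\<close>, \<open>p + f + c s * f\<close> and
  \<open>p + \<omega> * f + \<omega> * (c s * f)\<close>. Multiplying by 3 avoids divisions.\<close>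

definition centred where "centred s p f \<longleftrightarrow> 3 * p = - ((1 + \<omega>) * (1 + c s) * f)"

lemma centred_hexagon:
  assumes "centred s p f" "(t, x, g) \<in> hexagon s p f"
  shows "centred t x g"
proof -
  have p: "3 * p = - ((1 + \<omega>) * (1 + c s) * f)" using assms(1) unfolding centred_def .
  from assms(2) show ?thesis
  proof (cases rule: hexagon_cases)
    case 0 then show ?thesis using assms(1) by simp
  next
    case 1
    have "3 * x = 3 * p + 3 * f" unfolding 1 by simp
    then show ?thesis unfolding centred_def p 1 by (simp add: nf)
  next
    case 2
    have "3 * x = 3 * p + 3 * f + 3 * (c s * f)" unfolding 2 by simp
    then show ?thesis unfolding centred_def p 2 by (simp add: nf)
  next
    case 3
    have "3 * x = 3 * p + 3 * (\<omega> * f) + 3 * (c s * f)" unfolding 3 by simp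
    then show ?thesis unfolding centred_def p 3 by (simp add: nf)
  next
    case 4
    have "3 * x = 3 * p + 3 * (\<omega> * f) + 3 * (\<omega> * (c s * f))" unfolding 4 by simp
    then show ?thesis unfolding centred_def p 4 by (simp add: nf)
  next
    case 5
    have "3 * x = 3 * p + 3 * (\<omega> * (c s * f))" unfolding 5 by simp
    then show ?thesis unfolding centred_def p 5 by (simp add: nf)
  qed
qed

text \<open>The diagonals starting from the six vertices are the multiples of one of them by the
  sixth roots of unity, each occurring once. So a side of a given shield can be recovered from its
  diagonal.\<close>

lemma diagonal_hexagon:
  assumes "(t, x, g) \<in> hexagon s p f"
  obtains k where "k \<in> {1, \<omega>, \<omega> - 1, - 1, - \<omega>, 1 - \<omega>}" "(\<omega> + c t) * g = k * ((\<omega> + c s) * f)"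
    "k = 1 \<Longrightarrow> (t, x, g) = (s, p, f)"
proof -
  have n: "\<omega> \<noteq> 1" "\<omega> - 1 \<noteq> 1" "- \<omega> \<noteq> 1" "1 - \<omega> \<noteq> 1" "- 1 \<noteq> (1::complex)"
    by (simp_all add: omega_Complex complex_eq_iff)
  from assms show thesis
  proof (cases rule: hexagon_cases)
    case 0 show ?thesis by (rule that[of 1]) (simp_all add: 0)
  next
    case 1 show ?thesis by (rule that[of \<omega>]) (use n in \<open>simp_all add: 1 nf\<close>)
  next
    case 2 show ?thesis by (rule that[of "\<omega> - 1"]) (use n in \<open>simp_all add: 2 nf\<close>)
  next
    case 3 show ?thesis by (rule that[of "- 1"]) (use n in \<open>simp_all add: 3 nf\<close>)
  next
    case 4 show ?thesis by (rule that[of "- \<omega>"]) (use n in \<open>simp_all add: 4 nf\<close>)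
  next
    case 5 show ?thesis by (rule that[of "1 - \<omega>"]) (use n in \<open>simp_all add: 5 nf\<close>)
  qed
qed

lemma unit_norms: "norm \<omega> = 1" "norm (\<omega> - 1) = 1" "norm (1 - \<omega>) = 1"
proof -
  show 1: "norm \<omega> = 1" by (simp add: \<omega>_def)
  show 2: "norm (\<omega> - 1) = 1" unfolding omega_sq[symmetric] by (simp add: norm_mult 1)
  show "norm (1 - \<omega>) = 1" using 2 by (simp add: norm_minus_commute)
qed

lemma sqrt3_norms: "(norm (1 + \<omega>))\<^sup>2 = 3" "(norm (2 - \<omega>))\<^sup>2 = 3" "(norm (2 * \<omega> - 1))\<^sup>2 = 3"
  unfolding cmod_power2 by (simp_all add: omega_Complex power2_eq_square field_simps)

text \<open>The circumradius of the unit triangle is a third of the square root of 3; the bound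
  \<open>3 / 5\<close> keeps the later distance estimates rational.\<close>

lemma third_norms: "norm (1 + \<omega>) / 3 \<le> 3 / 5" "norm (2 - \<omega>) / 3 \<le> 3 / 5" "norm (2 * \<omega> - 1) / 3 \<le> 3 / 5"
proof -
  have "x / 3 \<le> 3 / 5" if "x\<^sup>2 = 3" for x :: real
  proof -
    have "x \<le> 9 / 5"
    proof (rule power2_le_imp_le)
      show "x\<^sup>2 \<le> (9 / 5)\<^sup>2" unfolding that by (simp add: power2_eq_square)
    qed simp
    then show ?thesis by simp
  qed
  then show "norm (1 + \<omega>) / 3 \<le> 3 / 5" "norm (2 - \<omega>) / 3 \<le> 3 / 5" "norm (2 * \<omega> - 1) / 3 \<le> 3 / 5"
    using sqrt3_norms by blast+
qed

lemma opposite_disjoint: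
  assumes d: "norm d = 1"
  shows "interior (tile l z d) \<inter> tile l' (z + d) (- d) = {}"
proof (rule ccontr)
  assume "\<not> ?thesis"
  then obtain x where x: "x \<in> interior (tile l z d)" "x \<in> tile l' (z + d) (- d)" by blast
  obtain r where r: "0 < r" "ball x r \<subseteq> tile l z d" using x(1) unfolding mem_interior by blast
  define y where "y = x - of_real (r / 2) * (\<i> * d)"
  have "dist x y < r" unfolding y_def using d r by (simp add: dist_norm norm_mult)
  then have "y \<in> tile l z d" using r by auto
  then have a: "0 \<le> Im ((y - z) * cnj d)" by (rule tile_side[OF d])
  define w where "w = (x - z) * cnj d"
  have "(y - z) * cnj d = w - of_real (r / 2) * \<i> * (d * cnj d)" unfolding y_def w_def by (simp add: algebra_simps)
  then have b: "(y - z) * cnj d = w - of_real (r / 2) * \<i>" unfolding norm_1_cnj[OF d] by simp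
  have e: "0 \<le> Im ((x - (z + d)) * cnj (- d))" using x(2) d by (intro tile_side) auto
  have "(x - (z + d)) * cnj (- d) = d * cnj d - w" unfolding w_def by (simp add: algebra_simps)
  then have e': "(x - (z + d)) * cnj (- d) = 1 - w" unfolding norm_1_cnj[OF d] .
  have "Im w \<le> 0" using e unfolding e' by simp
  moreover have "r / 2 \<le> Im w" using a unfolding b by simp
  ultimately show False using r(1) by linarith
qed

lemma triangle_ball:
  assumes d: "norm d = 1"
  shows "tile None z d \<subseteq> cball (z + (1 + \<omega>) * d / 3) (3 / 5)"
  unfolding tile_def
proof (rule hull_minimal)
  have "dist (z + (1 + \<omega>) * d / 3) z = norm (1 + \<omega>) / 3"
    using d by (simp add: dist_norm norm_mult norm_divide)
  moreover have "dist (z + (1 + \<omega>) * d / 3) (z + d) = norm (2 - \<omega>) / 3"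
  proof -
    have "dist (z + (1 + \<omega>) * d / 3) (z + d) = norm (- ((2 - \<omega>) * d / 3))" unfolding dist_norm
      by (rule arg_cong[of _ _ norm]) (simp add: field_simps)
    then show ?thesis using d by (simp add: norm_mult norm_divide)
  qed
  moreover have "dist (z + (1 + \<omega>) * d / 3) (z + \<omega> * d) = norm (2 * \<omega> - 1) / 3"
  proof -
    have "dist (z + (1 + \<omega>) * d / 3) (z + \<omega> * d) = norm (- ((2 * \<omega> - 1) * d / 3))" unfolding dist_norm
      by (rule arg_cong[of _ _ norm]) (simp add: field_simps)
    then show ?thesis using d by (simp add: norm_mult norm_divide)
  qed
  ultimately show "verts None z d \<subseteq> cball (z + (1 + \<omega>) * d / 3) (3 / 5)"
    unfolding verts_simps using third_norms by simp
qed simp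

text \<open>By \<open>centred\<close>, a vertex is at distance
  \<open>norm (1 + \<omega>) * norm (1 + c t) / 3\<close> from the centre, which is at most
  \<open>2 * (3 / 5)\<close>.\<close>

lemma hexagon_ball:
  assumes d: "norm f = 1" and cen: "centred s p f"
  shows "tile (Some s) (p + l) f \<subseteq> cball l (6 / 5)"
  unfolding tile_def
proof (rule hull_minimal)
  show "verts (Some s) (p + l) f \<subseteq> cball l (6 / 5)"
  proof
    fix q assume "q \<in> verts (Some s) (p + l) f"
    then obtain n l' g where n: "(next_dart ^^ n) (Some s, p + l, f) = (l', q, g)" by (rule vertex_dart)
    obtain t where "(t, q, g) \<in> hexagon s (p + l) f" by (rule hexagon_label[OF n])
    then have q: "(t, q - l, g) \<in> hexagon s p f" using hexagon_translate[of t "q - l" l g s p f] by simp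
    have g: "norm g = 1" using hexagon_norm[OF q] d by simp
    have "norm (3 * (q - l)) = norm (1 + \<omega>) * norm (1 + c t)"
      using centred_hexagon[OF cen q] g unfolding centred_def by (simp add: norm_mult)
    moreover have "norm (1 + c t) \<le> 2" using norm_triangle_ineq[of 1 "c t"] c_norm[of t] by simp
    ultimately have "norm (3 * (q - l)) \<le> norm (1 + \<omega>) * 2" by (simp add: mult_left_mono)
    moreover have "norm (3 * (q - l)) = 3 * norm (q - l)" by (simp only: norm_mult norm_numeral)
    ultimately have "norm (q - l) \<le> 6 / 5" using third_norms(1) by linarith
    then show "q \<in> cball l (6 / 5)" by (simp add: dist_norm norm_minus_commute)
  qed
qed simp

text \<open>The unit vectors \<open>\<omega>\<close> and \<open>c s\<close> enclose an angle below
  \<open>pi / 3\<close>.\<close>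

lemma diagonal_norm: "3 \<le> (norm (\<omega> + c s))\<^sup>2"
proof -
  let ?a = "ph s - pi / 3"
  have "(norm (\<omega> + c s))\<^sup>2 = 2 + 2 * cos ?a"
  proof -
    have "(norm (\<omega> + c s))\<^sup>2 = (cos (pi / 3) + cos (ph s))\<^sup>2 + (sin (pi / 3) + sin (ph s))\<^sup>2"
      unfolding cmod_power2 \<omega>_def c_def by simp
    also have "\<dots> = ((sin (pi/3))\<^sup>2 + (cos (pi/3))\<^sup>2) + ((sin (ph s))\<^sup>2 + (cos (ph s))\<^sup>2) +
        2 * (cos (ph s) * cos (pi / 3) + sin (ph s) * sin (pi / 3))"
      by (simp only: power2_eq_square algebra_simps)
    also have "\<dots> = 2 + 2 * cos ?a" unfolding sin_cos_squared_add cos_diff by simp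
    finally show ?thesis .
  qed
  moreover have "cos (pi / 3) \<le> cos \<bar>?a\<bar>"
  proof (rule cos_monotone_0_pi_le)
    show "\<bar>?a\<bar> \<le> pi / 3" using ph(1,2)[of s] by linarith
  qed simp_all
  ultimately show ?thesis by (simp add: cos_60)
qed

text \<open>\<open>- (1 + \<omega>) / 3\<close> is the centre of the lattice triangle
  \<open>0\<close>, \<open>- 1\<close>, \<open>- \<omega>\<close>. The squared norm is
  \<open>3 + 9 * ?M\<close> with an integer \<open>?M\<close> that is positive unless the lattice
  point is one of these three.\<close>

lemma lattice_gap:
  fixes i j :: int
  assumes "(i, j) \<notin> {(0, 0), (- 1, 0), (0, - 1)}"
  shows "12 \<le> (norm (3 * (of_int i + of_int j * \<omega>) + (1 + \<omega>)))\<^sup>2"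
proof -
  let ?M = "i * i + i * j + j * j + i + j"
  \<comment> \<open>Completing the square in \<open>i\<close>; the second summand is positive unless
    \<open>j\<close> is 0 or -1.\<close>
  have 4: "4 * ?M = (2 * i + j + 1) * (2 * i + j + 1) + (j + 1) * (3 * j - 1)" by (simp add: algebra_simps)
  have "1 \<le> ?M"
  proof (cases "j = 0 \<or> j = - 1")
    case True
    then show ?thesis
    proof
      assume j: "j = 0"
      then have "0 < i \<or> i + 1 < 0" using assms by auto
      then have "0 < i * (i + 1)" by (auto intro: mult_pos_pos mult_neg_neg)
      then show ?thesis using j by (simp add: algebra_simps)
    next
      assume j: "j = - 1"
      then have "i \<noteq> 0" using assms by auto
      then have "0 < i * i" by (auto simp: zero_less_mult_iff)
      then show ?thesis using j by simp
    qed
  next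
    case False
    then have "0 < j \<or> j + 1 < 0" by auto
    then have "0 < (j + 1) * (3 * j - 1)" by (auto intro: mult_pos_pos mult_neg_neg)
    moreover have "0 \<le> (2 * i + j + 1) * (2 * i + j + 1)" by simp
    ultimately have "0 < 4 * ?M" unfolding 4 by linarith
    then have "0 < ?M" by (simp only: zero_less_mult_iff) simp
    then show ?thesis by (simp only: int_one_le_iff_zero_less)
  qed
  define R where "R = real_of_int ?M"
  have M: "1 \<le> R" unfolding R_def using \<open>1 \<le> ?M\<close> by (simp only: of_int_1_le_iff)
  have "(norm (3 * (of_int i + of_int j * \<omega>) + (1 + \<omega>)))\<^sup>2 = 3 + 9 * R"
    unfolding cmod_power2 R_def by (simp add: omega_Complex power2_eq_square algebra_simps)
  then show ?thesis using M by linarith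
qed

text \<open>The Eisenstein lattice spanned by \<open>v\<close>. Its invariance under
  \<open>\<omega>\<close> makes it the same for all six diagonals of a shield.\<close>

definition lat :: "complex \<Rightarrow> complex set" where
  "lat v = {(of_int i + of_int j * \<omega>) * v | i j. True}"

lemma lat_omega: "lat (\<omega> * v) = lat v"
proof -
  have "(of_int i + of_int j * \<omega>) * (\<omega> * v) = (of_int (- j) + of_int (i + j) * \<omega>) * v"
    "(of_int i + of_int j * \<omega>) * v = (of_int (i + j) + of_int (- i) * \<omega>) * (\<omega> * v)" for i j
    by (simp_all add: nf)
  then show ?thesis unfolding lat_def by blast
qed

lemma shield_lattice_lat: "shield_lattice u = lat u"
proof -
  have e: "cis (2 * pi / 3) = \<omega> - 1" unfolding omega_sq[symmetric] by (simp add: \<omega>_def cis_mult)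
  have "of_int i * u + of_int j * ((\<omega> - 1) * u) = (of_int (i - j) + of_int j * \<omega>) * u"
    "(of_int i + of_int j * \<omega>) * u = of_int (i + j) * u + of_int j * ((\<omega> - 1) * u)" for i j
    by (simp_all add: algebra_simps)
  then show ?thesis unfolding shield_lattice_def lat_def e by (metis (no_types, lifting))
qed

lemma lat_hexagon:
  assumes "(t, x, g) \<in> hexagon s p f"
  shows "lat ((\<omega> + c t) * g) = lat ((\<omega> + c s) * f)"
proof -
  let ?v = "(\<omega> + c s) * f"
  have w: "lat ((\<omega> - 1) * v) = lat v" "lat (- v) = lat v" "lat (- (\<omega> * v)) = lat v" "lat ((1 - \<omega>) * v) = lat v" for v
  proof -
    show 1: "lat ((\<omega> - 1) * v) = lat v" for v
      using lat_omega[of "\<omega> * v"] lat_omega[of v] by (simp add: nf)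
    show 2: "lat (- v) = lat v" for v
      using lat_omega[of "(\<omega> - 1) * v"] 1[of v] by (simp add: nf)
    show "lat (- (\<omega> * v)) = lat v" using 2[of "\<omega> * v"] lat_omega by simp
    show "lat ((1 - \<omega>) * v) = lat v" using 2[of "(\<omega> - 1) * v"] 1[of v] by (simp add: algebra_simps)
  qed
  obtain k where k: "k \<in> {1, \<omega>, \<omega> - 1, - 1, - \<omega>, 1 - \<omega>}" "(\<omega> + c t) * g = k * ?v"
    using diagonal_hexagon[OF assms] by metis
  have "lat (k * ?v) = lat ?v" using k(1) w[of ?v] lat_omega[of ?v] by auto
  then show ?thesis unfolding k(2) .
qed

lemma lat_translate: "a \<in> lat v \<Longrightarrow> l \<in> lat v \<Longrightarrow> \<exists>i j. l = a + (of_int i + of_int j * \<omega>) * v"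
proof -
  assume "a \<in> lat v" "l \<in> lat v"
  then obtain i j k m where "a = (of_int i + of_int j * \<omega>) * v" "l = (of_int k + of_int m * \<omega>) * v"
    unfolding lat_def by blast
  then have "l = a + (of_int (k - i) + of_int (m - j) * \<omega>) * v" by (simp add: algebra_simps)
  then show ?thesis by blast
qed

text \<open>The three shields around the triangle lying outside the edge \<open>(p, p + f)\<close> of the shield at \<open>a\<close>.\<close>

lemma around_triangle:
  shows "tile (Some s) (p + (a - (\<omega> + c s) * f)) f = tile (Some s) (a + p + f - \<omega> * f) ((\<omega> - 1) * f)"
    and "tile (Some s) (p + (a - \<omega> * ((\<omega> + c s) * f))) f = tile (Some s) (a + p + f) (- (\<omega> * f))"
proof -
  have "(s, a + p + f - \<omega> * f, (\<omega> - 1) * f) \<in> hexagon s (p + (a - (\<omega> + c s) * f)) f"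
    unfolding hexagon_darts_def by (simp add: algebra_simps)
  from hexagon_tile[OF this]
  show "tile (Some s) (p + (a - (\<omega> + c s) * f)) f = tile (Some s) (a + p + f - \<omega> * f) ((\<omega> - 1) * f)" by simp
  have "p + (a - \<omega> * ((\<omega> + c s) * f)) + \<omega> * f + \<omega> * (c s * f) = a + p + f" by (simp add: nf)
  then have "(s, a + p + f, - (\<omega> * f)) \<in> hexagon s (p + (a - \<omega> * ((\<omega> + c s) * f))) f"
    unfolding hexagon_darts_def by simp
  from hexagon_tile[OF this]
  show "tile (Some s) (p + (a - \<omega> * ((\<omega> + c s) * f))) f = tile (Some s) (a + p + f) (- (\<omega> * f))" by simp
qed

lemma outer_triangle_rotations:
  "tile None (a + p + f) (- f) = tile None (a + p) ((1 - \<omega>) * f)"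
  "tile None (a + p + f) (- f) = tile None (a + p + f - \<omega> * f) (\<omega> * f)"
proof -
  have "(next_dart ^^ 1) (None, a + p + f, - f) = (None, a + p, (1 - \<omega>) * f)"
    "(next_dart ^^ 2) (None, a + p + f, - f) = (None, a + p + f - \<omega> * f, \<omega> * f)"
    by (simp_all add: eval_nat_numeral nf)
  then show "tile None (a + p + f) (- f) = tile None (a + p) ((1 - \<omega>) * f)"
    "tile None (a + p + f) (- f) = tile None (a + p + f - \<omega> * f) (\<omega> * f)"
    using dart_tile_iter[of 1 "(None, a + p + f, - f)"] dart_tile_iter[of 2 "(None, a + p + f, - f)"] by simp_all
qed

text \<open>Three shields lie across the three sides of the triangle. The centre of any other shield
  is at distance at least 2 from that of the triangle, since 36 is the product of the bounds 12 and
  3, and 2 exceeds \<open>3 / 5 + 6 / 5\<close>.\<close>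

lemma hole_disjoint:
  assumes f: "norm f = 1" and cen: "centred s p f" and a: "a \<in> lat ((\<omega> + c s) * f)" and l: "l \<in> lat ((\<omega> + c s) * f)"
  shows "interior (tile None (a + p + f) (- f)) \<inter> tile (Some s) (p + l) f = {}"
proof -
  let ?v = "(\<omega> + c s) * f"
  obtain i j where ij: "l = a + (of_int i + of_int j * \<omega>) * ?v" using lat_translate[OF a l] by blast
  have nf1: "norm (- f) = 1" "norm ((1 - \<omega>) * f) = 1" "norm (\<omega> * f) = 1"
    using f unit_norms by (simp_all add: norm_mult)
  show ?thesis
  proof (cases "(i, j) \<in> {(0, 0), (- 1, 0), (0, - 1)}")
    case True
    then consider "i = 0 \<and> j = 0" | "i = - 1 \<and> j = 0" | "i = 0 \<and> j = - 1" by auto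
    then show ?thesis
    proof cases
      case 1
      then have "p + l = a + p + f + - f" using ij by (simp add: add.commute)
      then show ?thesis using opposite_disjoint[OF nf1(1), of None "a + p + f" "Some s"] by (simp only: minus_minus)
    next
      case 2
      then have "l = a - ?v" using ij by simp
      have e: "a + p + f - \<omega> * f = a + p + (1 - \<omega>) * f" "(\<omega> - 1) * f = - ((1 - \<omega>) * f)"
        by (simp_all add: algebra_simps)
      have "tile (Some s) (p + l) f = tile (Some s) (a + p + (1 - \<omega>) * f) (- ((1 - \<omega>) * f))"
        unfolding \<open>l = a - ?v\<close> around_triangle(1) e ..
      then show ?thesis using opposite_disjoint[OF nf1(2), of None "a + p" "Some s"] unfolding outer_triangle_rotations(1) by simp
    next
      case 3
      then have "l = a - \<omega> * ?v" using ij by simp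
      then have "tile (Some s) (p + l) f = tile (Some s) (a + p + f - \<omega> * f + \<omega> * f) (- (\<omega> * f))"
        using around_triangle(2)[of s p a f] by simp
      then show ?thesis using opposite_disjoint[OF nf1(3), of None "a + p + f - \<omega> * f" "Some s"]
        unfolding outer_triangle_rotations(2) by simp
    qed
  next
    case False
    \<comment> \<open>The centre of the triangle. As the shield is centred, it equals
      \<open>a - (1 + \<omega>) * ?v / 3\<close>.\<close>
    let ?t = "a + p + f + (1 + \<omega>) * (- f) / 3"
    have t: "3 * ?t = 3 * a - (1 + \<omega>) * ?v"
    proof -
      have "3 * ((1 + \<omega>) * (- f) / 3) = (1 + \<omega>) * (- f)" by simp
      then have "3 * ?t = 3 * (a + p + f) + (1 + \<omega>) * (- f)" by (simp only: distrib_left)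
      also have "\<dots> = 3 * a + 3 * p + 3 * f - (1 + \<omega>) * f" by (simp add: algebra_simps)
      also have "\<dots> = 3 * a - (1 + \<omega>) * ?v" using cen unfolding centred_def by (simp add: nf)
      finally show ?thesis .
    qed
    have "3 * (l - ?t) = 3 * l - 3 * ?t" by (simp only: right_diff_distrib)
    also have "\<dots> = (3 * (of_int i + of_int j * \<omega>) + (1 + \<omega>)) * ?v"
      unfolding t ij by (simp add: algebra_simps)
    finally have "3 * (l - ?t) = (3 * (of_int i + of_int j * \<omega>) + (1 + \<omega>)) * ?v" .
    then have "norm (3 * (l - ?t)) = norm (3 * (of_int i + of_int j * \<omega>) + (1 + \<omega>)) * norm ?v"
      by (simp only: norm_mult)
    moreover have "norm ?v = norm (\<omega> + c s)" using f by (simp add: norm_mult)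
    moreover have "norm (3 * (l - ?t)) = 3 * norm (l - ?t)" by (simp only: norm_mult norm_numeral)
    ultimately have e: "3 * norm (l - ?t) = norm (3 * (of_int i + of_int j * \<omega>) + (1 + \<omega>)) * norm (\<omega> + c s)"
      by (simp only:)
    have "(3 * norm (l - ?t))\<^sup>2 = (norm (3 * (of_int i + of_int j * \<omega>) + (1 + \<omega>)))\<^sup>2 * (norm (\<omega> + c s))\<^sup>2"
      unfolding e by (rule power_mult_distrib)
    also have "\<dots> \<ge> 12 * 3"
      by (rule mult_mono[OF lattice_gap[OF False] diagonal_norm]) simp_all
    finally have "6\<^sup>2 \<le> (3 * norm (l - ?t))\<^sup>2" by simp
    then have "6 \<le> 3 * norm (l - ?t)" by (rule power2_le_imp_le) simp
    then have d: "2 \<le> dist l ?t" by (simp add: dist_norm)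
    have False if x: "x \<in> tile None (a + p + f) (- f)" "x \<in> tile (Some s) (p + l) f" for x
    proof -
      have "dist ?t x \<le> 3 / 5" using triangle_ball[OF nf1(1), of "a + p + f"] x(1) by auto
      moreover have "dist l x \<le> 6 / 5" using hexagon_ball[OF f cen, of l] x(2) by auto
      ultimately show False using d dist_triangle2[of l ?t x] by linarith
    qed
    then show ?thesis using interior_subset by blast
  qed
qed

lemma triangle_unit: "norm d = 1 \<Longrightarrow> unit_triangle (tile None z d)"
  unfolding unit_triangle_def tile_def verts_simps
  by (rule exI[of _ z], rule exI[of _ "z + d"], rule exI[of _ "z + \<omega> * d"])
    (simp add: dist_norm norm_mult unit_norms flip: left_diff_distrib[of 1 \<omega> d, simplified])

lemma triangle_centre:
  assumes d: "norm d = 1" "norm d' = 1" and eq: "tile None z d = tile None z' d'"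
  shows "3 * z + (1 + \<omega>) * d = 3 * z' + (1 + \<omega>) * d'"
proof -
  have v: "verts None z d = verts None z' d'"
    using tile_extreme[OF d(1), of _ None z] tile_extreme[OF d(2), of _ None z'] eq by auto
  have s: "\<Sum>(verts None z d) = 3 * z + (1 + \<omega>) * d" if d: "norm d = 1" for z d
  proof -
    have "d \<noteq> 0" using d by auto
    moreover have "1 * d \<noteq> \<omega> * d" "\<omega> \<noteq> 0"
      unfolding mult_cancel_right using omega_facts(1,2) \<open>d \<noteq> 0\<close> by auto
    ultimately have "z \<noteq> z + d" "z \<noteq> z + \<omega> * d" "z + d \<noteq> z + \<omega> * d" by auto
    then show ?thesis unfolding verts_simps by (simp add: algebra_simps)
  qed
  show ?thesis using s[OF d(1), of z] s[OF d(2), of z'] v by simp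
qed

text \<open>The circumcentre of the triangle \<open>0\<close>, \<open>- 3\<close>,
  \<open>- 3 * \<omega>\<close> is determined by its distances to the three vertices.\<close>

lemma three_distances:
  assumes "(norm w)\<^sup>2 = 3" "(norm (w + 3))\<^sup>2 = 3" "(norm (w + 3 * \<omega>))\<^sup>2 = 3"
  shows "w = - (1 + \<omega>)"
proof -
  define x y where "x = Re w" and "y = Im w"
  have 1: "x\<^sup>2 + y\<^sup>2 = 3" and 2: "(x + 3)\<^sup>2 + y\<^sup>2 = 3"
    and 3: "(x + 3 / 2)\<^sup>2 + (y + 3 * (sqrt 3 / 2))\<^sup>2 = 3"
    using assms unfolding cmod_power2 x_def y_def by (simp_all add: omega_Complex)
  have x: "x = - 3 / 2" using 1 2 by (simp add: power2_eq_square algebra_simps)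
  have y2: "y\<^sup>2 = 3 / 4" using 1 unfolding x by (simp add: power2_eq_square)
  have "y\<^sup>2 + 3 * sqrt 3 * y + 27 / 4 = 3" using 3 unfolding x by (simp add: power2_eq_square algebra_simps)
  then have "sqrt 3 * y = - 3 / 2" using y2 by linarith
  then have "sqrt 3 * (sqrt 3 * y) = sqrt 3 * (- 3 / 2)" by simp
  then have "y = - sqrt 3 / 2" by (simp add: mult.assoc[symmetric])
  then show ?thesis using x unfolding x_def y_def by (simp add: omega_Complex complex_eq_iff)
qed

text \<open>The boundary of the triangle is covered by three shields. A connected set that avoids
  the shields and meets the interior cannot leave it, so the interior is a full component of the
  complement.\<close>

lemma outer_triangle_hole:
  assumes f: "norm f = 1" and cen: "centred s p f" and L: "shield_lattice u = lat ((\<omega> + c s) * f)"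
    and a: "a \<in> shield_lattice u"
  shows "tile None (a + p + f) (- f) \<in> hole_triangles (tile (Some s) p f) u"
proof -
  let ?v = "(\<omega> + c s) * f"
  let ?T = "tile None (a + p + f) (- f)"
  define U where "U = - (\<Union>l\<in>shield_lattice u. (+) l ` tile (Some s) p f)"
  have nf1: "norm (- f) = 1" "norm ((\<omega> - 1) * f) = 1" "norm (\<omega> * f) = 1"
    using f unit_norms by (simp_all add: norm_mult)
  obtain i j where ij: "a = (of_int i + of_int j * \<omega>) * ?v" using a unfolding L lat_def by blast
  have "a - ?v = (of_int (i - 1) + of_int j * \<omega>) * ?v" "a - \<omega> * ?v = (of_int i + of_int (j - 1) * \<omega>) * ?v"
    unfolding ij by (simp_all add: algebra_simps)
  then have a': "a - ?v \<in> shield_lattice u" "a - \<omega> * ?v \<in> shield_lattice u" unfolding L lat_def by blast+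
  have sh: "l \<in> shield_lattice u \<Longrightarrow> tile (Some s) (p + l) f \<inter> U = {}" for l
    unfolding U_def tile_translate by blast
  have sub: "interior ?T \<subseteq> U"
    using hole_disjoint[OF f cen] a L unfolding U_def tile_translate by blast
  have seg: "closed_segment (a + p + f) (a + p) \<inter> U = {}"
    "closed_segment (a + p) (a + p + f - \<omega> * f) \<inter> U = {}"
    "closed_segment (a + p + f - \<omega> * f) (a + p + f) \<inter> U = {}"
  proof -
    have "closed_segment (p + a) (p + a + f) \<subseteq> tile (Some s) (p + a) f" by (rule seg_tile)
    moreover have "closed_segment (a + p + f) (a + p) = closed_segment (p + a) (p + a + f)"
      unfolding add.commute[of a p] by (rule closed_segment_commute)
    ultimately show "closed_segment (a + p + f) (a + p) \<inter> U = {}" using sh[OF a] by blast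
    have e1: "a + p + f - \<omega> * f + (\<omega> - 1) * f = a + p" by (simp add: algebra_simps)
    have "closed_segment (a + p + f - \<omega> * f) (a + p) \<subseteq> tile (Some s) (p + (a - ?v)) f"
      using seg_tile[of "a + p + f - \<omega> * f" "(\<omega> - 1) * f" "Some s"] unfolding around_triangle(1) e1 .
    then show "closed_segment (a + p) (a + p + f - \<omega> * f) \<inter> U = {}"
      using sh[OF a'(1)] unfolding closed_segment_commute[of "a + p"] by blast
    have e2: "a + p + f + - (\<omega> * f) = a + p + f - \<omega> * f" by simp
    have "closed_segment (a + p + f) (a + p + f - \<omega> * f) \<subseteq> tile (Some s) (p + (a - \<omega> * ?v)) f"
      using seg_tile[of "a + p + f" "- (\<omega> * f)" "Some s"] unfolding around_triangle(2) e2 .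
    then show "closed_segment (a + p + f - \<omega> * f) (a + p + f) \<inter> U = {}"
      using sh[OF a'(2)] unfolding closed_segment_commute[of "a + p + f - \<omega> * f"] by blast
  qed
  have T3: "?T = convex hull {a + p + f, a + p, a + p + f - \<omega> * f}"
    unfolding tile_def verts_simps by (rule arg_cong[of _ _ "(hull) convex"]) simp
  have fr: "frontier (interior ?T) \<inter> U = {}"
  proof -
    have "frontier ?T = closed_segment (a + p + f) (a + p) \<union> closed_segment (a + p) (a + p + f - \<omega> * f) \<union>
        closed_segment (a + p + f - \<omega> * f) (a + p + f)"
      unfolding T3 by (rule frontier_of_triangle) simp
    then have "frontier (interior ?T) \<subseteq> closed_segment (a + p + f) (a + p) \<union>
        closed_segment (a + p) (a + p + f - \<omega> * f) \<union> closed_segment (a + p + f - \<omega> * f) (a + p + f)"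
      using frontier_interior_subset[of ?T] by simp
    then show ?thesis using seg by blast
  qed
  have "interior ?T \<in> components U"
    unfolding in_components_maximal
  proof (intro conjI allI impI)
    show "interior ?T \<noteq> {}" by (rule tile_interior[OF nf1(1)])
    show "interior ?T \<subseteq> U" by (rule sub)
    show "connected (interior ?T)" by (rule convex_connected, rule convex_interior, rule tile_props(1))
    fix C assume C: "C \<noteq> {} \<and> interior ?T \<subseteq> C \<and> C \<subseteq> U \<and> connected C"
    show "C = interior ?T"
    proof (rule ccontr)
      assume "C \<noteq> interior ?T"
      then have "C - interior ?T \<noteq> {}" using C by blast
      moreover have "C \<inter> interior ?T \<noteq> {}" using C tile_interior[OF nf1(1), of None "a + p + f"] by blast
      ultimately have "C \<inter> frontier (interior ?T) \<noteq> {}" using C connected_Int_frontier by blast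
      then show False using fr C by blast
    qed
  qed
  then show ?thesis unfolding hole_triangles_def U_def using triangle_unit[OF nf1(1)] by (intro CollectI conjI)
qed

text \<open>If both tiles had the common side as a dart in the same direction, their interiors would
  overlap near it; so the triangle is the one outside that side of the shield.\<close>

lemma hole_shares_edge:
  assumes f: "norm f = 1" and T: "T \<in> hole_triangles (tile (Some s) p f) u" and l: "l \<in> shield_lattice u"
    and sh: "shares_edge T ((+) l ` tile (Some s) p f)"
  obtains t x g where "(t, x, g) \<in> hexagon s p f" "T = tile None (l + x + g) (- g)"
proof -
  have ut: "unit_triangle T" and sub: "interior T \<subseteq> - (\<Union>l\<in>shield_lattice u. (+) l ` tile (Some s) p f)"
    using T in_components_subset unfolding hole_triangles_def by blast+
  obtain z d where d: "norm d = 1" and Tz: "T = tile None z d" using triangle_tile[OF ut] by blast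
  obtain e where e: "e edge_of tile None z d" "e edge_of tile (Some s) (p + l) f"
    using sh unfolding shares_edge_def Tz tile_translate by blast
  obtain n l1 z1 d1 where 1: "(next_dart ^^ n) (None, z, d) = (l1, z1, d1)" "e = closed_segment z1 (z1 + d1)"
    by (rule edge_dart[OF d e(1)])
  obtain m l2 z2 d2 where 2: "(next_dart ^^ m) (Some s, p + l, f) = (l2, z2, d2)" "e = closed_segment z2 (z2 + d2)"
    by (rule edge_dart[OF f e(2)])
  have l1: "l1 = None" using triangle_orbit[OF 1(1)] by simp
  obtain t where t: "l2 = Some t" "(t, z2, d2) \<in> hexagon s (p + l) f"
    by (rule hexagon_label[OF 2(1)])
  have T1: "T = tile None z1 d1" using dart_tile_iter[of n "(None, z, d)"] 1(1) l1 Tz by simp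
  have n2: "norm d2 = 1" using hexagon_norm[OF t(2)] f by simp
  have "{z1, z1 + d1} = {z2, z2 + d2}" using 1(2) 2(2) closed_segment_eq by metis
  then have "z1 = z2 \<and> d1 = d2 \<or> z1 = z2 + d2 \<and> d1 = - d2" by (auto simp: doubleton_eq_iff add_eq_0_iff)
  moreover have False if "z1 = z2 \<and> d1 = d2"
  proof -
    have t0: "0 < pi / 6" "pi / 6 < tile_angle None" by simp_all
    have t1: "pi / 6 < tile_angle (Some t)" using tile_angle(3)[of "Some t"] pi_gt_zero by linarith
    obtain e1 where e1: "0 < e1" "\<And>e. 0 < e \<Longrightarrow> e < e1 \<Longrightarrow> z2 + e *\<^sub>R (cis (pi / 6) * d2) \<in> interior (tile None z2 d2)"
      using sector_tile[OF n2 t0(1,2)] by metis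
    obtain e2 where e2: "0 < e2" "\<And>e. 0 < e \<Longrightarrow> e < e2 \<Longrightarrow> z2 + e *\<^sub>R (cis (pi / 6) * d2) \<in> interior (tile (Some t) z2 d2)"
      using sector_tile[OF n2 t0(1) t1] by metis
    obtain e where e: "0 < e" "e < e1" "e < e2" using e1(1) e2(1) by (metis dense min_less_iff_conj)
    have "z2 + e *\<^sub>R (cis (pi / 6) * d2) \<in> interior T" using e1(2)[OF e(1,2)] T1 that by simp
    moreover have "z2 + e *\<^sub>R (cis (pi / 6) * d2) \<in> tile (Some s) (p + l) f"
      using subsetD[OF interior_subset e2(2)[OF e(1,3)]] hexagon_tile[OF t(2)] by simp
    ultimately show False using sub l unfolding tile_translate by blast
  qed
  ultimately have "z1 = z2 + d2 \<and> d1 = - d2" by blast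
  then have "T = tile None (l + (z2 - l) + d2) (- d2)" using T1 by simp
  moreover have "(t, z2 - l, d2) \<in> hexagon s p f" using t(2) hexagon_translate[of t "z2 - l" l d2 s p f] by simp
  ultimately show thesis using that by blast
qed

text \<open>Uniqueness for the definite description: a hole triangle sharing an edge with the shield
  at \<open>l\<close> has its centre at \<open>l - (1 + \<omega>) / 3\<close> times the diagonal of
  that side. The three given sites therefore have equal distances from the centre and determine it,
  and the centre determines the side of the shield at \<open>a\<close>.\<close>

lemma tri_tile_eq:
  assumes f: "norm f = 1" and cen: "centred s p f" and L: "shield_lattice u = lat ((\<omega> + c s) * f)"
    and a: "a \<in> shield_lattice u"
  shows "tri_tile (tile (Some s) p f) u a (a - (\<omega> + c s) * f) (a - \<omega> * ((\<omega> + c s) * f)) = tile None (a + p + f) (- f)"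
  unfolding tri_tile_def
proof (rule the_equality)
  let ?v = "(\<omega> + c s) * f" let ?S = "tile (Some s) p f"
  let ?T = "tile None (a + p + f) (- f)"
  have nf1: "norm (- f) = 1" "norm ((1 - \<omega>) * f) = 1" "norm (\<omega> * f) = 1" "norm ((\<omega> - 1) * f) = 1" "norm (- (\<omega> * f)) = 1"
    using f unit_norms by (simp_all add: norm_mult)
  have s1: "shares_edge ?T ((+) a ` ?S)"
  proof -
    have "closed_segment (a + p + f) (a + p) edge_of ?T" using dart_edge[OF nf1(1), of "a + p + f" None] by simp
    moreover have "closed_segment (a + p) (a + p + f) edge_of tile (Some s) (a + p) f" by (rule dart_edge[OF f])
    ultimately show ?thesis unfolding shares_edge_def tile_translate
      by (metis closed_segment_commute add.commute[of a p])
  qed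
  have s2: "shares_edge ?T ((+) (a - ?v) ` ?S)"
  proof -
    have "closed_segment (a + p) (a + p + (1 - \<omega>) * f) edge_of ?T"
      unfolding outer_triangle_rotations(1) by (rule dart_edge[OF nf1(2)])
    moreover have "closed_segment (a + p + f - \<omega> * f) (a + p + f - \<omega> * f + (\<omega> - 1) * f) edge_of tile (Some s) (p + (a - ?v)) f"
      unfolding around_triangle(1) by (rule dart_edge[OF nf1(4)])
    moreover have "a + p + f - \<omega> * f + (\<omega> - 1) * f = a + p" "a + p + (1 - \<omega>) * f = a + p + f - \<omega> * f"
      by (simp_all add: algebra_simps)
    ultimately show ?thesis unfolding shares_edge_def tile_translate by (metis closed_segment_commute)
  qed
  have s3: "shares_edge ?T ((+) (a - \<omega> * ?v) ` ?S)"
  proof -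
    have "closed_segment (a + p + f - \<omega> * f) (a + p + f - \<omega> * f + \<omega> * f) edge_of ?T"
      unfolding outer_triangle_rotations(2) by (rule dart_edge[OF nf1(3)])
    moreover have "closed_segment (a + p + f) (a + p + f + - (\<omega> * f)) edge_of tile (Some s) (p + (a - \<omega> * ?v)) f"
      unfolding around_triangle(2) by (rule dart_edge[OF nf1(5)])
    moreover have "a + p + f + - (\<omega> * f) = a + p + f - \<omega> * f" "a + p + f - \<omega> * f + \<omega> * f = a + p + f" by simp_all
    ultimately show ?thesis unfolding shares_edge_def tile_translate by (metis closed_segment_commute)
  qed
  show "?T \<in> hole_triangles ?S u \<and> (\<forall>l\<in>{a, a - ?v, a - \<omega> * ?v}. shares_edge ?T ((+) l ` ?S))"
    using outer_triangle_hole[OF f cen L a] s1 s2 s3 by blast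
  fix T assume T: "T \<in> hole_triangles ?S u \<and> (\<forall>l\<in>{a, a - ?v, a - \<omega> * ?v}. shares_edge T ((+) l ` ?S))"
  obtain i j where ij: "a = (of_int i + of_int j * \<omega>) * ?v" using a unfolding L lat_def by blast
  have "a - ?v = (of_int (i - 1) + of_int j * \<omega>) * ?v" "a - \<omega> * ?v = (of_int i + of_int (j - 1) * \<omega>) * ?v"
    unfolding ij by (simp_all add: algebra_simps)
  then have a': "a - ?v \<in> shield_lattice u" "a - \<omega> * ?v \<in> shield_lattice u" unfolding L lat_def by blast+
  obtain z d where d: "norm d = 1" and Tz: "T = tile None z d"
    using triangle_tile T unfolding hole_triangles_def by blast
  define K where "K = 3 * z + (1 + \<omega>) * d"
  have near: "\<exists>t x g. (t, x, g) \<in> hexagon s p f \<and> T = tile None (l + x + g) (- g) \<and> K = 3 * l - (1 + \<omega>) * ((\<omega> + c t) * g)"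
    if l: "l \<in> {a, a - ?v, a - \<omega> * ?v}" for l
  proof -
    have ll: "l \<in> shield_lattice u" using l a a' by blast
    obtain t x g where h: "(t, x, g) \<in> hexagon s p f" "T = tile None (l + x + g) (- g)"
      using hole_shares_edge[OF f _ ll] T l by metis
    have g: "norm (- g) = 1" using hexagon_norm[OF h(1)] f by simp
    have "K = 3 * (l + x + g) + (1 + \<omega>) * (- g)" unfolding K_def
      by (rule triangle_centre[OF d g]) (use h Tz in simp)
    also have "\<dots> = 3 * l + 3 * x + 3 * g - (1 + \<omega>) * g" by (simp add: algebra_simps)
    also have "\<dots> = 3 * l - (1 + \<omega>) * ((\<omega> + c t) * g)"
      using centred_hexagon[OF cen h(1)] unfolding centred_def by (simp add: nf)
    finally show ?thesis using h by blast
  qed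
  have v0: "?v \<noteq> 0" using diagonal_norm[of s] f by auto
  have dist3: "(norm ((K - 3 * l) / ?v))\<^sup>2 = 3" if l: "l \<in> {a, a - ?v, a - \<omega> * ?v}" for l
  proof -
    obtain t x g where h: "(t, x, g) \<in> hexagon s p f" "K = 3 * l - (1 + \<omega>) * ((\<omega> + c t) * g)" using near[OF l] by blast
    obtain k where k: "k \<in> {1, \<omega>, \<omega> - 1, - 1, - \<omega>, 1 - \<omega>}" "(\<omega> + c t) * g = k * ?v"
      using diagonal_hexagon[OF h(1)] by metis
    have nk: "norm k = 1" using k(1) unit_norms by auto
    have "(K - 3 * l) / ?v = - ((1 + \<omega>) * k)" unfolding h(2) k(2) using v0 by simp
    then show ?thesis using sqrt3_norms(1) nk by (simp add: norm_mult)
  qed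
  define w where "w = (K - 3 * a) / ?v"
  have "(K - 3 * (a - ?v)) / ?v = w + 3" "(K - 3 * (a - \<omega> * ?v)) / ?v = w + 3 * \<omega>"
  proof -
    have "K - 3 * (a - ?v) = (K - 3 * a) + 3 * ?v" "K - 3 * (a - \<omega> * ?v) = (K - 3 * a) + 3 * \<omega> * ?v"
      by (simp_all add: algebra_simps)
    then show "(K - 3 * (a - ?v)) / ?v = w + 3" "(K - 3 * (a - \<omega> * ?v)) / ?v = w + 3 * \<omega>"
      unfolding w_def using v0 by (simp_all only: add_divide_distrib nonzero_mult_div_cancel_right not_False_eq_True)
  qed
  then have "w = - (1 + \<omega>)"
    using dist3[of a] dist3[of "a - ?v"] dist3[of "a - \<omega> * ?v"] unfolding w_def[symmetric] by (intro three_distances) simp_all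
  obtain t x g where h: "(t, x, g) \<in> hexagon s p f" "T = tile None (a + x + g) (- g)"
    "K = 3 * a - (1 + \<omega>) * ((\<omega> + c t) * g)" using near[of a] by blast
  obtain k where k: "(\<omega> + c t) * g = k * ?v" "k = 1 \<Longrightarrow> (t, x, g) = (s, p, f)"
    using diagonal_hexagon[OF h(1)] by metis
  have "- (1 + \<omega>) = - ((1 + \<omega>) * k)"
    using \<open>w = - (1 + \<omega>)\<close> v0 unfolding w_def h(3) k(1) by simp
  moreover have "1 + \<omega> \<noteq> 0" by (simp add: omega_Complex complex_eq_iff)
  ultimately have "(1 + \<omega>) * k = (1 + \<omega>) * 1" by (simp only: mult_1_right neg_equal_iff_equal)
  then have "k = 1" unfolding mult_cancel_left using \<open>1 + \<omega> \<noteq> 0\<close> by blast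
  then show "T = ?T" using k(2) h(2) by simp
qed

lemma apex_eq:
  assumes f: "norm f = 1"
  shows "apex (tile None (a + p + f) (- f)) ((+) a ` tile (Some s) p f) = a + p + (1 - \<omega>) * f"
  unfolding apex_def
proof (rule the_equality)
  have nf: "norm (- f) = 1" using f by simp
  have v: "x extreme_point_of tile None (a + p + f) (- f) \<longleftrightarrow> x = a + p + f \<or> x = a + p \<or> x = a + p + (1 - \<omega>) * f" for x
    unfolding tile_extreme[OF nf] verts_simps by (auto simp: algebra_simps)
  have i: "Im ((a + p + (1 - \<omega>) * f - (p + a)) * cnj f) < 0"
  proof -
    have "(a + p + (1 - \<omega>) * f - (p + a)) * cnj f = (1 - \<omega>) * (f * cnj f)" by (simp add: algebra_simps)
    then have "(a + p + (1 - \<omega>) * f - (p + a)) * cnj f = 1 - \<omega>"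
      unfolding norm_1_cnj[OF f] by (simp only: mult_1_right)
    moreover have "Im (1 - \<omega>) < 0" using Im_omega by simp
    ultimately show ?thesis by (simp only:)
  qed
  show "a + p + (1 - \<omega>) * f extreme_point_of tile None (a + p + f) (- f) \<and> a + p + (1 - \<omega>) * f \<notin> (+) a ` tile (Some s) p f"
    unfolding v tile_translate using i tile_side[OF f, of _ "Some s" "p + a"] by force
  fix x assume x: "x extreme_point_of tile None (a + p + f) (- f) \<and> x \<notin> (+) a ` tile (Some s) p f"
  have "a + p \<in> tile (Some s) (p + a) f" "a + p + f \<in> tile (Some s) (p + a) f"
    using z_verts(1,2)[of "p + a"] tile_props(5)[of "Some s" "p + a" f] by (metis add.commute subsetD)+
  then show "x = a + p + (1 - \<omega>) * f" using x unfolding v tile_translate by blast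
qed

end

section \<open>Shield triangles\<close>

context shield_angle begin

text \<open>\<open>zb s\<close> is the initial vertex of the shield centred at the origin whose first side has direction \<open>1\<close>.\<close>

definition zb where "zb s = - ((1 + \<omega>) * (1 + c s) / 3)"
definition v0 where "v0 s = \<omega> + c s"
definition S0 where "S0 s = tile (Some s) (zb s) 1"
text \<open>The vector has to start in an \<open>\<alpha>\<close>-vertex. If \<open>s\<close> is
  false, this is the vertex after \<open>zb s\<close>, whose diagonal is
  \<open>\<omega> * v0 s\<close>.\<close>

definition u0 where "u0 s = (if s then v0 s else \<omega> * v0 s)"

lemma centred_zb: "centred s (zb s) 1"
  unfolding centred_def zb_def by simp

lemma v0_norm: "v0 s \<noteq> 0"
  using diagonal_norm[of s] unfolding v0_def by auto

lemma lat_u0: "shield_lattice (u0 s) = lat (v0 s)"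
  unfolding shield_lattice_lat u0_def using lat_omega by simp

lemma norm_u0: "norm (u0 s) = norm (v0 s)"
  unfolding u0_def by (simp add: norm_mult unit_norms)

lemma shield_frame_S0: "shield_frame \<alpha> (S0 s) (u0 s) (v0 s) (\<omega> * v0 s)"
  unfolding shield_frame_def
proof (intro conjI)
  show "\<exists>q. shield_vertices \<alpha> q \<and> S0 s = convex hull (q ` {..<6}) \<and> u0 s = q 3 - q 0"
  proof (cases s)
    case True
    have "u0 s = hexv (zb s) 1 3 - hexv (zb s) 1 0" unfolding u0_def v0_def hexv_simps using True by simp
    moreover have "S0 s = convex hull (hexv (zb s) 1 ` {..<6})" unfolding S0_def tile_def hexv_image using True by simp
    moreover have "shield_vertices \<alpha> (hexv (zb s) 1)" by (rule shield_vertices_hexv) simp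
    ultimately show ?thesis by blast
  next
    case False
    have S: "S0 s = tile (Some True) (zb s + 1) (c False)"
      using hexagon_tile[of True "zb s + 1" "c False" False "zb s" 1] False
      unfolding S0_def hexagon_darts_def by simp
    have "u0 s = hexv (zb s + 1) (c False) 3 - hexv (zb s + 1) (c False) 0"
      unfolding u0_def v0_def hexv_simps using False by (simp add: c_TF nf)
    moreover have "S0 s = convex hull (hexv (zb s + 1) (c False) ` {..<6})" unfolding S tile_def hexv_image ..
    moreover have "shield_vertices \<alpha> (hexv (zb s + 1) (c False))" by (rule shield_vertices_hexv) (rule c_norm)
    ultimately show ?thesis by blast
  qed
  have "rotation 0 (2 * pi / 3) = (\<lambda>x. 0 + (\<omega> - 1) * x)"
  proof
    fix x
    have "cis (2 * pi / 3) = \<omega> - 1" unfolding omega_sq[symmetric] by (simp add: \<omega>_def cis_mult)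
    then show "rotation 0 (2 * pi / 3) x = 0 + (\<omega> - 1) * x" unfolding rotation_def by simp
  qed
  then have "rotation 0 (2 * pi / 3) ` S0 s = tile (Some s) (0 + (\<omega> - 1) * zb s) ((\<omega> - 1) * 1)"
    unfolding S0_def by (simp only: tile_image)
  also have "\<dots> = S0 s"
  proof -
    have z: "3 * zb s = - ((1 + \<omega>) * (1 + c s))" using centred_zb unfolding centred_def by simp
    have "3 * ((\<omega> - 1) * zb s) = (\<omega> - 1) * (3 * zb s)" by simp
    also have "\<dots> = 3 * zb s + 3 + 3 * c s" unfolding z by (simp add: nf)
    also have "\<dots> = 3 * (zb s + 1 + c s)" by simp
    finally have t: "3 * ((\<omega> - 1) * zb s) = 3 * (zb s + 1 + c s)" .
    have "x = y" if "3 * x = 3 * y" for x y :: complex using that by simp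
    from this[OF t] have "0 + (\<omega> - 1) * zb s = zb s + 1 + c s * 1" by (simp only: add_0 mult_1_right)
    then have "(s, 0 + (\<omega> - 1) * zb s, (\<omega> - 1) * 1) \<in> hexagon s (zb s) 1" unfolding hexagon_darts_def by simp
    from hexagon_tile[OF this] show ?thesis unfolding S0_def .
  qed
  finally show "rotation 0 (2 * pi / 3) ` S0 s = S0 s" .
  have "v0 s = (of_int 1 + of_int 0 * \<omega>) * v0 s" "\<omega> * v0 s = (of_int 0 + of_int 1 * \<omega>) * v0 s" by simp_all
  then show "v0 s \<in> shield_lattice (u0 s)" "\<omega> * v0 s \<in> shield_lattice (u0 s)"
    unfolding lat_u0 lat_def by blast+
  show "norm (v0 s) = norm (u0 s)" "norm (\<omega> * v0 s) = norm (u0 s)"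
    unfolding norm_u0 by (simp_all add: norm_mult unit_norms)
  have "inner (v0 s) (\<omega> * v0 s) = (norm (v0 s))\<^sup>2 / 2"
    unfolding cmod_power2 by (simp add: inner_complex_def omega_Complex power2_eq_square field_simps)
  then have "inner (v0 s) (\<omega> * v0 s) / (norm (v0 s) * norm (\<omega> * v0 s)) = cos (pi / 3)"
    using v0_norm[of s] by (simp add: norm_mult unit_norms power2_eq_square cos_60)
  then show "vec_angle (v0 s) (\<omega> * v0 s) = pi / 3" unfolding vec_angle_def by (simp only:) (simp add: arccos_cos)
qed

end

section \<open>Tilings without shields\<close>

context shield_plane begin

text \<open>Turning about a vertex and crossing sides produce six darts at every point of a
  triangular lattice; these are closed under both moves, so by connectedness they are all.\<close>

lemma regular_tiling:
  assumes no: "\<And>s z d. \<not> D (Some s) z d"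
  shows "shield_triangle_tiling \<alpha> \<T>"
proof -
  obtain X0 where "X0 \<in> \<T>" using cover by blast
  then obtain l z0 d where 0: "D l z0 d" using tile_rep by blast
  have N: "D None z f" if "D l z f" for l z f using that no by (cases l) auto
  have z0: "DN z0 d" using N[OF 0] .
  have d: "norm d = 1" using z0 unfolding D_def by simp
  have rot: "DN z (\<omega> * f)" if "DN z f" for z f
    using rotate[OF that] N unfolding tile_turn_cis[symmetric] by auto
  have rev: "DN (z + f) (- f)" if "DN z f" for z f using neighbour[OF that] N by blast
  have fw: "DN (z + f) f" if "DN z f" for z f
    using rot[OF rot[OF rot[OF rev[OF that]]]] by (simp add: nf)
  have six: "DN z (\<omega> * f)" "DN z ((\<omega> - 1) * f)" "DN z (- f)" "DN z (- (\<omega> * f))" "DN z ((1 - \<omega>) * f)"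
    if "DN z f" for z f
    using rot[OF that] rot[OF rot[OF that]] rot[OF rot[OF rot[OF that]]]
      rot[OF rot[OF rot[OF rot[OF that]]]] rot[OF rot[OF rot[OF rot[OF rot[OF that]]]]] by (simp_all add: nf)
  have st: "DN (z + of_int n * d) d" if "DN z d" for n :: int and z
  proof (induction n rule: int_induct[where k = 0])
    case base then show ?case using that by simp
  next
    case (step1 i) show ?case using fw[OF step1(2)] by (simp add: algebra_simps)
  next
    case (step2 i)
    have "DN (z + of_int i * d + - d) (- d)" by (rule fw[OF six(3)[OF step2(2)]])
    from six(3)[OF this] show ?case by (simp add: algebra_simps)
  qed
  have st': "DN (z + of_int n * (\<omega> * d)) d" if "DN z d" for n :: int and z
  proof (induction n rule: int_induct[where k = 0])
    case base then show ?case using that by simp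
  next
    case (step1 i)
    have "DN (z + of_int i * (\<omega> * d) + \<omega> * d) (\<omega> * d)" by (rule fw[OF six(1)[OF step1(2)]])
    from six(5)[OF this] show ?case by (simp add: nf)
  next
    case (step2 i)
    have "DN (z + of_int i * (\<omega> * d) + - (\<omega> * d)) (- (\<omega> * d))" by (rule fw[OF six(4)[OF step2(2)]])
    from six(2)[OF this] show ?case by (simp add: nf)
  qed
  have all: "DN (z0 + (of_int i + of_int j * \<omega>) * d) d" for i j
    using st'[OF st[OF z0]] by (simp add: algebra_simps)
  define Z where "Z = {z0 + (of_int i + of_int j * \<omega>) * d | i j. True}"
  have Zs: "z + k * d \<in> Z" if zk: "z \<in> Z" "k \<in> {1, \<omega>, \<omega> - 1, - 1, - \<omega>, 1 - \<omega>}" for z k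
  proof -
    obtain i j where z: "z = z0 + (of_int i + of_int j * \<omega>) * d" using zk(1) unfolding Z_def by blast
    have "z + 1 * d = z0 + (of_int (i + 1) + of_int j * \<omega>) * d"
      "z + \<omega> * d = z0 + (of_int i + of_int (j + 1) * \<omega>) * d"
      "z + (\<omega> - 1) * d = z0 + (of_int (i - 1) + of_int (j + 1) * \<omega>) * d"
      "z + - 1 * d = z0 + (of_int (i - 1) + of_int j * \<omega>) * d"
      "z + - \<omega> * d = z0 + (of_int i + of_int (j - 1) * \<omega>) * d"
      "z + (1 - \<omega>) * d = z0 + (of_int (i + 1) + of_int (j - 1) * \<omega>) * d"
      unfolding z by (simp_all add: algebra_simps)
    then show ?thesis using zk(2) unfolding Z_def by blast
  qed
  define R where "R l z f \<longleftrightarrow> l = None \<and> z \<in> Z \<and> (\<exists>k\<in>{1, \<omega>, \<omega> - 1, - 1, - \<omega>, 1 - \<omega>}. f = k * d)" for l :: "bool option" and z f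
  have Rall: "R l z f" if "D l z f" for l z f
  proof (rule connected_tiles[OF _ _ _ _ that])
    show "D l z f" if r: "R l z f" for l z f
    proof -
      obtain i j k where z: "z = z0 + (of_int i + of_int j * \<omega>) * d" and k: "k \<in> {1, \<omega>, \<omega> - 1, - 1, - \<omega>, 1 - \<omega>}" "f = k * d"
        and l: "l = None" using r unfolding R_def Z_def by blast
      show ?thesis using all[of i j] six[OF all[of i j]] k(1) unfolding l z k(2) by auto
    qed
    have km: "(\<omega> - 1) * k \<in> {1, \<omega>, \<omega> - 1, - 1, - \<omega>, 1 - \<omega>}" "- k \<in> {1, \<omega>, \<omega> - 1, - 1, - \<omega>, 1 - \<omega>}"
      if "k \<in> {1, \<omega>, \<omega> - 1, - 1, - \<omega>, 1 - \<omega>}" for k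
    proof -
      have "(\<omega> - 1) * 1 = \<omega> - 1" "(\<omega> - 1) * \<omega> = - 1" "(\<omega> - 1) * (\<omega> - 1) = - \<omega>" "(\<omega> - 1) * (- 1) = 1 - \<omega>"
        "(\<omega> - 1) * (- \<omega>) = 1" "(\<omega> - 1) * (1 - \<omega>) = \<omega>" "- (1 - \<omega>) = \<omega> - 1" "- (\<omega> - 1) = 1 - \<omega>" by (simp_all add: nf)
      then show "(\<omega> - 1) * k \<in> {1, \<omega>, \<omega> - 1, - 1, - \<omega>, 1 - \<omega>}" "- k \<in> {1, \<omega>, \<omega> - 1, - 1, - \<omega>, 1 - \<omega>}"
        using that unfolding insert_iff empty_iff by (elim disjE; simp)+
    qed
    show "case next_dart (l, z, f) of (l', z', d') \<Rightarrow> R l' z' d'" if r: "R l z f" for l z f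
    proof -
      obtain k where k: "k \<in> {1, \<omega>, \<omega> - 1, - 1, - \<omega>, 1 - \<omega>}" "f = k * d" and l: "l = None" "z \<in> Z"
        using r unfolding R_def by blast
      have "(\<omega> - 1) * f = ((\<omega> - 1) * k) * d" unfolding k(2) by (simp only: mult.assoc)
      moreover have "z + f \<in> Z" unfolding k(2) by (rule Zs[OF l(2) k(1)])
      ultimately show ?thesis unfolding l(1) next_dart.simps prod.case R_def using km(1)[OF k(1)] by blast
    qed
    show "\<exists>l'. R l' (z + f) (- f)" if r: "R l z f" for l z f
    proof -
      obtain k where k: "k \<in> {1, \<omega>, \<omega> - 1, - 1, - \<omega>, 1 - \<omega>}" "f = k * d" and l: "l = None" "z \<in> Z"
        using r unfolding R_def by blast
      have "- f = (- k) * d" unfolding k(2) by simp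
      moreover have "z + f \<in> Z" unfolding k(2) by (rule Zs[OF l(2) k(1)])
      ultimately show ?thesis unfolding R_def using km(2)[OF k(1)] by blast
    qed
    have "z0 = z0 + (of_int 0 + of_int 0 * \<omega>) * d" by simp
    then have "z0 \<in> Z" unfolding Z_def by blast
    moreover have "d = 1 * d" by simp
    ultimately show "R None z0 d" unfolding R_def by blast
  qed
  let ?f = "\<lambda>x. z0 + d * x"
  have reg: "regular_triangle_tiles = {tile None w k | w k. (\<exists>i j. w = of_int i + of_int j * \<omega>) \<and> (k = 1 \<or> k = 1 - \<omega>)}"
  proof -
    have c: "cis (pi / 3) = \<omega>" "cis (- pi / 3) = 1 - \<omega>"
      by (simp_all add: \<omega>_def complex_eq_iff cos_60 sin_60)
    have t1: "convex hull {w, w + 1, w + \<omega>} = tile None w 1" for w unfolding tile_def verts_simps by simp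
    have t2: "convex hull {w, w + 1, w + (1 - \<omega>)} = tile None w (1 - \<omega>)" for w
    proof -
      have "\<omega> * (1 - \<omega>) = 1" by (simp add: nf)
      then show ?thesis unfolding tile_def verts_simps by (simp only: insert_commute)
    qed
    show ?thesis unfolding regular_triangle_tiles_def
    proof (intro equalityI subsetI)
      fix B assume "B \<in> {convex hull {z, z + 1, z + cis \<theta>} | z \<theta>.
        z \<in> {of_int i + of_int j * cis (pi / 3) | i j. True} \<and> \<theta> \<in> {pi / 3, - pi / 3}}"
      then obtain w \<theta> where w: "B = convex hull {w, w + 1, w + cis \<theta>}" "\<exists>i j. w = of_int i + of_int j * \<omega>" "\<theta> = pi / 3 \<or> \<theta> = - pi / 3"
        unfolding c(1) by blast
      from w(3) show "B \<in> {tile None w k | w k. (\<exists>i j. w = of_int i + of_int j * \<omega>) \<and> (k = 1 \<or> k = 1 - \<omega>)}"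
      proof
        assume t: "\<theta> = pi / 3"
        have "B = tile None w 1" unfolding w(1) t c(1) t1 ..
        then show ?thesis using w(2) by blast
      next
        assume t: "\<theta> = - pi / 3"
        have "B = tile None w (1 - \<omega>)" unfolding w(1) t c(2) t2 ..
        then show ?thesis using w(2) by blast
      qed
    next
      fix B assume "B \<in> {tile None w k | w k. (\<exists>i j. w = of_int i + of_int j * \<omega>) \<and> (k = 1 \<or> k = 1 - \<omega>)}"
      then obtain w k where w: "B = tile None w k" "\<exists>i j. w = of_int i + of_int j * \<omega>" "k = 1 \<or> k = 1 - \<omega>" by blast
      from w(3) have "\<exists>\<theta>\<in>{pi / 3, - pi / 3}. B = convex hull {w, w + 1, w + cis \<theta>}"
      proof
        assume "k = 1"
        then have "B = convex hull {w, w + 1, w + cis (pi / 3)}" unfolding w(1) c t1 by simp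
        then show ?thesis by blast
      next
        assume "k = 1 - \<omega>"
        then have "B = convex hull {w, w + 1, w + cis (- pi / 3)}" unfolding w(1) c t2 by simp
        then show ?thesis by blast
      qed
      then show "B \<in> {convex hull {z, z + 1, z + cis \<theta>} | z \<theta>.
        z \<in> {of_int i + of_int j * cis (pi / 3) | i j. True} \<and> \<theta> \<in> {pi / 3, - pi / 3}}"
        using w(2) unfolding c(1) by blast
    qed
  qed
  have im: "?f ` tile None w k = tile None (z0 + d * w) (d * k)" for w k by (rule tile_image[symmetric])
  have "\<T> = (`) ?f ` regular_triangle_tiles"
  proof (intro equalityI subsetI)
    fix B assume "B \<in> \<T>"
    then obtain l z f where D: "D l z f" and B: "B = tile l z f" using tile_rep by blast
    obtain k where k: "k \<in> {1, \<omega>, \<omega> - 1, - 1, - \<omega>, 1 - \<omega>}" "f = k * d" and l: "l = None" "z \<in> Z"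
      using Rall[OF D] unfolding R_def by blast
    have orb: "tile None z f = tile None (z + f) ((\<omega> - 1) * f)" "tile None z f = tile None (z + \<omega> * f) (- (\<omega> * f))" for z f
    proof -
      have "(next_dart ^^ 1) (None, z, f) = (None, z + f, (\<omega> - 1) * f)" "(next_dart ^^ 2) (None, z, f) = (None, z + \<omega> * f, - (\<omega> * f))"
        by (simp_all add: eval_nat_numeral nf)
      then show "tile None z f = tile None (z + f) ((\<omega> - 1) * f)" "tile None z f = tile None (z + \<omega> * f) (- (\<omega> * f))"
        using dart_tile_iter[of 1 "(None, z, f)"] dart_tile_iter[of 2 "(None, z, f)"] by simp_all
    qed
    \<comment> \<open>The three directions of a triangle differ by rotations by
      \<open>2 * pi / 3\<close>, so exactly one of them is \<open>d\<close> or
      \<open>(1 - \<omega>) * d\<close>. These are the two shapes in the definition of the regular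
      tiling.\<close>
    have "\<exists>y\<in>Z. \<exists>e\<in>{1, 1 - \<omega>}. B = tile None y (d * e)"
    proof -
      have g: ?thesis if "B = tile None y (d * e)" "y \<in> Z" "e = 1 \<or> e = 1 - \<omega>" for y e using that by blast
      from k(1) consider "k = 1" | "k = \<omega>" | "k = \<omega> - 1" | "k = - 1" | "k = - \<omega>" | "k = 1 - \<omega>" by blast
      then show ?thesis
      proof cases
        case 1 show ?thesis by (rule g[of z 1]) (simp_all add: B l k(2) 1)
      next
        case 2
        show ?thesis by (rule g[of "z + (\<omega> - 1) * d" "1 - \<omega>"])
          (use orb(2)[of z f] Zs[OF l(2), of "\<omega> - 1"] in \<open>simp_all add: B l(1) k(2) 2 nf\<close>)
      next
        case 3
        show ?thesis by (rule g[of "z + - 1 * d" 1])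
          (use orb(2)[of z f] Zs[OF l(2), of "- 1"] in \<open>simp_all add: B l(1) k(2) 3 nf\<close>)
      next
        case 4
        show ?thesis by (rule g[of "z + - 1 * d" "1 - \<omega>"])
          (use orb(1)[of z f] Zs[OF l(2), of "- 1"] in \<open>simp_all add: B l(1) k(2) 4 nf\<close>)
      next
        case 5
        show ?thesis by (rule g[of "z + - \<omega> * d" 1])
          (use orb(1)[of z f] Zs[OF l(2), of "- \<omega>"] in \<open>simp_all add: B l(1) k(2) 5 nf\<close>)
      next
        case 6 show ?thesis by (rule g[of z "1 - \<omega>"]) (use l(2) in \<open>simp_all add: B l(1) k(2) 6 mult.commute\<close>)
      qed
    qed
    then obtain y e where y: "y \<in> Z" "e = 1 \<or> e = 1 - \<omega>" "B = tile None y (d * e)" by blast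
    obtain i j where "y = z0 + (of_int i + of_int j * \<omega>) * d" using y(1) unfolding Z_def by blast
    then have "B = ?f ` tile None (of_int i + of_int j * \<omega>) e" unfolding im y(3) by (simp add: mult.commute)
    then show "B \<in> (`) ?f ` regular_triangle_tiles" unfolding reg using y(2) by blast
  next
    fix B assume "B \<in> (`) ?f ` regular_triangle_tiles"
    then obtain i j k where k: "k = 1 \<or> k = 1 - \<omega>" "B = ?f ` tile None (of_int i + of_int j * \<omega>) k" unfolding reg by blast
    have "DN (z0 + (of_int i + of_int j * \<omega>) * d) (k * d)" using k(1) all[of i j] six(5)[OF all[of i j]] by auto
    then show "B \<in> \<T>" unfolding k(2) im D_def by (simp add: mult.commute)
  qed
  moreover have "T_tiles (S0 True) (u0 True) (v0 True) (\<omega> * v0 True) 0 = regular_triangle_tiles"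
    unfolding T_tiles_def zero_enat_def by simp
  moreover have "dist (?f x) (?f y) = dist x y" for x y
  proof -
    have "?f x - ?f y = d * (x - y)" by (simp add: algebra_simps)
    then show ?thesis unfolding dist_norm using d by (simp add: norm_mult)
  qed
  ultimately show ?thesis unfolding shield_triangle_tiling_def using tiling shield_frame_S0[of True] by metis
qed

end

section \<open>Lattice sites and the triangles of a patch\<close>

context shield_angle begin

definition site where "site s i j = (of_nat i + of_nat j * \<omega>) * v0 s"
definition sites where "sites s K = {site s i j | i j. enat (i + j) < K}"

lemma site_lat: "site s i j \<in> lat (v0 s)"
  unfolding site_def lat_def by (metis (mono_tags, lifting) mem_Collect_eq of_int_of_nat_eq)

lemma lat_coords:
  assumes "(of_int i + of_int j * \<omega>) * v0 s = (of_int k + of_int l * \<omega>) * v0 s"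
  shows "i = k" "j = l"
proof -
  have e: "of_int i + of_int j * \<omega> = of_int k + of_int l * \<omega>" using assms v0_norm[of s] by simp
  from arg_cong[OF e, of Im] show j: "j = l" by (simp add: omega_Complex)
  from arg_cong[OF e, of Re] j show "i = k" by simp
qed

lemma site_eq: "site s i j = (of_int (int i) + of_int (int j) * \<omega>) * v0 s"
  unfolding site_def by simp

lemma sites_iff:
  "(of_int a + of_int b * \<omega>) * v0 s \<in> sites s K \<longleftrightarrow> 0 \<le> a \<and> 0 \<le> b \<and> enat (nat (a + b)) < K"
proof
  assume "(of_int a + of_int b * \<omega>) * v0 s \<in> sites s K"
  then obtain i j where ij: "enat (i + j) < K"
    "(of_int a + of_int b * \<omega>) * v0 s = (of_int (int i) + of_int (int j) * \<omega>) * v0 s"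
    unfolding sites_def site_eq by blast
  show "0 \<le> a \<and> 0 \<le> b \<and> enat (nat (a + b)) < K"
    using lat_coords[OF ij(2)] ij(1) by (simp add: nat_int_add)
next
  assume r: "0 \<le> a \<and> 0 \<le> b \<and> enat (nat (a + b)) < K"
  then have "(of_int a + of_int b * \<omega>) * v0 s = site s (nat a) (nat b)" unfolding site_eq by simp
  moreover have "nat (a + b) = nat a + nat b" using r by (intro nat_add_distrib) simp_all
  then have "enat (nat a + nat b) < K" using r by simp
  ultimately show "(of_int a + of_int b * \<omega>) * v0 s \<in> sites s K" unfolding sites_def by blast
qed

lemma tri_tile_cong: "{a, b, e} = {a', b', e'} \<Longrightarrow> tri_tile S u a b e = tri_tile S u a' b' e'"
  unfolding tri_tile_def by (simp only:)

lemma tri_tile_dart: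
  assumes h: "(t, x, g) \<in> hexagon s (zb s) 1" and l: "l \<in> lat (v0 s)"
  shows "tri_tile (S0 s) (u0 s) l (l - (\<omega> + c t) * g) (l - \<omega> * ((\<omega> + c t) * g)) = tile None (l + x + g) (- g)"
proof -
  have g: "norm g = 1" using hexagon_norm[OF h] by simp
  have c: "centred t x g" by (rule centred_hexagon[OF centred_zb h])
  have L: "shield_lattice (u0 s) = lat ((\<omega> + c t) * g)" unfolding lat_u0 lat_hexagon[OF h] v0_def by simp
  have l': "l \<in> shield_lattice (u0 s)" unfolding lat_u0 by (rule l)
  show ?thesis using tri_tile_eq[OF g c L l'] unfolding S0_def hexagon_tile[OF h] .
qed

lemma diagonal_dart:
  assumes "k \<in> {1, \<omega>, \<omega> - 1, - 1, - \<omega>, 1 - \<omega>}"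
  obtains t x g where "(t, x, g) \<in> hexagon s z d" "(\<omega> + c t) * g = k * ((\<omega> + c s) * d)"
proof -
  note h = hexagon_darts_def[of c s z d]
  from assms consider "k = 1" | "k = \<omega>" | "k = \<omega> - 1" | "k = - 1" | "k = - \<omega>" | "k = 1 - \<omega>" by blast
  then show thesis
  proof cases
    case 1 show ?thesis by (rule that[of s z d]) (simp add: h, simp add: 1 nf)
  next
    case 2 show ?thesis by (rule that[of "\<not> s" "z + d" "c s * d"]) (simp add: h, simp add: 2 nf)
  next
    case 3 show ?thesis by (rule that[of s "z + d + c s * d" "(\<omega> - 1) * d"]) (simp add: h, simp add: 3 nf)
  next
    case 4 show ?thesis by (rule that[of "\<not> s" "z + \<omega> * d + c s * d" "(\<omega> - 1) * (c s * d)"]) (simp add: h, simp add: 4 nf)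
  next
    case 5 show ?thesis by (rule that[of s "z + \<omega> * d + \<omega> * (c s * d)" "- (\<omega> * d)"]) (simp add: h, simp add: 5 nf)
  next
    case 6 show ?thesis by (rule that[of "\<not> s" "z + \<omega> * (c s * d)" "- (\<omega> * (c s * d))"]) (simp add: h, simp add: 6 nf)
  qed
qed

text \<open>Four times the norm form is \<open>(2 * i + j)\<^sup>2 + 3 * j * j\<close>, so norm 1
  forces \<open>\<bar>j\<bar> \<le> 1\<close>, and by symmetry the same holds for
  \<open>i\<close>.\<close>

lemma unit_lattice:
  fixes i j :: int
  assumes "norm (of_int i + of_int j * \<omega>) = 1"
  shows "of_int i + of_int j * \<omega> \<in> {1, \<omega>, \<omega> - 1, - 1, - \<omega>, 1 - \<omega>}"
proof -
  have "(norm (of_int i + of_int j * \<omega>))\<^sup>2 = of_int (i * i + i * j + j * j)"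
    unfolding cmod_power2 by (simp add: omega_Complex power2_eq_square algebra_simps)
  then have "real_of_int (i * i + i * j + j * j) = of_int 1" using assms by simp
  then have q: "i * i + i * j + j * j = 1" by (simp only: of_int_eq_iff)
  have bound: "\<bar>b\<bar> \<le> 1" if "a * a + a * b + b * b = 1" for a b :: int
  proof (rule ccontr)
    assume "\<not> \<bar>b\<bar> \<le> 1"
    then have "2 * 2 \<le> \<bar>b\<bar> * \<bar>b\<bar>" by (intro mult_mono) auto
    then have "4 \<le> b * b" by simp
    moreover have "(2 * a + b)\<^sup>2 = 4 * (a * a + a * b + b * b) - 3 * (b * b)" by (simp add: power2_eq_square algebra_simps)
    then have "0 \<le> 4 - 3 * (b * b)" unfolding that by (metis mult_1_right zero_le_power2)
    ultimately show False by linarith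
  qed
  have "\<bar>j\<bar> \<le> 1" by (rule bound[OF q])
  moreover have "\<bar>i\<bar> \<le> 1" by (rule bound[of j i]) (use q in \<open>simp add: algebra_simps\<close>)
  ultimately consider "j = 0" "i = 1 \<or> i = 0 \<or> i = - 1" | "j = 1" "i = 1 \<or> i = 0 \<or> i = - 1" | "j = - 1" "i = 1 \<or> i = 0 \<or> i = - 1" by linarith
  then show ?thesis
  proof cases
    case 1 then show ?thesis using q by auto
  next
    case 2 then show ?thesis using q by auto
  next
    case 3 then show ?thesis using q by auto
  qed
qed

lemma equilateral_units:
  assumes "norm k = 1" "norm m = 1" "norm (k - m) = 1"
  shows "m = \<omega> * k \<or> k = \<omega> * m"
proof -
  define q where "q = m / k"
  have k0: "k \<noteq> 0" using assms(1) by auto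
  have m: "m = q * k" unfolding q_def using k0 by simp
  have "norm q = 1" unfolding q_def using assms by (simp add: norm_divide)
  moreover have "k - m = (1 - q) * k" unfolding m by (simp add: algebra_simps)
  then have "norm (1 - q) = 1" using assms(1,3) by (simp add: norm_mult)
  ultimately have 1: "(Re q)\<^sup>2 + (Im q)\<^sup>2 = 1" and 2: "(1 - Re q)\<^sup>2 + (Im q)\<^sup>2 = 1"
    using cmod_power2[of q] cmod_power2[of "1 - q"] by simp_all
  from 1 2 have re: "Re q = 1 / 2" by (simp add: power2_eq_square algebra_simps)
  have "(Im q)\<^sup>2 = 3 / 4" using 1 unfolding re by (simp add: power2_eq_square)
  then have "(Im q)\<^sup>2 = (sqrt 3 / 2)\<^sup>2" by (simp add: power2_eq_square)
  then have "Im q = sqrt 3 / 2 \<or> Im q = - (sqrt 3 / 2)" by (rule power2_eq_iff[THEN iffD1])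
  then have "q = \<omega> \<or> \<omega> * q = 1" using re by (auto simp: omega_Complex complex_eq_iff)
  then show ?thesis
  proof
    assume "\<omega> * q = 1"
    then have "k = \<omega> * m" unfolding m by (simp add: mult.assoc[symmetric])
    then show ?thesis ..
  qed (simp add: m)
qed

lemma two_members:
  assumes "2 \<le> card ({a, b, e} \<inter> A)"
  shows "a \<in> A \<and> b \<in> A \<or> a \<in> A \<and> e \<in> A \<or> b \<in> A \<and> e \<in> A"
proof (rule ccontr)
  assume "\<not> ?thesis"
  then have "\<exists>x. {a, b, e} \<inter> A \<subseteq> {x}" by auto
  then obtain x where "{a, b, e} \<inter> A \<subseteq> {x}" by blast
  from card_mono[OF _ this] show False using assms by simp
qed

text \<open>The definition names a triangle by three sites, this lemma by one site in
  \<open>A\<close> and a side of the shield there. Seen from \<open>l\<close> in \<open>A\<close>,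
  the other two sites in counterclockwise order are \<open>l + r * v0 s\<close> and
  \<open>l + \<omega> * r * v0 s\<close> with a sixth root of unity \<open>r\<close>, and the side
  is the one with diagonal \<open>- r * v0 s\<close>.\<close>

lemma patch_eq:
  assumes A: "A \<subseteq> lat (v0 s)"
  shows "patch (S0 s) (u0 s) A = {(+) l ` S0 s | l. l \<in> A} \<union>
    {tile None (l + x + g) (- g) | l t x g. l \<in> A \<and> (t, x, g) \<in> hexagon s (zb s) 1 \<and>
       (l - (\<omega> + c t) * g \<in> A \<or> l - \<omega> * ((\<omega> + c t) * g) \<in> A)}" (is "_ = _ \<union> ?R")
proof -
  let ?L = "{tri_tile (S0 s) (u0 s) a b e | a b e.
        a \<in> shield_lattice (u0 s) \<and> b \<in> shield_lattice (u0 s) \<and> e \<in> shield_lattice (u0 s) \<and>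
        dist a b = norm (u0 s) \<and> dist b e = norm (u0 s) \<and> dist a e = norm (u0 s) \<and>
        card ({a, b, e} \<inter> A) \<ge> 2}"
  have "?L = ?R"
  proof (intro equalityI subsetI)
    fix B assume "B \<in> ?L"
    then obtain a b e where B: "B = tri_tile (S0 s) (u0 s) a b e"
      and lt: "a \<in> lat (v0 s)" "b \<in> lat (v0 s)" "e \<in> lat (v0 s)"
      and ds: "dist a b = norm (v0 s)" "dist b e = norm (v0 s)" "dist a e = norm (v0 s)"
      and cd: "2 \<le> card ({a, b, e} \<inter> A)" unfolding lat_u0 norm_u0 by blast
    have key: "B \<in> ?R" if l: "l \<in> A" and m: "m \<in> A" and lmn: "{a, b, e} = {l, m, n}"
      and d: "dist l m = norm (v0 s)" "dist l n = norm (v0 s)" "dist m n = norm (v0 s)"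
      and n: "n \<in> lat (v0 s)" for l m n
    proof -
      have ll: "l \<in> lat (v0 s)" and ml: "m \<in> lat (v0 s)" using A l m by blast+
      have unit: "\<exists>k\<in>{1, \<omega>, \<omega> - 1, - 1, - \<omega>, 1 - \<omega>}. y = l + k * v0 s"
        if y: "y \<in> lat (v0 s)" "dist l y = norm (v0 s)" for y
      proof -
        obtain i j where ij: "y = l + (of_int i + of_int j * \<omega>) * v0 s" using lat_translate[OF ll y(1)] by blast
        have "norm (of_int i + of_int j * \<omega>) = 1" using y(2) v0_norm[of s] unfolding ij dist_norm by (simp add: norm_mult)
        from unit_lattice[OF this] ij show ?thesis by blast
      qed
      obtain k where k: "k \<in> {1, \<omega>, \<omega> - 1, - 1, - \<omega>, 1 - \<omega>}" "m = l + k * v0 s" using unit[OF ml d(1)] by blast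
      obtain k' where k': "k' \<in> {1, \<omega>, \<omega> - 1, - 1, - \<omega>, 1 - \<omega>}" "n = l + k' * v0 s" using unit[OF n d(2)] by blast
      have un: "norm y = 1" if "y \<in> {1, \<omega>, \<omega> - 1, - 1, - \<omega>, 1 - \<omega>}" for y using that unit_norms by auto
      have "m - n = (k - k') * v0 s" unfolding k(2) k'(2) by (simp add: algebra_simps)
      then have "norm (k - k') = 1" using d(3) v0_norm[of s] unfolding dist_norm by (simp add: norm_mult)
      from equilateral_units[OF un[OF k(1)] un[OF k'(1)] this]
      have kk: "k' = \<omega> * k \<or> k = \<omega> * k'" .
      have neg: "- y \<in> {1, \<omega>, \<omega> - 1, - 1, - \<omega>, 1 - \<omega>}" if "y \<in> {1, \<omega>, \<omega> - 1, - 1, - \<omega>, 1 - \<omega>}" for y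
        using that by auto
      have fin: ?thesis if r: "r \<in> {1, \<omega>, \<omega> - 1, - 1, - \<omega>, 1 - \<omega>}"
        and pq: "{a, b, e} = {l, l + r * v0 s, l + \<omega> * r * v0 s}" "l + r * v0 s \<in> A \<or> l + \<omega> * r * v0 s \<in> A" for r
      proof -
        obtain t x g where h: "(t, x, g) \<in> hexagon s (zb s) 1" "(\<omega> + c t) * g = (- r) * ((\<omega> + c s) * 1)"
          by (rule diagonal_dart[OF neg[OF r]])
        have w: "l + r * v0 s = l - (\<omega> + c t) * g" "l + \<omega> * r * v0 s = l - \<omega> * ((\<omega> + c t) * g)"
          unfolding h(2) v0_def by simp_all
        have "B = tile None (l + x + g) (- g)"
          unfolding B tri_tile_cong[OF pq(1)] w by (rule tri_tile_dart[OF h(1) ll])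
        then show ?thesis using l h(1) pq(2) unfolding w by blast
      qed
      from kk show ?thesis
      proof
        assume "k' = \<omega> * k"
        then show ?thesis using fin[OF k(1)] lmn m unfolding k(2) k'(2) by simp
      next
        assume "k = \<omega> * k'"
        then show ?thesis using fin[OF k'(1)] lmn m unfolding k(2) k'(2) by (simp add: insert_commute)
      qed
    qed
    from two_members[OF cd] show "B \<in> ?R"
    proof (elim disjE conjE)
      assume "a \<in> A" "b \<in> A" then show ?thesis using key[of a b e] lt ds by simp
    next
      assume "a \<in> A" "e \<in> A" then show ?thesis using key[of a e b] lt ds by (simp add: dist_commute insert_commute)
    next
      assume "b \<in> A" "e \<in> A" then show ?thesis using key[of b e a] lt ds by (simp add: dist_commute insert_commute)
    qed
  next
    fix B assume "B \<in> ?R"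
    then obtain l t x g where B: "B = tile None (l + x + g) (- g)" and l: "l \<in> A" and h: "(t, x, g) \<in> hexagon s (zb s) 1"
      and o: "l - (\<omega> + c t) * g \<in> A \<or> l - \<omega> * ((\<omega> + c t) * g) \<in> A" by blast
    let ?w = "(\<omega> + c t) * g"
    have ll: "l \<in> lat (v0 s)" using A l by blast
    obtain k where k: "k \<in> {1, \<omega>, \<omega> - 1, - 1, - \<omega>, 1 - \<omega>}" "?w = k * v0 s"
      using diagonal_hexagon[OF h] unfolding v0_def by (metis mult.right_neutral)
    have nw: "norm ?w = norm (v0 s)" unfolding k(2) using k(1) unit_norms by (auto simp: norm_mult)
    have lw: "lat ?w = lat (v0 s)" using lat_hexagon[OF h] unfolding v0_def by simp
    obtain i j where ij: "l = (of_int i + of_int j * \<omega>) * ?w" using ll lw unfolding lat_def by blast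
    have "l - ?w = (of_int (i - 1) + of_int j * \<omega>) * ?w" "l - \<omega> * ?w = (of_int i + of_int (j - 1) * \<omega>) * ?w"
      unfolding ij by (simp_all add: algebra_simps)
    then have la: "l - ?w \<in> lat (v0 s)" "l - \<omega> * ?w \<in> lat (v0 s)" using lw unfolding lat_def by blast+
    have w0: "?w \<noteq> 0" using nw v0_norm[of s] by auto
    have "l - ?w \<noteq> l" "l - \<omega> * ?w \<noteq> l" using w0 omega_facts(1) by simp_all
    then have cd: "2 \<le> card ({l, l - ?w, l - \<omega> * ?w} \<inter> A)"
    proof -
      from o obtain y where y: "y \<in> A" "y \<noteq> l" "y \<in> {l, l - ?w, l - \<omega> * ?w}"
        using \<open>l - ?w \<noteq> l\<close> \<open>l - \<omega> * ?w \<noteq> l\<close> by blast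
      have "{l, y} \<subseteq> {l, l - ?w, l - \<omega> * ?w} \<inter> A" using y l by blast
      from card_mono[OF _ this] show ?thesis using y(2) by simp
    qed
    have "(l - ?w) - (l - \<omega> * ?w) = (\<omega> - 1) * ?w" by (simp add: algebra_simps)
    then have ds: "dist l (l - ?w) = norm (v0 s)" "dist (l - ?w) (l - \<omega> * ?w) = norm (v0 s)" "dist l (l - \<omega> * ?w) = norm (v0 s)"
      unfolding dist_norm using nw unit_norms by (simp_all add: norm_mult)
    have "B = tri_tile (S0 s) (u0 s) l (l - ?w) (l - \<omega> * ?w)" unfolding B tri_tile_dart[OF h ll] ..
    then show "B \<in> ?L" unfolding lat_u0 norm_u0 using ll la ds cd by blast
  qed
  then show ?thesis unfolding patch_def by (simp only:)
qed

end

section \<open>The tiles of a shield triangle, listed by site and side\<close>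

context shield_angle begin

text \<open>The darts of the shield at the origin are numbered from 0 to 5, so that conditions on a
  side become conditions on its number and the coordinates of the site.\<close>

definition side_label :: "bool \<Rightarrow> nat \<Rightarrow> bool" where "side_label s k = (if even k then s else \<not> s)"
definition side_start where
  "side_start s k = zb s + [0, 1, 1 + c s, \<omega> + c s, \<omega> + \<omega> * c s, \<omega> * c s] ! k"
definition side_dir where
  "side_dir s k = [1, c s, \<omega> - 1, (\<omega> - 1) * c s, - \<omega>, - (\<omega> * c s)] ! k"

lemma less_6: "k < (6::nat) \<Longrightarrow> k = 0 \<or> k = 1 \<or> k = 2 \<or> k = 3 \<or> k = 4 \<or> k = 5"
  by linarith

lemma ex_less_6: "(\<exists>k<6::nat. P k) \<longleftrightarrow> P 0 \<or> P 1 \<or> P 2 \<or> P 3 \<or> P 4 \<or> P 5"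
proof
  assume "\<exists>k<6. P k"
  then obtain k where "k < 6" "P k" by blast
  from less_6[OF this(1)] this(2) show "P 0 \<or> P 1 \<or> P 2 \<or> P 3 \<or> P 4 \<or> P 5" by (elim disjE) simp_all
next
  have "(0::nat) < 6" "(1::nat) < 6" "(2::nat) < 6" "(3::nat) < 6" "(4::nat) < 6" "(5::nat) < 6" by simp_all
  then show "P 0 \<or> P 1 \<or> P 2 \<or> P 3 \<or> P 4 \<or> P 5 \<Longrightarrow> \<exists>k<6. P k" by blast
qed

lemmas side_simps = side_label_def side_start_def side_dir_def

lemma side_nums:
  "side_label s 0 = s" "side_label s 1 = (\<not> s)" "side_label s 2 = s" "side_label s 3 = (\<not> s)" "side_label s 4 = s" "side_label s 5 = (\<not> s)"
  "side_start s 0 = zb s" "side_start s 1 = zb s + 1" "side_start s 2 = zb s + 1 + c s" "side_start s 3 = zb s + \<omega> + c s"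
  "side_start s 4 = zb s + \<omega> + \<omega> * c s" "side_start s 5 = zb s + \<omega> * c s"
  "side_dir s 0 = 1" "side_dir s 1 = c s" "side_dir s 2 = \<omega> - 1" "side_dir s 3 = (\<omega> - 1) * c s" "side_dir s 4 = - \<omega>" "side_dir s 5 = - (\<omega> * c s)"
  unfolding side_simps by simp_all

lemma hexagon_sides: "hexagon s (zb s) 1 = {(side_label s k, side_start s k, side_dir s k) | k. k < 6}"
proof -
  have "(y \<in> {(side_label s k, side_start s k, side_dir s k) | k. k < 6}) \<longleftrightarrow>
      (\<exists>k<6. y = (side_label s k, side_start s k, side_dir s k))" for y by blast
  then show ?thesis unfolding ex_less_6 side_nums hexagon_darts_def
    by (simp only: set_eq_iff insert_iff empty_iff mult_1_right HOL.simp_thms)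
qed

lemma side_hexagon: "k < 6 \<Longrightarrow> (side_label s k, side_start s k, side_dir s k) \<in> hexagon s (zb s) 1"
  unfolding hexagon_sides by blast

lemma hexagon_affine: "hexagon s (A + b * p) (b * f) = (\<lambda>(t, x, g). (t, A + b * x, b * g)) ` hexagon s p f"
  unfolding hexagon_darts_def by (simp add: algebra_simps)

text \<open>Side \<open>k\<close> of the shield at \<open>site s i j\<close> borders a triangle of the shield triangle of order \<open>K\<close>.\<close>

definition side_triangle :: "nat \<Rightarrow> nat \<Rightarrow> enat \<Rightarrow> nat \<Rightarrow> bool" where
  "side_triangle i j K k \<longleftrightarrow> even k \<or> k = 1 \<and> 0 < j \<or> k = 3 \<and> enat (Suc (i + j)) < K \<or> k = 5 \<and> 0 < i"

definition shield_at where "shield_at s i j = tile (Some s) (site s i j + zb s) 1"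
definition triangle_at where
  "triangle_at s i j k = tile None (site s i j + side_start s k + side_dir s k) (- side_dir s k)"

definition pieces where
  "pieces s K = {shield_at s i j | i j. enat (i + j) < K} \<union>
    {triangle_at s i j k | i j k. enat (i + j) < K \<and> k < 6 \<and> side_triangle i j K k}"

lemma side_diagonal:
  assumes "k < 6"
  shows "(\<omega> + c (side_label s k)) * side_dir s k = [1, \<omega>, \<omega> - 1, - 1, - \<omega>, 1 - \<omega>] ! k * v0 s"
  using less_6[OF assms] by (elim disjE) (simp_all add: side_simps v0_def nf)

text \<open>The triangles with at least two of their three sites in the index set. The three
  implications remove exactly the corner triangles, each of which touches a single shield of the
  set.\<close>

definition inner where
  "inner i j K k \<longleftrightarrow> side_triangle i j K k \<and> (k = 0 \<longrightarrow> 0 < i \<or> 0 < j) \<and>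
    (k = 2 \<longrightarrow> 0 < j \<or> enat (Suc (i + j)) < K) \<and> (k = 4 \<longrightarrow> 0 < i \<or> enat (Suc (i + j)) < K)"

lemma sites_shift:
  assumes "enat (i + j) < K"
  shows "site s i j - v0 s \<in> sites s K \<longleftrightarrow> 0 < i"
    and "site s i j - \<omega> * v0 s \<in> sites s K \<longleftrightarrow> 0 < j"
    and "site s i j - (\<omega> - 1) * v0 s \<in> sites s K \<longleftrightarrow> 0 < j"
    and "site s i j + v0 s \<in> sites s K \<longleftrightarrow> enat (Suc (i + j)) < K"
    and "site s i j + \<omega> * v0 s \<in> sites s K \<longleftrightarrow> enat (Suc (i + j)) < K"
    and "site s i j - (1 - \<omega>) * v0 s \<in> sites s K \<longleftrightarrow> 0 < i"
proof -
  have lt: "enat m < K" if "m \<le> i + j" for m using order.strict_trans1[OF _ assms, of "enat m"] that by simp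
  have e: "site s i j + (of_int a + of_int b * \<omega>) * v0 s = (of_int (int i + a) + of_int (int j + b) * \<omega>) * v0 s" for a b
    unfolding site_eq by (simp add: algebra_simps)
  have r: "site s i j - v0 s = (of_int (int i + (-1)) + of_int (int j + 0) * \<omega>) * v0 s"
    "site s i j - \<omega> * v0 s = (of_int (int i + 0) + of_int (int j + (-1)) * \<omega>) * v0 s"
    "site s i j - (\<omega> - 1) * v0 s = (of_int (int i + 1) + of_int (int j + (-1)) * \<omega>) * v0 s"
    "site s i j + v0 s = (of_int (int i + 1) + of_int (int j + 0) * \<omega>) * v0 s"
    "site s i j + \<omega> * v0 s = (of_int (int i + 0) + of_int (int j + 1) * \<omega>) * v0 s"
    "site s i j - (1 - \<omega>) * v0 s = (of_int (int i + (-1)) + of_int (int j + 1) * \<omega>) * v0 s"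
    unfolding e[symmetric] by (simp_all add: algebra_simps)
  have n: "nat (int i + (-1) + (int j + 0)) \<le> i + j" "nat (int i + 0 + (int j + (-1))) \<le> i + j"
    "nat (int i + 1 + (int j + (-1))) \<le> i + j" "nat (int i + (-1) + (int j + 1)) \<le> i + j" by linarith+
  have n': "nat (int i + 1 + (int j + 0)) = Suc (i + j)" "nat (int i + 0 + (int j + 1)) = Suc (i + j)" by linarith+
  show "site s i j - v0 s \<in> sites s K \<longleftrightarrow> 0 < i" unfolding r sites_iff using lt[OF n(1)] by auto
  show "site s i j - \<omega> * v0 s \<in> sites s K \<longleftrightarrow> 0 < j" unfolding r sites_iff using lt[OF n(2)] by auto
  show "site s i j - (\<omega> - 1) * v0 s \<in> sites s K \<longleftrightarrow> 0 < j" unfolding r sites_iff using lt[OF n(3)] by auto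
  show "site s i j + v0 s \<in> sites s K \<longleftrightarrow> enat (Suc (i + j)) < K" unfolding r sites_iff n' by simp
  show "site s i j + \<omega> * v0 s \<in> sites s K \<longleftrightarrow> enat (Suc (i + j)) < K" unfolding r sites_iff n' by simp
  show "site s i j - (1 - \<omega>) * v0 s \<in> sites s K \<longleftrightarrow> 0 < i" unfolding r sites_iff using lt[OF n(4)] by auto
qed

lemma inner_iff:
  assumes ij: "enat (i + j) < K" and "k < 6"
  shows "site s i j - (\<omega> + c (side_label s k)) * side_dir s k \<in> sites s K \<or>
    site s i j - \<omega> * ((\<omega> + c (side_label s k)) * side_dir s k) \<in> sites s K \<longleftrightarrow> inner i j K k"
proof -
  have o: "\<omega> * (\<omega> * v0 s) = (\<omega> - 1) * v0 s" "\<omega> * ((\<omega> - 1) * v0 s) = - v0 s" "\<omega> * ((1 - \<omega>) * v0 s) = v0 s"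
    "\<omega> * (- \<omega> * v0 s) = (1 - \<omega>) * v0 s" by (simp_all add: nf)
  note S = sites_shift[OF ij]
  from less_6[OF assms(2)] show ?thesis
  proof (elim disjE)
    assume k: "k = 0" show ?thesis unfolding side_diagonal[OF assms(2)] unfolding k using S(1,2) by (simp add: inner_def side_triangle_def)
  next
    assume k: "k = 1" show ?thesis unfolding side_diagonal[OF assms(2)] unfolding k using S(2,3) by (simp add: inner_def side_triangle_def o)
  next
    assume k: "k = 2" show ?thesis unfolding side_diagonal[OF assms(2)] unfolding k using S(3,4) by (simp add: inner_def side_triangle_def o)
  next
    assume k: "k = 3" show ?thesis unfolding side_diagonal[OF assms(2)] unfolding k using S(4,5) by (simp add: inner_def side_triangle_def)
  next
    assume k: "k = 4" show ?thesis unfolding side_diagonal[OF assms(2)] unfolding k using S(5,6) o(4) by (auto simp: inner_def side_triangle_def)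
  next
    assume k: "k = 5" show ?thesis unfolding side_diagonal[OF assms(2)] unfolding k using S(6,1) by (simp add: inner_def side_triangle_def o)
  qed
qed

lemma patch_sites:
  "patch (S0 s) (u0 s) (sites s K) = {shield_at s i j | i j. enat (i + j) < K} \<union>
    {triangle_at s i j k | i j k. enat (i + j) < K \<and> k < 6 \<and> inner i j K k}"
proof -
  have A: "sites s K \<subseteq> lat (v0 s)" unfolding sites_def using site_lat by blast
  have 1: "{(+) l ` S0 s | l. l \<in> sites s K} = {shield_at s i j | i j. enat (i + j) < K}"
    unfolding S0_def tile_translate shield_at_def sites_def unfolding add.commute[of "zb s"] by blast
  have 2: "{tile None (l + x + g) (- g) | l t x g. l \<in> sites s K \<and> (t, x, g) \<in> hexagon s (zb s) 1 \<and>
       (l - (\<omega> + c t) * g \<in> sites s K \<or> l - \<omega> * ((\<omega> + c t) * g) \<in> sites s K)} =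
    {triangle_at s i j k | i j k. enat (i + j) < K \<and> k < 6 \<and> inner i j K k}" (is "?L = ?R")
  proof (intro equalityI subsetI)
    fix B assume "B \<in> ?L"
    then obtain l t x g where B: "B = tile None (l + x + g) (- g)" and l: "l \<in> sites s K"
      and h: "(t, x, g) \<in> hexagon s (zb s) 1"
      and o: "l - (\<omega> + c t) * g \<in> sites s K \<or> l - \<omega> * ((\<omega> + c t) * g) \<in> sites s K" by blast
    obtain i j where ij: "l = site s i j" "enat (i + j) < K" using l unfolding sites_def by blast
    obtain k where k: "k < 6" "t = side_label s k" "x = side_start s k" "g = side_dir s k" using h unfolding hexagon_sides by blast
    have "inner i j K k" using o inner_iff[OF ij(2) k(1)] unfolding ij(1) k(2-) by blast
    then show "B \<in> ?R" unfolding B ij(1) k(3,4) triangle_at_def[symmetric] using ij(2) k(1) by blast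
  next
    fix B assume "B \<in> ?R"
    then obtain i j k where B: "B = triangle_at s i j k" "enat (i + j) < K" "k < 6" "inner i j K k" by blast
    have "site s i j \<in> sites s K" unfolding sites_def using B(2) by blast
    then show "B \<in> ?L" using side_hexagon[OF B(3)] inner_iff[OF B(2,3)] B(4) unfolding B(1) triangle_at_def by blast
  qed
  show ?thesis unfolding patch_eq[OF A] 1 2 ..
qed

lemma corner_tile:
  assumes "k < 6"
  shows "tri_tile (S0 s) (u0 s) (site s i j) (site s i j - [1, \<omega>, \<omega> - 1, - 1, - \<omega>, 1 - \<omega>] ! k * v0 s)
    (site s i j - \<omega> * ([1, \<omega>, \<omega> - 1, - 1, - \<omega>, 1 - \<omega>] ! k * v0 s)) = triangle_at s i j k"
  using tri_tile_dart[OF side_hexagon[OF assms] site_lat, of s i j] unfolding side_diagonal[OF assms] triangle_at_def .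

lemma corner_tile_0: "tri_tile (S0 s) (u0 s) 0 (- v0 s) (- (\<omega> * v0 s)) = triangle_at s 0 0 0"
  using corner_tile[of 0 s 0 0] by (simp add: site_def)

lemma infinite_pieces:
  "patch (S0 s) (u0 s) {of_nat i * v0 s + of_nat j * (\<omega> * v0 s) | i j :: nat. True} \<union>
    {tri_tile (S0 s) (u0 s) 0 (- v0 s) (- (\<omega> * v0 s))} = pieces s \<infinity>"
proof -
  have e: "of_nat i * v0 s + of_nat j * (\<omega> * v0 s) = site s i j" for i j unfolding site_def by (simp add: algebra_simps)
  have S: "{of_nat i * v0 s + of_nat j * (\<omega> * v0 s) | i j :: nat. True} = sites s \<infinity>"
    unfolding e sites_def by simp
  have "inner i j \<infinity> k \<longleftrightarrow> side_triangle i j \<infinity> k \<and> \<not> (i = 0 \<and> j = 0 \<and> k = 0)" for i j k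
    unfolding inner_def by auto
  moreover have "side_triangle 0 0 \<infinity> 0" unfolding side_triangle_def by simp
  moreover have "enat (0 + 0) < \<infinity>" "(0::nat) < 6" by simp_all
  ultimately have m: "B \<in> {triangle_at s i j k | i j k. enat (i + j) < \<infinity> \<and> k < 6 \<and> inner i j \<infinity> k} \<union> {triangle_at s 0 0 0} \<longleftrightarrow>
    B \<in> {triangle_at s i j k | i j k. enat (i + j) < \<infinity> \<and> k < 6 \<and> side_triangle i j \<infinity> k}" for B
    unfolding Un_iff mem_Collect_eq singleton_iff by metis
  have "{triangle_at s i j k | i j k. enat (i + j) < \<infinity> \<and> k < 6 \<and> inner i j \<infinity> k} \<union> {triangle_at s 0 0 0} =
    {triangle_at s i j k | i j k. enat (i + j) < \<infinity> \<and> k < 6 \<and> side_triangle i j \<infinity> k}" by (rule Set.set_eqI, rule m)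
  then show ?thesis unfolding S patch_sites corner_tile_0 pieces_def by (simp only: Un_assoc)
qed

lemma corner_tiles_finite:
  "tri_tile (S0 s) (u0 s) (of_nat N * v0 s) (of_nat N * v0 s + v0 s) (of_nat N * v0 s + v0 s - \<omega> * v0 s) = triangle_at s N 0 2"
  "tri_tile (S0 s) (u0 s) (of_nat N * (\<omega> * v0 s)) (of_nat N * (\<omega> * v0 s) + \<omega> * v0 s) (of_nat N * (\<omega> * v0 s) + \<omega> * v0 s - v0 s) = triangle_at s 0 N 4"
proof -
  have s: "site s N 0 = of_nat N * v0 s" "site s 0 N = of_nat N * (\<omega> * v0 s)" unfolding site_def by simp_all
  have a: "of_nat N * v0 s - [1, \<omega>, \<omega> - 1, - 1, - \<omega>, 1 - \<omega>] ! 2 * v0 s = of_nat N * v0 s + v0 s - \<omega> * v0 s"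
    "of_nat N * v0 s - \<omega> * ([1, \<omega>, \<omega> - 1, - 1, - \<omega>, 1 - \<omega>] ! 2 * v0 s) = of_nat N * v0 s + v0 s"
    "of_nat N * (\<omega> * v0 s) - [1, \<omega>, \<omega> - 1, - 1, - \<omega>, 1 - \<omega>] ! 4 * v0 s = of_nat N * (\<omega> * v0 s) + \<omega> * v0 s"
    "of_nat N * (\<omega> * v0 s) - \<omega> * ([1, \<omega>, \<omega> - 1, - 1, - \<omega>, 1 - \<omega>] ! 4 * v0 s) = of_nat N * (\<omega> * v0 s) + \<omega> * v0 s - v0 s"
    by (simp_all add: nf)
  show "tri_tile (S0 s) (u0 s) (of_nat N * v0 s) (of_nat N * v0 s + v0 s) (of_nat N * v0 s + v0 s - \<omega> * v0 s) = triangle_at s N 0 2"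
  proof -
    have "tri_tile (S0 s) (u0 s) (of_nat N * v0 s) (of_nat N * v0 s + v0 s - \<omega> * v0 s) (of_nat N * v0 s + v0 s) = triangle_at s N 0 2"
      using corner_tile[of 2 s N 0] unfolding s a by simp
    then show ?thesis by (subst tri_tile_cong[OF arg_cong[of _ _ "insert _", OF insert_commute]])
  qed
  show "tri_tile (S0 s) (u0 s) (of_nat N * (\<omega> * v0 s)) (of_nat N * (\<omega> * v0 s) + \<omega> * v0 s) (of_nat N * (\<omega> * v0 s) + \<omega> * v0 s - v0 s) = triangle_at s 0 N 4"
    using corner_tile[of 4 s 0 N] unfolding s a by simp
qed

text \<open>The index set of order \<open>k\<close> is bounded by \<open>k - 1\<close>, hence the
  order \<open>Suc N\<close> with bound \<open>N\<close>. The three corner triangles added in the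
  definition are those that \<open>inner\<close> leaves out.\<close>

lemma finite_pieces: "shield_triangle (S0 s) (u0 s) (v0 s) (\<omega> * v0 s) (Suc N) = pieces s (enat (Suc N))"
proof -
  have e: "of_nat i * v0 s + of_nat j * (\<omega> * v0 s) = site s i j" for i j unfolding site_def by (simp add: algebra_simps)
  have S: "{of_nat i * v0 s + of_nat j * (\<omega> * v0 s) | i j. i + j \<le> N} = sites s (enat (Suc N))"
    unfolding e sites_def by (simp add: less_Suc_eq_le)
  have in1: "inner i j (enat (Suc N)) k \<longleftrightarrow> side_triangle i j (enat (Suc N)) k \<and> (i, j, k) \<notin> {(0, 0, 0), (N, 0, 2), (0, N, 4)}"
    if "i + j \<le> N" for i j k
    using that unfolding inner_def by auto
  have "side_triangle 0 0 (enat (Suc N)) 0" "side_triangle N 0 (enat (Suc N)) 2" "side_triangle 0 N (enat (Suc N)) 4" unfolding side_triangle_def by simp_all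
  then have "{triangle_at s i j k | i j k. i + j \<le> N \<and> k < 6 \<and> inner i j (enat (Suc N)) k} \<union>
      {triangle_at s 0 0 0, triangle_at s N 0 2, triangle_at s 0 N 4}
    = {triangle_at s i j k | i j k. i + j \<le> N \<and> k < 6 \<and> side_triangle i j (enat (Suc N)) k}" (is "?L = ?R")
  proof (intro equalityI subsetI)
    fix B assume g: "side_triangle 0 0 (enat (Suc N)) 0" "side_triangle N 0 (enat (Suc N)) 2" "side_triangle 0 N (enat (Suc N)) 4" and "B \<in> ?L"
    then consider "B \<in> {triangle_at s i j k | i j k. i + j \<le> N \<and> k < 6 \<and> inner i j (enat (Suc N)) k}"
      | "B = triangle_at s 0 0 0" | "B = triangle_at s N 0 2" | "B = triangle_at s 0 N 4" by blast
    then show "B \<in> ?R"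
    proof cases
      case 1 then show ?thesis using in1 by blast
    next
      case 2
      have "(0::nat) + 0 \<le> N" "(0::nat) < 6" by simp_all
      then show ?thesis using g(1) 2 by blast
    next
      case 3
      have "N + 0 \<le> N" "(2::nat) < 6" by simp_all
      then show ?thesis using g(2) 3 by blast
    next
      case 4
      have "0 + N \<le> N" "(4::nat) < 6" by simp_all
      then show ?thesis using g(3) 4 by blast
    qed
  next
    fix B assume "B \<in> ?R"
    then obtain i j k where B: "B = triangle_at s i j k" "i + j \<le> N" "k < 6" "side_triangle i j (enat (Suc N)) k" by blast
    show "B \<in> ?L"
    proof (cases "(i, j, k) \<in> {(0, 0, 0), (N, 0, 2), (0, N, 4)}")
      case True then show ?thesis unfolding B(1) by auto
    next
      case False
      then have "inner i j (enat (Suc N)) k" using in1[OF B(2)] B(4) by blast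
      then show ?thesis using B by blast
    qed
  qed
  then show ?thesis
    unfolding shield_triangle_def Let_def diff_Suc_1 S patch_sites corner_tile_0 corner_tiles_finite pieces_def
    by (simp only: enat_ord_simps less_Suc_eq_le Un_assoc)
qed

end

section \<open>Copies of a shield triangle in the tiling\<close>

context shield_plane begin

lemma pt_affine: "pt s (A + b * z) (b * f) i j = A + b * pt s z f i j"
  unfolding pt_def by (simp add: algebra_simps)

lemma pt_zb: "pt s (zb s) 1 i j = site s i j + zb s"
  unfolding pt_def site_def v0_def by (simp add: algebra_simps)

text \<open>The even sides are those of \<open>placed_edges\<close>, sides 1 and 5 are decided by
  the walls, and side 3 by whether the row is the last one.\<close>

lemma side_ST:
  assumes st: "state s (A + b * zb s) b K" and ij: "enat (i + j) < K" and k: "k < 6"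
  shows "ST (side_label s k) (A + b * (site s i j + side_start s k)) (b * side_dir s k) \<longleftrightarrow> side_triangle i j K k"
proof -
  define P where "P = pt s (A + b * zb s) b i j"
  have P: "P = A + b * (site s i j + zb s)" using pt_affine[of s A b "zb s" 1 i j] unfolding P_def pt_zb by simp
  note pl = state_placed[OF st ij]
  note pd = pl[unfolded placed_def, folded P_def]
  note e = placed_edges[OF pl, folded P_def]
  have 1: "ST (\<not> s) (P + b) (c s * b) \<longleftrightarrow> 0 < j"
    using pd X_iff SS_ST by (cases "j = 0") blast+
  have 5: "ST (\<not> s) (P + \<omega> * (c s * b)) (- (\<omega> * (c s * b))) \<longleftrightarrow> 0 < i"
    using pd X_iff SS_ST by (cases "i = 0") blast+
  have H3: "D (Some (\<not> s)) (P + \<omega> * b + c s * b) ((\<omega> - 1) * (c s * b))"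
    by (rule H_cycle(3)[OF ST_H[OF e(1)]])
  have 3: "ST (\<not> s) (P + \<omega> * b + c s * b) ((\<omega> - 1) * (c s * b)) \<longleftrightarrow> enat (Suc (i + j)) < K"
  proof -
    have "enat (Suc (i + j)) \<le> K" using ij by (simp add: Suc_ile_eq)
    then have "enat (Suc (i + j)) < K \<longleftrightarrow> K \<noteq> enat (Suc (i + j))" by (auto simp: less_le)
    also have "\<dots> \<longleftrightarrow> \<not> top s (A + b * zb s) b i j" using state_top[OF st ij] by blast
    finally show ?thesis unfolding top_def P_def[symmetric] using edge_cases[OF H3] SS_ST by blast
  qed
  have a: "A + b * (site s i j + side_start s k) = P + b * (side_start s k - zb s)" for k
    unfolding P by (simp add: algebra_simps)
  from less_6[OF k] show ?thesis
  proof (elim disjE)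
    assume k: "k = 0" show ?thesis using e(1) unfolding k unfolding a unfolding side_nums side_triangle_def by simp
  next
    assume k: "k = 1" show ?thesis using 1 unfolding k unfolding a unfolding side_nums side_triangle_def by (simp add: mult.commute)
  next
    assume k: "k = 2" show ?thesis using e(2) unfolding k unfolding a unfolding side_nums side_triangle_def by (simp add: algebra_simps)
  next
    assume k: "k = 3" show ?thesis using 3 unfolding k unfolding a unfolding side_nums side_triangle_def by (simp add: algebra_simps)
  next
    assume k: "k = 4" show ?thesis using e(3) unfolding k unfolding a unfolding side_nums side_triangle_def by (simp add: algebra_simps)
  next
    assume k: "k = 5" show ?thesis using 5 unfolding k unfolding a unfolding side_nums side_triangle_def by (simp add: algebra_simps)
  qed
qed

lemma shield_at_image: "(\<lambda>x. A + b * x) ` shield_at s i j = tile (Some s) (A + b * (site s i j + zb s)) b"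
  unfolding shield_at_def by (simp only: tile_image[symmetric] mult_1_right)

lemma triangle_at_image: "(\<lambda>x. A + b * x) ` triangle_at s i j k =
    tile None (A + b * (site s i j + side_start s k) + b * side_dir s k) (- (b * side_dir s k))"
  unfolding triangle_at_def by (simp only: tile_image[symmetric] mult_minus_right distrib_left add.assoc)

lemma pieces_in:
  assumes st: "state s (A + b * zb s) b K" and B: "B \<in> pieces s K"
  shows "(\<lambda>x. A + b * x) ` B \<in> \<T>"
proof -
  from B consider i j where "enat (i + j) < K" "B = shield_at s i j"
    | i j k where "enat (i + j) < K" "k < 6" "side_triangle i j K k" "B = triangle_at s i j k" unfolding pieces_def by blast
  then show ?thesis
  proof cases
    case 1
    have "ST s (A + b * (site s i j + zb s)) b" using side_ST[OF st 1(1), of 0] unfolding side_nums side_triangle_def by simp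
    then show ?thesis unfolding 1(2) shield_at_image ST_def D_def by blast
  next
    case 2
    then show ?thesis using side_ST[OF st 2(1,2)] unfolding 2(4) triangle_at_image ST_def D_def by blast
  qed
qed

text \<open>\<open>\<Phi>\<close> is the set of placements of the model shield triangle and
  \<open>F\<close> the set of its corner darts, one or three. The assumptions \<open>rot\<close> and
  \<open>rot_inv\<close> say that turning a placement about any of its apexes gives a placement;
  \<open>cells\<close> recounts a shield from the corner \<open>(zb s, 1)\<close>, no matter from
  which corner it was counted.\<close>

lemma pieces_cover:
  assumes ne: "\<Phi> \<noteq> {}" "(zb s, 1) \<in> F"
    and st: "\<And>A b z f. (A, b) \<in> \<Phi> \<Longrightarrow> (z, f) \<in> F \<Longrightarrow> state s (A + b * z) (b * f) K"
    and cells: "\<And>z f i j. (z, f) \<in> F \<Longrightarrow> enat (i + j) < K \<Longrightarrow>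
      \<exists>i' j'. enat (i' + j') < K \<and> hexagon s (pt s z f i j) f = hexagon s (pt s (zb s) 1 i' j') 1"
    and kappa: "\<And>z f N. (z, f) \<in> F \<Longrightarrow> K = enat (Suc N) \<Longrightarrow> (pt s z f N 0 + f + c s * f, (\<omega> - 1) * f) \<in> F"
    and rot: "\<And>A b z f. (A, b) \<in> \<Phi> \<Longrightarrow> (z, f) \<in> F \<Longrightarrow> (A + b * (z - \<omega> * f - \<omega> * z), b * \<omega>) \<in> \<Phi>"
    and rot_inv: "\<And>A b z f. (A, b) \<in> \<Phi> \<Longrightarrow> (z, f) \<in> F \<Longrightarrow> (A + b * (z + f - (1 - \<omega>) * z), b * (1 - \<omega>)) \<in> \<Phi>"
  shows "\<T> = {(\<lambda>x. A + b * x) ` B | A b B. (A, b) \<in> \<Phi> \<and> B \<in> pieces s K}"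
proof -
  define \<Sigma> where "\<Sigma> = {(A + b * z, b * f) | A b z f. (A, b) \<in> \<Phi> \<and> (z, f) \<in> F}"
  have \<Sigma>I: "(y, e) \<in> \<Sigma>" if "(A, b) \<in> \<Phi>" "(z, f) \<in> F" "y = A + b * z" "e = b * f" for A b z f y e
    using that unfolding \<Sigma>_def by blast
  have base: "state s (A + b * zb s) b K" if "(A, b) \<in> \<Phi>" for A b using st[OF that ne(2)] by simp
  have S1: "state s y e K" if "(y, e) \<in> \<Sigma>" for y e using that st unfolding \<Sigma>_def by blast
  have S2: "(y - \<omega> * e, \<omega> * e) \<in> \<Sigma>" if "(y, e) \<in> \<Sigma>" for y e
  proof -
    obtain A b z f where m: "(A, b) \<in> \<Phi>" "(z, f) \<in> F" "y = A + b * z" "e = b * f" using \<open>(y, e) \<in> \<Sigma>\<close> unfolding \<Sigma>_def by blast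
    show ?thesis by (rule \<Sigma>I[OF rot[OF m(1,2)] m(2)]) (simp_all add: m(3,4) algebra_simps)
  qed
  have S3: "(y + e, (1 - \<omega>) * e) \<in> \<Sigma>" if "(y, e) \<in> \<Sigma>" for y e
  proof -
    obtain A b z f where m: "(A, b) \<in> \<Phi>" "(z, f) \<in> F" "y = A + b * z" "e = b * f" using \<open>(y, e) \<in> \<Sigma>\<close> unfolding \<Sigma>_def by blast
    show ?thesis by (rule \<Sigma>I[OF rot_inv[OF m(1,2)] m(2)]) (simp_all add: m(3,4) algebra_simps)
  qed
  have S4: "(pt s y e N 0 + e + c s * e, (\<omega> - 1) * e) \<in> \<Sigma>" if "(y, e) \<in> \<Sigma>" and K: "K = enat (Suc N)" for y e N
  proof -
    obtain A b z f where m: "(A, b) \<in> \<Phi>" "(z, f) \<in> F" "y = A + b * z" "e = b * f" using \<open>(y, e) \<in> \<Sigma>\<close> unfolding \<Sigma>_def by blast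
    show ?thesis by (rule \<Sigma>I[OF m(1) kappa[OF m(2) K]]) (simp_all add: m(3,4) pt_affine algebra_simps)
  qed
  obtain A0 b0 where "(A0, b0) \<in> \<Phi>" using ne(1) by auto
  then have S5: "(A0 + b0 * zb s, b0 * 1) \<in> \<Sigma>" using ne(2) unfolding \<Sigma>_def by blast
  have cell: "\<exists>A b i' j' k. (A, b) \<in> \<Phi> \<and> enat (i' + j') < K \<and> k < 6 \<and> t = side_label s k \<and>
      x = A + b * (site s i' j' + side_start s k) \<and> g = b * side_dir s k"
    if "(y, e) \<in> \<Sigma>" "enat (i + j) < K" "(t, x, g) \<in> hexagon s (pt s y e i j) e" for y e i j t x g
  proof -
    obtain A b z f where m: "(A, b) \<in> \<Phi>" "(z, f) \<in> F" "y = A + b * z" "e = b * f" using \<open>(y, e) \<in> \<Sigma>\<close> unfolding \<Sigma>_def by blast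
    obtain i' j' where ij: "enat (i' + j') < K" "hexagon s (pt s z f i j) f = hexagon s (pt s (zb s) 1 i' j') 1"
      using cells[OF m(2) \<open>enat (i + j) < K\<close>] by blast
    have "(t, x, g) \<in> (\<lambda>(t, x, g). (t, A + b * x, b * g)) ` hexagon s (site s i' j' + zb s) 1"
      using \<open>(t, x, g) \<in> hexagon s (pt s y e i j) e\<close> unfolding m(3,4) pt_affine hexagon_affine ij(2) pt_zb .
    then obtain x' g' where h: "(t, x', g') \<in> hexagon s (site s i' j' + zb s) 1" "x = A + b * x'" "g = b * g'" by auto
    have "(t, x' - site s i' j', g') \<in> hexagon s (zb s) 1"
      using h(1) hexagon_translate[of t "x' - site s i' j'" "site s i' j'" g' s "zb s" 1] by (simp add: add.commute)
    then obtain k where k: "k < 6" "t = side_label s k" "x' - site s i' j' = side_start s k" "g' = side_dir s k"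
      unfolding hexagon_sides by blast
    have "x' = site s i' j' + side_start s k" using k(3) by (simp add: algebra_simps)
    then show ?thesis using m(1) ij(1) k h(2,3) by blast
  qed
  note cover' = sectors_cover[of \<Sigma> s K, OF S1 S2 S3 S4 S5]
  show ?thesis
  proof (intro equalityI subsetI)
    fix B assume "B \<in> \<T>"
    then obtain l x g where D: "D l x g" and B: "B = tile l x g" using tile_rep by blast
    have g1: "norm g = 1" using D unfolding D_def by blast
    show "B \<in> {(\<lambda>x. A + b * x) ` B | A b B. (A, b) \<in> \<Phi> \<and> B \<in> pieces s K}"
    proof (cases l)
      case (Some t)
      obtain y e i j where y: "(y, e) \<in> \<Sigma>" "enat (i + j) < K" "(t, x, g) \<in> hexagon s (pt s y e i j) e"
        using cover'(1)[of t x g] D unfolding Some by blast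
      obtain A b i' j' k where m: "(A, b) \<in> \<Phi>" "enat (i' + j') < K" "k < 6" "t = side_label s k"
        "x = A + b * (site s i' j' + side_start s k)" "g = b * side_dir s k" using cell[OF y] by metis
      have "(t, site s i' j' + side_start s k, side_dir s k) \<in> hexagon s (site s i' j' + zb s) 1"
        using side_hexagon[OF m(3), of s] hexagon_translate[of t "side_start s k" "site s i' j'" "side_dir s k" s "zb s" 1]
        unfolding m(4) by (simp add: add.commute)
      from hexagon_tile[OF this] have "B = (\<lambda>x. A + b * x) ` shield_at s i' j'"
        unfolding B Some m(5,6) tile_image shield_at_def by simp
      moreover have "shield_at s i' j' \<in> pieces s K" unfolding pieces_def using m(2) by blast
      ultimately show ?thesis using m(1) by blast
    next
      case None
      obtain y e i j t p h where y: "(y, e) \<in> \<Sigma>" "enat (i + j) < K" "(t, p, h) \<in> hexagon s (pt s y e i j) e"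
        and ST: "ST t p h" and xg: "(x, g) \<in> {(p + h, - h), (p, - ((\<omega> - 1) * h)), (p + h - \<omega> * h, \<omega> * h)}"
        using cover'(2)[of x g] D unfolding None by blast
      obtain A b i' j' k where m: "(A, b) \<in> \<Phi>" "enat (i' + j') < K" "k < 6" "t = side_label s k"
        "p = A + b * (site s i' j' + side_start s k)" "h = b * side_dir s k" using cell[OF y] by metis
      have "side_triangle i' j' K k" using ST side_ST[OF base[OF m(1)] m(2,3)] unfolding m(4-6) by blast
      then have "triangle_at s i' j' k \<in> pieces s K" unfolding pieces_def using m(2,3) by blast
      moreover have "B = tile None (p + h) (- h)"
      proof -
        have "- ((\<omega> - 1) * h) = (1 - \<omega>) * h" by (simp add: algebra_simps)
        then show ?thesis using xg outer_triangle_rotations[of 0 p h] unfolding B None by auto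
      qed
      then have "B = (\<lambda>x. A + b * x) ` triangle_at s i' j' k" unfolding triangle_at_image m(5,6) .
      ultimately show ?thesis using m(1) by blast
    qed
  next
    fix B assume "B \<in> {(\<lambda>x. A + b * x) ` B | A b B. (A, b) \<in> \<Phi> \<and> B \<in> pieces s K}"
    then show "B \<in> \<T>" using pieces_in base by blast
  qed
qed

end

section \<open>Apexes, and rotations as affine maps in the group of bijections\<close>

context shield_angle begin

lemma apex_corner:
  assumes "k < 6" "even k"
  shows "apex (triangle_at s i j k) ((+) (site s i j) ` S0 s) = site s i j + side_start s k + (1 - \<omega>) * side_dir s k"
proof -
  have t: "side_label s k = s" using assms(2) unfolding side_label_def by simp
  note h = side_hexagon[OF assms(1), of s, unfolded t]
  have "norm (side_dir s k) = 1" using hexagon_norm[OF h] by simp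
  from apex_eq[OF this] show ?thesis unfolding triangle_at_def S0_def hexagon_tile[OF h, symmetric] .
qed

text \<open>The threefold symmetry of a shield: starting two sides later gives the same six
  darts.\<close>

lemma hexagon_turn: "hexagon s (p + f + c s * f) ((\<omega> - 1) * f) = hexagon s p f"
proof -
  let ?q = "p + f + c s * f" and ?g = "(\<omega> - 1) * f"
  have "?q + ?g = p + \<omega> * f + c s * f" "c s * ?g = (\<omega> - 1) * (c s * f)"
    "?q + ?g + c s * ?g = p + \<omega> * f + \<omega> * (c s * f)" "(\<omega> - 1) * ?g = - (\<omega> * f)"
    "?q + \<omega> * ?g + c s * ?g = p + \<omega> * (c s * f)" "(\<omega> - 1) * (c s * ?g) = - (\<omega> * (c s * f))"
    "?q + \<omega> * ?g + \<omega> * (c s * ?g) = p" "- (\<omega> * ?g) = f"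
    "?q + \<omega> * (c s * ?g) = p + f" "- (\<omega> * (c s * ?g)) = c s * f"
    by (simp_all add: nf)
  then have e: "hexagon s ?q ?g = {(s, ?q, ?g), (\<not> s, p + \<omega> * f + c s * f, (\<omega> - 1) * (c s * f)),
     (s, p + \<omega> * f + \<omega> * (c s * f), - (\<omega> * f)), (\<not> s, p + \<omega> * (c s * f), - (\<omega> * (c s * f))),
     (s, p, f), (\<not> s, p + f, c s * f)}" unfolding hexagon_darts_def by (simp only:)
  show ?thesis unfolding e unfolding hexagon_darts_def by (simp only: insert_commute)
qed

lemma rotation_sixth: "rotation p (of_nat n * (pi / 3)) x = (p - \<omega> ^ n * p) + \<omega> ^ n * x"
proof -
  have "cis (of_nat n * (pi / 3)) = \<omega> ^ n"
    unfolding \<omega>_def by (rule Complex.DeMoivre[symmetric])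
  then show ?thesis unfolding rotation_def by (simp add: algebra_simps)
qed

lemma omega_power_6: "\<omega> ^ n = \<omega> ^ (n mod 6)"
proof -
  have "\<omega> ^ 6 = 1" by (simp add: eval_nat_numeral nf)
  then have "\<omega> ^ (6 * (n div 6)) = 1" by (simp add: power_mult)
  moreover have "n = 6 * (n div 6) + n mod 6" by simp
  ultimately show ?thesis by (metis mult_1 power_add)
qed

lemma affine_Bij: "b \<noteq> 0 \<Longrightarrow> (\<lambda>x. A + b * x) \<in> carrier (BijGroup (UNIV :: complex set))"
proof -
  assume b: "b \<noteq> 0"
  have "bij (\<lambda>x. A + b * x)"
    by (rule bij_betw_byWitness[where f' = "\<lambda>x. (x - A) / b"]) (use b in auto)
  then show ?thesis unfolding BijGroup_def Bij_def by simp
qed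

lemma BijGroup_comp:
  assumes "g \<in> carrier (BijGroup UNIV)" "h \<in> carrier (BijGroup UNIV)"
  shows "(g \<otimes>\<^bsub>BijGroup UNIV\<^esub> h) x = g (h x)"
  using assms unfolding BijGroup_def by (simp add: compose_def)

lemma BijGroup_one: "\<one>\<^bsub>BijGroup UNIV\<^esub> = (\<lambda>x. x)"
  unfolding BijGroup_def by (simp add: restrict_def)

lemma affine_inv:
  assumes b: "b * b' = 1" and A: "A + b * A' = 0"
  shows "inv\<^bsub>BijGroup UNIV\<^esub> (\<lambda>x. A + b * x) = (\<lambda>x. A' + b' * (x::complex))"
proof -
  have c: "(\<lambda>x. A + b * x) \<in> carrier (BijGroup UNIV)" "(\<lambda>x. A' + b' * x) \<in> carrier (BijGroup UNIV)"
    using b by (auto intro!: affine_Bij)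
  have bA: "b' * A = - A'"
  proof -
    have "b' * (A + b * A') = b' * A + (b * b') * A'" by (simp add: algebra_simps)
    then show ?thesis unfolding A b by (simp add: eq_neg_iff_add_eq_0)
  qed
  have "((\<lambda>x. A' + b' * x) \<otimes>\<^bsub>BijGroup UNIV\<^esub> (\<lambda>x. A + b * x)) x = x" for x
  proof -
    have "A' + b' * (A + b * x) = A' + b' * A + (b * b') * x" by (simp add: algebra_simps)
    then show ?thesis unfolding BijGroup_comp[OF c(2,1)] by (simp add: bA b)
  qed
  then have "(\<lambda>x. A' + b' * x) \<otimes>\<^bsub>BijGroup UNIV\<^esub> (\<lambda>x. A + b * x) = \<one>\<^bsub>BijGroup UNIV\<^esub>"
    unfolding BijGroup_one by (rule ext)
  then show ?thesis by (rule group.inv_equality[OF group_BijGroup _ c])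
qed

end

section \<open>Shield triangle tilings of infinite and of finite order\<close>

context shield_plane begin

text \<open>There is only one corner, so the placements are the powers of one rotation. The exponent
  is left unbounded to make closure immediate, and is reduced modulo 6 only when comparing with the
  definition.\<close>

lemma infinite_triangle_tiling:
  assumes st: "state s z d \<infinity>" and d: "norm d = 1"
  shows "shield_triangle_tiling \<alpha> \<T>"
proof -
  define A0 where "A0 = z - d * zb s"
  define p where "p = zb s + (1 - \<omega>)"
  define \<Phi> where "\<Phi> = {(A0 + d * (p - \<omega> ^ n * p), d * \<omega> ^ n) | n. True}"
  have base: "state s (A0 + d * (p - \<omega> ^ n * p) + d * \<omega> ^ n * zb s) (d * \<omega> ^ n) \<infinity>" for n
  proof (induction n)
    case 0 then show ?case using st by (simp add: A0_def)
  next
    case (Suc n)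
    have "A0 + d * (p - \<omega> ^ n * p) + d * \<omega> ^ n * zb s - \<omega> * (d * \<omega> ^ n) =
        A0 + d * (p - \<omega> ^ Suc n * p) + d * \<omega> ^ Suc n * zb s"
      unfolding p_def by (simp add: nf)
    moreover have "\<omega> * (d * \<omega> ^ n) = d * \<omega> ^ Suc n" by simp
    ultimately show ?case using state_rot[OF Suc] by (simp only:)
  qed
  have T: "\<T> = {(\<lambda>x. A + b * x) ` B | A b B. (A, b) \<in> \<Phi> \<and> B \<in> pieces s \<infinity>}"
  proof (rule pieces_cover[where F = "{(zb s, 1)}"])
    show "\<Phi> \<noteq> {}" unfolding \<Phi>_def by blast
    show "(zb s, 1) \<in> {(zb s, 1)}" by simp
    show "state s (A + b * z) (b * f) \<infinity>" if "(A, b) \<in> \<Phi>" "(z, f) \<in> {(zb s, 1)}" for A b z f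
      using that base unfolding \<Phi>_def by auto
    show "\<exists>i' j'. enat (i' + j') < \<infinity> \<and> hexagon s (pt s z f i j) f = hexagon s (pt s (zb s) 1 i' j') 1"
      if "(z, f) \<in> {(zb s, 1)}" "enat (i + j) < \<infinity>" for z f i j using that by auto
    show "(pt s z f N 0 + f + c s * f, (\<omega> - 1) * f) \<in> {(zb s, 1)}" if "\<infinity> = enat (Suc N)" for z f N using that by simp
    show "(A + b * (z - \<omega> * f - \<omega> * z), b * \<omega>) \<in> \<Phi>" if h: "(A, b) \<in> \<Phi>" "(z, f) \<in> {(zb s, 1)}" for A b z f
    proof -
      obtain n where n: "A = A0 + d * (p - \<omega> ^ n * p)" "b = d * \<omega> ^ n" using h(1) unfolding \<Phi>_def by blast
      have "A + b * (z - \<omega> * f - \<omega> * z) = A0 + d * (p - \<omega> ^ Suc n * p)" "b * \<omega> = d * \<omega> ^ Suc n"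
        using h(2) unfolding n p_def by (simp_all add: nf)
      then show ?thesis unfolding \<Phi>_def by blast
    qed
    show "(A + b * (z + f - (1 - \<omega>) * z), b * (1 - \<omega>)) \<in> \<Phi>" if h: "(A, b) \<in> \<Phi>" "(z, f) \<in> {(zb s, 1)}" for A b z f
    proof -
      obtain n where n: "A = A0 + d * (p - \<omega> ^ n * p)" "b = d * \<omega> ^ n" using h(1) unfolding \<Phi>_def by blast
      \<comment> \<open>The inverse of the rotation is its fifth power, so turning back also stays
        in \<open>\<Phi>\<close>.\<close>
      have 5: "\<omega> ^ (n + 5) = \<omega> ^ n * (1 - \<omega>)" by (simp add: eval_nat_numeral nf)
      have "A + b * (z + f - (1 - \<omega>) * z) = A0 + d * (p - \<omega> ^ (n + 5) * p)" "b * (1 - \<omega>) = d * \<omega> ^ (n + 5)"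
        using h(2) unfolding n p_def 5 by (simp_all add: nf)
      then show ?thesis unfolding \<Phi>_def by blast
    qed
  qed
  let ?f = "\<lambda>x. A0 + d * x"
  have ap: "apex (tri_tile (S0 s) (u0 s) 0 (- v0 s) (- (\<omega> * v0 s))) (S0 s) = p"
    using apex_corner[of 0 s 0 0] unfolding corner_tile_0 p_def by (simp add: site_def side_nums)
  have comp: "(\<lambda>x. A0 + d * (p - \<omega> ^ n * p) + d * \<omega> ^ n * x) ` B = ?f ` rotation p (of_nat n * (pi / 3)) ` B" for n B
    unfolding image_image rotation_sixth by (simp add: algebra_simps)
  have mod: "rotation p (of_nat n * (pi / 3)) = rotation p (of_nat (n mod 6) * (pi / 3))" for n
    unfolding fun_eq_iff rotation_sixth using omega_power_6[of n] by simp
  have tiles: "T_tiles (S0 s) (u0 s) (v0 s) (\<omega> * v0 s) \<infinity> =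
      {rotation p (of_nat n * (pi / 3)) ` X | n X. n < 6 \<and> X \<in> pieces s \<infinity>}"
    unfolding T_tiles_def enat.case shield_triangle_tiles_infinite_def Let_def ap infinite_pieces by simp
  have "\<T> = (`) ?f ` T_tiles (S0 s) (u0 s) (v0 s) (\<omega> * v0 s) \<infinity>"
  proof (intro equalityI subsetI)
    fix B assume "B \<in> \<T>"
    then obtain n X where X: "X \<in> pieces s \<infinity>" "B = ?f ` rotation p (of_nat n * (pi / 3)) ` X"
      unfolding T \<Phi>_def using comp by blast
    have "n mod 6 < 6" by simp
    moreover have "B = ?f ` (rotation p (of_nat (n mod 6) * (pi / 3)) ` X)" using X(2) unfolding mod[of n] .
    ultimately show "B \<in> (`) ?f ` T_tiles (S0 s) (u0 s) (v0 s) (\<omega> * v0 s) \<infinity>"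
      unfolding tiles using X(1) by blast
  next
    fix B assume "B \<in> (`) ?f ` T_tiles (S0 s) (u0 s) (v0 s) (\<omega> * v0 s) \<infinity>"
    then obtain n X where X: "X \<in> pieces s \<infinity>" "B = ?f ` rotation p (of_nat n * (pi / 3)) ` X" unfolding tiles by blast
    have "(A0 + d * (p - \<omega> ^ n * p), d * \<omega> ^ n) \<in> \<Phi>" unfolding \<Phi>_def by blast
    then show "B \<in> \<T>" unfolding T X(2) comp[symmetric] using X(1) by blast
  qed
  moreover have "dist (?f x) (?f y) = dist x y" for x y
  proof -
    have "?f x - ?f y = d * (x - y)" by (simp add: algebra_simps)
    then show ?thesis unfolding dist_norm using d by (simp add: norm_mult)
  qed
  ultimately show ?thesis unfolding shield_triangle_tiling_def using tiling shield_frame_S0[of s] by metis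
qed

text \<open>The three corners of the model arise from one by \<open>state_kappa\<close>, whose third
  application returns to the start. With \<open>G\<close> the group generated by the rotations about
  the three apexes, the placements are the maps \<open>A0 + d * g x\<close> for \<open>g\<close> in
  \<open>G\<close>.\<close>

lemma finite_triangle_tiling:
  assumes st: "state s z d (enat (Suc N))" and d: "norm d = 1"
  shows "shield_triangle_tiling \<alpha> \<T>"
proof -
  let ?K = "enat (Suc N)"
  define A0 where "A0 = z - d * zb s"
  define z1 where "z1 = pt s (zb s) 1 N 0 + 1 + c s"
  define z2 where "z2 = pt s z1 (\<omega> - 1) N 0 + (\<omega> - 1) + c s * (\<omega> - 1)"
  define F where "F = {(zb s, 1), (z1, \<omega> - 1), (z2, - \<omega>)}"
  have z3: "pt s z2 (- \<omega>) N 0 + (- \<omega>) + c s * (- \<omega>) = zb s"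
    unfolding z2_def z1_def pt_def by (simp add: nf)
  have z1': "z1 = site s N 0 + side_start s 2" unfolding z1_def pt_zb side_nums by simp
  have z2': "z2 = site s 0 N + side_start s 4"
    unfolding z2_def z1_def pt_def site_def v0_def side_nums by (simp add: nf)
  have sq: "(\<omega> - 1) * (\<omega> - 1) = - \<omega>" "(\<omega> - 1) * (- \<omega>) = 1" by (simp_all add: nf)
  have kap: "(pt s y f N 0 + f + c s * f, (\<omega> - 1) * f) \<in> F" if "(y, f) \<in> F" for y f
  proof -
    from that consider "y = zb s" "f = 1" | "y = z1" "f = \<omega> - 1" | "y = z2" "f = - \<omega>" unfolding F_def by blast
    then show ?thesis
    proof cases
      case 1 show ?thesis unfolding 1 F_def z1_def by simp
    next
      case 2 show ?thesis unfolding 2 F_def sq z2_def by simp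
    next
      case 3 show ?thesis unfolding 3 sq z3 F_def by simp
    qed
  qed
  have step: "state s (A + b * (pt s y f N 0 + f + c s * f)) (b * ((\<omega> - 1) * f)) ?K"
    if "state s (A + b * y) (b * f) ?K" for A b y f
    using state_kappa[OF that] unfolding pt_affine by (simp add: algebra_simps)
  have s01: "state s (A + b * z1) (b * (\<omega> - 1)) ?K" if "state s (A + b * zb s) (b * 1) ?K" for A b
    using step[OF that] unfolding z1_def by simp
  have s12: "state s (A + b * z2) (b * (- \<omega>)) ?K" if "state s (A + b * z1) (b * (\<omega> - 1)) ?K" for A b
    using step[OF that] unfolding z2_def[symmetric] sq .
  have s20: "state s (A + b * zb s) (b * 1) ?K" if "state s (A + b * z2) (b * (- \<omega>)) ?K" for A b
    using step[OF that] unfolding z3 sq .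
  have from_base: "state s (A + b * y) (b * f) ?K" if "(y, f) \<in> F" "state s (A + b * zb s) (b * 1) ?K" for A b y f
    using that(1) s01[OF that(2)] s12[OF s01[OF that(2)]] that(2) unfolding F_def by auto
  have to_base: "state s (A + b * zb s) (b * 1) ?K" if "(y, f) \<in> F" "state s (A + b * y) (b * f) ?K" for A b y f
  proof -
    from that(1) consider "y = zb s" "f = 1" | "y = z1" "f = \<omega> - 1" | "y = z2" "f = - \<omega>" unfolding F_def by blast
    then show ?thesis
    proof cases
      case 1 show ?thesis using \<open>state s (A + b * y) (b * f) ?K\<close> unfolding 1 .
    next
      case 2 show ?thesis using s20[OF s12] \<open>state s (A + b * y) (b * f) ?K\<close> unfolding 2 by blast
    next
      case 3 show ?thesis using s20 \<open>state s (A + b * y) (b * f) ?K\<close> unfolding 3 by blast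
    qed
  qed
  have turn: "hexagon s (pt s (pt s y f N 0 + f + c s * f) ((\<omega> - 1) * f) i j) ((\<omega> - 1) * f) =
      hexagon s (pt s y f (N - i - j) i) f" if "i + j \<le> N" for y f i j
    unfolding pt_kappa[OF that] by (rule hexagon_turn)
  have cells: "\<exists>i' j'. enat (i' + j') < ?K \<and> hexagon s (pt s y f i j) f = hexagon s (pt s (zb s) 1 i' j') 1"
    if yf: "(y, f) \<in> F" and ij: "enat (i + j) < ?K" for y f i j
  proof -
    have le: "i + j \<le> N" using ij by simp
    have t1: "hexagon s (pt s z1 (\<omega> - 1) i j) (\<omega> - 1) = hexagon s (pt s (zb s) 1 (N - i - j) i) 1"
      if "i + j \<le> N" for i j using turn[OF that, of "zb s" 1] unfolding z1_def by simp
    have t2: "hexagon s (pt s z2 (- \<omega>) i j) (- \<omega>) = hexagon s (pt s z1 (\<omega> - 1) (N - i - j) i) (\<omega> - 1)"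
      using turn[OF le, of z1 "\<omega> - 1"] unfolding z2_def[symmetric] sq .
    have l': "N - i - j + i \<le> N" using le by simp
    have lt: "enat (N - i - j + i) < ?K" "enat (N - (N - i - j) - i + (N - i - j)) < ?K" using le by simp_all
    from yf consider "y = zb s" "f = 1" | "y = z1" "f = \<omega> - 1" | "y = z2" "f = - \<omega>" unfolding F_def by blast
    then show ?thesis
    proof cases
      case 1 show ?thesis unfolding 1 using ij by blast
    next
      case 2 show ?thesis unfolding 2 using t1[OF le] lt by blast
    next
      case 3 show ?thesis unfolding 3 t2 using t1[OF l'] lt by blast
    qed
  qed
  define G where "G = generate (BijGroup UNIV) ((\<lambda>p. rotation p (pi / 3)) ` {y + (1 - \<omega>) * f | y f. (y, f) \<in> F})"
  have rotf: "rotation (y + (1 - \<omega>) * f) (pi / 3) = (\<lambda>x. (y - \<omega> * f - \<omega> * y) + \<omega> * x)" for y f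
    using rotation_sixth[of "y + (1 - \<omega>) * f" 1] by (auto simp: nf)
  have rot_in: "(\<lambda>x. (y - \<omega> * f - \<omega> * y) + \<omega> * x) \<in> G" if "(y, f) \<in> F" for y f
    unfolding G_def rotf[symmetric] by (rule generate.incl) (use that in blast)
  have inv_eq: "inv\<^bsub>BijGroup UNIV\<^esub> (\<lambda>x. (y - \<omega> * f - \<omega> * y) + \<omega> * x) = (\<lambda>x. (y + f - (1 - \<omega>) * y) + (1 - \<omega>) * x)" for y f
    by (rule affine_inv) (simp_all add: nf)
  have inv_in: "(\<lambda>x. (y + f - (1 - \<omega>) * y) + (1 - \<omega>) * x) \<in> G" if "(y, f) \<in> F" for y f
    unfolding G_def inv_eq[symmetric] unfolding rotf[symmetric] by (rule generate.inv) (use that in blast)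
  \<comment> \<open>The state is transported from an arbitrary placement \<open>(A', b')\<close>,
    not just from the initial one, because in a product the second factor acts within the placement
    reached by the first.\<close>
  have aff: "\<exists>A b. b \<noteq> 0 \<and> g = (\<lambda>x. A + b * x) \<and> (\<forall>A' b'. state s (A' + b' * zb s) (b' * 1) ?K \<longrightarrow>
      state s (A' + b' * A + b' * b * zb s) (b' * b * 1) ?K)" if "g \<in> G" for g
    using that unfolding G_def
  proof (induction rule: generate.induct)
    case one
    show ?case by (rule exI[of _ 0], rule exI[of _ 1]) (simp add: BijGroup_one)
  next
    case (incl h)
    then obtain y f where yf: "(y, f) \<in> F" and h: "h = rotation (y + (1 - \<omega>) * f) (pi / 3)" by blast
    have "state s (A' + b' * (y - \<omega> * f - \<omega> * y) + b' * \<omega> * zb s) (b' * \<omega> * 1) ?K"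
      if s: "state s (A' + b' * zb s) (b' * 1) ?K" for A' b'
    \<comment> \<open>The rotation is about the apex of the corner \<open>(y, f)\<close>, so
      \<open>state_rot\<close> applies at that corner; the state is moved there from the base corner
      beforehand and back afterwards.\<close>
    proof (rule to_base[OF yf])
      show "state s (A' + b' * (y - \<omega> * f - \<omega> * y) + b' * \<omega> * y) (b' * \<omega> * f) ?K"
        using state_rot[OF from_base[OF yf s]] by (simp add: algebra_simps)
    qed
    then show ?case unfolding h rotf using omega_facts(1) by blast
  next
    case (inv h)
    then obtain y f where yf: "(y, f) \<in> F" and h: "h = rotation (y + (1 - \<omega>) * f) (pi / 3)" by blast
    have "state s (A' + b' * (y + f - (1 - \<omega>) * y) + b' * (1 - \<omega>) * zb s) (b' * (1 - \<omega>) * 1) ?K"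
      if s: "state s (A' + b' * zb s) (b' * 1) ?K" for A' b'
    proof (rule to_base[OF yf])
      show "state s (A' + b' * (y + f - (1 - \<omega>) * y) + b' * (1 - \<omega>) * y) (b' * (1 - \<omega>) * f) ?K"
        using state_rot_inv[OF from_base[OF yf s]] by (simp add: algebra_simps)
    qed
    moreover have "1 - \<omega> \<noteq> 0" using omega_facts(2) by simp
    ultimately show ?case unfolding h rotf inv_eq by blast
  next
    case (eng h1 h2)
    obtain A1 b1 where 1: "b1 \<noteq> 0" "h1 = (\<lambda>x. A1 + b1 * x)" "\<And>A' b'. state s (A' + b' * zb s) (b' * 1) ?K \<Longrightarrow>
      state s (A' + b' * A1 + b' * b1 * zb s) (b' * b1 * 1) ?K" using eng.IH(1) by blast
    obtain A2 b2 where 2: "b2 \<noteq> 0" "h2 = (\<lambda>x. A2 + b2 * x)" "\<And>A' b'. state s (A' + b' * zb s) (b' * 1) ?K \<Longrightarrow>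
      state s (A' + b' * A2 + b' * b2 * zb s) (b' * b2 * 1) ?K" using eng.IH(2) by blast
    have "(h1 \<otimes>\<^bsub>BijGroup UNIV\<^esub> h2) x = (A1 + b1 * A2) + (b1 * b2) * x" for x
      unfolding 1(2) 2(2) BijGroup_comp[OF affine_Bij[OF 1(1)] affine_Bij[OF 2(1)]] by (simp add: algebra_simps)
    then have e: "h1 \<otimes>\<^bsub>BijGroup UNIV\<^esub> h2 = (\<lambda>x. (A1 + b1 * A2) + (b1 * b2) * x)" by (rule ext)
    have "state s (A' + b' * (A1 + b1 * A2) + b' * (b1 * b2) * zb s) (b' * (b1 * b2) * 1) ?K"
      if "state s (A' + b' * zb s) (b' * 1) ?K" for A' b'
      using 2(3)[OF 1(3)[OF that]] by (simp add: algebra_simps)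
    moreover have "b1 * b2 \<noteq> 0" using 1(1) 2(1) by simp
    ultimately show ?case unfolding e by blast
  qed
  have carr: "g \<in> carrier (BijGroup UNIV)" if "g \<in> G" for g using aff[OF that] affine_Bij by metis
  define \<Phi> where "\<Phi> = {(A, b). \<exists>g\<in>G. \<forall>x. A0 + d * g x = A + b * x}"
  \<comment> \<open>Multiplying by a generator on the right turns a copy about one of its own
    apexes; these are the moves by which neighbouring copies are reached.\<close>
  have mult: "(A + b * A1, b * b1) \<in> \<Phi>" if "(A, b) \<in> \<Phi>" and h: "(\<lambda>x. A1 + b1 * x) \<in> G" for A b A1 b1
  proof -
    obtain g where g: "g \<in> G" "\<And>x. A0 + d * g x = A + b * x" using \<open>(A, b) \<in> \<Phi>\<close> unfolding \<Phi>_def by blast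
    have "g \<otimes>\<^bsub>BijGroup UNIV\<^esub> (\<lambda>x. A1 + b1 * x) \<in> G" using g(1) h unfolding G_def by (rule generate.eng)
    moreover have "A0 + d * (g \<otimes>\<^bsub>BijGroup UNIV\<^esub> (\<lambda>x. A1 + b1 * x)) x = A + b * A1 + b * b1 * x" for x
      unfolding BijGroup_comp[OF carr[OF g(1)] carr[OF h]] g(2) by (simp add: algebra_simps)
    ultimately show ?thesis unfolding \<Phi>_def by blast
  qed
  have T: "\<T> = {(\<lambda>x. A + b * x) ` B | A b B. (A, b) \<in> \<Phi> \<and> B \<in> pieces s ?K}"
  proof (rule pieces_cover[where F = F])
    have "\<one>\<^bsub>BijGroup UNIV\<^esub> \<in> G" unfolding G_def by (rule generate.one)
    then have "(\<lambda>x. x) \<in> G" unfolding BijGroup_one .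
    then have "(A0, d) \<in> \<Phi>" unfolding \<Phi>_def by (auto intro!: bexI[where x = "\<lambda>x. x"])
    then show "\<Phi> \<noteq> {}" by blast
    show "(zb s, 1) \<in> F" unfolding F_def by simp
    show "state s (A + b * y) (b * f) ?K" if "(A, b) \<in> \<Phi>" "(y, f) \<in> F" for A b y f
    proof -
      obtain g where g: "g \<in> G" "\<And>x. A0 + d * g x = A + b * x" using \<open>(A, b) \<in> \<Phi>\<close> unfolding \<Phi>_def by blast
      obtain A1 b1 where 1: "g = (\<lambda>x. A1 + b1 * x)" "\<And>A' b'. state s (A' + b' * zb s) (b' * 1) ?K \<Longrightarrow>
        state s (A' + b' * A1 + b' * b1 * zb s) (b' * b1 * 1) ?K" using aff[OF g(1)] by blast
      have A: "A = A0 + d * A1" using g(2)[of 0] unfolding 1(1) by simp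
      then have b: "b = d * b1" using g(2)[of 1] unfolding 1(1) by (simp add: algebra_simps)
      have "state s (A0 + d * zb s) (d * 1) ?K" using st unfolding A0_def by simp
      from from_base[OF \<open>(y, f) \<in> F\<close> 1(2)[OF this]] show ?thesis unfolding A b .
    qed
    show "\<exists>i' j'. enat (i' + j') < ?K \<and> hexagon s (pt s y f i j) f = hexagon s (pt s (zb s) 1 i' j') 1"
      if "(y, f) \<in> F" "enat (i + j) < ?K" for y f i j using cells[OF that] .
    show "(pt s y f M 0 + f + c s * f, (\<omega> - 1) * f) \<in> F" if "(y, f) \<in> F" "?K = enat (Suc M)" for y f M
      using kap[OF that(1)] that(2) by simp
    show "(A + b * (y - \<omega> * f - \<omega> * y), b * \<omega>) \<in> \<Phi>" if "(A, b) \<in> \<Phi>" "(y, f) \<in> F" for A b y f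
      by (rule mult[OF that(1) rot_in[OF that(2)]])
    show "(A + b * (y + f - (1 - \<omega>) * y), b * (1 - \<omega>)) \<in> \<Phi>" if "(A, b) \<in> \<Phi>" "(y, f) \<in> F" for A b y f
      by (rule mult[OF that(1) inv_in[OF that(2)]])
  qed
  let ?f = "\<lambda>x. A0 + d * x"
  let ?ap = "{apex (tri_tile (S0 s) (u0 s) 0 (- v0 s) (- (\<omega> * v0 s))) (S0 s),
      apex (tri_tile (S0 s) (u0 s) (of_nat N * v0 s) (of_nat N * v0 s + v0 s) (of_nat N * v0 s + v0 s - \<omega> * v0 s)) ((+) (of_nat N * v0 s) ` S0 s),
      apex (tri_tile (S0 s) (u0 s) (of_nat N * (\<omega> * v0 s)) (of_nat N * (\<omega> * v0 s) + \<omega> * v0 s) (of_nat N * (\<omega> * v0 s) + \<omega> * v0 s - v0 s)) ((+) (of_nat N * (\<omega> * v0 s)) ` S0 s)}"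
  have ap: "?ap = {y + (1 - \<omega>) * f | y f. (y, f) \<in> F}"
  proof -
    have s: "site s N 0 = of_nat N * v0 s" "site s 0 N = of_nat N * (\<omega> * v0 s)" unfolding site_def by simp_all
    have a0: "apex (triangle_at s 0 0 0) (S0 s) = zb s + (1 - \<omega>) * 1"
      using apex_corner[of 0 s 0 0] by (simp add: site_def side_nums)
    have a1: "apex (triangle_at s N 0 2) ((+) (of_nat N * v0 s) ` S0 s) = z1 + (1 - \<omega>) * (\<omega> - 1)"
      using apex_corner[of 2 s N 0] unfolding s(1) z1' side_nums by simp
    have a2: "apex (triangle_at s 0 N 4) ((+) (of_nat N * (\<omega> * v0 s)) ` S0 s) = z2 + (1 - \<omega>) * (- \<omega>)"
      using apex_corner[of 4 s 0 N] unfolding s(2) z2' side_nums by simp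
    show ?thesis unfolding corner_tile_0 corner_tiles_finite a0 a1 a2 F_def by blast
  qed
  have tiles: "T_tiles (S0 s) (u0 s) (v0 s) (\<omega> * v0 s) ?K = {g ` X | g X. X \<in> pieces s ?K \<and> g \<in> G}"
    unfolding T_tiles_def enat.case shield_triangle_tiles_def Let_def diff_Suc_1 ap finite_pieces G_def by simp
  have "\<T> = (`) ?f ` T_tiles (S0 s) (u0 s) (v0 s) (\<omega> * v0 s) ?K"
  proof (intro equalityI subsetI)
    fix B assume "B \<in> \<T>"
    then obtain A b X where X: "X \<in> pieces s ?K" "B = (\<lambda>x. A + b * x) ` X" "(A, b) \<in> \<Phi>" unfolding T by blast
    obtain g where g: "g \<in> G" "\<And>x. A0 + d * g x = A + b * x" using X(3) unfolding \<Phi>_def by blast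
    have "B = ?f ` (g ` X)" unfolding X(2) image_image g(2) ..
    then show "B \<in> (`) ?f ` T_tiles (S0 s) (u0 s) (v0 s) (\<omega> * v0 s) ?K" unfolding tiles using g(1) X(1) by blast
  next
    fix B assume "B \<in> (`) ?f ` T_tiles (S0 s) (u0 s) (v0 s) (\<omega> * v0 s) ?K"
    then obtain g X where X: "X \<in> pieces s ?K" "g \<in> G" "B = ?f ` (g ` X)" unfolding tiles by blast
    obtain A b where g: "g = (\<lambda>x. A + b * x)" using aff[OF X(2)] by blast
    have e: "A0 + d * g x = (A0 + d * A) + (d * b) * x" for x unfolding g by (simp add: algebra_simps)
    then have "(A0 + d * A, d * b) \<in> \<Phi>" unfolding \<Phi>_def using X(2) by blast
    moreover have "B = (\<lambda>x. (A0 + d * A) + (d * b) * x) ` X" unfolding X(3) image_image e ..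
    ultimately show "B \<in> \<T>" unfolding T using X(1) by blast
  qed
  moreover have "dist (?f x) (?f y) = dist x y" for x y
  proof -
    have "?f x - ?f y = d * (x - y)" by (simp add: algebra_simps)
    then show ?thesis unfolding dist_norm using d by (simp add: norm_mult)
  qed
  ultimately show ?thesis unfolding shield_triangle_tiling_def using tiling shield_frame_S0[of s] by metis
qed

theorem line_or_triangle_tiling: "shield_line_tiling \<alpha> \<T> \<or> shield_triangle_tiling \<alpha> \<T>"
proof (cases "\<exists>s z d. D (Some s) z d")
  case True
  then obtain s z d where "D (Some s) z d" by blast
  from corner_or_line[OF this] consider s z d where "corner s z d" | z d where "line True z d" by blast
  then show ?thesis
  proof cases
    case (1 s z d)
    obtain K where K: "state s z d K" using corner_state[OF 1] by blast
    have d: "norm d = 1" using 1 unfolding corner_def ST_def D_def by blast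
    have "0 < K" using K unfolding state_def by blast
    then consider N where "K = enat (Suc N)" | "K = \<infinity>" by (cases K) (auto simp: zero_enat_def gr0_conv_Suc)
    then show ?thesis
    proof cases
      case (1 N)
      show ?thesis using finite_triangle_tiling[OF K[unfolded 1] d] ..
    next
      case 2
      show ?thesis using infinite_triangle_tiling[OF K[unfolded 2] d] ..
    qed
  next
    case (2 z d)
    then show ?thesis using line_tiling by blast
  qed
next
  case False
  then show ?thesis using regular_tiling by blast
qed

end

theorem theorem1:
  fixes \<alpha> :: real and \<T> :: "complex set set"
  assumes "pi / 3 < \<alpha>" and "\<alpha> < 2 * pi / 3" and "\<alpha> \<noteq> pi / 2"
    and "shield_tiling \<alpha> \<T>"
  shows "shield_line_tiling \<alpha> \<T> \<or> shield_triangle_tiling \<alpha> \<T>"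
proof -
  interpret shield_plane \<alpha> \<T> using assms by unfold_locales
  show ?thesis by (rule line_or_triangle_tiling)
qed

end
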